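(* Let the standing assumptions listed in the context be satisfied. Let $r_2>r_1$ be such that $c_s,\rho\in W^{1,\infty}(B_{r_2})$, let $\omega\neq0$, let $\theta$ be as defined in the context, and let $$\|c_s^{-1}\mathbf b\|_{\mathbf L^\infty}^2<\frac{1}{1+\tan^2\theta}.$$ Then the operator $A_{\mathrm{Cow}}\in L(\mathbf X)$ is bijective.
   Context: Notation. $B_r:=\{\mathbf x\in\mathbb R^3:|\mathbf x|<r\}$. All function spaces are complex-valued with default domain $\mathbb R^3$; boldface spaces are spaces of $\mathbb C^3$-valued functions. Suprema and infima of $L^\infty$ functions are essential ones; $\|c_s^{-1}\mathbf b\|_{\mathbf L^\infty}$ is the essential supremum of $|c_s^{-1}\mathbf b|$. Standing assumptions. $\omega\in\mathbb R$, $\Omega\in\mathbb R^3$. $\rho\in L^\infty(\mathbb R^3,\mathbb R)$ with $\inf_{B_r}\rho>0$ for every $r>0$. $c_s,\gamma\in L^\infty(\mathbb R^3,\mathbb R)$ with $\inf_{\mathbb R^3}c_s>0$, $\inf_{\mathbb R^3}\gamma>0$. $p,\phi\in W^{2,\infty}_{\mathrm{loc}}(\mathbb R^3,\mathbb R)$, and with $$\mathbf q:=\frac{1}{c_s^2\rho}\nabla p,\qquad m_1:=-\rho^{-1}\big(\operatorname{Hess}(p)-\rho\operatorname{Hess}(\phi)-c_s^2\rho\,\mathbf q\mathbf q^\top\big)$$ one has $\mathbf q\in L^\infty(\mathbb R^3,\mathbb R^3)$, $m_1\in L^\infty(\mathbb R^3,\mathbb R^{3\times3})$. $\mathbf b\in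 L^\infty(\mathbb R^3,\mathbb R^3)$ with $\operatorname{div}(\rho\mathbf b)\in L^2(\mathbb R^3,\mathbb R)$, and $r_1>0$ is such that $\operatorname{supp}\mathbf b\subset B_{r_1}$. Spaces. $\langle u,u'\rangle=\int_{\mathbb R^3}\rho\,u\overline{u'}\,d\mathbf x$ and $\langle\mathbf u,\mathbf u'\rangle=\int_{\mathbb R^3}\rho\,\mathbf u\cdot\overline{\mathbf u'}\,d\mathbf x$ are the scalar products of $L^2_\rho$, $\mathbf L^2_\rho$. $\partial_{\mathbf b}=\sum_l\mathbf b_l\partial_{\mathbf x_l}$, defined weakly by $\int\rho\,\partial_{\mathbf b}\mathbf u\cdot\overline{\mathbf u'}=-\int\rho\,\mathbf u\cdot\overline{\partial_{\mathbf b}\mathbf u'}-\int\operatorname{div}(\rho\mathbf b)\,\mathbf u\cdot\overline{\mathbf u'}$ for smooth compactly supported $\mathbf u'$. $\mathbf X:=\{\mathbf u\in\mathbf L^2_\rho:\operatorname{div}\mathbf u\in L^2_\rho,\ \partial_{\mathbf b}\mathbf u\in\mathbf L^2_\rho\}$ with $\langle\mathbf u,\mathbf u'\rangle_{\mathbf X}=\langle\operatorname{div}\mathbf u,\operatorname{div}\mathbf u'\rangle+\langle\partial_{\mathbf b}\mathbf u,\partial_{\mathbf b}\mathbf u'\rangle+\langle\mathbf u,\mathbf u'\rangle$, a Hilbert space. Form (Cowling approximation). $$\begin{aligned}a_{\mathrm{Cow}}(\mathbf u,\mathbf u'):={}&\langle c_s^2(\operatorname{div}\mathbf u+\mathbf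 q\cdot\mathbf u),\operatorname{div}\mathbf u'+\mathbf q\cdot\mathbf u'\rangle-\langle(\omega+i\partial_{\mathbf b}+i\Omega\times)\mathbf u,(\omega+i\partial_{\mathbf b}+i\Omega\times)\mathbf u'\rangle\\&-\langle m_1\mathbf u,\mathbf u'\rangle-i\omega\langle\gamma\mathbf u,\mathbf u'\rangle,\end{aligned}$$ and $A_{\mathrm{Cow}}\in L(\mathbf X)$ is its Riesz representation: $\langle A_{\mathrm{Cow}}\mathbf u,\mathbf u'\rangle_{\mathbf X}=a_{\mathrm{Cow}}(\mathbf u,\mathbf u')$. Angle $\theta$. With $\arg\in(-\pi,\pi]$ and $\operatorname{num\,ran}M:=\{\xi^HM\xi:\xi\in\mathbb C^3,|\xi|=1\}$, $$\theta:=\max\Big\{0,\ \sup_{\mathbf x\in B_{r_2}}\ \sup\big|\arg\operatorname{num\,ran}\big(i\omega\gamma(\mathbf x)I_{3\times3}+m_1(\mathbf x)\big)\big|-\pi/2\Big\}\in[0,\pi/2),$$ the inner supremum being over the numerical range. *)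

theory Defs
  imports "HOL-Analysis.Analysis" "HOL-Probability.Essential_Supremum"
begin

text \<open>
  Functions on \<open>\<real>\<^sup>3\<close> are total functions on \<^typ>\<open>real^3\<close>, measurable means Lebesgue measurable, and
  all integrals are Bochner integrals with respect to \<^term>\<open>lebesgue\<close>. Weak derivatives are determined
  only up to null sets; the functions \<open>weak_...\<close> below select a representative, and everything
  built from them is insensitive to the choice up to null sets.
\<close>


subsection \<open>Essentially bounded functions\<close>

definition Linf_norm :: "'a measure \<Rightarrow> ('a \<Rightarrow> 'b::real_normed_vector) \<Rightarrow> ereal"
  where "Linf_norm M f = esssup M (\<lambda>x. ereal (norm (f x)))"

definition Linf :: "'a measure \<Rightarrow> ('a \<Rightarrow> 'b::real_normed_vector) set"
  where "Linf M = {f \<in> borel_measurable M. Linf_norm M f < \<infinity>}"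

definition essinf :: "'a measure \<Rightarrow> ('a \<Rightarrow> real) \<Rightarrow> ereal"
  where "essinf M f = - esssup M (\<lambda>x. ereal (- f x))"

text \<open>The support of an equivalence class: the complement of the largest open set on which the
  function vanishes almost everywhere.\<close>

definition ess_supp :: "(real^3 \<Rightarrow> 'a::zero) \<Rightarrow> (real^3) set"
  where "ess_supp f = - \<Union>{U. open U \<and> (AE x in lebesgue. x \<in> U \<longrightarrow> f x = 0)}"


subsection \<open>Test functions\<close>

definition partial :: "3 \<Rightarrow> (real^3 \<Rightarrow> 'a::real_normed_vector) \<Rightarrow> real^3 \<Rightarrow> 'a"
  where "partial l f x = frechet_derivative f (at x) (axis l 1)"

definition smooth :: "(real^3 \<Rightarrow> 'a::real_normed_vector) \<Rightarrow> bool"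
  where "smooth f \<longleftrightarrow> (\<forall>ls x. foldr partial ls f differentiable (at x))"

definition test_functions :: "(real^3) set \<Rightarrow> (real^3 \<Rightarrow> 'a::real_normed_vector) set"
  where "test_functions U =
    {\<psi>. smooth \<psi> \<and> compact (closure {x. \<psi> x \<noteq> 0}) \<and> closure {x. \<psi> x \<noteq> 0} \<subseteq> U}"


subsection \<open>Weak derivatives and Sobolev spaces\<close>

text \<open>Local integrability is part of every notion of weak derivative below, because the Bochner
  integral of a non-integrable function is \<open>0\<close>.\<close>

definition loc_integrable ::
    "(real^3) set \<Rightarrow> (real^3 \<Rightarrow> 'a::{banach, second_countable_topology}) \<Rightarrow> bool"
  where "loc_integrable U f \<longleftrightarrow> (\<forall>K. compact K \<and> K \<subseteq> U \<longrightarrow> set_integrable lebesgue K f)"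

definition has_weak_partial ::
    "(real^3) set \<Rightarrow> 3 \<Rightarrow> (real^3 \<Rightarrow> real) \<Rightarrow> (real^3 \<Rightarrow> real) \<Rightarrow> bool"
  where "has_weak_partial U l f g \<longleftrightarrow> loc_integrable U f \<and> loc_integrable U g \<and>
    (\<forall>\<psi>\<in>test_functions U.
      (LINT x:U|lebesgue. f x * partial l \<psi> x) = - (LINT x:U|lebesgue. g x * \<psi> x))"

definition weak_partial :: "3 \<Rightarrow> (real^3 \<Rightarrow> real) \<Rightarrow> real^3 \<Rightarrow> real"
  where "weak_partial l f = (SOME g. has_weak_partial UNIV l f g)"

definition weak_grad :: "(real^3 \<Rightarrow> real) \<Rightarrow> real^3 \<Rightarrow> real^3"
  where "weak_grad f x = (\<chi> l. weak_partial l f x)"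

definition weak_hess :: "(real^3 \<Rightarrow> real) \<Rightarrow> real^3 \<Rightarrow> real^3^3"
  where "weak_hess f x = (\<chi> k l. weak_partial k (weak_partial l f) x)"

text \<open>The Sobolev spaces \<open>W\<^bsup>k,\<infinity>\<^esup>(U)\<close> of an open set \<open>U\<close>, and their local versions on \<open>\<real>\<^sup>3\<close>.\<close>

primrec sobolev_inf :: "nat \<Rightarrow> (real^3) set \<Rightarrow> (real^3 \<Rightarrow> real) set" where
  "sobolev_inf 0 U = Linf (lebesgue_on U)"
| "sobolev_inf (Suc k) U =
    {f \<in> Linf (lebesgue_on U). \<forall>l. \<exists>g\<in>sobolev_inf k U. has_weak_partial U l f g}"

definition sobolev_inf_loc :: "nat \<Rightarrow> (real^3 \<Rightarrow> real) set"
  where "sobolev_inf_loc k = {f. \<forall>r>0. f \<in> sobolev_inf k (ball 0 r)}"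

text \<open>Used both for real and for complex vector fields; by linearity, real test functions
  suffice for the latter.\<close>

definition has_weak_div ::
    "(real^3 \<Rightarrow> ('a::{banach, second_countable_topology})^3) \<Rightarrow> (real^3 \<Rightarrow> 'a) \<Rightarrow> bool"
  where "has_weak_div u g \<longleftrightarrow> (\<forall>l. loc_integrable UNIV (\<lambda>x. u x $ l)) \<and> loc_integrable UNIV g \<and>
    (\<forall>\<psi>\<in>test_functions UNIV.
      (LINT x|lebesgue. (\<Sum>l\<in>UNIV. partial l \<psi> x *\<^sub>R u x $ l))
        = - (LINT x|lebesgue. \<psi> x *\<^sub>R g x))"

definition weak_div :: "(real^3 \<Rightarrow> ('a::{banach, second_countable_topology})^3) \<Rightarrow> real^3 \<Rightarrow> 'a"
  where "weak_div u = (SOME g. has_weak_div u g)"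


subsection \<open>Weighted square-integrable functions\<close>

definition L2w :: "(real^3 \<Rightarrow> real) \<Rightarrow> (real^3 \<Rightarrow> 'a::real_normed_vector) set"
  where "L2w \<rho> = {u \<in> borel_measurable lebesgue. integrable lebesgue (\<lambda>x. \<rho> x * (norm (u x))\<^sup>2)}"

definition cdot :: "complex^3 \<Rightarrow> complex^3 \<Rightarrow> complex"
  where "cdot v w = (\<Sum>l\<in>UNIV. v $ l * w $ l)"

definition vcnj :: "complex^3 \<Rightarrow> complex^3"
  where "vcnj v = (\<chi> l. cnj (v $ l))"

definition cvec :: "real^3 \<Rightarrow> complex^3"
  where "cvec v = (\<chi> l. complex_of_real (v $ l))"

definition cmat :: "real^3^3 \<Rightarrow> complex^3^3"
  where "cmat M = (\<chi> k l. complex_of_real (M $ k $ l))"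

definition ccross :: "complex^3 \<Rightarrow> complex^3 \<Rightarrow> complex^3"
  where "ccross v w =
    vector [v$2 * w$3 - v$3 * w$2,
            v$3 * w$1 - v$1 * w$3,
            v$1 * w$2 - v$2 * w$1]"

definition ip :: "(real^3 \<Rightarrow> real) \<Rightarrow> (real^3 \<Rightarrow> complex) \<Rightarrow> (real^3 \<Rightarrow> complex) \<Rightarrow> complex"
  where "ip \<rho> u u' = (LINT x|lebesgue. complex_of_real (\<rho> x) * (u x * cnj (u' x)))"

definition ipv :: "(real^3 \<Rightarrow> real) \<Rightarrow> (real^3 \<Rightarrow> complex^3) \<Rightarrow> (real^3 \<Rightarrow> complex^3) \<Rightarrow> complex"
  where "ipv \<rho> u u' = (LINT x|lebesgue. complex_of_real (\<rho> x) * cdot (u x) (vcnj (u' x)))"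


subsection \<open>The derivative along the background flow\<close>

definition flow_deriv :: "(real^3 \<Rightarrow> real^3) \<Rightarrow> (real^3 \<Rightarrow> complex^3) \<Rightarrow> real^3 \<Rightarrow> complex^3"
  where "flow_deriv b u x = (\<Sum>l\<in>UNIV. b x $ l *\<^sub>R partial l u x)"

definition has_weak_flow_deriv :: "(real^3 \<Rightarrow> real) \<Rightarrow> (real^3 \<Rightarrow> real^3) \<Rightarrow>
    (real^3 \<Rightarrow> complex^3) \<Rightarrow> (real^3 \<Rightarrow> complex^3) \<Rightarrow> bool"
  where "has_weak_flow_deriv \<rho> b u v \<longleftrightarrow> loc_integrable UNIV u \<and> loc_integrable UNIV v \<and>
    (\<forall>u'\<in>test_functions UNIV.
      ipv \<rho> v u' = - ipv \<rho> u (flow_deriv b u')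
        - (LINT x|lebesgue. complex_of_real (weak_div (\<lambda>y. \<rho> y *\<^sub>R b y) x)
                              * cdot (u x) (vcnj (u' x))))"

definition weak_flow_deriv :: "(real^3 \<Rightarrow> real) \<Rightarrow> (real^3 \<Rightarrow> real^3) \<Rightarrow>
    (real^3 \<Rightarrow> complex^3) \<Rightarrow> real^3 \<Rightarrow> complex^3"
  where "weak_flow_deriv \<rho> b u = (SOME v. has_weak_flow_deriv \<rho> b u v)"


subsection \<open>The Hilbert space\<close>

definition X_fun :: "(real^3 \<Rightarrow> real) \<Rightarrow> (real^3 \<Rightarrow> real^3) \<Rightarrow> (real^3 \<Rightarrow> complex^3) set"
  where "X_fun \<rho> b = {u \<in> L2w \<rho>.
    (\<exists>g\<in>L2w \<rho>. has_weak_div u g) \<and> (\<exists>v\<in>L2w \<rho>. has_weak_flow_deriv \<rho> b u v)}"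

definition X_space :: "(real^3 \<Rightarrow> real) \<Rightarrow> (real^3 \<Rightarrow> real^3) \<Rightarrow> (real^3 \<Rightarrow> complex^3) set set"
  where "X_space \<rho> b = X_fun \<rho> b //
    {(u, v). u \<in> X_fun \<rho> b \<and> v \<in> X_fun \<rho> b \<and> (AE x in lebesgue. u x = v x)}"

definition rep :: "(real^3 \<Rightarrow> complex^3) set \<Rightarrow> real^3 \<Rightarrow> complex^3"
  where "rep U = (SOME u. u \<in> U)"

definition X_inner :: "(real^3 \<Rightarrow> real) \<Rightarrow> (real^3 \<Rightarrow> real^3) \<Rightarrow>
    (real^3 \<Rightarrow> complex^3) set \<Rightarrow> (real^3 \<Rightarrow> complex^3) set \<Rightarrow> complex"
  where "X_inner \<rho> b U U' = (let u = rep U; u' = rep U' in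
    ip \<rho> (weak_div u) (weak_div u')
    + ipv \<rho> (weak_flow_deriv \<rho> b u) (weak_flow_deriv \<rho> b u')
    + ipv \<rho> u u')"


subsection \<open>The form and the operator in the Cowling approximation\<close>

definition q_field ::
    "(real^3 \<Rightarrow> real) \<Rightarrow> (real^3 \<Rightarrow> real) \<Rightarrow> (real^3 \<Rightarrow> real) \<Rightarrow> real^3 \<Rightarrow> real^3"
  where "q_field \<rho> cs p x = (1 / ((cs x)\<^sup>2 * \<rho> x)) *\<^sub>R weak_grad p x"

definition m1_field :: "(real^3 \<Rightarrow> real) \<Rightarrow> (real^3 \<Rightarrow> real) \<Rightarrow>
    (real^3 \<Rightarrow> real) \<Rightarrow> (real^3 \<Rightarrow> real) \<Rightarrow> real^3 \<Rightarrow> real^3^3"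
  where "m1_field \<rho> cs p \<phi> x =
    - (1 / \<rho> x) *\<^sub>R (weak_hess p x - \<rho> x *\<^sub>R weak_hess \<phi> x
        - ((cs x)\<^sup>2 * \<rho> x) *\<^sub>R (\<chi> k l. q_field \<rho> cs p x $ k * q_field \<rho> cs p x $ l))"

definition conv_op :: "real \<Rightarrow> real^3 \<Rightarrow> (real^3 \<Rightarrow> real) \<Rightarrow> (real^3 \<Rightarrow> real^3) \<Rightarrow>
    (real^3 \<Rightarrow> complex^3) \<Rightarrow> real^3 \<Rightarrow> complex^3"
  where "conv_op \<omega> \<Omega> \<rho> b u x =
    complex_of_real \<omega> *s u x + \<i> *s weak_flow_deriv \<rho> b u x + \<i> *s ccross (cvec \<Omega>) (u x)"

definition a_Cow :: "real \<Rightarrow> real^3 \<Rightarrow> (real^3 \<Rightarrow> real) \<Rightarrow> (real^3 \<Rightarrow> real) \<Rightarrow> (real^3 \<Rightarrow> real) \<Rightarrow>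
    (real^3 \<Rightarrow> real) \<Rightarrow> (real^3 \<Rightarrow> real) \<Rightarrow> (real^3 \<Rightarrow> real^3) \<Rightarrow>
    (real^3 \<Rightarrow> complex^3) set \<Rightarrow> (real^3 \<Rightarrow> complex^3) set \<Rightarrow> complex"
  where "a_Cow \<omega> \<Omega> \<rho> cs \<gamma> p \<phi> b U U' = (let u = rep U; u' = rep U'; q = q_field \<rho> cs p in
    ip \<rho> (\<lambda>x. complex_of_real ((cs x)\<^sup>2) * (weak_div u x + cdot (cvec (q x)) (u x)))
         (\<lambda>x. weak_div u' x + cdot (cvec (q x)) (u' x))
    - ipv \<rho> (conv_op \<omega> \<Omega> \<rho> b u) (conv_op \<omega> \<Omega> \<rho> b u')
    - ipv \<rho> (\<lambda>x. cmat (m1_field \<rho> cs p \<phi> x) *v u x) u'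
    - \<i> * complex_of_real \<omega> * ipv \<rho> (\<lambda>x. complex_of_real (\<gamma> x) *s u x) u')"

text \<open>The Riesz representation of the form.\<close>

definition A_Cow :: "real \<Rightarrow> real^3 \<Rightarrow> (real^3 \<Rightarrow> real) \<Rightarrow> (real^3 \<Rightarrow> real) \<Rightarrow> (real^3 \<Rightarrow> real) \<Rightarrow>
    (real^3 \<Rightarrow> real) \<Rightarrow> (real^3 \<Rightarrow> real) \<Rightarrow> (real^3 \<Rightarrow> real^3) \<Rightarrow>
    (real^3 \<Rightarrow> complex^3) set \<Rightarrow> (real^3 \<Rightarrow> complex^3) set"
  where "A_Cow \<omega> \<Omega> \<rho> cs \<gamma> p \<phi> b U =
    (THE V. V \<in> X_space \<rho> b \<and>
      (\<forall>U'\<in>X_space \<rho> b. X_inner \<rho> b V U' = a_Cow \<omega> \<Omega> \<rho> cs \<gamma> p \<phi> b U U'))"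


subsection \<open>The angle\<close>

definition num_ran :: "complex^3^3 \<Rightarrow> complex set"
  where "num_ran M = {cdot (vcnj \<xi>) (M *v \<xi>) | \<xi>. norm \<xi> = 1}"

text \<open>The supremum over the ball is essential, as \<open>\<gamma>\<close> and \<open>m\<^sub>1\<close> are given up to null sets only. The
  function in question takes values in \<open>[0, \<pi>]\<close>, and it is measurable because \<open>m\<^sub>1\<close> is symmetric
  and \<open>\<omega> \<gamma> \<noteq> 0\<close> almost everywhere, so that the numerical range avoids the branch cut of the argument.\<close>

definition theta :: "real \<Rightarrow> (real^3 \<Rightarrow> real) \<Rightarrow> (real^3 \<Rightarrow> real) \<Rightarrow> (real^3 \<Rightarrow> real) \<Rightarrow>
    (real^3 \<Rightarrow> real) \<Rightarrow> (real^3 \<Rightarrow> real) \<Rightarrow> real \<Rightarrow> real"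
  where "theta \<omega> \<rho> cs \<gamma> p \<phi> r2 = max 0
    (real_of_ereal (esssup (lebesgue_on (ball 0 r2)) (\<lambda>x. ereal
      (SUP z\<in>num_ran (mat (\<i> * complex_of_real (\<omega> * \<gamma> x)) + cmat (m1_field \<rho> cs p \<phi> x)). \<bar>Arg z\<bar>)))
     - pi / 2)"

end

theory Submission
  imports Defs
begin

text \<open>Since \<open>1 / (1 + tan\<^sup>2 \<theta>) \<le> 1\<close>, the hypothesis gives \<open>\<kappa> = \<parallel>c\<^sub>s\<inverse> b\<parallel> < 1\<close>, and the angle plays no
  further role. As \<open>m\<^sub>1\<close> is symmetric, \<open>Im a(u, u) = - \<omega> \<langle>\<gamma> u, u\<rangle>\<close>; hence the adjoint of \<open>A\<close> is injective,
  and it suffices to bound \<open>\<parallel>u\<parallel>\<^sub>X\<close> by \<open>\<parallel>A u\<parallel>\<^sub>X\<close>. Let \<open>\<parallel>u\<^sub>n\<parallel>\<^sub>X = 1\<close> and \<open>A u\<^sub>n \<rightarrow> 0\<close>. The imaginary part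
  gives \<open>u\<^sub>n \<rightarrow> 0\<close> in \<open>L\<^sup>2\<close>, and testing with \<open>\<eta> u\<^sub>n\<close>, where \<open>\<eta>\<close> vanishes near the support of \<open>b\<close>, gives
  \<open>div u\<^sub>n \<rightarrow> 0\<close> away from that support. Elsewhere \<open>div u\<^sub>n\<close> is, up to \<open>o(1)\<close>, the Laplacian of a test
  function \<open>\<psi>\<^sub>n\<close> with small gradient, because the range of \<open>\<Delta> - 1\<close> on test functions is dense.
  For a Lipschitz weight \<open>w\<close> integration by parts replaces \<open>\<integral> w |D\<^sup>2 \<psi>|\<^sup>2\<close> by \<open>\<integral> w |\<Delta> \<psi>|\<^sup>2\<close> up to lower order
  terms. With \<open>w = \<rho> c\<^sub>s\<^sup>2\<close> near the support of \<open>b\<close>, the field \<open>v\<^sub>n = \<nabla> \<psi>\<^sub>n\<close> therefore satisfies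
  \<open>\<parallel>\<partial>\<^sub>b v\<^sub>n\<parallel> \<le> \<kappa> \<parallel>c\<^sub>s div v\<^sub>n\<parallel> + o(1)\<close>. Testing with \<open>u\<^sub>n\<close> and \<open>v\<^sub>n\<close> yields
  \<open>\<parallel>c\<^sub>s div u\<^sub>n\<parallel>\<^sup>2 \<le> \<parallel>\<partial>\<^sub>b u\<^sub>n\<parallel> \<parallel>\<partial>\<^sub>b v\<^sub>n\<parallel> + o(1) \<le> \<kappa> \<parallel>c\<^sub>s div u\<^sub>n\<parallel>\<^sup>2 + o(1)\<close>, so \<open>\<parallel>u\<^sub>n\<parallel>\<^sub>X \<rightarrow> 0\<close>.\<close>

section \<open>Smooth functions and cutoffs\<close>

text \<open>The form is indefinite and X does not embed compactly into L^2, so no Fredholm argument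
  is at hand; the damping term replaces compactness by forcing the L^2 norm of u_n to zero directly.
  What remains is the wrong sign of the flow term. For a general field div u does not control the
  derivative along b, but for a gradient it does, which is why u_n is compared with a gradient of
  nearly the same divergence. The last chain of the overview also uses that testing with u_n itself
  gives |\<partial>_b u_n|^2 <= |c_s div u_n|^2 + o(1). Solving the Laplace equation exactly would
  call for elliptic regularity and decay at infinity. Approximating inside the test functions avoids
  both: every integration by parts is exact. The shift by -1 makes the energy control the potential
  as well as its gradient, and bounds both by the field rather than by its divergence, so the
  gradient is small although div u_n need not be. Density of the range of \<Delta> - 1 rests on a
  maximum principle: pairing an orthogonal function with all translates of one test function
  produces a bounded solution of \<Delta>H = H.\<close>

lemma partial_eq:
  "(f has_derivative f') (at x) \<Longrightarrow> partial l f x = f' (axis l 1)"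
  unfolding partial_def by (metis frechet_derivative_at)

lemma axis_basis_expansion: "(h::real^3) = (\<Sum>l\<in>UNIV. h $ l *\<^sub>R axis l 1)"
  by (simp add: vec_eq_iff axis_def sum.delta if_distrib[of "\<lambda>t. _ * t"] cong: if_cong)

lemma has_derivative_partials:
  assumes "f differentiable (at x)"
  shows "(f has_derivative (\<lambda>h. \<Sum>l\<in>UNIV. h $ l *\<^sub>R partial l f x)) (at x)"
proof -
  let ?D = "frechet_derivative f (at x)"
  have lin: "linear ?D" using assms by (rule linear_frechet_derivative)
  have "?D h = (\<Sum>l\<in>UNIV. h $ l *\<^sub>R partial l f x)" for h
    by (subst axis_basis_expansion[of h])
       (simp add: linear_sum[OF lin] linear_cmul[OF lin] partial_def)
  then have "?D = (\<lambda>h. \<Sum>l\<in>UNIV. h $ l *\<^sub>R partial l f x)" by auto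
  then show ?thesis using assms by (metis frechet_derivative_works)
qed

text \<open>Induction on the list of directions keeps every iterated derivative inside
  \<open>S\<close>. The closure properties below exhibit a suitable \<open>S\<close> each, which
  avoids product and chain rules of higher order.\<close>

lemma smooth_coinduct:
  assumes "f \<in> S" and "\<And>f x. f \<in> S \<Longrightarrow> f differentiable (at x)"
    and "\<And>f l. f \<in> S \<Longrightarrow> partial l f \<in> S"
  shows "smooth f"
proof -
  have "foldr partial ls f \<in> S" for ls by (induction ls) (auto simp: assms)
  then show ?thesis by (auto simp: smooth_def assms(2))
qed

lemma smooth_differentiable: "smooth f \<Longrightarrow> f differentiable (at x)"
  unfolding smooth_def by (metis foldr.simps(1) id_apply)

lemma smooth_partial: "smooth f \<Longrightarrow> smooth (partial l f)"
  unfolding smooth_def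
proof (intro allI)
  fix ls x assume "\<forall>ls x. foldr partial ls f differentiable (at x)"
  \<comment> \<open>\<open>foldr\<close> applies the last entry of the list first, so the extra
    direction is appended at the end.\<close>
  then have "foldr partial (ls @ [l]) f differentiable (at x)" by blast
  then show "foldr partial ls (partial l f) differentiable (at x)" by simp
qed

lemma smooth_has_derivative:
  "smooth f \<Longrightarrow> (f has_derivative (\<lambda>h. \<Sum>l\<in>UNIV. h $ l *\<^sub>R partial l f x)) (at x)"
  by (intro has_derivative_partials smooth_differentiable)

lemma smooth_continuous: "smooth f \<Longrightarrow> continuous_on A f"
  by (meson continuous_at_imp_continuous_on differentiable_imp_continuous_within smooth_differentiable)

lemma smooth_const [simp]: "smooth (\<lambda>x. c)"
  by (rule smooth_coinduct[where S="range (\<lambda>c x. c)"])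
     (auto simp: partial_def fun_eq_iff)

lemma partial_const [simp]: "partial l (\<lambda>x. c) = (\<lambda>x. 0)"
  by (auto simp: partial_def fun_eq_iff)

lemma partial_linear: "bounded_linear f \<Longrightarrow> partial l f = (\<lambda>x. f (axis l 1))"
  by (rule ext, rule partial_eq) (rule bounded_linear_imp_has_derivative)

lemma smooth_linear: "bounded_linear f \<Longrightarrow> smooth f"
  by (rule smooth_coinduct[where S="insert f (range (\<lambda>c x. c))"])
     (auto simp: partial_linear bounded_linear_imp_differentiable)

lemma partial_add:
  "f differentiable (at x) \<Longrightarrow> g differentiable (at x) \<Longrightarrow>
   partial l (\<lambda>x. f x + g x) x = partial l f x + partial l g x"
  unfolding partial_def[of l f] partial_def[of l g]
  by (rule partial_eq, rule has_derivative_add) (use frechet_derivative_works in blast)+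

lemma partial_bounded_linear:
  assumes "bounded_linear h" "f differentiable (at x)"
  shows "partial l (\<lambda>x. h (f x)) x = h (partial l f x)"
  unfolding partial_def[of l f]
  by (rule partial_eq, rule bounded_linear.has_derivative[OF assms(1)])
     (use assms(2) frechet_derivative_works in blast)

lemma partial_bilinear:
  assumes "bounded_bilinear pr" "f differentiable (at x)" "g differentiable (at x)"
  shows "partial l (\<lambda>x. pr (f x) (g x)) x = pr (f x) (partial l g x) + pr (partial l f x) (g x)"
  unfolding partial_def[of l f] partial_def[of l g]
  by (rule partial_eq, rule bounded_bilinear.FDERIV[OF assms(1)])
     (use assms frechet_derivative_works in blast)+

text \<open>Products alone are not stable under \<open>partial\<close>, because the Leibniz rule
  produces a sum of two of them; closing under addition gives a set to which coinduction
  applies.\<close>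

inductive_set bilin_span :: "('a::real_normed_vector \<Rightarrow> 'b::real_normed_vector \<Rightarrow> 'c::real_normed_vector) \<Rightarrow> (real^3 \<Rightarrow> 'c) set"
  for pr where
  base: "smooth f \<Longrightarrow> smooth g \<Longrightarrow> (\<lambda>x. pr (f x) (g x)) \<in> bilin_span pr"
| add: "f \<in> bilin_span pr \<Longrightarrow> g \<in> bilin_span pr \<Longrightarrow> (\<lambda>x. f x + g x) \<in> bilin_span pr"

lemma smooth_bilinear:
  assumes pr: "bounded_bilinear pr" and "smooth f" "smooth g"
  shows "smooth (\<lambda>x. pr (f x) (g x))"
proof (rule smooth_coinduct[where S="bilin_span pr"])
  show "(\<lambda>x. pr (f x) (g x)) \<in> bilin_span pr" using assms by (intro bilin_span.base)
  have *: "(\<forall>x. f differentiable (at x)) \<and> (\<forall>l. partial l f \<in> bilin_span pr)"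
    if "f \<in> bilin_span pr" for f
    using that
  proof induction
    case (base f g)
    have "(\<lambda>x. pr (f x) (g x)) differentiable (at x)" for x
      unfolding differentiable_def
      by (rule exI, rule bounded_bilinear.FDERIV[OF pr smooth_has_derivative smooth_has_derivative]) (fact base)+
    moreover have "partial l (\<lambda>x. pr (f x) (g x)) = (\<lambda>x. pr (f x) (partial l g x) + pr (partial l f x) (g x))" for l
      by (rule ext, rule partial_bilinear[OF pr]) (auto simp: base smooth_differentiable)
    ultimately show ?case
      using base by (auto intro!: bilin_span.intros smooth_partial)
  next
    case (add f g)
    then have "partial l (\<lambda>x. f x + g x) = (\<lambda>x. partial l f x + partial l g x)" for l
      by (intro ext partial_add) auto
    then show ?case using add by (auto intro!: bilin_span.add differentiable_add)
  qed
  then show "\<And>f x. f \<in> bilin_span pr \<Longrightarrow> f differentiable at x"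
    "\<And>f l. f \<in> bilin_span pr \<Longrightarrow> partial l f \<in> bilin_span pr" by blast+
qed

lemma smooth_bounded_linear:
  assumes "bounded_linear h" "smooth f"
  shows "smooth (\<lambda>x. h (f x))"
proof (rule smooth_coinduct[where S="{\<lambda>x. h (f x) |f. smooth f}"])
  fix g x assume "g \<in> {\<lambda>x. h (f x) |f. smooth f}"
  then show "g differentiable (at x)"
    using bounded_linear.has_derivative[OF assms(1)] smooth_has_derivative
    unfolding differentiable_def by blast
next
  fix g l assume "g \<in> {\<lambda>x. h (f x) |f. smooth f}"
  then obtain f where f: "g = (\<lambda>x. h (f x))" "smooth f" by auto
  then have "partial l g = (\<lambda>x. h (partial l f x))"
    by (auto intro!: partial_bounded_linear assms smooth_differentiable)
  then show "partial l g \<in> {\<lambda>x. h (f x) |f. smooth f}" using smooth_partial[OF f(2)] by auto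
qed (use assms in auto)

lemma smooth_add:
  assumes "smooth f" "smooth g" shows "smooth (\<lambda>x. f x + g x)"
proof (rule smooth_coinduct[where S="{\<lambda>x. f x + g x |f g. smooth f \<and> smooth g}"])
  fix h l assume "h \<in> {\<lambda>x. f x + g x |f g. smooth f \<and> smooth g}"
  then obtain f g where f: "h = (\<lambda>x. f x + g x)" "smooth f" "smooth g" by auto
  then have "partial l h = (\<lambda>x. partial l f x + partial l g x)"
    by (auto intro!: partial_add smooth_differentiable)
  then show "partial l h \<in> {\<lambda>x. f x + g x |f g. smooth f \<and> smooth g}"
    using smooth_partial f by blast
next
  show "(\<lambda>x. f x + g x) \<in> {\<lambda>x. f x + g x |f g. smooth f \<and> smooth g}" using assms by blast
next
  fix h x assume "h \<in> {\<lambda>x. f x + g x |f g. smooth f \<and> smooth g}"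
  then obtain f g where "h = (\<lambda>x. f x + g x)" "smooth f" "smooth g" by auto
  then show "h differentiable (at x)"
    using differentiable_add[OF smooth_differentiable smooth_differentiable] by blast
qed

lemma smooth_mult:
  fixes f g :: "real^3 \<Rightarrow> 'a::real_normed_algebra"
  shows "smooth f \<Longrightarrow> smooth g \<Longrightarrow> smooth (\<lambda>x. f x * g x)"
  by (rule smooth_bilinear[OF bounded_bilinear_mult])

lemma smooth_minus: "smooth f \<Longrightarrow> smooth (\<lambda>x. - f x)"
  by (rule smooth_bounded_linear[OF bounded_linear_minus[OF bounded_linear_ident]])

lemma smooth_diff: "smooth f \<Longrightarrow> smooth g \<Longrightarrow> smooth (\<lambda>x. f x - g x)"
  using smooth_add[OF _ smooth_minus, of f g] by simp

lemma smooth_sum: "finite A \<Longrightarrow> (\<And>i. i \<in> A \<Longrightarrow> smooth (f i)) \<Longrightarrow> smooth (\<lambda>x. \<Sum>i\<in>A. f i x)"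
  by (induction A rule: finite_induct) (auto intro!: smooth_add)

lemma smooth_prod:
  fixes f :: "'i \<Rightarrow> real^3 \<Rightarrow> real"
  shows "finite A \<Longrightarrow> (\<And>i. i \<in> A \<Longrightarrow> smooth (f i)) \<Longrightarrow> smooth (\<lambda>x. \<Prod>i\<in>A. f i x)"
  by (induction A rule: finite_induct) (auto intro!: smooth_mult)

lemma partial_translate:
  assumes "f differentiable (at (x + a))"
  shows "partial l (\<lambda>x. f (x + a)) x = partial l f (x + a)"
  unfolding partial_def[of l f]
proof (rule partial_eq)
  have "((\<lambda>x. x + a) has_derivative (\<lambda>h. h)) (at x)"
    by (auto intro!: derivative_eq_intros)
  from has_derivative_compose[OF this, of f]
  show "((\<lambda>x. f (x + a)) has_derivative frechet_derivative f (at (x + a))) (at x)"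
    using assms frechet_derivative_works by auto
qed

lemma smooth_translate:
  assumes "smooth f" shows "smooth (\<lambda>x. f (x + a))"
proof (rule smooth_coinduct[where S="{\<lambda>x. f (x + a) |f. smooth f}"])
  fix g x assume "g \<in> {\<lambda>x. f (x + a) |f. smooth f}"
  then obtain f where f: "g = (\<lambda>x. f (x + a))" "smooth f" by auto
  have "((\<lambda>x. x + a) has_derivative (\<lambda>h. h)) (at x)"
    by (auto intro!: derivative_eq_intros)
  from has_derivative_compose[OF this, of f]
  show "g differentiable (at x)" unfolding f using smooth_has_derivative[OF f(2)] differentiable_def by blast
next
  fix g l assume "g \<in> {\<lambda>x. f (x + a) |f. smooth f}"
  then obtain f where f: "g = (\<lambda>x. f (x + a))" "smooth f" by auto
  then have "partial l g = (\<lambda>x. partial l f (x + a))"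
    by (auto intro!: partial_translate smooth_differentiable)
  then show "partial l g \<in> {\<lambda>x. f (x + a) |f. smooth f}" using smooth_partial[OF f(2)] by auto
qed (use assms in auto)

lemma partial_compose_real:
  assumes "(D has_real_derivative D' ) (at (f x))" "f differentiable (at x)"
  shows "partial l (\<lambda>x. D (f x)) x = D' * partial l f x"
  unfolding partial_def[of l f]
proof (rule partial_eq)
  show "((\<lambda>x. D (f x)) has_derivative (\<lambda>h. D' * frechet_derivative f (at x) h)) (at x)"
    by (rule has_derivative_compose[of f _ x UNIV D "\<lambda>h. D' * h"])
       (use assms frechet_derivative_works in \<open>auto simp: has_field_derivative_def\<close>)
qed

text \<open>Here \<open>D\<close> lists the successive derivatives of the outer function.
  Differentiating \<open>D n (f x)\<close> yields the smooth factor \<open>partial l f x\<close>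
  times \<open>D (Suc n) (f x)\<close>, so sums of smooth multiples of all the
  \<open>D n (f x)\<close> are stable.\<close>

inductive_set chain_span :: "(nat \<Rightarrow> real \<Rightarrow> real) \<Rightarrow> (real^3 \<Rightarrow> real) \<Rightarrow> (real^3 \<Rightarrow> real) set" for D f where
  base: "smooth h \<Longrightarrow> (\<lambda>x. h x * D n (f x)) \<in> chain_span D f"
| add: "g \<in> chain_span D f \<Longrightarrow> h \<in> chain_span D f \<Longrightarrow> (\<lambda>x. g x + h x) \<in> chain_span D f"

lemma smooth_compose_real:
  assumes D: "\<And>n x. (D n has_real_derivative D (Suc n) x) (at x)" and f: "smooth f"
  shows "smooth (\<lambda>x. D n (f x))"
proof (rule smooth_coinduct[where S="chain_span D f"])
  show "(\<lambda>x. D n (f x)) \<in> chain_span D f" using chain_span.base[of "\<lambda>x. 1" D n f] by simp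
  have *: "(\<forall>x. g differentiable (at x)) \<and> (\<forall>l. partial l g \<in> chain_span D f)"
    if "g \<in> chain_span D f" for g
    using that
  proof induction
    case (base h n)
    have d: "(\<lambda>x. D n (f x)) differentiable (at x)" for x n
      unfolding differentiable_def
      by (rule exI, rule has_derivative_compose[OF smooth_has_derivative[OF f], of "D n" "(*) (D (Suc n) (f x))"])
         (use D in \<open>auto simp: has_field_derivative_def\<close>)
    have p: "partial l (\<lambda>x. D n (f x)) x = D (Suc n) (f x) * partial l f x" for l x
      by (rule partial_compose_real[OF D smooth_differentiable[OF f]])
    have "partial l (\<lambda>x. h x * D n (f x)) = (\<lambda>x. (h x * partial l f x) * D (Suc n) (f x) + partial l h x * D n (f x))" for l
      by (rule ext, subst partial_bilinear[OF bounded_bilinear_mult smooth_differentiable[OF base] d])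
         (simp add: p)
    moreover have "(\<lambda>x. h x * D n (f x)) differentiable (at x)" for x
      by (rule differentiable_mult[OF smooth_differentiable[OF base] d])
    ultimately show ?case
      using base f by (auto intro!: chain_span.intros smooth_mult smooth_partial)
  next
    case (add g h)
    then have "partial l (\<lambda>x. g x + h x) = (\<lambda>x. partial l g x + partial l h x)" for l
      by (intro ext partial_add) auto
    then show ?case using add by (auto intro!: chain_span.add differentiable_add)
  qed
  then show "\<And>g x. g \<in> chain_span D f \<Longrightarrow> g differentiable at x"
    "\<And>g l. g \<in> chain_span D f \<Longrightarrow> partial l g \<in> chain_span D f" by blast+
qed

section \<open>A function flat at the origin, and cutoffs built from it\<close>

fun flat_poly :: "nat \<Rightarrow> real poly" where
  "flat_poly 0 = 1"
| "flat_poly (Suc n) = [:0, 0, 1:] * (flat_poly n - pderiv (flat_poly n))"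

text \<open>The n-th derivative of exp(-1/t), extended by 0 to t <= 0. Differentiating p(s) exp(-s)
  with s = 1/t replaces p by s^2 (p - p'), which is the recursion of
  \<open>flat_poly\<close>.\<close>

definition flat :: "nat \<Rightarrow> real \<Rightarrow> real"
  where "flat n t = (if t > 0 then poly (flat_poly n) (1 / t) * exp (- (1 / t)) else 0)"

lemma tendsto_poly_exp_0: "((\<lambda>x::real. poly p x * exp (- x)) \<longlongrightarrow> 0) at_top"
proof -
  have "((\<lambda>x::real. (\<Sum>i\<le>degree p. coeff p i * (x ^ i / exp x))) \<longlongrightarrow> (\<Sum>i\<le>degree p. coeff p i * 0)) at_top"
    by (intro tendsto_intros tendsto_power_div_exp_0)
  moreover have "(\<Sum>i\<le>degree p. coeff p i * (x ^ i / exp x)) = poly p x * exp (- x)" for x :: real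
    by (simp add: poly_altdef sum_distrib_right exp_minus divide_simps)
  ultimately show ?thesis by simp
qed

lemma flat_has_derivative: "(flat n has_real_derivative flat (Suc n) t) (at t)"
proof -
  consider "t > 0" | "t < 0" | "t = 0" by linarith
  then show ?thesis
  proof cases
    case 1
    have "((\<lambda>t. poly (flat_poly n) (1 / t) * exp (- (1 / t))) has_real_derivative flat (Suc n) t) (at t)"
      using 1 by (auto simp: flat_def divide_simps power2_eq_square algebra_simps
          intro!: derivative_eq_intros)
    then show ?thesis
      by (rule has_field_derivative_transform_within[of _ _ _ _ t])
         (use 1 in \<open>auto simp: flat_def dist_real_def\<close>)
  next
    case 2
    have "((\<lambda>t. 0) has_real_derivative flat (Suc n) t) (at t)" using 2 by (auto simp: flat_def)
    then show ?thesis
      by (rule has_field_derivative_transform_within[of _ _ _ _ "- t"])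
         (use 2 in \<open>auto simp: flat_def dist_real_def\<close>)
  next
    case 3
    \<comment> \<open>With s = 1/h the difference quotient at 0 is s p(s) exp(-s); the extra factor
      s is the \<open>pCons 0\<close>.\<close>
    have r: "((\<lambda>h. poly (pCons 0 (flat_poly n)) (1 / h) * exp (- (1 / h))) \<longlongrightarrow> 0) (at_right 0)"
      by (rule filterlim_compose[OF tendsto_poly_exp_0, of "\<lambda>h. 1 / h"])
         (use filterlim_inverse_at_top_right in \<open>simp add: inverse_eq_divide\<close>)
    have "((\<lambda>h. flat n h / h) \<longlongrightarrow> 0) (at_right 0)"
      by (rule Lim_transform_eventually[OF r])
         (auto simp: flat_def eventually_at_right_less intro!: eventually_mono[OF eventually_at_right_less[of 0]])
    moreover have "((\<lambda>h. flat n h / h) \<longlongrightarrow> 0) (at_left 0)"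
      by (rule Lim_transform_eventually[OF tendsto_const])
         (auto simp: flat_def eventually_at_left_field intro!: exI[of _ "-1"])
    ultimately have "((\<lambda>h. flat n h / h) \<longlongrightarrow> 0) (at 0)"
      by (simp add: filterlim_split_at)
    then show ?thesis using 3 by (simp add: DERIV_def flat_def)
  qed
qed

lemma flat_pos: "t > 0 \<Longrightarrow> flat 0 t > 0" and flat_eq_0: "t \<le> 0 \<Longrightarrow> flat 0 t = 0"
  and flat_mono: "s \<le> t \<Longrightarrow> flat 0 s \<le> flat 0 t"
  by (auto simp: flat_def frac_le)

lemma flat_nonneg: "flat 0 t \<ge> 0"
  using flat_mono[of "min 0 t" t] flat_eq_0[of "min 0 t"] by simp

lemma smooth_flat: "smooth f \<Longrightarrow> smooth (\<lambda>x. flat 0 (f x))"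
  by (rule smooth_compose_real[of flat, OF flat_has_derivative])

lemma smooth_cutoff_exists:
  fixes a :: "real^3"
  assumes "0 \<le> r" "r < R"
  obtains \<eta> :: "real^3 \<Rightarrow> real" where "smooth \<eta>" "\<And>x. 0 \<le> \<eta> x" "\<And>x. \<eta> x \<le> 1"
    "\<And>x. dist a x \<le> r \<Longrightarrow> \<eta> x = 1" "\<And>x. dist a x \<ge> R \<Longrightarrow> \<eta> x = 0"
proof
  define c where "c = flat 0 (R\<^sup>2 - r\<^sup>2)"
  have "R\<^sup>2 - r\<^sup>2 > 0" using assms by (simp add: power_strict_mono)
  then have c: "c > 0" by (simp add: c_def flat_pos)
  \<comment> \<open>Two layers: the inner \<open>flat 0\<close> vanishes up to radius r and is at
    least c from radius R on, so the outer one has its full value \<open>flat 0 c\<close> inside and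
    vanishes outside; the last factor normalises. The distance enters squared, as a polynomial in
    the coordinates, to be smooth at the centre.\<close>
  define \<eta> where "\<eta> x = flat 0 (c - flat 0 ((\<Sum>l\<in>UNIV. (x $ l - a $ l) * (x $ l - a $ l)) - r\<^sup>2)) * (1 / flat 0 c)" for x :: "real^3"
  have d: "(\<Sum>l\<in>UNIV. (x $ l - a $ l) * (x $ l - a $ l)) = (dist a x)\<^sup>2" for x :: "real^3"
    unfolding dist_norm norm_vec_def L2_set_def
    by (subst real_sqrt_pow2[OF sum_nonneg], simp) (simp add: power2_eq_square algebra_simps)
  have lin: "smooth (\<lambda>x::real^3. x $ l)" for l by (intro smooth_linear bounded_linear_vec_nth)
  show "smooth \<eta>" unfolding \<eta>_def
    by (intro smooth_mult smooth_flat smooth_diff smooth_const smooth_sum lin) auto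
  show "0 \<le> \<eta> x" for x by (simp add: \<eta>_def flat_nonneg)
  show "\<eta> x \<le> 1" for x
    using flat_mono[of "c - flat 0 ((dist a x)\<^sup>2 - r\<^sup>2)" c] flat_nonneg[of "(dist a x)\<^sup>2 - r\<^sup>2"] flat_pos[OF c]
    by (simp add: \<eta>_def d)
  show "\<eta> x = 1" if "dist a x \<le> r" for x
    using that power_mono[OF that, of 2] flat_pos[OF c] by (simp add: \<eta>_def d flat_eq_0)
  show "\<eta> x = 0" if "dist a x \<ge> R" for x
  proof -
    have "R\<^sup>2 \<le> (dist a x)\<^sup>2" using that assms by (intro power_mono) auto
    then have "c \<le> flat 0 ((dist a x)\<^sup>2 - r\<^sup>2)" unfolding c_def by (intro flat_mono) auto
    then show ?thesis by (simp add: \<eta>_def d flat_eq_0)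
  qed
qed

section \<open>Test functions\<close>

lemma in_support: "f x \<noteq> 0 \<Longrightarrow> x \<in> closure {x. f x \<noteq> 0}"
  using closure_subset[of "{x. f x \<noteq> 0}"] by blast

lemma test_functions_iff:
  "\<psi> \<in> test_functions U \<longleftrightarrow> smooth \<psi> \<and> bounded {x. \<psi> x \<noteq> 0} \<and> closure {x. \<psi> x \<noteq> 0} \<subseteq> U"
  by (auto simp: test_functions_def compact_closure)

lemma test_smooth: "\<psi> \<in> test_functions U \<Longrightarrow> smooth \<psi>"
  by (simp add: test_functions_def)

lemma test_mono: "\<psi> \<in> test_functions U \<Longrightarrow> U \<subseteq> V \<Longrightarrow> \<psi> \<in> test_functions V"
  by (auto simp: test_functions_def)

text \<open>The condition refers to the closed support because a derivative of \<psi> may be nonzero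
  at a zero of \<psi>, but not off its closed support.\<close>

lemma test_support_mono:
  assumes "\<psi> \<in> test_functions U" "smooth \<phi>" "\<And>x. \<phi> x \<noteq> 0 \<Longrightarrow> x \<in> closure {x. \<psi> x \<noteq> 0}"
  shows "\<phi> \<in> test_functions U"
proof -
  have "closure {x. \<phi> x \<noteq> 0} \<subseteq> closure {x. \<psi> x \<noteq> 0}"
    using assms(3) by (metis (mono_tags, lifting) closed_closure closure_minimal mem_Collect_eq subsetI)
  then show ?thesis
    using assms(1,2) unfolding test_functions_iff
    by (meson bounded_closure bounded_subset closure_subset order_trans)
qed

lemma test_bilinear_right:
  assumes "bounded_bilinear pr" "smooth f" "\<psi> \<in> test_functions U"
  shows "(\<lambda>x. pr (f x) (\<psi> x)) \<in> test_functions U"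
  by (rule test_support_mono[OF assms(3) smooth_bilinear[OF assms(1,2) test_smooth[OF assms(3)]]])
     (metis bounded_bilinear.zero_right[OF assms(1)] in_support)

lemma test_bilinear_left:
  assumes "bounded_bilinear pr" "\<psi> \<in> test_functions U" "smooth f"
  shows "(\<lambda>x. pr (\<psi> x) (f x)) \<in> test_functions U"
  by (rule test_support_mono[OF assms(2) smooth_bilinear[OF assms(1) test_smooth[OF assms(2)] assms(3)]])
     (metis bounded_bilinear.zero_left[OF assms(1)] in_support)

lemma test_bounded_linear:
  assumes "bounded_linear h" "\<psi> \<in> test_functions U"
  shows "(\<lambda>x. h (\<psi> x)) \<in> test_functions U"
proof (rule test_support_mono[OF assms(2) smooth_bounded_linear[OF assms(1) test_smooth[OF assms(2)]]])
  fix x assume "h (\<psi> x) \<noteq> 0"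
  then have "\<psi> x \<noteq> 0" using linear_0[OF bounded_linear.linear[OF assms(1)]] by auto
  then show "x \<in> closure {x. \<psi> x \<noteq> 0}" by (rule in_support)
qed

lemma test_add:
  assumes "\<psi> \<in> test_functions U" "\<phi> \<in> test_functions U"
  shows "(\<lambda>x. \<psi> x + \<phi> x) \<in> test_functions U"
proof -
  have "{x. \<psi> x + \<phi> x \<noteq> 0} \<subseteq> {x. \<psi> x \<noteq> 0} \<union> {x. \<phi> x \<noteq> 0}" by auto
  from closure_mono[OF this] bounded_subset[OF _ this]
  show ?thesis using assms by (auto simp: test_functions_iff intro!: smooth_add)
qed

lemma test_zero [simp]: "(\<lambda>x. 0) \<in> test_functions U"
  by (simp add: test_functions_iff)

lemma test_sum:
  "finite A \<Longrightarrow> (\<And>i. i \<in> A \<Longrightarrow> f i \<in> test_functions U) \<Longrightarrow> (\<lambda>x. \<Sum>i\<in>A. f i x) \<in> test_functions U"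
  by (induction A rule: finite_induct) (auto intro: test_add)

lemma test_minus: "\<psi> \<in> test_functions U \<Longrightarrow> (\<lambda>x. - \<psi> x) \<in> test_functions U"
  by (rule test_bounded_linear[OF bounded_linear_minus[OF bounded_linear_ident]])

lemma test_diff: "\<psi> \<in> test_functions U \<Longrightarrow> \<phi> \<in> test_functions U \<Longrightarrow> (\<lambda>x. \<psi> x - \<phi> x) \<in> test_functions U"
  using test_add[OF _ test_minus, of \<psi> U \<phi>] by simp

lemma test_mult_right:
  fixes f \<psi> :: "real^3 \<Rightarrow> 'a::real_normed_algebra"
  shows "smooth f \<Longrightarrow> \<psi> \<in> test_functions U \<Longrightarrow> (\<lambda>x. f x * \<psi> x) \<in> test_functions U"
  by (rule test_bilinear_right[OF bounded_bilinear_mult])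

lemma test_mult_left:
  fixes f \<psi> :: "real^3 \<Rightarrow> 'a::real_normed_algebra"
  shows "\<psi> \<in> test_functions U \<Longrightarrow> smooth f \<Longrightarrow> (\<lambda>x. \<psi> x * f x) \<in> test_functions U"
  by (rule test_bilinear_left[OF bounded_bilinear_mult])

lemma partial_eq_0_outside:
  assumes "x \<notin> closure {x. f x \<noteq> 0}"
  shows "partial l f x = 0"
proof -
  have "((\<lambda>x. 0) has_derivative (\<lambda>h. 0)) (at x)" by simp
  then have "(f has_derivative (\<lambda>h. 0)) (at x)"
    by (rule has_derivative_transform_within_open[where s="- closure {x. f x \<noteq> 0}"])
       (use assms in_support in auto)
  then show ?thesis by (rule partial_eq)
qed

lemma test_partial: "\<psi> \<in> test_functions U \<Longrightarrow> partial l \<psi> \<in> test_functions U"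
  using test_support_mono[OF _ smooth_partial[OF test_smooth]] partial_eq_0_outside by blast

lemma test_translate:
  assumes "\<psi> \<in> test_functions UNIV"
  shows "(\<lambda>x. \<psi> (x + a)) \<in> test_functions UNIV"
proof -
  have "{x. \<psi> (x + a) \<noteq> 0} = (\<lambda>x. x - a) ` {x. \<psi> x \<noteq> 0}"
    by (auto simp: image_iff) (metis add_diff_cancel)
  moreover have "bounded ((\<lambda>x. x - a) ` {x. \<psi> x \<noteq> 0})"
    using assms by (intro bounded_translation_minus) (auto simp: test_functions_iff)
  ultimately show ?thesis using assms by (auto simp: test_functions_iff intro: smooth_translate)
qed

lemma test_bounded:
  assumes "\<psi> \<in> test_functions U"
  obtains B where "B > 0" "\<And>x. norm (\<psi> x) \<le> B"
proof -
  have "bounded (\<psi> ` closure {x. \<psi> x \<noteq> 0})"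
    using assms by (intro compact_imp_bounded compact_continuous_image smooth_continuous)
      (auto simp: test_functions_def)
  then obtain B where B: "B > 0" "\<And>x. x \<in> closure {x. \<psi> x \<noteq> 0} \<Longrightarrow> norm (\<psi> x) \<le> B"
    by (force simp: bounded_pos)
  have "norm (\<psi> x) \<le> B" for x
  proof (cases "\<psi> x = 0")
    case False
    then show ?thesis using B(2)[OF in_support] by blast
  qed (use B in auto)
  then show ?thesis using B(1) that by blast
qed

section \<open>Integrability of products with test functions\<close>

lemma smooth_measurable [measurable]:
  fixes f :: "real^3 \<Rightarrow> 'a::{real_normed_vector, second_countable_topology}"
  shows "smooth f \<Longrightarrow> f \<in> borel_measurable lebesgue"
  by (intro measurable_completion) (simp add: borel_measurable_continuous_onI smooth_continuous)

text \<open>The test function is bounded with compact closed support, so the product is dominated by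
  a multiple of f restricted to that support. An arbitrary bounded bilinear product covers real
  products, scalar multiples and Hermitian pairings at once.\<close>

lemma integrable_loc_times_test:
  fixes f :: "real^3 \<Rightarrow> 'a::{banach, second_countable_topology}"
    and \<psi> :: "real^3 \<Rightarrow> 'b::{banach, second_countable_topology}"
    and pr :: "'a \<Rightarrow> 'b \<Rightarrow> 'c::{banach, second_countable_topology}"
  assumes pr: "bounded_bilinear pr" and f: "loc_integrable U f" and \<psi>: "\<psi> \<in> test_functions U"
  shows "integrable lebesgue (\<lambda>x. pr (f x) (\<psi> x))"
proof -
  let ?K = "closure {x. \<psi> x \<noteq> 0}"
  obtain B where B: "B > 0" "\<And>x. norm (\<psi> x) \<le> B" using test_bounded[OF \<psi>] by blast
  obtain C where C: "C > 0" "\<And>a b. norm (pr a b) \<le> norm a * norm b * C"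
    using bounded_bilinear.pos_bounded[OF pr] by blast
  have int: "integrable lebesgue (\<lambda>x. indicator ?K x *\<^sub>R f x)"
    using f \<psi> unfolding loc_integrable_def set_integrable_def test_functions_def by blast
  have eq: "pr (f x) (\<psi> x) = pr (indicator ?K x *\<^sub>R f x) (\<psi> x)" for x
  proof (cases "x \<in> ?K")
    case False
    then have "\<psi> x = 0" using in_support by blast
    then show ?thesis using bounded_bilinear.zero_right[OF pr] by simp
  qed simp
  show ?thesis
  proof (rule Bochner_Integration.integrable_bound)
    show "integrable lebesgue (\<lambda>x. (B * C) *\<^sub>R (indicator ?K x *\<^sub>R f x))" using int by (rule integrable_scaleR_right)
    have "continuous_on UNIV (\<lambda>p. pr (fst p) (snd p))"
      by (intro bounded_bilinear.continuous_on[OF pr] continuous_intros)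
    then show "(\<lambda>x. pr (f x) (\<psi> x)) \<in> borel_measurable lebesgue"
      unfolding eq
      by (rule borel_measurable_continuous_Pair[where H=pr, OF borel_measurable_integrable[OF int]
            smooth_measurable[OF test_smooth[OF \<psi>]]])
    show "AE x in lebesgue. norm (pr (f x) (\<psi> x)) \<le> norm ((B * C) *\<^sub>R (indicator ?K x *\<^sub>R f x))"
    proof (rule AE_I2)
      fix x
      have "norm (pr (f x) (\<psi> x)) \<le> norm (indicator ?K x *\<^sub>R f x) * norm (\<psi> x) * C" unfolding eq by (rule C)
      also have "\<dots> \<le> norm (indicator ?K x *\<^sub>R f x) * B * C" using B C by (intro mult_right_mono mult_left_mono) auto
      also have "\<dots> = norm ((B * C) *\<^sub>R (indicator ?K x *\<^sub>R f x))" using B C by (simp add: abs_mult)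
      finally show "norm (pr (f x) (\<psi> x)) \<le> norm ((B * C) *\<^sub>R (indicator ?K x *\<^sub>R f x))" .
    qed
  qed
qed

lemma loc_integrable_const: "loc_integrable U (\<lambda>x. c)"
  unfolding loc_integrable_def set_integrable_def
proof (intro allI impI integrable_scaleR_left)
  fix K :: "(real^3) set" assume "compact K \<and> K \<subseteq> U"
  then have "K \<in> lmeasurable" by (intro lmeasurable_compact) simp
  then show "integrable lebesgue (indicat_real K)"
    by (intro integrable_real_indicator) (auto simp: fmeasurable_def)
qed

lemma test_integrable:
  fixes \<psi> :: "real^3 \<Rightarrow> 'b::{banach, second_countable_topology}"
  assumes "\<psi> \<in> test_functions U"
  shows "integrable lebesgue \<psi>"
  using integrable_loc_times_test[OF bounded_bilinear_scaleR loc_integrable_const[of U 1] assms] by simp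

lemma loc_integrable_mono: "loc_integrable U f \<Longrightarrow> V \<subseteq> U \<Longrightarrow> loc_integrable V f"
  by (auto simp: loc_integrable_def)

lemma loc_integrable_add: "loc_integrable U f \<Longrightarrow> loc_integrable U g \<Longrightarrow> loc_integrable U (\<lambda>x. f x + g x)"
  by (auto simp: loc_integrable_def)

lemma loc_integrable_diff: "loc_integrable U f \<Longrightarrow> loc_integrable U g \<Longrightarrow> loc_integrable U (\<lambda>x. f x - g x)"
  by (auto simp: loc_integrable_def)

lemma loc_integrable_minus: "loc_integrable U f \<Longrightarrow> loc_integrable U (\<lambda>x. - f x)"
  using loc_integrable_diff[OF loc_integrable_const[of U 0]] by simp

lemma loc_integrable_bounded_linear:
  "bounded_linear h \<Longrightarrow> loc_integrable U f \<Longrightarrow> loc_integrable U (\<lambda>x. h (f x))"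
  unfolding loc_integrable_def set_integrable_def
  by (auto simp: linear_cmul[OF bounded_linear.linear, symmetric] intro: integrable_bounded_linear)

subsection \<open>The fundamental lemma of the calculus of variations\<close>

lemma test_approx_compact:
  fixes K :: "(real^3) set"
  assumes "compact K" "e > 0"
  obtains F :: "real^3 \<Rightarrow> real" where "F \<in> test_functions UNIV" "\<And>x. 0 \<le> F x" "\<And>x. F x \<le> 1"
    "\<And>x. x \<in> K \<Longrightarrow> F x = 1" "\<And>x. F x \<noteq> 0 \<Longrightarrow> \<exists>y\<in>K. dist y x < e"
proof -
  have "K \<subseteq> (\<Union>x\<in>K. ball x (e/2))" using assms by (auto intro!: bexI)
  then obtain D where D: "D \<subseteq> K" "finite D" "K \<subseteq> (\<Union>x\<in>D. ball x (e/2))"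
    using compactE_image[OF assms(1), of K "\<lambda>x. ball x (e/2)"] by blast
  have "\<exists>\<eta>::real^3 \<Rightarrow> real. smooth \<eta> \<and> (\<forall>x. 0 \<le> \<eta> x) \<and> (\<forall>x. \<eta> x \<le> 1) \<and>
    (\<forall>x. dist a x \<le> e/2 \<longrightarrow> \<eta> x = 1) \<and> (\<forall>x. dist a x \<ge> e \<longrightarrow> \<eta> x = 0)" for a
    by (rule smooth_cutoff_exists[of "e/2" e a]) (use assms in auto)
  then obtain \<eta> :: "real^3 \<Rightarrow> real^3 \<Rightarrow> real" where \<eta>: "\<And>a. smooth (\<eta> a)" "\<And>a x. 0 \<le> \<eta> a x" "\<And>a x. \<eta> a x \<le> 1"
    "\<And>a x. dist a x \<le> e/2 \<Longrightarrow> \<eta> a x = 1" "\<And>a x. dist a x \<ge> e \<Longrightarrow> \<eta> a x = 0"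
    by metis
  \<comment> \<open>One minus the product equals 1 as soon as a single cutoff is 1, vanishes where
    all cutoffs vanish, and stays in [0, 1].\<close>
  define F where "F x = 1 - (\<Prod>a\<in>D. 1 - \<eta> a x)" for x
  have p: "0 \<le> (\<Prod>a\<in>D. 1 - \<eta> a x)" "(\<Prod>a\<in>D. 1 - \<eta> a x) \<le> 1" for x
    by (auto intro!: prod_nonneg prod_le_1 simp: \<eta>)
  have near: "\<exists>y\<in>K. dist y x < e" if "F x \<noteq> 0" for x
  proof (rule ccontr)
    assume "\<not> ?thesis"
    then have "\<eta> a x = 0" if "a \<in> D" for a using D that by (intro \<eta>) force
    then show False using that by (simp add: F_def)
  qed
  have "bounded (\<Union>y\<in>K. \<Union>z\<in>ball 0 e. {y + z})"
    using assms by (intro bounded_sums) (auto intro: compact_imp_bounded)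
  moreover have "{x. F x \<noteq> 0} \<subseteq> (\<Union>y\<in>K. \<Union>z\<in>ball 0 e. {y + z})"
  proof
    fix x assume "x \<in> {x. F x \<noteq> 0}"
    then obtain y where "y \<in> K" "dist y x < e" using near by blast
    then show "x \<in> (\<Union>y\<in>K. \<Union>z\<in>ball 0 e. {y + z})"
      by (intro UN_I[of y] UN_I[of "x - y"]) (auto simp: dist_norm norm_minus_commute)
  qed
  ultimately have "bounded {x. F x \<noteq> 0}" by (rule bounded_subset)
  moreover have "smooth F" unfolding F_def using D by (intro smooth_diff smooth_prod smooth_const \<eta>)
  ultimately have "F \<in> test_functions UNIV" by (simp add: test_functions_iff)
  moreover have "F x = 1" if x: "x \<in> K" for x
  proof -
    obtain a where "a \<in> D" "dist a x < e/2" using D(3) x by auto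
    then have "(\<Prod>a\<in>D. 1 - \<eta> a x) = 0" using D(2) \<eta>(4)[of a x] by (intro prod_zero) auto
    then show ?thesis by (simp add: F_def)
  qed
  ultimately show thesis using that[of F] p near by (auto simp: F_def)
qed

text \<open>Test functions equal to 1 on C and supported in neighbourhoods shrinking to C converge
  pointwise to the indicator of C. All of them live in one compact K inside U, where |h| is an
  integrable majorant.\<close>

lemma compact_integral_nonneg:
  fixes h :: "real^3 \<Rightarrow> real"
  assumes "open U" "loc_integrable U h" "compact C" "C \<subseteq> U"
    and pos: "\<And>F. F \<in> test_functions U \<Longrightarrow> (\<And>x. 0 \<le> F x) \<Longrightarrow> 0 \<le> (LINT x|lebesgue. h x * F x)"
  shows "0 \<le> (LINT x:C|lebesgue. h x)"
proof -
  obtain d where d: "d > 0" "(\<Union>x\<in>C. cball x d) \<subseteq> U" using compact_subset_open_imp_cball_epsilon_subset[OF assms(3,1,4)] by blast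
  define K where "K = (\<Union>x\<in>C. \<Union>z\<in>cball 0 d. {x + z})"
  have "compact K" unfolding K_def by (intro compact_sums' compact_cball assms)
  have Kiff: "x \<in> K \<longleftrightarrow> (\<exists>y\<in>C. dist y x \<le> d)" for x
  proof
    assume "\<exists>y\<in>C. dist y x \<le> d"
    then obtain y where "y \<in> C" "dist y x \<le> d" by blast
    then show "x \<in> K" unfolding K_def
      by (intro UN_I[of y] UN_I[of "x - y"]) (auto simp: dist_norm norm_minus_commute)
  next
    assume "x \<in> K"
    then obtain y z where "y \<in> C" "norm z \<le> d" "x = y + z" by (auto simp: K_def)
    then show "\<exists>y\<in>C. dist y x \<le> d" by (intro bexI[of _ y]) (auto simp: dist_norm)
  qed
  have "K \<subseteq> U" using d(2) by (force simp: Kiff)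
  have "\<exists>F :: real^3 \<Rightarrow> real. F \<in> test_functions UNIV \<and> (\<forall>x. 0 \<le> F x) \<and> (\<forall>x. F x \<le> 1) \<and>
    (\<forall>x\<in>C. F x = 1) \<and> (\<forall>x. F x \<noteq> 0 \<longrightarrow> (\<exists>y\<in>C. dist y x < d / Suc n))" for n
    by (rule test_approx_compact[OF assms(3), of "d / Suc n"]) (use d in auto)
  then obtain F :: "nat \<Rightarrow> real^3 \<Rightarrow> real" where F: "\<And>n. F n \<in> test_functions UNIV" "\<And>n x. 0 \<le> F n x" "\<And>n x. F n x \<le> 1"
    "\<And>n x. x \<in> C \<Longrightarrow> F n x = 1" "\<And>n x. F n x \<noteq> 0 \<Longrightarrow> \<exists>y\<in>C. dist y x < d / Suc n"
    by metis
  have small: "d / Suc n \<le> d" for n using d by (simp add: divide_le_eq)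
  have FK: "x \<in> K" if "F n x \<noteq> 0" for n x
    using F(5)[OF that] small[of n] unfolding Kiff by force
  have FU: "F n \<in> test_functions U" for n
  proof -
    have "closure {x. F n x \<noteq> 0} \<subseteq> K"
      using FK \<open>compact K\<close> by (intro closure_minimal compact_imp_closed) auto
    then show ?thesis using F(1)[of n] \<open>K \<subseteq> U\<close> by (auto simp: test_functions_iff)
  qed
  have intK: "integrable lebesgue (\<lambda>x. indicator K x *\<^sub>R h x)"
    using assms(2) \<open>compact K\<close> \<open>K \<subseteq> U\<close> by (auto simp: loc_integrable_def set_integrable_def)
  have "(\<lambda>n. LINT x|lebesgue. h x * F n x) \<longlonglongrightarrow> (LINT x|lebesgue. indicator C x *\<^sub>R h x)"
  proof (rule integral_dominated_convergence[where w="\<lambda>x. norm (indicator K x *\<^sub>R h x)"])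
    show "(\<lambda>x. indicator C x *\<^sub>R h x) \<in> borel_measurable lebesgue"
      using assms(2-4) by (auto simp: loc_integrable_def set_integrable_def)
    show "(\<lambda>x. h x * F n x) \<in> borel_measurable lebesgue" for n
      using integrable_loc_times_test[OF bounded_bilinear_mult assms(2) FU] by auto
    show "AE x in lebesgue. (\<lambda>n. h x * F n x) \<longlonglongrightarrow> indicator C x *\<^sub>R h x"
    proof (rule AE_I2)
      fix x
      have "(\<lambda>n. F n x) \<longlonglongrightarrow> indicator C x"
      proof (cases "x \<in> C")
        case False
        then obtain r where r: "r > 0" "\<forall>y\<in>C. \<not> dist x y < r"
          using compact_imp_closed[OF assms(3)] by (metis closed_approachable dist_commute)
        have "(\<lambda>n. d / Suc n) \<longlonglongrightarrow> 0" by (rule LIMSEQ_Suc, rule lim_const_over_n)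
        then have "eventually (\<lambda>n. d / Suc n < r) sequentially" by (rule order_tendstoD) (use r in auto)
        then have "eventually (\<lambda>n. F n x = 0) sequentially"
          by eventually_elim (use F(5) r(2) in \<open>force simp: dist_commute\<close>)
        then have "eventually (\<lambda>n. indicator C x = F n x) sequentially" using False by (auto elim: eventually_mono)
        then show ?thesis by (rule Lim_transform_eventually[OF tendsto_const])
      qed (simp add: F)
      then show "(\<lambda>n. h x * F n x) \<longlonglongrightarrow> indicator C x *\<^sub>R h x"
        by (auto intro!: tendsto_eq_intros)
    qed
    show "AE x in lebesgue. norm (h x * F n x) \<le> norm (indicator K x *\<^sub>R h x)" for n
    proof (rule AE_I2)
      fix x
      show "norm (h x * F n x) \<le> norm (indicator K x *\<^sub>R h x)"
        by (cases "F n x = 0") (use F(2,3) FK[of n x] in \<open>auto simp: abs_mult mult_left_le\<close>)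
    qed
  qed (use intK in auto)
  then show ?thesis unfolding set_lebesgue_integral_def
    by (rule LIMSEQ_le_const) (use pos[OF FU] F(2) in auto)
qed

text \<open>Inner regularity of Lebesgue measure: over a closed subset of the set where h < 0 the
  integral of h is nonnegative by the previous lemma although the integrand is negative, so every
  such subset is null.\<close>

lemma AE_nonneg_if_test:
  fixes h :: "real^3 \<Rightarrow> real"
  assumes "open U" "loc_integrable U h"
    and pos: "\<And>F. F \<in> test_functions U \<Longrightarrow> (\<And>x. 0 \<le> F x) \<Longrightarrow> 0 \<le> (LINT x|lebesgue. h x * F x)"
  shows "AE x in lebesgue. x \<in> U \<longrightarrow> 0 \<le> h x"
proof -
  have K: "AE x in lebesgue. x \<in> K \<longrightarrow> 0 \<le> h x" if K: "compact K" "K \<subseteq> U" for K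
  proof -
    define N where "N = {x. indicator K x *\<^sub>R h x < 0}"
    have "(\<lambda>x. indicator K x *\<^sub>R h x) \<in> borel_measurable lebesgue"
      using assms(2) K by (auto simp: loc_integrable_def set_integrable_def)
    from borel_measurable_less[OF this borel_measurable_const[of 0]]
    have N: "N \<in> sets lebesgue"
      by (simp only: N_def space_completion space_lborel space_borel UNIV_I simp_thms)
    have NK: "N \<subseteq> K" by (auto simp: N_def indicator_def split: if_splits)
    have null: "C \<in> null_sets lebesgue" if C: "closed C" "C \<subseteq> N" for C
    proof -
      have cC: "compact C" using C NK K by (metis closed_Int_compact inf.absorb1 subset_trans)
      have int: "integrable lebesgue (\<lambda>x. indicator C x *\<^sub>R h x)"
        using assms(2) cC C NK K unfolding loc_integrable_def set_integrable_def by blast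
      have neg: "indicator C x *\<^sub>R h x \<le> 0" for x
      proof (cases "x \<in> C")
        case True
        then have "indicator K x *\<^sub>R h x < 0" "x \<in> K" using C NK by (auto simp: N_def)
        then show ?thesis using True by simp
      qed simp
      have "0 \<le> (LINT x|lebesgue. indicator C x *\<^sub>R h x)"
        using compact_integral_nonneg[OF assms(1,2) cC _ pos] C NK K
        unfolding set_lebesgue_integral_def by blast
      then have "(LINT x|lebesgue. - (indicator C x *\<^sub>R h x)) = 0"
        using integral_nonneg_AE[of "\<lambda>x. - (indicator C x *\<^sub>R h x)" lebesgue] neg by auto
      then have "AE x in lebesgue. - (indicator C x *\<^sub>R h x) = 0"
        by (subst (asm) integral_nonneg_eq_0_iff_AE) (use int neg in auto)
      then have "AE x in lebesgue. x \<notin> C"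
        by (rule AE_mp) (use C in \<open>auto simp: N_def indicator_def split: if_splits intro!: AE_I2\<close>)
      moreover have "C \<in> sets lebesgue" using C by auto
      ultimately show ?thesis by (simp add: AE_iff_null_sets)
    qed
    have "emeasure lebesgue N \<le> 0 + ennreal e" if "e > 0" for e
    proof -
      obtain T where T: "closed T" "T \<subseteq> N" "N - T \<in> lmeasurable" "emeasure lebesgue (N - T) < ennreal e"
        using sets_lebesgue_inner_closed[OF N \<open>e > 0\<close>] by blast
      have "N = T \<union> (N - T)" using T by auto
      then have "emeasure lebesgue N \<le> emeasure lebesgue T + emeasure lebesgue (N - T)"
        using T by (metis emeasure_subadditive fmeasurableD lebesgue_closedin closed_closedin
          lborelD sets_completionI_sets borel_closed sets_lborel)
      then show ?thesis using null[OF T(1,2)] T(4) by (auto simp: null_sets_def)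
    qed
    then have "emeasure lebesgue N \<le> 0" by (rule ennreal_le_epsilon)
    then have "N \<in> null_sets lebesgue" using N by auto
    then have "AE x in lebesgue. x \<notin> N" by (rule AE_not_in)
    then show ?thesis by (rule AE_mp) (auto simp: N_def intro!: AE_I2)
  qed
  obtain C :: "nat \<Rightarrow> (real^3) set" where C: "\<And>n. compact (C n)" "\<And>n. C n \<subseteq> U" "U = (\<Union>n. C n)"
    using open_Union_compact_subsets[OF assms(1)] by metis
  have "AE x in lebesgue. \<forall>n. x \<in> C n \<longrightarrow> 0 \<le> h x"
    unfolding AE_all_countable by (intro allI K C)
  then show ?thesis by (rule AE_mp) (auto simp: C(3) intro!: AE_I2)
qed

lemma AE_zero_if_test:
  fixes h :: "real^3 \<Rightarrow> real"
  assumes "open U" "loc_integrable U h"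
    and zero: "\<And>F. F \<in> test_functions U \<Longrightarrow> (LINT x|lebesgue. h x * F x) = 0"
  shows "AE x in lebesgue. x \<in> U \<longrightarrow> h x = 0"
proof -
  have "AE x in lebesgue. x \<in> U \<longrightarrow> 0 \<le> h x"
    by (rule AE_nonneg_if_test) (auto simp: assms)
  moreover have "AE x in lebesgue. x \<in> U \<longrightarrow> 0 \<le> - h x"
    by (rule AE_nonneg_if_test) (auto simp: assms loc_integrable_minus)
  ultimately show ?thesis by eventually_elim auto
qed

lemma AE_zero_if_test_complex:
  fixes h :: "real^3 \<Rightarrow> complex"
  assumes "loc_integrable UNIV h"
    and zero: "\<And>F::real^3 \<Rightarrow> real. F \<in> test_functions UNIV \<Longrightarrow> (LINT x|lebesgue. F x *\<^sub>R h x) = 0"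
  shows "AE x in lebesgue. h x = 0"
proof -
  have int: "integrable lebesgue (\<lambda>x. F x *\<^sub>R h x)" if "F \<in> test_functions UNIV" for F :: "real^3 \<Rightarrow> real"
    using integrable_loc_times_test[OF bounded_bilinear.flip[OF bounded_bilinear_scaleR] assms(1) that] by simp
  have "AE x in lebesgue. x \<in> UNIV \<longrightarrow> Re (h x) = 0"
  proof (rule AE_zero_if_test)
    show "loc_integrable UNIV (\<lambda>x. Re (h x))"
      by (rule loc_integrable_bounded_linear[OF bounded_linear_Re assms(1)])
    fix F :: "real^3 \<Rightarrow> real" assume F: "F \<in> test_functions UNIV"
    show "(LINT x|lebesgue. Re (h x) * F x) = 0"
      using integral_Re[OF int[OF F]] zero[OF F] by (simp add: mult.commute)
  qed simp
  moreover have "AE x in lebesgue. x \<in> UNIV \<longrightarrow> Im (h x) = 0"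
  proof (rule AE_zero_if_test)
    show "loc_integrable UNIV (\<lambda>x. Im (h x))"
      by (rule loc_integrable_bounded_linear[OF bounded_linear_Im assms(1)])
    fix F :: "real^3 \<Rightarrow> real" assume F: "F \<in> test_functions UNIV"
    show "(LINT x|lebesgue. Im (h x) * F x) = 0"
      using integral_Im[OF int[OF F]] zero[OF F] by (simp add: mult.commute)
  qed simp
  ultimately show ?thesis by eventually_elim (simp add: complex_eq_iff)
qed

lemma AE_bounded_if_test:
  fixes h :: "real^3 \<Rightarrow> real"
  assumes h: "loc_integrable UNIV h"
    and bnd: "\<And>F. F \<in> test_functions UNIV \<Longrightarrow> (\<And>x. 0 \<le> F x) \<Longrightarrow>
      \<bar>LINT x|lebesgue. h x * F x\<bar> \<le> C * (LINT x|lebesgue. F x)"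
  shows "AE x in lebesgue. \<bar>h x\<bar> \<le> C"
proof -
  have int: "integrable lebesgue (\<lambda>x. h x * F x)" if "F \<in> test_functions UNIV" for F
    by (rule integrable_loc_times_test[OF bounded_bilinear_mult h that])
  have "AE x in lebesgue. x \<in> UNIV \<longrightarrow> 0 \<le> C - h x"
  proof (rule AE_nonneg_if_test)
    fix F :: "real^3 \<Rightarrow> real" assume F: "F \<in> test_functions UNIV" "\<And>x. 0 \<le> F x"
    show "0 \<le> (LINT x|lebesgue. (C - h x) * F x)"
      using bnd[OF F] int[OF F(1)] test_integrable[OF F(1)] by (simp add: left_diff_distrib)
  qed (auto intro: loc_integrable_diff loc_integrable_const h)
  moreover have "AE x in lebesgue. x \<in> UNIV \<longrightarrow> 0 \<le> C + h x"
  proof (rule AE_nonneg_if_test)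
    fix F :: "real^3 \<Rightarrow> real" assume F: "F \<in> test_functions UNIV" "\<And>x. 0 \<le> F x"
    show "0 \<le> (LINT x|lebesgue. (C + h x) * F x)"
      using bnd[OF F] int[OF F(1)] test_integrable[OF F(1)] by (simp add: distrib_right)
  qed (auto intro: loc_integrable_add loc_integrable_const h)
  ultimately show ?thesis by eventually_elim auto
qed

section \<open>Translations and integration by parts\<close>

lemma lebesgue_distr_translate: "distr lebesgue lebesgue (\<lambda>x. x + a) = (lebesgue :: (real^3) measure)"
  using lebesgue_affine_euclidean[of "\<lambda>_. 1" a]
  by (simp add: euclidean_representation density_1 add.commute)

lemma measurable_lebesgue_translate [measurable]:
  "(\<lambda>x. x + a) \<in> (lebesgue :: (real^3) measure) \<rightarrow>\<^sub>M lebesgue"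
  using lebesgue_affine_measurable[of "\<lambda>_. 1" a]
  by (simp add: euclidean_representation add.commute)

lemma AE_translate:
  fixes a :: "real^3"
  assumes "AE x in lebesgue. P x" shows "AE x in lebesgue. P (x + a)"
proof -
  have "almost_everywhere (distr lebesgue lebesgue (\<lambda>x. x + a)) P"
    using assms by (subst lebesgue_distr_translate)
  from AE_distrD[OF measurable_lebesgue_translate this] show ?thesis .
qed

lemma integrable_translate:
  fixes f :: "real^3 \<Rightarrow> 'a::{banach, second_countable_topology}"
  assumes "integrable lebesgue f" shows "integrable lebesgue (\<lambda>x. f (x + a))"
  using integrable_distr[OF measurable_lebesgue_translate, of a f] assms
  by (simp add: lebesgue_distr_translate)

lemma integral_translate:
  fixes f :: "real^3 \<Rightarrow> 'a::{banach, second_countable_topology}"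
  assumes "integrable lebesgue f"
  shows "(LINT x|lebesgue. f (x + a)) = (LINT x|lebesgue. f x)"
  using integral_distr[OF measurable_lebesgue_translate borel_measurable_integrable[OF assms], of a]
  by (simp add: lebesgue_distr_translate)

lemma loc_integrable_translate:
  assumes "loc_integrable UNIV f" shows "loc_integrable UNIV (\<lambda>x. f (x + a))"
  unfolding loc_integrable_def set_integrable_def
proof (intro allI impI)
  fix K :: "(real^3) set" assume "compact K \<and> K \<subseteq> UNIV"
  then have "compact ((\<lambda>x. a + x) ` K)" by (intro compact_translation) simp
  then have "integrable lebesgue (\<lambda>x. indicator ((\<lambda>x. a + x) ` K) x *\<^sub>R f x)"
    using assms by (simp add: loc_integrable_def set_integrable_def)
  from integrable_translate[OF this, of a]
  have "integrable lebesgue (\<lambda>x. indicator ((\<lambda>x. a + x) ` K) (x + a) *\<^sub>R f (x + a))" .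
  moreover have "(indicator ((\<lambda>x. a + x) ` K) (x + a) :: real) = indicator K x" for x
    by (auto simp: indicator_def)
  ultimately show "integrable lebesgue (\<lambda>x. indicator K x *\<^sub>R f (x + a))" by simp
qed

lemma DERIV_axis:
  fixes f :: "real^3 \<Rightarrow> real"
  assumes "smooth f"
  shows "((\<lambda>t. f (x + t *\<^sub>R axis l 1)) has_real_derivative partial l f (x + t *\<^sub>R axis l 1)) (at t)"
proof -
  have "((\<lambda>t. x + t *\<^sub>R axis l 1) has_derivative (\<lambda>h. h *\<^sub>R axis l 1)) (at t)"
    by (auto intro!: derivative_eq_intros)
  from has_derivative_compose[OF this smooth_has_derivative[OF assms]]
  have "((\<lambda>t. f (x + t *\<^sub>R axis l 1)) has_derivative
    (\<lambda>h. \<Sum>k\<in>UNIV. (h *\<^sub>R axis l 1) $ k *\<^sub>R partial k f (x + t *\<^sub>R axis l 1))) (at t)" .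
  moreover have "(\<Sum>k\<in>UNIV. (h *\<^sub>R axis l 1) $ k *\<^sub>R partial k f y) = partial l f y * h" for h y
    by (simp add: axis_def if_distrib[of "\<lambda>t. t * _"] if_distrib[of "\<lambda>t. _ * t"] cong: if_cong)
  ultimately show ?thesis by (simp add: has_field_derivative_def)
qed

lemma test_axis_lipschitz:
  fixes \<psi> :: "real^3 \<Rightarrow> real"
  assumes "\<psi> \<in> test_functions UNIV"
  obtains B where "B > 0" "\<And>x s. \<bar>\<psi> (x + s *\<^sub>R axis l 1) - \<psi> x\<bar> \<le> B * \<bar>s\<bar>"
proof -
  obtain B where B: "B > 0" "\<And>x. norm (partial l \<psi> x) \<le> B"
    using test_bounded[OF test_partial[OF assms]] by blast
  have "norm (\<psi> (x + s *\<^sub>R axis l 1) - \<psi> (x + 0 *\<^sub>R axis l 1)) \<le> B * norm (s - 0)" for x s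
    by (rule field_differentiable_bound[OF convex_UNIV])
       (use DERIV_axis[OF test_smooth[OF assms]] B in \<open>auto intro: has_field_derivative_at_within\<close>)
  then show ?thesis using that B(1) by simp
qed

text \<open>Differentiation under the integral sign, with all derivatives falling on \<psi>. Its
  difference quotients are bounded by a Lipschitz constant and, for bounded shifts, vanish outside a
  fixed ball on which f is integrable.\<close>

lemma DERIV_integral_test:
  fixes f \<psi> :: "real^3 \<Rightarrow> real"
  assumes f: "loc_integrable UNIV f" and \<psi>: "\<psi> \<in> test_functions UNIV"
  shows "((\<lambda>s. LINT x|lebesgue. f x * \<psi> (x + s *\<^sub>R axis l 1)) has_real_derivative
           (LINT x|lebesgue. f x * partial l \<psi> (x + t *\<^sub>R axis l 1))) (at t)"
proof -
  \<comment> \<open>The derivative at 0 for every test function suffices: at a general t replace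
    \<psi> by its translate.\<close>
  have zero: "((\<lambda>s. LINT x|lebesgue. f x * \<psi> (x + s *\<^sub>R axis l 1)) has_real_derivative
           (LINT x|lebesgue. f x * partial l \<psi> x)) (at 0)" if \<psi>: "\<psi> \<in> test_functions UNIV" for \<psi>
    unfolding DERIV_def tendsto_at_iff_sequentially comp_def
  proof (intro allI impI)
    fix X :: "nat \<Rightarrow> real" assume X: "\<forall>i. X i \<in> UNIV - {0}" "X \<longlonglongrightarrow> 0"
    obtain M where M: "M > 0" "\<And>i. \<bar>X i\<bar> \<le> M"
      using convergent_imp_Bseq[of X] X(2) by (auto simp: convergent_def Bseq_def)
    obtain B where B: "B > 0" "\<And>x s. \<bar>\<psi> (x + s *\<^sub>R axis l 1) - \<psi> x\<bar> \<le> B * \<bar>s\<bar>"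
      using test_axis_lipschitz[OF \<psi>, of l] by blast
    obtain R where R: "\<And>x. \<psi> x \<noteq> 0 \<Longrightarrow> norm x \<le> R"
      using \<psi> by (auto simp: test_functions_iff bounded_iff)
    let ?K = "cball 0 (R + M) :: (real^3) set"
    have int: "integrable lebesgue (\<lambda>x. indicator ?K x *\<^sub>R f x)"
      using f by (simp add: loc_integrable_def set_integrable_def)
    have intT: "integrable lebesgue (\<lambda>x. f x * \<psi> (x + a))" for a
      by (rule integrable_loc_times_test[OF bounded_bilinear_mult f test_translate[OF \<psi>]])
    have "(\<lambda>i. LINT x|lebesgue. f x * ((\<psi> (x + X i *\<^sub>R axis l 1) - \<psi> x) / X i))
      \<longlonglongrightarrow> (LINT x|lebesgue. f x * partial l \<psi> x)"
    proof (rule integral_dominated_convergence[where w="\<lambda>x. B * norm (indicator ?K x *\<^sub>R f x)"])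
      show "(\<lambda>x. f x * partial l \<psi> x) \<in> borel_measurable lebesgue"
        using integrable_loc_times_test[OF bounded_bilinear_mult f test_partial[OF \<psi>]] by auto
      show "(\<lambda>x. f x * ((\<psi> (x + X i *\<^sub>R axis l 1) - \<psi> x) / X i)) \<in> borel_measurable lebesgue" for i
        using borel_measurable_integrable[OF integrable_divide_zero[OF Bochner_Integration.integrable_diff[OF intT[of "X i *\<^sub>R axis l 1"] intT[of 0]], of "X i"]]
        by (simp add: field_simps)
      show "integrable lebesgue (\<lambda>x. B * norm (indicator ?K x *\<^sub>R f x))" using int by auto
      show "AE x in lebesgue. (\<lambda>i. f x * ((\<psi> (x + X i *\<^sub>R axis l 1) - \<psi> x) / X i)) \<longlonglongrightarrow> f x * partial l \<psi> x"
      proof (intro AE_I2 tendsto_mult tendsto_const)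
        fix x
        have "((\<lambda>h. (\<psi> (x + (0 + h) *\<^sub>R axis l 1) - \<psi> (x + 0 *\<^sub>R axis l 1)) / h) \<longlongrightarrow> partial l \<psi> (x + 0 *\<^sub>R axis l 1)) (at 0)"
          using DERIV_axis[OF test_smooth[OF \<psi>], of x l 0] unfolding DERIV_def .
        then have "((\<lambda>h. (\<psi> (x + h *\<^sub>R axis l 1) - \<psi> x) / h) \<longlongrightarrow> partial l \<psi> x) (at 0)" by simp
        then show "(\<lambda>i. (\<psi> (x + X i *\<^sub>R axis l 1) - \<psi> x) / X i) \<longlonglongrightarrow> partial l \<psi> x"
          using X unfolding tendsto_at_iff_sequentially comp_def by blast
      qed
      show "AE x in lebesgue. norm (f x * ((\<psi> (x + X i *\<^sub>R axis l 1) - \<psi> x) / X i)) \<le> B * norm (indicator ?K x *\<^sub>R f x)" for i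
      proof (rule AE_I2)
        fix x
        show "norm (f x * ((\<psi> (x + X i *\<^sub>R axis l 1) - \<psi> x) / X i)) \<le> B * norm (indicator ?K x *\<^sub>R f x)"
        proof (cases "x \<in> ?K")
          case True
          have "\<bar>(\<psi> (x + X i *\<^sub>R axis l 1) - \<psi> x) / X i\<bar> \<le> B"
            using B(2)[of x "X i"] X(1) by (auto simp: divide_le_eq)
          then have "\<bar>f x\<bar> * \<bar>(\<psi> (x + X i *\<^sub>R axis l 1) - \<psi> x) / X i\<bar> \<le> \<bar>f x\<bar> * B"
            by (intro mult_left_mono) auto
          then show ?thesis using True by (simp add: abs_mult mult.commute)
        next
          case False
          then have n: "norm x > R + M" by simp
          then have "\<psi> x = 0" using R[of x] M by force
          moreover have "norm (x + X i *\<^sub>R axis l 1) > R"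
            using n M(2)[of i] norm_triangle_ineq2[of x "- X i *\<^sub>R axis l 1"] by (simp add: norm_axis_1)
          then have "\<psi> (x + X i *\<^sub>R axis l 1) = 0" using R[of "x + X i *\<^sub>R axis l 1"] by force
          ultimately show ?thesis using False by simp
        qed
      qed
    qed
    moreover have "(LINT x|lebesgue. f x * ((\<psi> (x + X i *\<^sub>R axis l 1) - \<psi> x) / X i)) =
       ((LINT x|lebesgue. f x * \<psi> (x + (0 + X i) *\<^sub>R axis l 1)) - (LINT x|lebesgue. f x * \<psi> (x + 0 *\<^sub>R axis l 1))) / X i" for i
    proof -
      have "f x * ((\<psi> (x + X i *\<^sub>R axis l 1) - \<psi> x) / X i) =
        (f x * \<psi> (x + X i *\<^sub>R axis l 1) - f x * \<psi> (x + 0)) / X i" for x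
        by (simp add: right_diff_distrib)
      then have "(LINT x|lebesgue. f x * ((\<psi> (x + X i *\<^sub>R axis l 1) - \<psi> x) / X i)) =
        (LINT x|lebesgue. f x * \<psi> (x + X i *\<^sub>R axis l 1) - f x * \<psi> (x + 0)) / X i"
        by (simp only: integral_divide_zero)
      also have "\<dots> = ((LINT x|lebesgue. f x * \<psi> (x + X i *\<^sub>R axis l 1)) - (LINT x|lebesgue. f x * \<psi> (x + 0))) / X i"
        by (subst Bochner_Integration.integral_diff[OF intT intT]) (rule refl)
      finally show ?thesis by (simp only: add_0 scaleR_zero_left)
    qed
    ultimately show "(\<lambda>i. ((LINT x|lebesgue. f x * \<psi> (x + (0 + X i) *\<^sub>R axis l 1)) -
        (LINT x|lebesgue. f x * \<psi> (x + 0 *\<^sub>R axis l 1))) / X i) \<longlonglongrightarrow> (LINT x|lebesgue. f x * partial l \<psi> x)"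
      by (simp only:)
  qed
  have p: "partial l (\<lambda>x. \<psi> (x + t *\<^sub>R axis l 1)) x = partial l \<psi> (x + t *\<^sub>R axis l 1)" for x
    by (rule partial_translate[OF smooth_differentiable[OF test_smooth[OF \<psi>]]])
  have "((\<lambda>s. LINT x|lebesgue. f x * \<psi> (x + s *\<^sub>R axis l 1 + t *\<^sub>R axis l 1)) has_real_derivative
           (LINT x|lebesgue. f x * partial l \<psi> (x + t *\<^sub>R axis l 1))) (at 0)"
    using zero[OF test_translate[OF \<psi>, of "t *\<^sub>R axis l 1"]] by (simp add: p)
  then have "((\<lambda>s. LINT x|lebesgue. f x * \<psi> (x + (s + t) *\<^sub>R axis l 1)) has_real_derivative
           (LINT x|lebesgue. f x * partial l \<psi> (x + t *\<^sub>R axis l 1))) (at 0)"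
    by (simp add: scaleR_add_left add.assoc)
  then show ?thesis
    using DERIV_shift[of "\<lambda>s. LINT x|lebesgue. f x * \<psi> (x + s *\<^sub>R axis l 1)" _ 0 t] by simp
qed

text \<open>Translation invariance makes the integral of the shifted \<psi> constant in the shift,
  and its derivative in the shift is the integral of the partial derivative.\<close>

lemma integral_partial_test:
  fixes \<psi> :: "real^3 \<Rightarrow> real"
  assumes "\<psi> \<in> test_functions UNIV"
  shows "(LINT x|lebesgue. partial l \<psi> x) = 0"
proof -
  have "((\<lambda>s. LINT x|lebesgue. 1 * \<psi> (x + s *\<^sub>R axis l 1)) has_real_derivative
           (LINT x|lebesgue. 1 * partial l \<psi> (x + 0 *\<^sub>R axis l 1))) (at 0)"
    by (rule DERIV_integral_test[OF loc_integrable_const assms])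
  then have "((\<lambda>s::real. LINT x|lebesgue. \<psi> x) has_real_derivative (LINT x|lebesgue. partial l \<psi> x)) (at 0)"
    by (simp add: integral_translate[OF test_integrable[OF assms]])
  then show ?thesis using DERIV_unique DERIV_const by blast
qed

lemma integral_by_parts_test:
  fixes f \<psi> :: "real^3 \<Rightarrow> real"
  assumes "smooth f" "\<psi> \<in> test_functions UNIV"
  shows "(LINT x|lebesgue. f x * partial l \<psi> x) = - (LINT x|lebesgue. partial l f x * \<psi> x)"
proof -
  have t: "(\<lambda>x. f x * partial l \<psi> x) \<in> test_functions UNIV" "(\<lambda>x. partial l f x * \<psi> x) \<in> test_functions UNIV"
    by (intro test_mult_right test_partial smooth_partial assms)+
  have "partial l (\<lambda>x. f x * \<psi> x) = (\<lambda>x. f x * partial l \<psi> x + partial l f x * \<psi> x)"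
    by (rule ext, rule partial_bilinear[OF bounded_bilinear_mult])
       (use assms in \<open>auto intro: smooth_differentiable test_smooth\<close>)
  with integral_partial_test[OF test_mult_right[OF assms], of l]
  have "(LINT x|lebesgue. f x * partial l \<psi> x + partial l f x * \<psi> x) = 0" by simp
  then show ?thesis
    using Bochner_Integration.integral_add[OF test_integrable[OF t(1)] test_integrable[OF t(2)]] by simp
qed

section \<open>Symmetry of second derivatives\<close>

lemma mixed_quotient:
  fixes f :: "real^3 \<Rightarrow> real"
  assumes f: "smooth f" and h: "h > 0"
  shows "\<exists>a b. 0 < a \<and> a < h \<and> 0 < b \<and> b < h \<and>
    f (x + h *\<^sub>R axis k 1 + h *\<^sub>R axis l 1) - f (x + h *\<^sub>R axis k 1) - f (x + h *\<^sub>R axis l 1) + f x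
      = h * h * partial l (partial k f) (x + a *\<^sub>R axis k 1 + b *\<^sub>R axis l 1)"
proof -
  let ?g = "\<lambda>s. f (x + h *\<^sub>R axis l 1 + s *\<^sub>R axis k 1) - f (x + s *\<^sub>R axis k 1)"
  let ?g' = "\<lambda>s. partial k f (x + h *\<^sub>R axis l 1 + s *\<^sub>R axis k 1) - partial k f (x + s *\<^sub>R axis k 1)"
  have "(?g has_real_derivative ?g' s) (at s)" for s
    by (intro DERIV_diff DERIV_axis f)
  from MVT2[OF h this] obtain a where a: "0 < a" "a < h" "?g h - ?g 0 = (h - 0) * ?g' a" by blast
  let ?k = "\<lambda>t. partial k f (x + a *\<^sub>R axis k 1 + t *\<^sub>R axis l 1)"
  have "(?k has_real_derivative partial l (partial k f) (x + a *\<^sub>R axis k 1 + t *\<^sub>R axis l 1)) (at t)" for t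
    by (intro DERIV_axis smooth_partial f)
  from MVT2[OF h this] obtain b where b: "0 < b" "b < h"
    "?k h - ?k 0 = (h - 0) * partial l (partial k f) (x + a *\<^sub>R axis k 1 + b *\<^sub>R axis l 1)" by blast
  have "?g' a = ?k h - ?k 0" by (simp add: add_ac)
  with a b have "?g h - ?g 0 = h * (h * partial l (partial k f) (x + a *\<^sub>R axis k 1 + b *\<^sub>R axis l 1))" by simp
  then show ?thesis using a b by (intro exI[of _ a] exI[of _ b]) (simp add: add_ac algebra_simps)
qed

text \<open>The second difference over a square of side h is symmetric in the two directions, and
  the mean value theorem evaluates it as h^2 times either mixed derivative at nearby points.
  Continuity then allows h to tend to 0.\<close>

lemma partial_commute:
  fixes f :: "real^3 \<Rightarrow> real"
  assumes f: "smooth f"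
  shows "partial k (partial l f) = partial l (partial k f)"
proof
  fix x
  let ?y = "\<lambda>a b. x + a *\<^sub>R axis k (1::real) + b *\<^sub>R axis l (1::real)"
  have ex: "\<exists>a b c d. 0 < a \<and> a < h \<and> 0 < b \<and> b < h \<and> 0 < c \<and> c < h \<and> 0 < d \<and> d < h \<and>
    partial l (partial k f) (?y a b) = partial k (partial l f) (?y c d)" if h: "h > 0" for h
  proof -
    obtain a b where a: "0 < a" "a < h" "0 < b" "b < h"
      "f (x + h *\<^sub>R axis k 1 + h *\<^sub>R axis l 1) - f (x + h *\<^sub>R axis k 1) - f (x + h *\<^sub>R axis l 1) + f x
      = h * h * partial l (partial k f) (?y a b)"
      using mixed_quotient[OF f h, of x k l] by blast
    obtain d c where c: "0 < c" "c < h" "0 < d" "d < h"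
      "f (x + h *\<^sub>R axis l 1 + h *\<^sub>R axis k 1) - f (x + h *\<^sub>R axis l 1) - f (x + h *\<^sub>R axis k 1) + f x
      = h * h * partial k (partial l f) (x + d *\<^sub>R axis l 1 + c *\<^sub>R axis k 1)"
      using mixed_quotient[OF f h, of x l k] by blast
    have "h * h * partial l (partial k f) (?y a b) = h * h * partial k (partial l f) (?y c d)"
    proof -
      have "x + h *\<^sub>R axis l 1 + h *\<^sub>R axis k 1 = x + h *\<^sub>R axis k 1 + h *\<^sub>R axis l 1"
        "x + d *\<^sub>R axis l 1 + c *\<^sub>R axis k 1 = x + c *\<^sub>R axis k 1 + d *\<^sub>R axis l 1" by (simp_all add: add_ac)
      then show ?thesis using a(5) c(5) by (simp only:)
    qed
    then have "partial l (partial k f) (?y a b) = partial k (partial l f) (?y c d)" using h by simp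
    with a c show ?thesis by blast
  qed
  have "\<exists>a b c d. 0 < a \<and> a < 1 / Suc n \<and> 0 < b \<and> b < 1 / Suc n \<and> 0 < c \<and> c < 1 / Suc n \<and> 0 < d \<and> d < 1 / Suc n \<and>
    partial l (partial k f) (?y a b) = partial k (partial l f) (?y c d)" for n
    by (rule ex) simp
  then obtain a b c d where ab: "\<And>n. 0 < a n" "\<And>n. a n < 1 / Suc n" "\<And>n. 0 < b n" "\<And>n. b n < 1 / Suc n"
    "\<And>n. 0 < c n" "\<And>n. c n < 1 / Suc n" "\<And>n. 0 < d n" "\<And>n. d n < 1 / Suc n"
    and eq: "\<And>n. partial l (partial k f) (?y (a n) (b n)) = partial k (partial l f) (?y (c n) (d n))"
    by metis
  have lim0: "u \<longlonglongrightarrow> 0" if "\<And>n. 0 < u n" "\<And>n. u n < 1 / Suc n" for u :: "nat \<Rightarrow> real"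
    by (rule tendsto_sandwich[OF _ _ tendsto_const LIMSEQ_Suc[OF lim_const_over_n[of 1]]])
       (use that in \<open>auto intro!: always_eventually less_imp_le\<close>)
  have lim: "(\<lambda>n. g (?y (u n) (v n))) \<longlonglongrightarrow> g x" if "smooth g" "u \<longlonglongrightarrow> 0" "v \<longlonglongrightarrow> 0" for g :: "real^3 \<Rightarrow> real" and u v
  proof -
    have "(\<lambda>n. ?y (u n) (v n)) \<longlonglongrightarrow> x + 0 *\<^sub>R axis k 1 + 0 *\<^sub>R axis l 1"
      by (intro tendsto_intros that)
    then have "(\<lambda>n. ?y (u n) (v n)) \<longlonglongrightarrow> x" by simp
    then show ?thesis
      by (rule continuous_on_tendsto_compose[OF smooth_continuous[OF that(1), of UNIV]]) auto
  qed
  have "(\<lambda>n. partial l (partial k f) (?y (a n) (b n))) \<longlonglongrightarrow> partial l (partial k f) x"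
    by (rule lim) (intro smooth_partial f lim0 ab)+
  moreover have "(\<lambda>n. partial k (partial l f) (?y (c n) (d n))) \<longlonglongrightarrow> partial k (partial l f) x"
    by (rule lim) (intro smooth_partial f lim0 ab)+
  ultimately show "partial k (partial l f) x = partial l (partial k f) x"
    unfolding eq by (rule LIMSEQ_unique[symmetric])
qed

section \<open>Density of the range of the Laplacian minus the identity\<close>

lemma second_derivative_test:
  fixes g :: "real \<Rightarrow> real"
  assumes g: "\<And>t. (g has_real_derivative g1 t) (at t)" and g1: "(g1 has_real_derivative c) (at 0)"
    and max: "\<And>t. g t \<le> g 0"
  shows "c \<le> 0"
proof (rule ccontr)
  assume "\<not> c \<le> 0"
  then have "0 < c" by simp
  have "g1 0 = 0" using DERIV_local_max[OF g, of 1 0] max by simp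
  obtain d where d: "d > 0" "\<And>h. 0 < h \<Longrightarrow> h < d \<Longrightarrow> g1 0 < g1 (0 + h)"
    using DERIV_pos_inc_right[OF g1 \<open>0 < c\<close>] by blast
  have "0 < d / 2" using d by simp
  from MVT2[OF this g] obtain z where z: "0 < z" "z < d / 2" "g (d / 2) - g 0 = (d / 2 - 0) * g1 z" by blast
  have "g1 z > 0" using d(2)[of z] z \<open>g1 0 = 0\<close> d(1) by simp
  then have "(d / 2 - 0) * g1 z > 0" using d(1) by simp
  then have "g (d / 2) - g 0 > 0" using z(3) by simp
  then show False using max[of "d/2"] by simp
qed

text \<open>Maximum principle. Subtracting a small paraboloid forces a maximum to be attained, and
  there each second derivative of H is at most 2 \<delta>; the three directions together bound H by
  6 \<delta>. The derivatives are taken along the axes because this is what differentiation under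
  the integral sign provides.\<close>

lemma bounded_subsolution_nonpos:
  fixes H :: "real^3 \<Rightarrow> real"
  assumes cont: "continuous_on UNIV H" and bnd: "\<And>x. \<bar>H x\<bar> \<le> M"
    and D1: "\<And>l x t. ((\<lambda>t. H (x + t *\<^sub>R axis l 1)) has_real_derivative DH l (x + t *\<^sub>R axis l 1)) (at t)"
    and D2: "\<And>l x t. ((\<lambda>t. DH l (x + t *\<^sub>R axis l 1)) has_real_derivative DDH l (x + t *\<^sub>R axis l 1)) (at t)"
    and eq: "\<And>x. (\<Sum>l\<in>UNIV. DDH l x) = H x"
  shows "H x0 \<le> 0"
proof -
  have le: "H x0 \<le> 6 * \<delta>" if \<delta>: "\<delta> > 0" for \<delta>
  proof -
    define V where "V y = H y - \<delta> * ((y - x0) \<bullet> (y - x0))" for y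
    \<comment> \<open>At this radius the paraboloid has height 2 M + 1, more than the oscillation 2
      M of H, so beyond it V stays below its value at the centre.\<close>
    define R where "R = sqrt ((2 * M + 1) / \<delta>)"
    have M: "M \<ge> 0" using bnd[of x0] by simp
    have R2: "\<delta> * R\<^sup>2 = 2 * M + 1" "R > 0" using M \<delta> by (auto simp: R_def)
    have "continuous_on (cball x0 R) V" unfolding V_def
      by (intro continuous_intros continuous_on_subset[OF cont]) auto
    then obtain y where y: "y \<in> cball x0 R" "\<And>z. z \<in> cball x0 R \<Longrightarrow> V z \<le> V y"
      using continuous_attains_sup[of "cball x0 R" V] R2 by auto
    have max: "V z \<le> V y" for z
    proof (cases "z \<in> cball x0 R")
      case False
      then have "R \<le> norm (z - x0)" by (simp add: dist_norm norm_minus_commute)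
      then have "R\<^sup>2 \<le> (norm (z - x0))\<^sup>2" using R2 by (intro power_mono) auto
      then have "\<delta> * R\<^sup>2 \<le> \<delta> * ((z - x0) \<bullet> (z - x0))" using \<delta> by (simp add: power2_norm_eq_inner)
      then have "V z \<le> - M" using bnd[of z] R2 unfolding V_def by linarith
      also have "\<dots> \<le> V x0" using bnd[of x0] by (simp add: V_def)
      also have "\<dots> \<le> V y" using R2 by (intro y) auto
      finally show ?thesis .
    qed (use y in auto)
    have "DDH l y \<le> 2 * \<delta>" for l
    proof -
      let ?q = "\<lambda>t. \<delta> * (((y - x0) \<bullet> (y - x0)) + 2 * t * (y - x0) $ l + t * t)"
      have V: "V (y + t *\<^sub>R axis l 1) = H (y + t *\<^sub>R axis l 1) - ?q t" for t
      proof -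
        have "(y + t *\<^sub>R axis l 1 - x0) = (y - x0) + t *\<^sub>R axis l 1" by simp
        moreover have "(v + t *\<^sub>R axis l 1) \<bullet> (v + t *\<^sub>R axis l 1)
          = v \<bullet> v + 2 * t * v $ l + t * t" for v :: "real^3"
        proof -
          have "axis l 1 \<bullet> v = v $ l" "v \<bullet> axis l 1 = v $ l" "axis l 1 \<bullet> (axis l 1 :: real^3) = 1"
            by (simp_all add: inner_axis inner_axis')
          then show ?thesis by (simp add: inner_add_left inner_add_right algebra_simps)
        qed
        ultimately show ?thesis by (simp only: V_def)
      qed
      have "(?q has_real_derivative \<delta> * (2 * (y - x0) $ l + 2 * t)) (at t)" for t
        by (auto intro!: derivative_eq_intros)
      then have g: "((\<lambda>t. V (y + t *\<^sub>R axis l 1)) has_real_derivative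
          DH l (y + t *\<^sub>R axis l 1) - \<delta> * (2 * (y - x0) $ l + 2 * t)) (at t)" for t
        unfolding V by (intro DERIV_diff D1)
      have "((\<lambda>t. \<delta> * (2 * (y - x0) $ l + 2 * t)) has_real_derivative \<delta> * 2) (at 0)"
        by (auto intro!: derivative_eq_intros)
      from DERIV_diff[OF D2[of l y 0] this]
      have "((\<lambda>t. DH l (y + t *\<^sub>R axis l 1) - \<delta> * (2 * (y - x0) $ l + 2 * t)) has_real_derivative
          DDH l y - \<delta> * 2) (at 0)" by simp
      from second_derivative_test[OF g this] max have "DDH l y - \<delta> * 2 \<le> 0" by simp
      then show ?thesis by simp
    qed
    then have "H y \<le> (\<Sum>l\<in>(UNIV::3 set). 2 * \<delta>)" unfolding eq[symmetric] by (intro sum_mono)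
    then have "H y \<le> 6 * \<delta>" by simp
    moreover have "V x0 \<le> V y" by (rule max)
    moreover have "V y \<le> H y" using \<delta> by (simp add: V_def)
    ultimately show ?thesis by (simp add: V_def)
  qed
  have "H x0 \<le> 0 + e" if "e > 0" for e using le[of "e / 6"] that by simp
  then show ?thesis by (rule field_le_epsilon)
qed

text \<open>Derivatives along the axes do not give joint continuity, which is needed for the maximum
  over a ball to be attained.\<close>

lemma continuous_integral_test:
  fixes f \<psi> :: "real^3 \<Rightarrow> real"
  assumes f: "loc_integrable UNIV f" and \<psi>: "\<psi> \<in> test_functions UNIV"
  shows "continuous_on UNIV (\<lambda>a. LINT x|lebesgue. f x * \<psi> (x + a))"
  unfolding continuous_on_sequentially comp_def
proof (intro ballI allI impI)
  fix X a assume "(\<forall>n. X n \<in> UNIV) \<and> X \<longlonglongrightarrow> (a :: real^3)"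
  then have X: "X \<longlonglongrightarrow> a" by simp
  obtain M where M: "M > 0" "\<And>i. norm (X i) \<le> M"
    using convergent_imp_Bseq[of X] X by (auto simp: convergent_def Bseq_def)
  obtain B where B: "B > 0" "\<And>x. norm (\<psi> x) \<le> B" using test_bounded[OF \<psi>] by blast
  obtain R where R: "\<And>x. \<psi> x \<noteq> 0 \<Longrightarrow> norm x \<le> R"
    using \<psi> by (auto simp: test_functions_iff bounded_iff)
  let ?K = "cball 0 (R + M) :: (real^3) set"
  have int: "integrable lebesgue (\<lambda>x. indicator ?K x *\<^sub>R f x)"
    using f by (simp add: loc_integrable_def set_integrable_def)
  show "(\<lambda>n. LINT x|lebesgue. f x * \<psi> (x + X n)) \<longlonglongrightarrow> (LINT x|lebesgue. f x * \<psi> (x + a))"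
  proof (rule integral_dominated_convergence[where w="\<lambda>x. B * norm (indicator ?K x *\<^sub>R f x)"])
    show "(\<lambda>x. f x * \<psi> (x + b)) \<in> borel_measurable lebesgue" for b
      using integrable_loc_times_test[OF bounded_bilinear_mult f test_translate[OF \<psi>]] by auto
    then show "(\<lambda>x. f x * \<psi> (x + X n)) \<in> borel_measurable lebesgue" for n .
    show "integrable lebesgue (\<lambda>x. B * norm (indicator ?K x *\<^sub>R f x))" using int by auto
    show "AE x in lebesgue. (\<lambda>i. f x * \<psi> (x + X i)) \<longlonglongrightarrow> f x * \<psi> (x + a)"
    proof (intro AE_I2 tendsto_mult tendsto_const)
      fix x
      have "(\<lambda>i. x + X i) \<longlonglongrightarrow> x + a" by (intro tendsto_intros X)
      then show "(\<lambda>i. \<psi> (x + X i)) \<longlonglongrightarrow> \<psi> (x + a)"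
        by (rule continuous_on_tendsto_compose[OF smooth_continuous[OF test_smooth[OF \<psi>], of UNIV]]) auto
    qed
    show "AE x in lebesgue. norm (f x * \<psi> (x + X i)) \<le> B * norm (indicator ?K x *\<^sub>R f x)" for i
    proof (rule AE_I2)
      fix x
      show "norm (f x * \<psi> (x + X i)) \<le> B * norm (indicator ?K x *\<^sub>R f x)"
      proof (cases "x \<in> ?K")
        case True
        then show ?thesis using mult_right_mono[OF B(2)[of "x + X i"] abs_ge_zero[of "f x"]]
          by (simp add: abs_mult mult.commute)
      next
        case False
        then have "norm (x + X i) > R"
          using M(2)[of i] norm_triangle_ineq2[of x "- X i"] by simp
        then have "\<psi> (x + X i) = 0" using R[of "x + X i"] by force
        then show ?thesis using False by simp
      qed
    qed
  qed
qed

lemma square_integrable_loc_integrable: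
  fixes h :: "real^3 \<Rightarrow> 'a::{banach, second_countable_topology}"
  assumes [measurable]: "h \<in> borel_measurable lebesgue" and "integrable lebesgue (\<lambda>x. (norm (h x))\<^sup>2)"
  shows "loc_integrable U h"
  unfolding loc_integrable_def set_integrable_def
proof (intro allI impI)
  fix K :: "(real^3) set" assume "compact K \<and> K \<subseteq> U"
  then have K: "K \<in> lmeasurable" by (intro lmeasurable_compact) simp
  then have [measurable]: "K \<in> sets lebesgue" by (rule fmeasurableD)
  have "norm (indicator K x *\<^sub>R h x) \<le> norm (indicator K x + (norm (h x))\<^sup>2)" for x
  proof -
    have "norm (h x) \<le> 1 + (norm (h x))\<^sup>2"
      using sum_squares_bound[of "norm (h x)" 1] by (simp, use norm_ge_zero[of "h x"] in linarith)
    then show ?thesis by (auto simp: indicator_def)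
  qed
  then show "integrable lebesgue (\<lambda>x. indicator K x *\<^sub>R h x)"
    using K assms(2)
    by (intro Bochner_Integration.integrable_bound[of lebesgue "\<lambda>x. indicator K x + (norm (h x))\<^sup>2" "\<lambda>x. indicator K x *\<^sub>R h x"])
       (auto simp: fmeasurable_def)
qed

definition laplacian :: "(real^3 \<Rightarrow> real) \<Rightarrow> real^3 \<Rightarrow> real"
  where "laplacian \<psi> x = (\<Sum>l\<in>UNIV. partial l (partial l \<psi>) x)"

lemma test_laplacian: "\<psi> \<in> test_functions U \<Longrightarrow> laplacian \<psi> \<in> test_functions U"
  unfolding laplacian_def[abs_def] by (intro test_sum test_partial) auto

text \<open>For a fixed \<psi> let H(a) be the integral of h against \<psi> shifted by a. It is
  bounded, and orthogonality applied to the shifted \<psi> says \<Delta>H = H, so the maximum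
  principle gives H(0) <= 0. The same for -\<psi> shows that h annihilates every test
  function.\<close>

lemma orthogonal_to_range_imp_zero:
  fixes h :: "real^3 \<Rightarrow> real"
  assumes h: "h \<in> borel_measurable lebesgue" "integrable lebesgue (\<lambda>x. (h x)\<^sup>2)"
    and orth: "\<And>\<psi>. \<psi> \<in> test_functions UNIV \<Longrightarrow> (LINT x|lebesgue. h x * (laplacian \<psi> x - \<psi> x)) = 0"
  shows "AE x in lebesgue. h x = 0"
proof -
  have loc: "loc_integrable UNIV h" by (rule square_integrable_loc_integrable) (use h in auto)
  have int: "integrable lebesgue (\<lambda>x. h x * \<psi> x)" if "\<psi> \<in> test_functions UNIV" for \<psi>
    by (rule integrable_loc_times_test[OF bounded_bilinear_mult loc that])
  have le: "(LINT x|lebesgue. h x * \<psi> x) \<le> 0" if \<psi>: "\<psi> \<in> test_functions UNIV" for \<psi>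
  proof -
    define H where "H a = (LINT x|lebesgue. h x * \<psi> (x + a))" for a
    define H1 where "H1 l a = (LINT x|lebesgue. h x * partial l \<psi> (x + a))" for l a
    define H2 where "H2 l a = (LINT x|lebesgue. h x * partial l (partial l \<psi>) (x + a))" for l a
    have sq: "integrable lebesgue (\<lambda>x. (\<psi> x)\<^sup>2)"
      using test_integrable[OF test_mult_right[OF test_smooth[OF \<psi>] \<psi>]] by (simp add: power2_eq_square)
    \<comment> \<open>Young's inequality bounds the pairing by the two squared norms, and
      translating \<psi> does not change the second one.\<close>
    define M where "M = (LINT x|lebesgue. (h x)\<^sup>2) + (LINT x|lebesgue. (\<psi> x)\<^sup>2)"
    have bnd: "\<bar>H a\<bar> \<le> M" for a
    proof -
      have "\<bar>H a\<bar> \<le> (LINT x|lebesgue. \<bar>h x * \<psi> (x + a)\<bar>)" unfolding H_def by (rule integral_abs_bound)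
      also have "\<dots> \<le> (LINT x|lebesgue. (h x)\<^sup>2 + (\<psi> (x + a))\<^sup>2)"
      proof (rule integral_mono)
        show "integrable lebesgue (\<lambda>x. \<bar>h x * \<psi> (x + a)\<bar>)" using int[OF test_translate[OF \<psi>]] by auto
        show "integrable lebesgue (\<lambda>x. (h x)\<^sup>2 + (\<psi> (x + a))\<^sup>2)" using h integrable_translate[OF sq, of a] by auto
        show "\<bar>h x * \<psi> (x + a)\<bar> \<le> (h x)\<^sup>2 + (\<psi> (x + a))\<^sup>2" for x
          using sum_squares_bound[of "\<bar>h x\<bar>" "\<bar>\<psi> (x + a)\<bar>"]
          by (simp add: abs_mult, use mult_nonneg_nonneg[of "\<bar>h x\<bar>" "\<bar>\<psi> (x + a)\<bar>"] in linarith)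
      qed
      also have "\<dots> = M" using h integrable_translate[OF sq, of a] integral_translate[OF sq, of a]
        by (simp add: M_def)
      finally show ?thesis .
    qed
    have D: "((\<lambda>t. LINT x|lebesgue. h x * \<phi> (x + (a + t *\<^sub>R axis l 1))) has_real_derivative
        (LINT x|lebesgue. h x * partial l \<phi> (x + (a + t *\<^sub>R axis l 1)))) (at t)"
      if \<phi>: "\<phi> \<in> test_functions UNIV" for \<phi> l a t
    proof -
      have p: "partial l (\<lambda>x. \<phi> (x + a)) x = partial l \<phi> (x + a)" for x
        by (rule partial_translate[OF smooth_differentiable[OF test_smooth[OF \<phi>]]])
      show ?thesis
        using DERIV_integral_test[OF loc test_translate[OF \<phi>, of a], of l t] by (simp add: p add_ac)
    qed
    have "H 0 \<le> 0"
    proof (rule bounded_subsolution_nonpos[where H=H and DH=H1 and DDH=H2, OF _ bnd])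
      show "continuous_on UNIV H" unfolding H_def by (rule continuous_integral_test[OF loc \<psi>])
      show "((\<lambda>t. H (x + t *\<^sub>R axis l 1)) has_real_derivative H1 l (x + t *\<^sub>R axis l 1)) (at t)" for l x t
        unfolding H_def H1_def by (rule D[OF \<psi>])
      show "((\<lambda>t. H1 l (x + t *\<^sub>R axis l 1)) has_real_derivative H2 l (x + t *\<^sub>R axis l 1)) (at t)" for l x t
        unfolding H1_def H2_def by (rule D[OF test_partial[OF \<psi>]])
      show "(\<Sum>l\<in>UNIV. H2 l a) = H a" for a
      proof -
        have p: "partial l (\<lambda>x. f (x + a)) = (\<lambda>x. partial l f (x + a))" if "smooth f" for f :: "real^3 \<Rightarrow> real" and l
          by (rule ext, rule partial_translate[OF smooth_differentiable[OF that]])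
        have lap: "laplacian (\<lambda>x. \<psi> (x + a)) x = (\<Sum>l\<in>UNIV. partial l (partial l \<psi>) (x + a))" for x
          unfolding laplacian_def by (simp add: p test_smooth[OF \<psi>] smooth_partial)
        have t: "(\<lambda>x. partial l (partial l \<psi>) (x + a)) \<in> test_functions UNIV" for l
          by (intro test_translate test_partial \<psi>)
        have "(LINT x|lebesgue. h x * laplacian (\<lambda>x. \<psi> (x + a)) x - h x * \<psi> (x + a)) = 0"
          using orth[OF test_translate[OF \<psi>, of a]] by (simp add: right_diff_distrib)
        then have "(LINT x|lebesgue. h x * laplacian (\<lambda>x. \<psi> (x + a)) x) = H a"
          using int[OF test_laplacian[OF test_translate[OF \<psi>]]] int[OF test_translate[OF \<psi>]]
          by (simp add: H_def)
        then show ?thesis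
          using int[OF t] by (simp add: lap H2_def sum_distrib_left)
      qed
    qed
    then show ?thesis by (simp add: H_def)
  qed
  have "(LINT x|lebesgue. h x * \<psi> x) = 0" if \<psi>: "\<psi> \<in> test_functions UNIV" for \<psi>
    using le[OF \<psi>] le[OF test_minus[OF \<psi>]] by simp
  from AE_zero_if_test[OF open_UNIV loc this] show ?thesis by simp
qed

section \<open>Lipschitz weights\<close>

text \<open>The pairing of w with the shifted F is differentiable in the shift, with derivative at
  most C times the integral of F, so it changes by at most that times |t|. Moving the shift onto w
  and varying F >= 0 gives the pointwise bound.\<close>

lemma weak_lipschitz_imp_translate:
  fixes w :: "real^3 \<Rightarrow> real"
  assumes w: "loc_integrable UNIV w"
    and lip: "\<And>F. F \<in> test_functions UNIV \<Longrightarrow> \<bar>LINT x|lebesgue. w x * partial l F x\<bar> \<le> C * (LINT x|lebesgue. \<bar>F x\<bar>)"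
  shows "AE x in lebesgue. \<bar>w (x + t *\<^sub>R axis l 1) - w x\<bar> \<le> C * \<bar>t\<bar>"
proof (rule AE_bounded_if_test)
  show "loc_integrable UNIV (\<lambda>x. w (x + t *\<^sub>R axis l 1) - w x)"
    by (intro loc_integrable_diff loc_integrable_translate w)
  fix F :: "real^3 \<Rightarrow> real" assume F: "F \<in> test_functions UNIV" "\<And>x. 0 \<le> F x"
  have int: "integrable lebesgue (\<lambda>x. f x * F (x + a))" if "loc_integrable UNIV f" for f a
    by (rule integrable_loc_times_test[OF bounded_bilinear_mult that test_translate[OF F(1)]])
  define \<Phi> where "\<Phi> s = (LINT x|lebesgue. w x * F (x + s *\<^sub>R axis l 1))" for s
  have "(\<Phi> has_real_derivative (LINT x|lebesgue. w x * partial l F (x + s *\<^sub>R axis l 1))) (at s)" for s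
    unfolding \<Phi>_def by (rule DERIV_integral_test[OF w F(1)])
  moreover have "\<bar>LINT x|lebesgue. w x * partial l F (x + s *\<^sub>R axis l 1)\<bar> \<le> C * (LINT x|lebesgue. F x)" for s
  proof -
    have p: "partial l (\<lambda>x. F (x + s *\<^sub>R axis l 1)) x = partial l F (x + s *\<^sub>R axis l 1)" for x
      by (rule partial_translate[OF smooth_differentiable[OF test_smooth[OF F(1)]]])
    show ?thesis
      using lip[OF test_translate[OF F(1), of "s *\<^sub>R axis l 1"]] F(2)
      by (simp add: p integral_translate[OF test_integrable[OF F(1)]])
  qed
  ultimately have "norm (\<Phi> (- t) - \<Phi> 0) \<le> C * (LINT x|lebesgue. F x) * norm (- t - 0)"
    by (intro field_differentiable_bound[OF convex_UNIV]) (auto intro: has_field_derivative_at_within)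
  moreover have "(LINT x|lebesgue. (w (x + t *\<^sub>R axis l 1) - w x) * F x) = \<Phi> (- t) - \<Phi> 0"
  proof -
    have "(LINT x|lebesgue. w (x + t *\<^sub>R axis l 1) * F x) = \<Phi> (- t)"
      using integral_translate[OF int[OF w, of "- t *\<^sub>R axis l 1"], of "t *\<^sub>R axis l 1"]
      by (simp add: \<Phi>_def)
    then show ?thesis
      using int[OF loc_integrable_translate[OF w], of "t *\<^sub>R axis l 1" 0] int[OF w, of 0]
      by (simp add: left_diff_distrib \<Phi>_def)
  qed
  ultimately show "\<bar>LINT x|lebesgue. (w (x + t *\<^sub>R axis l 1) - w x) * F x\<bar> \<le> C * \<bar>t\<bar> * (LINT x|lebesgue. F x)"
    by (simp add: mult_ac)
qed

text \<open>Converse of the preceding lemma, again by difference quotients of the pairing. The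
  detour through translations lets a product of weights be estimated pointwise instead of by a
  product rule for weak derivatives.\<close>

lemma translate_imp_weak_lipschitz:
  fixes w :: "real^3 \<Rightarrow> real"
  assumes w: "loc_integrable UNIV w"
    and lip: "\<And>t. AE x in lebesgue. \<bar>w (x + t *\<^sub>R axis l 1) - w x\<bar> \<le> C * \<bar>t\<bar>"
    and F: "F \<in> test_functions UNIV"
  shows "\<bar>LINT x|lebesgue. w x * partial l F x\<bar> \<le> C * (LINT x|lebesgue. \<bar>F x\<bar>)"
proof -
  have int: "integrable lebesgue (\<lambda>x. f x * F (x + a))" if "loc_integrable UNIV f" for f a
    by (rule integrable_loc_times_test[OF bounded_bilinear_mult that test_translate[OF F(1)]])
  define \<Phi> where "\<Phi> s = (LINT x|lebesgue. w x * F (x + s *\<^sub>R axis l 1))" for s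
  have "(\<Phi> has_real_derivative (LINT x|lebesgue. w x * partial l F (x + 0 *\<^sub>R axis l 1))) (at 0)"
    unfolding \<Phi>_def by (rule DERIV_integral_test[OF w F(1)])
  then have lim: "((\<lambda>s. \<bar>(\<Phi> s - \<Phi> 0) / s\<bar>) \<longlongrightarrow> \<bar>LINT x|lebesgue. w x * partial l F x\<bar>) (at 0)"
    unfolding DERIV_def by (intro tendsto_rabs) simp
  have b: "\<bar>\<Phi> s - \<Phi> 0\<bar> \<le> C * (LINT x|lebesgue. \<bar>F x\<bar>) * \<bar>s\<bar>" for s
  proof -
    have i: "integrable lebesgue (\<lambda>x. (w (x + (- s) *\<^sub>R axis l 1) - w x) * F x)"
      using int[OF loc_integrable_diff[OF loc_integrable_translate[OF w] w], of "(- s) *\<^sub>R axis l 1" 0] by simp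
    have "\<Phi> s = (LINT x|lebesgue. w (x + (- s) *\<^sub>R axis l 1) * F x)"
      using integral_translate[OF int[OF w, of "s *\<^sub>R axis l 1"], of "- s *\<^sub>R axis l 1"]
      by (simp add: \<Phi>_def)
    then have "\<Phi> s - \<Phi> 0 = (LINT x|lebesgue. (w (x + (- s) *\<^sub>R axis l 1) - w x) * F x)"
      using int[OF loc_integrable_translate[OF w], of "- s *\<^sub>R axis l 1" 0] int[OF w, of 0]
      by (simp add: left_diff_distrib \<Phi>_def)
    also have "\<bar>\<dots>\<bar> \<le> (LINT x|lebesgue. \<bar>(w (x + (- s) *\<^sub>R axis l 1) - w x) * F x\<bar>)"
      by (rule integral_abs_bound)
    also have "\<dots> \<le> (LINT x|lebesgue. C * \<bar>s\<bar> * \<bar>F x\<bar>)"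
    proof (rule integral_mono_AE)
      show "AE x in lebesgue. \<bar>(w (x + (- s) *\<^sub>R axis l 1) - w x) * F x\<bar> \<le> C * \<bar>s\<bar> * \<bar>F x\<bar>"
        using lip[of "- s"] by eventually_elim (simp add: abs_mult mult_right_mono)
    qed (use i test_integrable[OF F] in auto)
    finally show ?thesis by (simp add: mult_ac)
  qed
  show ?thesis
  proof (rule tendsto_upperbound[OF lim])
    have "\<bar>(\<Phi> s - \<Phi> 0) / s\<bar> \<le> C * (LINT x|lebesgue. \<bar>F x\<bar>)" if "s \<noteq> 0" for s
      using b[of s] that by (simp add: divide_le_eq)
    then show "eventually (\<lambda>s. \<bar>(\<Phi> s - \<Phi> 0) / s\<bar> \<le> C * (LINT x|lebesgue. \<bar>F x\<bar>)) (at 0)"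
      by (auto simp: eventually_at_filter)
  qed simp
qed

lemma translate_lipschitz_mult:
  fixes f g :: "real^3 \<Rightarrow> real"
  assumes f: "AE x in lebesgue. \<bar>f x\<bar> \<le> A" "AE x in lebesgue. \<bar>f (x + a) - f x\<bar> \<le> C * \<bar>t\<bar>"
    and g: "AE x in lebesgue. \<bar>g x\<bar> \<le> B" "AE x in lebesgue. \<bar>g (x + a) - g x\<bar> \<le> D * \<bar>t\<bar>"
  shows "AE x in lebesgue. \<bar>f (x + a) * g (x + a) - f x * g x\<bar> \<le> (A * D + B * C) * \<bar>t\<bar>"
  using AE_translate[OF f(1), of a] g(1) f(2) g(2)
proof eventually_elim
  case (elim x)
  have "f (x + a) * g (x + a) - f x * g x = f (x + a) * (g (x + a) - g x) + g x * (f (x + a) - f x)"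
    by (simp add: algebra_simps)
  also have "\<bar>\<dots>\<bar> \<le> \<bar>f (x + a)\<bar> * \<bar>g (x + a) - g x\<bar> + \<bar>g x\<bar> * \<bar>f (x + a) - f x\<bar>"
    by (metis abs_mult abs_triangle_ineq)
  also have "\<dots> \<le> A * (D * \<bar>t\<bar>) + B * (C * \<bar>t\<bar>)"
    using elim by (intro add_mono mult_mono) (auto intro: order_trans[OF abs_ge_zero])
  finally show ?case by (simp add: algebra_simps)
qed

text \<open>For each pair k, l the square of \<partial>_k \<partial>_l \<psi> minus the product of
  \<partial>_l \<partial>_l \<psi> and \<partial>_k \<partial>_k \<psi> equals \<partial>_k of
  \<open>?A\<close> minus \<partial>_l of \<open>?B\<close>, since the third derivatives cancel by
  symmetry. Hence only a first derivative of w is spent, against products of one gradient and one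
  Hessian entry.\<close>

lemma hessian_laplacian_weighted:
  fixes \<psi> w :: "real^3 \<Rightarrow> real"
  assumes \<psi>: "\<psi> \<in> test_functions UNIV" and w: "loc_integrable UNIV w"
    and lip: "\<And>l F. F \<in> test_functions UNIV \<Longrightarrow> \<bar>LINT x|lebesgue. w x * partial l F x\<bar> \<le> C * (LINT x|lebesgue. \<bar>F x\<bar>)"
  shows "\<bar>(\<Sum>k\<in>UNIV. \<Sum>l\<in>UNIV. LINT x|lebesgue. w x * (partial k (partial l \<psi>) x)\<^sup>2)
      - (LINT x|lebesgue. w x * (laplacian \<psi> x)\<^sup>2)\<bar>
    \<le> (\<Sum>k\<in>UNIV. \<Sum>l\<in>UNIV. C * (LINT x|lebesgue. \<bar>partial l \<psi> x * partial k (partial l \<psi>) x\<bar>)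
        + C * (LINT x|lebesgue. \<bar>partial l \<psi> x * partial k (partial k \<psi>) x\<bar>))"
proof -
  note sm = test_smooth[OF \<psi>]
  have int: "integrable lebesgue (\<lambda>x. w x * F x)" if "F \<in> test_functions UNIV" for F
    by (rule integrable_loc_times_test[OF bounded_bilinear_mult w that])
  have one: "\<bar>(LINT x|lebesgue. w x * (partial k (partial l \<psi>) x)\<^sup>2)
      - (LINT x|lebesgue. w x * (partial l (partial l \<psi>) x * partial k (partial k \<psi>) x))\<bar>
    \<le> C * (LINT x|lebesgue. \<bar>partial l \<psi> x * partial k (partial l \<psi>) x\<bar>)
        + C * (LINT x|lebesgue. \<bar>partial l \<psi> x * partial k (partial k \<psi>) x\<bar>)" for k l
  proof -
    let ?A = "\<lambda>x. partial l \<psi> x * partial k (partial l \<psi>) x"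
    let ?B = "\<lambda>x. partial l \<psi> x * partial k (partial k \<psi>) x"
    have tA: "?A \<in> test_functions UNIV" and tB: "?B \<in> test_functions UNIV"
      by (intro test_mult_right test_partial smooth_partial \<psi> sm)+
    have t3: "(\<lambda>x. partial l \<psi> x * partial k (partial k (partial l \<psi>)) x) \<in> test_functions UNIV"
      "(\<lambda>x. (partial k (partial l \<psi>) x)\<^sup>2) \<in> test_functions UNIV"
      "(\<lambda>x. partial l (partial l \<psi>) x * partial k (partial k \<psi>) x) \<in> test_functions UNIV"
      unfolding power2_eq_square by (intro test_mult_right test_partial smooth_partial \<psi> sm)+
    have c: "partial l (partial k (partial k \<psi>)) = partial k (partial k (partial l \<psi>))"
      by (simp add: partial_commute[of _ l k] smooth_partial sm)
    have pA: "partial k ?A x = partial l \<psi> x * partial k (partial k (partial l \<psi>)) x + (partial k (partial l \<psi>) x)\<^sup>2" for x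
      by (subst partial_bilinear[OF bounded_bilinear_mult])
         (auto intro!: smooth_differentiable smooth_partial sm simp: power2_eq_square)
    have pB: "partial l ?B x = partial l \<psi> x * partial k (partial k (partial l \<psi>)) x + partial l (partial l \<psi>) x * partial k (partial k \<psi>) x" for x
      by (subst partial_bilinear[OF bounded_bilinear_mult])
         (auto intro!: smooth_differentiable smooth_partial sm simp: c)
    have "(LINT x|lebesgue. w x * (partial k (partial l \<psi>) x)\<^sup>2)
      - (LINT x|lebesgue. w x * (partial l (partial l \<psi>) x * partial k (partial k \<psi>) x))
      = (LINT x|lebesgue. w x * partial k ?A x) - (LINT x|lebesgue. w x * partial l ?B x)"
      using int[OF t3(1)] int[OF t3(2)] int[OF t3(3)] by (simp add: pA pB distrib_left)
    then show ?thesis using lip[OF tA, of k] lip[OF tB, of l] by simp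
  qed
  have t: "(\<lambda>x. partial l (partial l \<psi>) x * partial k (partial k \<psi>) x) \<in> test_functions UNIV" for k l
    by (intro test_mult_right test_partial smooth_partial \<psi> sm)+
  have "(laplacian \<psi> x)\<^sup>2 = (\<Sum>k\<in>UNIV. \<Sum>l\<in>UNIV. partial l (partial l \<psi>) x * partial k (partial k \<psi>) x)" for x
    by (simp add: laplacian_def power2_eq_square sum_product mult.commute)
  then have "(LINT x|lebesgue. w x * (laplacian \<psi> x)\<^sup>2) =
     (\<Sum>k\<in>UNIV. \<Sum>l\<in>UNIV. LINT x|lebesgue. w x * (partial l (partial l \<psi>) x * partial k (partial k \<psi>) x))"
    using int[OF t] by (simp add: sum_distrib_left)
  then have "\<bar>(\<Sum>k\<in>UNIV. \<Sum>l\<in>UNIV. LINT x|lebesgue. w x * (partial k (partial l \<psi>) x)\<^sup>2)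
      - (LINT x|lebesgue. w x * (laplacian \<psi> x)\<^sup>2)\<bar> =
    \<bar>\<Sum>k\<in>UNIV. \<Sum>l\<in>UNIV. (LINT x|lebesgue. w x * (partial k (partial l \<psi>) x)\<^sup>2)
      - (LINT x|lebesgue. w x * (partial l (partial l \<psi>) x * partial k (partial k \<psi>) x))\<bar>"
    by (simp add: sum_subtractf)
  also have "\<dots> \<le> (\<Sum>k\<in>UNIV. \<Sum>l\<in>UNIV. C * (LINT x|lebesgue. \<bar>partial l \<psi> x * partial k (partial l \<psi>) x\<bar>)
        + C * (LINT x|lebesgue. \<bar>partial l \<psi> x * partial k (partial k \<psi>) x\<bar>))"
    by (intro order_trans[OF sum_abs] sum_mono one)
  finally show ?thesis .
qed

section \<open>Complete semi-inner-product spaces\<close>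

text \<open>Perturbing by the scalar -t z makes the cross term real, so that the variational
  inequalities below depend on the real parameter t alone.\<close>

lemma cnj_neg_scaled_mult: "cnj (- (complex_of_real t * z)) * z = complex_of_real (- t * (cmod z)\<^sup>2)"
  unfolding cmod_power2 by (rule complex_eqI) (simp_all add: power2_eq_square algebra_simps)

text \<open>The carrier need not be a vector space in the strict sense: the operations are only required to
  be compatible with the form, so that the laws hold up to vectors of norm zero.\<close>

locale semi_hilbert =
  fixes F :: "'v set" and add :: "'v \<Rightarrow> 'v \<Rightarrow> 'v" and smul :: "complex \<Rightarrow> 'v \<Rightarrow> 'v"
    and ip :: "'v \<Rightarrow> 'v \<Rightarrow> complex"
  assumes add_closed: "u \<in> F \<Longrightarrow> v \<in> F \<Longrightarrow> add u v \<in> F"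
    and smul_closed: "u \<in> F \<Longrightarrow> smul c u \<in> F"
    and ip_add: "u \<in> F \<Longrightarrow> v \<in> F \<Longrightarrow> w \<in> F \<Longrightarrow> ip (add u v) w = ip u w + ip v w"
    and ip_smul: "u \<in> F \<Longrightarrow> w \<in> F \<Longrightarrow> ip (smul c u) w = c * ip u w"
    and ip_cnj: "u \<in> F \<Longrightarrow> v \<in> F \<Longrightarrow> ip v u = cnj (ip u v)"
    and ip_pos: "u \<in> F \<Longrightarrow> 0 \<le> Re (ip u u)"
    and complete: "\<And>X. (\<And>n. X n \<in> F) \<Longrightarrow>
      (\<And>e. e > 0 \<Longrightarrow> \<exists>N. \<forall>m\<ge>N. \<forall>n\<ge>N. Re (ip (add (X m) (smul (-1) (X n))) (add (X m) (smul (-1) (X n)))) < e) \<Longrightarrow>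
      \<exists>u\<in>F. (\<lambda>n. Re (ip (add (X n) (smul (-1) u)) (add (X n) (smul (-1) u)))) \<longlonglongrightarrow> 0"
begin

definition sub where "sub u v = add u (smul (-1) v)"
definition nrm where "nrm u = sqrt (Re (ip u u))"

lemma sub_closed: "u \<in> F \<Longrightarrow> v \<in> F \<Longrightarrow> sub u v \<in> F"
  by (simp add: sub_def add_closed smul_closed)

lemma ip_add_right: "u \<in> F \<Longrightarrow> v \<in> F \<Longrightarrow> w \<in> F \<Longrightarrow> ip w (add u v) = ip w u + ip w v"
  by (metis add_closed complex_cnj_add ip_add ip_cnj)

lemma ip_smul_right: "u \<in> F \<Longrightarrow> w \<in> F \<Longrightarrow> ip w (smul c u) = cnj c * ip w u"
  by (metis complex_cnj_mult ip_cnj ip_smul smul_closed)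

lemma ip_sub: "u \<in> F \<Longrightarrow> v \<in> F \<Longrightarrow> w \<in> F \<Longrightarrow> ip (sub u v) w = ip u w - ip v w"
  by (simp add: sub_def ip_add ip_smul smul_closed)

lemma ip_sub_right: "u \<in> F \<Longrightarrow> v \<in> F \<Longrightarrow> w \<in> F \<Longrightarrow> ip w (sub u v) = ip w u - ip w v"
  by (simp add: sub_def ip_add_right ip_smul_right smul_closed)

lemma nrm_nonneg [simp]: "u \<in> F \<Longrightarrow> nrm u \<ge> 0"
  by (simp add: nrm_def ip_pos)

lemma nrm_sq: "u \<in> F \<Longrightarrow> (nrm u)\<^sup>2 = Re (ip u u)"
  by (simp add: nrm_def ip_pos)

lemma ip_self: "u \<in> F \<Longrightarrow> ip u u = complex_of_real ((nrm u)\<^sup>2)"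
  using ip_cnj[of u u] by (simp add: nrm_sq complex_eq_iff)

lemma Re_ip_commute: "u \<in> F \<Longrightarrow> v \<in> F \<Longrightarrow> Re (ip v u) = Re (ip u v)"
  using ip_cnj[of u v] by simp

lemma nrm_add_sq: "u \<in> F \<Longrightarrow> v \<in> F \<Longrightarrow> (nrm (add u v))\<^sup>2 = (nrm u)\<^sup>2 + 2 * Re (ip u v) + (nrm v)\<^sup>2"
  by (simp add: nrm_sq add_closed ip_add ip_add_right Re_ip_commute[of v u])

lemma nrm_sub_sq: "u \<in> F \<Longrightarrow> v \<in> F \<Longrightarrow> (nrm (sub u v))\<^sup>2 = (nrm u)\<^sup>2 - 2 * Re (ip u v) + (nrm v)\<^sup>2"
  by (simp add: nrm_sq sub_closed ip_sub ip_sub_right Re_ip_commute[of v u])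

lemma nrm_smul: "u \<in> F \<Longrightarrow> nrm (smul c u) = cmod c * nrm u"
proof -
  assume u: "u \<in> F"
  have "ip (smul c u) (smul c u) = (c * cnj c) * ip u u"
    using u by (simp add: ip_smul ip_smul_right smul_closed)
  also have "\<dots> = complex_of_real ((cmod c)\<^sup>2 * (nrm u)\<^sup>2)"
    by (simp add: complex_norm_square[symmetric] ip_self u)
  finally have "(nrm (smul c u))\<^sup>2 = (cmod c * nrm u)\<^sup>2"
    using u by (simp add: nrm_sq smul_closed power_mult_distrib)
  then show ?thesis using u by (simp add: smul_closed)
qed

lemma Cauchy_Schwarz:
  assumes u: "u \<in> F" and v: "v \<in> F"
  shows "cmod (ip u v) \<le> nrm u * nrm v"
proof -
  let ?b = "(cmod (ip u v))\<^sup>2" and ?a = "(nrm u)\<^sup>2" and ?c = "(nrm v)\<^sup>2"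
  have q: "0 \<le> ?a - 2 * t * ?b + t * t * ?b * ?c" for t :: real
  proof -
    let ?k = "- (complex_of_real t * ip u v)"
    have "(nrm (add u (smul ?k v)))\<^sup>2 = ?a + 2 * Re (cnj ?k * ip u v) + (cmod ?k)\<^sup>2 * ?c"
      using u v by (simp add: nrm_add_sq smul_closed ip_smul_right nrm_smul power_mult_distrib)
    moreover have "cnj ?k * ip u v = complex_of_real (- t * ?b)"
      by (rule cnj_neg_scaled_mult)
    moreover have "(cmod ?k)\<^sup>2 = t * t * ?b" by (simp add: norm_mult power_mult_distrib power2_eq_square)
    ultimately have "(nrm (add u (smul ?k v)))\<^sup>2 = ?a + 2 * (- t * ?b) + t * t * ?b * ?c"
      by (simp only: Re_complex_of_real)
    then show ?thesis using zero_le_power2[of "nrm (add u (smul ?k v))"] by simp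
  qed
  have "?b \<le> ?a * ?c"
  \<comment> \<open>A vector of norm zero need not be zero here, so this case is separate: the
    quadratic term is absent, and t = (a + 1) / (2 b) would violate \<open>q\<close> unless b =
    0.\<close>
  proof (cases "?c = 0")
    case True
    have "?b = 0"
    proof (rule ccontr)
      assume "?b \<noteq> 0"
      then have "2 * ((?a + 1) / (2 * ?b)) * ?b = ?a + 1" by simp
      then show False using q[of "(?a + 1) / (2 * ?b)"] True by simp
    qed
    then show ?thesis by simp
  next
    case False
    then have c: "?c > 0" by simp
    have "?a - 2 * (1 / ?c) * ?b + (1 / ?c) * (1 / ?c) * ?b * ?c = ?a - ?b / ?c"
      using False by (simp add: field_simps)
    then have "?b / ?c \<le> ?a" using q[of "1 / ?c"] by simp
    then show ?thesis using c by (simp add: pos_divide_le_eq)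
  qed
  then have "?b \<le> (nrm u * nrm v)\<^sup>2" by (simp add: power_mult_distrib)
  then show ?thesis using u v by (simp add: power2_le_iff_abs_le)
qed

lemma nrm_add_le: "u \<in> F \<Longrightarrow> v \<in> F \<Longrightarrow> nrm (add u v) \<le> nrm u + nrm v"
proof -
  assume u: "u \<in> F" "v \<in> F"
  have "(nrm (add u v))\<^sup>2 \<le> (nrm u + nrm v)\<^sup>2"
    using Cauchy_Schwarz[OF u] complex_Re_le_cmod[of "ip u v"] nrm_add_sq[OF u]
    by (simp add: power2_sum)
  then show ?thesis using u by (simp add: power2_le_iff_abs_le add_closed)
qed

section \<open>Minimisation, Riesz representation and density\<close>

lemma complete_nrm:
  assumes "\<And>n. X n \<in> F" "\<And>e. e > 0 \<Longrightarrow> \<exists>N. \<forall>m\<ge>N. \<forall>n\<ge>N. (nrm (sub (X m) (X n)))\<^sup>2 < e"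
  shows "\<exists>u\<in>F. (\<lambda>n. (nrm (sub (X n) u))\<^sup>2) \<longlonglongrightarrow> 0"
proof -
  have "\<exists>u\<in>F. (\<lambda>n. Re (ip (add (X n) (smul (-1) u)) (add (X n) (smul (-1) u)))) \<longlonglongrightarrow> 0"
    using assms(2) by (intro complete assms(1)) (simp add: nrm_sq sub_closed assms(1) sub_def[symmetric])
  then show ?thesis by (auto simp: nrm_sq sub_closed assms(1) sub_def[symmetric])
qed

text \<open>The representer is the limit of a minimising sequence for |u|^2 - 2 Re l(u). As M need
  not be closed, the limit lies only in its closure, which is the form that the density argument
  needs. The functional is antilinear because \<open>ip\<close> is linear in its first slot.\<close>

theorem riesz_closure:
  assumes M: "M \<subseteq> F" "M \<noteq> {}" "\<And>u v. u \<in> M \<Longrightarrow> v \<in> M \<Longrightarrow> add u v \<in> M" "\<And>c u. u \<in> M \<Longrightarrow> smul c u \<in> M"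
    and l: "\<And>u v. u \<in> M \<Longrightarrow> v \<in> M \<Longrightarrow> l (add u v) = l u + l v" "\<And>c u. u \<in> M \<Longrightarrow> l (smul c u) = cnj c * l u"
    and bnd: "\<And>u. u \<in> M \<Longrightarrow> cmod (l u) \<le> C * nrm u"
  obtains h where "h \<in> F" "\<And>m. m \<in> M \<Longrightarrow> ip h m = l m" "\<And>e. e > 0 \<Longrightarrow> \<exists>m\<in>M. nrm (sub m h) < e"
proof -
  have MF: "u \<in> F" if "u \<in> M" for u using that M(1) by auto
  define J where "J u = (nrm u)\<^sup>2 - 2 * Re (l u)" for u
  have Jlow: "J u \<ge> - C\<^sup>2" if "u \<in> M" for u
  proof -
    have "Re (l u) \<le> C * nrm u" using complex_Re_le_cmod[of "l u"] bnd[OF that] by linarith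
    moreover have "0 \<le> (nrm u - C)\<^sup>2" by simp
    ultimately show ?thesis by (simp add: J_def power2_diff mult.commute)
  qed
  define d where "d = Inf (J ` M)"
  have bdd: "bdd_below (J ` M)" using Jlow by (intro bdd_belowI[of _ "- C\<^sup>2"]) auto
  have dJ: "d \<le> J u" if "u \<in> M" for u unfolding d_def by (rule cInf_lower[OF _ bdd]) (use that in auto)
  have "\<exists>u\<in>M. J u < d + 1 / Suc n" for n
  proof -
    have "\<exists>x\<in>J ` M. x < d + 1 / Suc n"
      unfolding d_def by (rule cInf_lessD) (use M(2) in auto)
    then show ?thesis by auto
  qed
  then obtain X where X: "\<And>n. X n \<in> M" "\<And>n. J (X n) < d + 1 / Suc n" by metis
  have var: "0 \<le> 1 / Suc n + 2 * Re (ip (X n) s - l s) + (nrm s)\<^sup>2" if s: "s \<in> M" for n s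
  proof -
    have "J (add (X n) s) = J (X n) + 2 * Re (ip (X n) s - l s) + (nrm s)\<^sup>2"
      using X(1)[of n] s by (simp add: J_def nrm_add_sq MF l)
    then show ?thesis using dJ[OF M(3)[OF X(1)[of n] s]] X(2)[of n] by simp
  qed
  \<comment> \<open>Parallelogram law: the midpoint has the value (J (X m) + J (X n)) / 2 - |X m - X
    n|^2 / 4. This is at least the infimum d, which the two values themselves exceed by less than 1
    / Suc m and 1 / Suc n.\<close>
  have cauchy: "(nrm (sub (X m) (X n)))\<^sup>2 < 2 / Suc m + 2 / Suc n" for m n
  proof -
    let ?h = "smul (1/2) (add (X m) (X n))"
    have XF: "X m \<in> F" "X n \<in> F" using X(1) MF by auto
    have hM: "?h \<in> M" using X(1) M by blast
    have "(nrm ?h)\<^sup>2 = (1/4) * (nrm (add (X m) (X n)))\<^sup>2"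
      by (simp add: nrm_smul add_closed XF power_mult_distrib power2_eq_square)
    then have "(nrm ?h)\<^sup>2 = (1/4) * ((nrm (X m))\<^sup>2 + 2 * Re (ip (X m) (X n)) + (nrm (X n))\<^sup>2)"
      by (simp add: nrm_add_sq XF)
    moreover have "Re (l ?h) = (Re (l (X m)) + Re (l (X n))) / 2"
      using X(1) M(3) by (simp add: l)
    ultimately have "J ?h = (J (X m) + J (X n)) / 2 - (nrm (sub (X m) (X n)))\<^sup>2 / 4"
      by (simp add: J_def nrm_sub_sq XF field_simps)
    then have "d \<le> (J (X m) + J (X n)) / 2 - (nrm (sub (X m) (X n)))\<^sup>2 / 4" using dJ[OF hM] by simp
    moreover define a b where "a = 1 / real (Suc m)" and "b = 1 / real (Suc n)"
    moreover have "J (X m) < d + a" "J (X n) < d + b" using X(2) by (simp_all only: a_def b_def)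
    ultimately have "(nrm (sub (X m) (X n)))\<^sup>2 < 2 * a + 2 * b" by argo
    then show ?thesis by (simp add: a_def b_def)
  qed
  have lim0: "(\<lambda>n. c / Suc n) \<longlonglongrightarrow> 0" for c :: real by (rule LIMSEQ_Suc, rule lim_const_over_n)
  have "\<exists>N. \<forall>m\<ge>N. \<forall>n\<ge>N. (nrm (sub (X m) (X n)))\<^sup>2 < e" if e: "e > 0" for e
  proof -
    obtain N where N: "\<And>n. n \<ge> N \<Longrightarrow> 2 / Suc n < e / 2"
      using order_tendstoD(2)[OF lim0, of "e/2" 2] e by (auto simp: eventually_sequentially)
    show ?thesis
    proof (intro exI[of _ N] allI impI)
      fix m n assume mn: "N \<le> m" "N \<le> n"
      show "(nrm (sub (X m) (X n)))\<^sup>2 < e"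
        using cauchy[of m n] N[OF mn(1)] N[OF mn(2)] by linarith
    qed
  qed
  from complete_nrm[OF MF[OF X(1)] this] obtain h where h: "h \<in> F"
    and lim: "(\<lambda>n. (nrm (sub (X n) h))\<^sup>2) \<longlonglongrightarrow> 0" by blast
  have limn: "(\<lambda>n. nrm (sub (X n) h)) \<longlonglongrightarrow> 0"
    using tendsto_real_sqrt[OF lim] MF[OF X(1)] h by (simp add: sub_closed)
  have iplim: "(\<lambda>n. ip (X n) s) \<longlonglongrightarrow> ip h s" if s: "s \<in> F" for s
  proof -
    have "(\<lambda>n. ip (X n) s - ip h s) \<longlonglongrightarrow> 0"
    proof (rule Lim_null_comparison)
      show "(\<lambda>n. nrm (sub (X n) h) * nrm s) \<longlonglongrightarrow> 0" using tendsto_mult_right[OF limn, of "nrm s"] by simp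
      show "eventually (\<lambda>n. norm (ip (X n) s - ip h s) \<le> nrm (sub (X n) h) * nrm s) sequentially"
        using Cauchy_Schwarz[OF sub_closed[OF MF[OF X(1)] h] s] MF[OF X(1)] h s by (simp add: ip_sub)
    qed
    then show ?thesis by (simp add: LIM_zero_iff)
  qed
  have var': "0 \<le> 2 * Re (ip h s - l s) + (nrm s)\<^sup>2" if s: "s \<in> M" for s
  proof (rule tendsto_lowerbound)
    show "(\<lambda>n. 1 / Suc n + 2 * Re (ip (X n) s - l s) + (nrm s)\<^sup>2) \<longlonglongrightarrow> 2 * Re (ip h s - l s) + (nrm s)\<^sup>2"
      using tendsto_add[OF tendsto_add[OF lim0[of 1] tendsto_mult_left[OF tendsto_Re[OF
            tendsto_diff[OF iplim[OF MF[OF s]] tendsto_const[of "l s"]]], of 2]] tendsto_const[of "(nrm s)\<^sup>2"]]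
      by simp
    show "eventually (\<lambda>n. 0 \<le> 1 / Suc n + 2 * Re (ip (X n) s - l s) + (nrm s)\<^sup>2) sequentially"
      using var[OF s] by simp
  qed simp
  have "ip h m = l m" if m: "m \<in> M" for m
  proof -
    let ?z = "ip h m - l m" and ?b = "(cmod (ip h m - l m))\<^sup>2"
    have q: "0 \<le> - 2 * t * ?b + t * t * ?b * (nrm m)\<^sup>2" for t :: real
    proof -
      let ?k = "- (complex_of_real t * ?z)"
      have "ip h (smul ?k m) - l (smul ?k m) = cnj ?k * ?z"
        using m h by (simp add: ip_smul_right MF l right_diff_distrib)
      also have "\<dots> = complex_of_real (- t * ?b)" by (rule cnj_neg_scaled_mult)
      finally have "Re (ip h (smul ?k m) - l (smul ?k m)) = - t * ?b" by (simp only: Re_complex_of_real)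
      moreover have "(nrm (smul ?k m))\<^sup>2 = t * t * ?b * (nrm m)\<^sup>2"
        using m by (simp add: nrm_smul MF norm_mult power_mult_distrib power2_eq_square)
      ultimately show ?thesis using var'[OF M(4)[OF m, of ?k]] by simp
    qed
    \<comment> \<open>This t makes t |m|^2 <= 1, so the quadratic term absorbs at most half of the
      linear one.\<close>
    let ?t = "1 / ((nrm m)\<^sup>2 + 1)"
    have p: "(nrm m)\<^sup>2 + 1 > 0" by (smt (verit) zero_le_power2)
    have "?t * (nrm m)\<^sup>2 \<le> 1" using p by (simp add: divide_le_eq)
    then have "?t * ?b * (?t * (nrm m)\<^sup>2) \<le> ?t * ?b * 1" using p by (intro mult_left_mono) auto
    then have "?t * ?b \<le> 0" using q[of ?t] by (simp add: mult_ac)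
    moreover have "?t > 0" using p by simp
    ultimately have "?b \<le> 0" by (metis mult_le_0_iff not_le zero_le_power2 order_antisym)
    then show ?thesis by simp
  qed
  moreover have "\<exists>m\<in>M. nrm (sub m h) < e" if "e > 0" for e
    using order_tendstoD(2)[OF limn that] X(1) by (auto simp: eventually_sequentially)
  ultimately show thesis using h that by blast
qed

theorem riesz:
  assumes "F \<noteq> {}"
    and "\<And>u v. u \<in> F \<Longrightarrow> v \<in> F \<Longrightarrow> l (add u v) = l u + l v" "\<And>c u. u \<in> F \<Longrightarrow> l (smul c u) = cnj c * l u"
    and "\<And>u. u \<in> F \<Longrightarrow> cmod (l u) \<le> C * nrm u"
  obtains h where "h \<in> F" "\<And>u. u \<in> F \<Longrightarrow> ip h u = l u"
  by (rule riesz_closure[of F l C]) (use assms add_closed smul_closed in auto)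

text \<open>Represent the functional given by f on M: the representer lies in the closure of M and
  differs from f by a vector orthogonal to M, which has norm zero.\<close>

theorem dense_if_orthogonal_zero:
  assumes M: "M \<subseteq> F" "M \<noteq> {}" "\<And>u v. u \<in> M \<Longrightarrow> v \<in> M \<Longrightarrow> add u v \<in> M" "\<And>c u. u \<in> M \<Longrightarrow> smul c u \<in> M"
    and orth: "\<And>h. h \<in> F \<Longrightarrow> (\<And>m. m \<in> M \<Longrightarrow> ip h m = 0) \<Longrightarrow> nrm h = 0"
    and f: "f \<in> F" and e: "e > 0"
  shows "\<exists>m\<in>M. nrm (sub m f) < e"
proof -
  have MF: "u \<in> F" if "u \<in> M" for u using that M(1) by auto
  obtain h where h: "h \<in> F" "\<And>m. m \<in> M \<Longrightarrow> ip h m = ip f m" "\<And>e. e > 0 \<Longrightarrow> \<exists>m\<in>M. nrm (sub m h) < e"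
    by (rule riesz_closure[OF M, of "\<lambda>m. ip f m" "nrm f"])
       (auto simp: ip_add_right ip_smul_right f MF Cauchy_Schwarz)
  have "nrm (sub h f) = 0" by (rule orth) (simp_all add: sub_closed h f ip_sub MF)
  moreover obtain m where m: "m \<in> M" "nrm (sub m h) < e" using h(3)[OF e] by blast
  moreover have "nrm (sub m f) = nrm (add (sub m h) (sub h f))"
    using m(1) by (simp add: nrm_def ip_add ip_add_right ip_sub ip_sub_right add_closed sub_closed MF h(1) f)
  ultimately show ?thesis
    using nrm_add_le[of "sub m h" "sub h f"] by (auto simp: sub_closed MF h f intro!: bexI[of _ m])
qed

text \<open>Surjectivity: the lower bound makes \<open>\<langle>A u, A u'\<rangle>\<close> an equivalent inner product, for which
  \<open>u' \<mapsto> \<langle>f, A u'\<rangle>\<close> is represented by some \<open>u\<close>; then \<open>A u - f\<close> is orthogonal to the range.\<close>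

theorem lower_bound_imp_surjective:
  assumes ne: "F \<noteq> {}" and A: "\<And>u. u \<in> F \<Longrightarrow> A u \<in> F"
    and add: "\<And>u v w. u \<in> F \<Longrightarrow> v \<in> F \<Longrightarrow> w \<in> F \<Longrightarrow> ip (A (add u v)) w = ip (A u) w + ip (A v) w"
    and smul: "\<And>c u w. u \<in> F \<Longrightarrow> w \<in> F \<Longrightarrow> ip (A (smul c u)) w = c * ip (A u) w"
    and upper: "\<And>u. u \<in> F \<Longrightarrow> nrm (A u) \<le> C * nrm u" and lower: "\<And>u. u \<in> F \<Longrightarrow> nrm u \<le> D * nrm (A u)"
    and C: "C > 0" and D: "D > 0"
    and adj: "\<And>v. v \<in> F \<Longrightarrow> (\<And>u. u \<in> F \<Longrightarrow> ip (A u) v = 0) \<Longrightarrow> nrm v = 0"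
    and f: "f \<in> F"
  obtains u where "u \<in> F" "\<And>v. v \<in> F \<Longrightarrow> ip (A u) v = ip f v"
proof -
  have addr: "ip w (A (add u v)) = ip w (A u) + ip w (A v)" if "u \<in> F" "v \<in> F" "w \<in> F" for u v w
    by (metis A add add_closed complex_cnj_add ip_cnj that)
  have smulr: "ip w (A (smul c u)) = cnj c * ip w (A u)" if "u \<in> F" "w \<in> F" for c u w
    by (metis A complex_cnj_mult ip_cnj smul smul_closed that)
  let ?B = "\<lambda>u v. ip (A u) (A v)"
  have sub: "Re (?B (sub u v) (sub u v)) = (nrm (A (sub u v)))\<^sup>2" if "u \<in> F" "v \<in> F" for u v
    using that by (simp add: nrm_sq A sub_closed)
  \<comment> \<open>Completeness of the new inner product uses both bounds: \<open>lower\<close>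
    turns its Cauchy sequences into Cauchy sequences of the old norm, and \<open>upper\<close>
    carries the convergence back.\<close>
  interpret B: semi_hilbert F add smul ?B
  proof
    fix X :: "nat \<Rightarrow> 'v" assume X: "\<And>n. X n \<in> F"
    assume cau: "\<And>e. 0 < e \<Longrightarrow> \<exists>N. \<forall>m\<ge>N. \<forall>n\<ge>N.
      Re (?B (add (X m) (smul (- 1) (X n))) (add (X m) (smul (- 1) (X n)))) < e"
    have "\<exists>N. \<forall>m\<ge>N. \<forall>n\<ge>N. (nrm (sub (X m) (X n)))\<^sup>2 < e" if e: "e > 0" for e
    proof -
      have "e / D\<^sup>2 > 0" using e D by simp
      from cau[OF this] obtain N where N: "\<And>m n. m \<ge> N \<Longrightarrow> n \<ge> N \<Longrightarrow> (nrm (A (sub (X m) (X n))))\<^sup>2 < e / D\<^sup>2"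
        by (auto simp: sub_def[symmetric] sub X)
      have "(nrm (sub (X m) (X n)))\<^sup>2 < e" if "m \<ge> N" "n \<ge> N" for m n
      proof -
        have "(nrm (sub (X m) (X n)))\<^sup>2 \<le> (D * nrm (A (sub (X m) (X n))))\<^sup>2"
          by (intro power_mono lower sub_closed X nrm_nonneg)
        also have "\<dots> < e" using N[OF that] D by (simp add: power_mult_distrib pos_less_divide_eq mult.commute)
        finally show ?thesis .
      qed
      then show ?thesis by blast
    qed
    from complete_nrm[OF X this] obtain u where u: "u \<in> F" "(\<lambda>n. (nrm (sub (X n) u))\<^sup>2) \<longlonglongrightarrow> 0" by blast
    have "(\<lambda>n. (nrm (A (sub (X n) u)))\<^sup>2) \<longlonglongrightarrow> 0"
    proof (rule Lim_null_comparison)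
      show "(\<lambda>n. C\<^sup>2 * (nrm (sub (X n) u))\<^sup>2) \<longlonglongrightarrow> 0" using tendsto_mult_left[OF u(2), of "C\<^sup>2"] by simp
      show "eventually (\<lambda>n. norm ((nrm (A (sub (X n) u)))\<^sup>2) \<le> C\<^sup>2 * (nrm (sub (X n) u))\<^sup>2) sequentially"
      proof (intro always_eventually allI)
        fix n
        have "(nrm (A (sub (X n) u)))\<^sup>2 \<le> (C * nrm (sub (X n) u))\<^sup>2"
          by (intro power_mono upper nrm_nonneg A sub_closed X u)
        then show "norm ((nrm (A (sub (X n) u)))\<^sup>2) \<le> C\<^sup>2 * (nrm (sub (X n) u))\<^sup>2"
          by (simp add: power_mult_distrib)
      qed
    qed
    then show "\<exists>u\<in>F. (\<lambda>n. Re (?B (add (X n) (smul (- 1) u)) (add (X n) (smul (- 1) u)))) \<longlonglongrightarrow> 0"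
      using u(1) by (auto simp: sub_def[symmetric] sub X)
  qed (simp_all add: add_closed smul_closed A add smul ip_pos, metis A ip_cnj)
  have Bn: "B.nrm u = nrm (A u)" for u by (simp add: B.nrm_def nrm_def)
  obtain u where u: "u \<in> F" "\<And>v. v \<in> F \<Longrightarrow> ip (A u) (A v) = ip f (A v)"
    by (rule B.riesz[OF ne, of "\<lambda>v. ip f (A v)" "nrm f"])
       (auto simp: addr smulr f Bn Cauchy_Schwarz A)
  have "nrm (sub (A u) f) = 0"
  proof (rule adj)
    fix v assume v: "v \<in> F"
    have "ip (sub (A u) f) (A v) = 0" using u v f by (simp add: ip_sub A)
    then show "ip (A v) (sub (A u) f) = 0" using v u f by (metis A complex_cnj_zero ip_cnj sub_closed)
  qed (simp add: sub_closed A u f)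
  then have "ip (A u) v = ip f v" if "v \<in> F" for v
    using Cauchy_Schwarz[OF sub_closed[OF A[OF u(1)] f] that] that by (simp add: ip_sub A u f)
  then show thesis using u(1) that by blast
qed

end

section \<open>Weighted square-integrable functions\<close>

lemma power2_norm_add_le: "(norm (a + b))\<^sup>2 \<le> 2 * (norm a)\<^sup>2 + 2 * (norm (b :: 'a::real_normed_vector))\<^sup>2"
proof -
  have "(norm (a + b))\<^sup>2 \<le> (norm a + norm b)\<^sup>2" by (intro power_mono norm_triangle_ineq) auto
  also have "\<dots> \<le> 2 * (norm a)\<^sup>2 + 2 * (norm b)\<^sup>2"
    using sum_squares_bound[of "norm a" "norm b"] by (simp add: power2_sum)
  finally show ?thesis .
qed

lemma cdot_vcnj_self: "cdot v (vcnj v) = complex_of_real ((norm v)\<^sup>2)"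
  by (simp add: cdot_def vcnj_def norm_vec_def L2_set_def sum_nonneg complex_norm_square del: of_real_power)

lemma bounded_bilinear_cdot_vcnj: "bounded_bilinear (\<lambda>v w. cdot v (vcnj w))"
proof (rule bounded_bilinear.intro)
  show "\<exists>K. \<forall>a b. norm (cdot a (vcnj b)) \<le> norm a * norm b * K"
  proof (intro exI allI)
    fix a b :: "complex^3"
    have "norm (cdot a (vcnj b)) \<le> (\<Sum>l\<in>UNIV. norm (a $ l) * norm (b $ l))"
      unfolding cdot_def by (rule sum_norm_le) (simp add: vcnj_def norm_mult)
    also have "\<dots> \<le> (\<Sum>l\<in>(UNIV::3 set). norm a * norm b)"
      by (intro sum_mono mult_mono Finite_Cartesian_Product.norm_nth_le) auto
    finally show "norm (cdot a (vcnj b)) \<le> norm a * norm b * 3" by simp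
  qed
qed (auto simp: cdot_def vcnj_def algebra_simps sum.distrib scaleR_sum_right)

lemma measurable_vec_nth [measurable (raw)]:
  fixes f :: "'x \<Rightarrow> complex^3"
  shows "f \<in> borel_measurable M \<Longrightarrow> (\<lambda>x. f x $ l) \<in> borel_measurable M"
  by (rule borel_measurable_continuous_on[where f="\<lambda>v. v $ l"]) (auto intro: continuous_intros)

lemma measurable_cdot_vcnj [measurable (raw)]:
  "f \<in> borel_measurable M \<Longrightarrow> g \<in> borel_measurable M \<Longrightarrow> (\<lambda>x. cdot (f x) (vcnj (g x))) \<in> borel_measurable M"
  unfolding cdot_def vcnj_def vec_lambda_beta
  by (intro borel_measurable_sum borel_measurable_times measurable_vec_nth
      borel_measurable_continuous_on[where f=cnj]) (auto intro: continuous_intros)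

definition L2n :: "(real^3 \<Rightarrow> real) \<Rightarrow> (real^3 \<Rightarrow> 'a::real_normed_vector) \<Rightarrow> real"
  where "L2n \<rho> u = sqrt (LINT x|lebesgue. \<rho> x * (norm (u x))\<^sup>2)"

text \<open>The density may tend to zero at infinity, so a positive lower bound is available on
  balls only. The weighted norm is controlled by the unweighted one globally, but the converse holds
  just on bounded sets.\<close>

locale weight =
  fixes \<rho> :: "real^3 \<Rightarrow> real"
  assumes weight_measurable [measurable]: "\<rho> \<in> borel_measurable lebesgue"
    and weight_pos: "AE x in lebesgue. \<rho> x > 0"
    and weight_upper: "\<exists>P>0. AE x in lebesgue. \<rho> x \<le> P"
    and weight_lower: "\<And>R. \<exists>c>0. AE x in lebesgue. norm x < R \<longrightarrow> c \<le> \<rho> x"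
begin

lemma L2w_measurable [measurable_dest]: "u \<in> L2w \<rho> \<Longrightarrow> u \<in> borel_measurable lebesgue"
  by (simp add: L2w_def)

lemma L2w_integrable: "u \<in> L2w \<rho> \<Longrightarrow> integrable lebesgue (\<lambda>x. \<rho> x * (norm (u x))\<^sup>2)"
  by (simp add: L2w_def)

lemma L2n_nonneg [simp]: "L2n \<rho> u \<ge> 0"
  using weight_pos unfolding L2n_def by (auto intro!: integral_nonneg_AE elim!: eventually_mono)

lemma L2n_sq: "(L2n \<rho> u)\<^sup>2 = (LINT x|lebesgue. \<rho> x * (norm (u x))\<^sup>2)"
  using weight_pos unfolding L2n_def by (auto intro!: integral_nonneg_AE elim!: eventually_mono)

lemma L2w_bound:
  fixes u :: "real^3 \<Rightarrow> 'a::real_normed_vector" and g :: "real^3 \<Rightarrow> 'b::real_normed_vector"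
  assumes u: "u \<in> L2w \<rho>" and g[measurable]: "g \<in> borel_measurable lebesgue"
    and le: "AE x in lebesgue. norm (g x) \<le> C * norm (u x)" and C: "C \<ge> 0"
  shows "g \<in> L2w \<rho>" "L2n \<rho> g \<le> C * L2n \<rho> u"
proof -
  have b: "AE x in lebesgue. \<rho> x * (norm (g x))\<^sup>2 \<le> C\<^sup>2 * (\<rho> x * (norm (u x))\<^sup>2)"
    using weight_pos le
  proof eventually_elim
    case (elim x)
    have "(norm (g x))\<^sup>2 \<le> (C * norm (u x))\<^sup>2" by (rule power_mono) (use elim in auto)
    then have "\<rho> x * (norm (g x))\<^sup>2 \<le> \<rho> x * (C * norm (u x))\<^sup>2" using elim by (intro mult_left_mono) auto
    then show ?case by (simp add: power_mult_distrib mult_ac)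
  qed
  have int: "integrable lebesgue (\<lambda>x. C\<^sup>2 * (\<rho> x * (norm (u x))\<^sup>2))" using L2w_integrable[OF u] by simp
  have i: "integrable lebesgue (\<lambda>x. \<rho> x * (norm (g x))\<^sup>2)"
  proof (rule Bochner_Integration.integrable_bound[OF int])
    show "AE x in lebesgue. norm (\<rho> x * (norm (g x))\<^sup>2) \<le> norm (C\<^sup>2 * (\<rho> x * (norm (u x))\<^sup>2))"
      using b weight_pos by eventually_elim (simp add: abs_mult)
  qed measurable
  then show "g \<in> L2w \<rho>" by (simp add: L2w_def)
  have "(L2n \<rho> g)\<^sup>2 \<le> C\<^sup>2 * (L2n \<rho> u)\<^sup>2"
    unfolding L2n_sq using integral_mono_AE[OF i int b] by simp
  then have "(L2n \<rho> g)\<^sup>2 \<le> (C * L2n \<rho> u)\<^sup>2" by (simp add: power_mult_distrib)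
  then show "L2n \<rho> g \<le> C * L2n \<rho> u" by (rule power2_le_imp_le) (simp add: C)
qed

lemma L2w_cong_AE:
  assumes "u \<in> L2w \<rho>" "g \<in> borel_measurable lebesgue" "AE x in lebesgue. g x = u x"
  shows "g \<in> L2w \<rho>"
  by (rule L2w_bound(1)[OF assms(1,2), of 1]) (use assms(3) in \<open>auto elim: eventually_mono\<close>)

lemma L2w_add:
  fixes u v :: "real^3 \<Rightarrow> 'a::{real_normed_vector, second_countable_topology}"
  assumes u: "u \<in> L2w \<rho>" and v: "v \<in> L2w \<rho>"
  shows "(\<lambda>x. u x + v x) \<in> L2w \<rho>"
proof -
  note [measurable] = L2w_measurable[OF u] L2w_measurable[OF v]
  have "integrable lebesgue (\<lambda>x. \<rho> x * (norm (u x + v x))\<^sup>2)"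
  proof (rule Bochner_Integration.integrable_bound)
    show "integrable lebesgue (\<lambda>x. 2 * (\<rho> x * (norm (u x))\<^sup>2) + 2 * (\<rho> x * (norm (v x))\<^sup>2))"
      using L2w_integrable[OF u] L2w_integrable[OF v] by auto
    show "AE x in lebesgue. norm (\<rho> x * (norm (u x + v x))\<^sup>2)
        \<le> norm (2 * (\<rho> x * (norm (u x))\<^sup>2) + 2 * (\<rho> x * (norm (v x))\<^sup>2))"
      using weight_pos
    proof eventually_elim
      case (elim x)
      have "\<rho> x * (norm (u x + v x))\<^sup>2 \<le> \<rho> x * (2 * (norm (u x))\<^sup>2 + 2 * (norm (v x))\<^sup>2)"
        using elim by (intro mult_left_mono power2_norm_add_le) auto
      then show ?case using elim by (simp add: distrib_left mult_ac)
    qed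
  qed measurable
  then show ?thesis by (simp add: L2w_def)
qed

lemma L2w_scaleR:
  fixes u :: "real^3 \<Rightarrow> 'a::{real_normed_vector, second_countable_topology}"
  shows "u \<in> L2w \<rho> \<Longrightarrow> (\<lambda>x. c *\<^sub>R u x) \<in> L2w \<rho>"
  by (rule L2w_bound(1)[of u _ "\<bar>c\<bar>"]) auto

lemma L2w_diff:
  fixes u v :: "real^3 \<Rightarrow> 'a::{real_normed_vector, second_countable_topology}"
  shows "u \<in> L2w \<rho> \<Longrightarrow> v \<in> L2w \<rho> \<Longrightarrow> (\<lambda>x. u x - v x) \<in> L2w \<rho>"
  using L2w_add[OF _ L2w_scaleR[of v "-1"], of u] by simp

text \<open>The squared increments have integrals below 4^(-k), which remain summable after
  multiplication by 2^k. The sum of the \<open>t k\<close> is then finite almost everywhere and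
  bounds the k-th increment by a geometric sequence.\<close>

lemma L2w_fast_subseq_converges:
  fixes u :: "nat \<Rightarrow> real^3 \<Rightarrow> 'a::{banach, second_countable_topology}"
  assumes u: "\<And>n. u n \<in> L2w \<rho>"
    and fast: "\<And>k. (LINT x|lebesgue. \<rho> x * (norm (u (Suc k) x - u k x))\<^sup>2) \<le> (1/4) ^ k"
  shows "AE x in lebesgue. convergent (\<lambda>k. u k x)"
proof -
  note [measurable] = L2w_measurable[OF u]
  define t where "t k x = 2 ^ k * (\<rho> x * (norm (u (Suc k) x - u k x))\<^sup>2)" for k x
  have tm [measurable]: "t k \<in> borel_measurable lebesgue" for k unfolding t_def by measurable
  have tpos: "AE x in lebesgue. \<forall>k. 0 \<le> t k x"
    using weight_pos by eventually_elim (simp add: t_def)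
  have nn: "(\<integral>\<^sup>+x. ennreal (t k x) \<partial>lebesgue) \<le> ennreal ((1/2) ^ k)" for k
  proof -
    have i: "integrable lebesgue (\<lambda>x. \<rho> x * (norm (u (Suc k) x - u k x))\<^sup>2)"
      by (intro L2w_integrable L2w_diff u)
    then have "(\<integral>\<^sup>+x. ennreal (t k x) \<partial>lebesgue) = ennreal (LINT x|lebesgue. t k x)"
      using tpos by (intro nn_integral_eq_integral) (auto simp: t_def elim!: eventually_mono)
    also have "\<dots> \<le> ennreal (2 ^ k * (1/4) ^ k)"
      unfolding t_def using fast[of k] by (intro ennreal_leI) simp
    also have "(2::real) ^ k * (1/4) ^ k = (1/2) ^ k" by (simp flip: power_mult_distrib)
    finally show ?thesis .
  qed
  have "(\<integral>\<^sup>+x. (\<Sum>k. ennreal (t k x)) \<partial>lebesgue) = (\<Sum>k. \<integral>\<^sup>+x. ennreal (t k x) \<partial>lebesgue)"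
    by (rule nn_integral_suminf) measurable
  also have "\<dots> \<le> (\<Sum>k. ennreal ((1/2) ^ k))" by (intro suminf_le nn) auto
  also have "\<dots> = ennreal (\<Sum>k. (1/2) ^ k)" by (intro suminf_ennreal2) auto
  also have "\<dots> < \<infinity>" by simp
  finally have "(\<integral>\<^sup>+x. (\<Sum>k. ennreal (t k x)) \<partial>lebesgue) \<noteq> \<infinity>" by simp
  then have "AE x in lebesgue. (\<Sum>k. ennreal (t k x)) \<noteq> \<infinity>"
    by (intro nn_integral_PInf_AE) auto
  then show ?thesis using weight_pos tpos
  proof eventually_elim
    case (elim x)
    then obtain C where C: "C \<ge> 0" "(\<Sum>k. ennreal (t k x)) = ennreal C"
      by (metis ennreal_cases infinity_ennreal_def)
    have tC: "t k x \<le> C" for k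
    proof -
      have "ennreal (t k x) \<le> (\<Sum>k. ennreal (t k x))"
        using sum_le_suminf[of "\<lambda>k. ennreal (t k x)" "{k}"] by simp
      then show ?thesis using C by (simp add: ennreal_le_iff)
    qed
    have "norm (u (Suc k) x - u k x) \<le> sqrt (C / \<rho> x) * (sqrt (1/2)) ^ k" for k
    proof -
      have "(norm (u (Suc k) x - u k x))\<^sup>2 \<le> (C / \<rho> x) * (1/2) ^ k"
        using tC[of k] elim(2) by (simp add: t_def field_simps)
      then have "norm (u (Suc k) x - u k x) \<le> sqrt ((C / \<rho> x) * (1/2) ^ k)" by (rule real_le_rsqrt)
      then show ?thesis by (simp only: real_sqrt_mult real_sqrt_power)
    qed
    moreover have "summable (\<lambda>k. sqrt (C / \<rho> x) * (sqrt (1/2)) ^ k)"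
      by (intro summable_mult summable_geometric) (simp add: real_sqrt_divide)
    ultimately have "summable (\<lambda>k. u (Suc k) x - u k x)" by (rule summable_comparison_test'[rotated])
    then have "convergent (\<lambda>n. \<Sum>k<n. u (Suc k) x - u k x)" by (simp add: summable_iff_convergent)
    then have "convergent (\<lambda>n. u n x - u 0 x)" by (simp add: sum_lessThan_telescope[of "\<lambda>k. u k x"])
    then show ?case using convergent_add[OF _ convergent_const[of "u 0 x"]] by fastforce
  qed
qed

theorem L2w_complete:
  fixes u :: "nat \<Rightarrow> real^3 \<Rightarrow> 'a::{banach, second_countable_topology}"
  assumes u: "\<And>n. u n \<in> L2w \<rho>"
    and cauchy: "\<And>e. e > 0 \<Longrightarrow> \<exists>N. \<forall>m\<ge>N. \<forall>n\<ge>N. (LINT x|lebesgue. \<rho> x * (norm (u m x - u n x))\<^sup>2) < e"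
  obtains v where "v \<in> L2w \<rho>" "(\<lambda>n. LINT x|lebesgue. \<rho> x * (norm (u n x - v x))\<^sup>2) \<longlonglongrightarrow> 0"
proof -
  note [measurable] = L2w_measurable[OF u]
  let ?D = "\<lambda>m n. LINT x|lebesgue. \<rho> x * (norm (u m x - u n x))\<^sup>2"
  have "\<forall>k. \<exists>N. \<forall>m\<ge>N. \<forall>n\<ge>N. ?D m n < (1/4) ^ k" by (intro allI cauchy) simp
  from choice[OF this] obtain N where N: "\<And>k m n. m \<ge> N k \<Longrightarrow> n \<ge> N k \<Longrightarrow> ?D m n < (1/4) ^ k" by blast
  \<comment> \<open>The partial sum dominates every earlier index \<open>N j\<close>, so that
    \<open>s j\<close> lies beyond \<open>N k\<close> whenever j >= k.\<close>
  define s where "s k = (\<Sum>j\<le>k. N j) + k" for k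
  have sN: "s j \<ge> N k" if "j \<ge> k" for j k
  proof -
    have "N k \<le> (\<Sum>i\<le>j. N i)" using that by (intro member_le_sum) auto
    then show ?thesis by (simp add: s_def)
  qed
  have "AE x in lebesgue. convergent (\<lambda>k. u (s k) x)"
  proof (rule L2w_fast_subseq_converges[OF u])
    show "?D (s (Suc k)) (s k) \<le> (1/4) ^ k" for k
      using N[OF sN[of k "Suc k"] sN[of k k]] by simp
  qed
  then have conv: "AE x in lebesgue. (\<lambda>k. u (s k) x) \<longlonglongrightarrow> lim (\<lambda>k. u (s k) x)"
    by (simp add: convergent_LIMSEQ_iff)
  define v where "v x = lim (\<lambda>k. u (s k) x)" for x
  have [measurable]: "v \<in> borel_measurable lebesgue" unfolding v_def by measurable
  \<comment> \<open>Fatou's lemma along the subsequence transfers the Cauchy estimate to the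
    distance from the limit, for every sufficiently late member of the full sequence.\<close>
  have nn: "(\<integral>\<^sup>+x. ennreal (\<rho> x * (norm (u n x - v x))\<^sup>2) \<partial>lebesgue) \<le> ennreal ((1/4) ^ k)" if n: "n \<ge> N k" for n k
  proof -
    have "AE x in lebesgue. ennreal (\<rho> x * (norm (u n x - v x))\<^sup>2) =
        liminf (\<lambda>j. ennreal (\<rho> x * (norm (u n x - u (s j) x))\<^sup>2))"
      using conv
    proof eventually_elim
      case (elim x)
      then have "(\<lambda>j. ennreal (\<rho> x * (norm (u n x - u (s j) x))\<^sup>2)) \<longlonglongrightarrow> ennreal (\<rho> x * (norm (u n x - v x))\<^sup>2)"
        unfolding v_def by (intro tendsto_intros)
      then show ?case by (simp add: lim_imp_Liminf)
    qed
    then have "(\<integral>\<^sup>+x. ennreal (\<rho> x * (norm (u n x - v x))\<^sup>2) \<partial>lebesgue)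
      = (\<integral>\<^sup>+x. liminf (\<lambda>j. ennreal (\<rho> x * (norm (u n x - u (s j) x))\<^sup>2)) \<partial>lebesgue)"
      by (rule nn_integral_cong_AE)
    also have "\<dots> \<le> liminf (\<lambda>j. \<integral>\<^sup>+x. ennreal (\<rho> x * (norm (u n x - u (s j) x))\<^sup>2) \<partial>lebesgue)"
      by (rule nn_integral_liminf) measurable
    also have "\<dots> \<le> limsup (\<lambda>j. \<integral>\<^sup>+x. ennreal (\<rho> x * (norm (u n x - u (s j) x))\<^sup>2) \<partial>lebesgue)"
      by (rule Liminf_le_Limsup) simp
    also have "\<dots> \<le> ennreal ((1/4) ^ k)"
    proof (rule Limsup_bounded, unfold eventually_sequentially, intro exI allI impI)
      fix j assume "k \<le> j"
      have "(\<integral>\<^sup>+x. ennreal (\<rho> x * (norm (u n x - u (s j) x))\<^sup>2) \<partial>lebesgue) = ennreal (?D n (s j))"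
        using weight_pos by (intro nn_integral_eq_integral L2w_integrable L2w_diff u) (auto elim!: eventually_mono)
      also have "\<dots> \<le> ennreal ((1/4) ^ k)" using N[OF n sN[OF \<open>k \<le> j\<close>]] by (intro ennreal_leI) simp
      finally show "(\<integral>\<^sup>+x. ennreal (\<rho> x * (norm (u n x - u (s j) x))\<^sup>2) \<partial>lebesgue) \<le> ennreal ((1/4) ^ k)" .
    qed
    finally show ?thesis .
  qed
  have pos: "AE x in lebesgue. 0 \<le> \<rho> x * (norm (u n x - v x))\<^sup>2" for n
    using weight_pos by eventually_elim simp
  have int: "integrable lebesgue (\<lambda>x. \<rho> x * (norm (u n x - v x))\<^sup>2)" if "n \<ge> N k" for n k
    using nn[OF that] by (intro integrableI_nonneg pos) (auto intro: le_less_trans)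
  have "(\<lambda>x. u (N 0) x - v x) \<in> L2w \<rho>" using int[of 0 "N 0"] by (simp add: L2w_def)
  from L2w_diff[OF u[of "N 0"] this] have v: "v \<in> L2w \<rho>" by simp
  have bnd: "(LINT x|lebesgue. \<rho> x * (norm (u n x - v x))\<^sup>2) \<le> (1/4) ^ k" if "n \<ge> N k" for n k
  proof -
    have "ennreal (LINT x|lebesgue. \<rho> x * (norm (u n x - v x))\<^sup>2) \<le> ennreal ((1/4) ^ k)"
      using nn[OF that] nn_integral_eq_integral[OF int[OF that] pos] by simp
    then show ?thesis by (simp add: ennreal_le_iff)
  qed
  have "(\<lambda>n. LINT x|lebesgue. \<rho> x * (norm (u n x - v x))\<^sup>2) \<longlonglongrightarrow> 0"
  proof (rule LIMSEQ_I)
    fix r :: real assume "r > 0"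
    obtain k where k: "(1/4 :: real) ^ k < r" using real_arch_pow_inv[OF \<open>r > 0\<close>, of "1/4"] by auto
    have "norm ((LINT x|lebesgue. \<rho> x * (norm (u n x - v x))\<^sup>2) - 0) < r" if "n \<ge> N k" for n
      using bnd[OF that] integral_nonneg_AE[OF pos[of n]] k by simp
    then show "\<exists>no. \<forall>n\<ge>no. norm ((LINT x|lebesgue. \<rho> x * (norm (u n x - v x))\<^sup>2) - 0) < r" by blast
  qed
  with v show thesis by (rule that)
qed

lemma weighted_product_integrable:
  fixes pr :: "'a::{real_normed_vector, second_countable_topology} \<Rightarrow> 'a \<Rightarrow> complex"
  assumes u: "u \<in> L2w \<rho>" and v: "v \<in> L2w \<rho>"
    and pr: "bounded_bilinear pr"
  shows "integrable lebesgue (\<lambda>x. complex_of_real (\<rho> x) * pr (u x) (v x))"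
proof -
  note [measurable] = L2w_measurable[OF u] L2w_measurable[OF v]
  obtain K where K: "K > 0" "\<And>a b. norm (pr a b) \<le> norm a * norm b * K"
    using bounded_bilinear.pos_bounded[OF pr] by blast
  have [measurable]: "(\<lambda>x. pr (u x) (v x)) \<in> borel_measurable lebesgue"
    by (rule borel_measurable_continuous_Pair[where H=pr])
       (auto intro!: bounded_bilinear.continuous_on[OF pr] continuous_intros)
  show ?thesis
  proof (rule Bochner_Integration.integrable_bound)
    show "integrable lebesgue (\<lambda>x. K * (\<rho> x * (norm (u x))\<^sup>2 + \<rho> x * (norm (v x))\<^sup>2))"
      using L2w_integrable[OF u] L2w_integrable[OF v] by auto
    show "AE x in lebesgue. norm (complex_of_real (\<rho> x) * pr (u x) (v x)) \<le>
        norm (K * (\<rho> x * (norm (u x))\<^sup>2 + \<rho> x * (norm (v x))\<^sup>2))"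
      using weight_pos
    proof eventually_elim
      case (elim x)
      have "norm (u x) * norm (v x) \<le> (norm (u x))\<^sup>2 + (norm (v x))\<^sup>2"
        using sum_squares_bound[of "norm (u x)" "norm (v x)"] mult_nonneg_nonneg[OF norm_ge_zero norm_ge_zero, of "u x" "v x"]
        by linarith
      then have "norm (pr (u x) (v x)) \<le> ((norm (u x))\<^sup>2 + (norm (v x))\<^sup>2) * K"
        using K(2)[of "u x" "v x"] K(1) by (meson mult_right_mono less_imp_le order_trans)
      then have "\<rho> x * norm (pr (u x) (v x)) \<le> \<rho> x * (((norm (u x))\<^sup>2 + (norm (v x))\<^sup>2) * K)"
        using elim by (intro mult_left_mono) auto
      then show ?case using elim K by (simp add: norm_mult algebra_simps)
    qed
  qed measurable
qed

lemma bounded_bilinear_mult_cnj: "bounded_bilinear (\<lambda>a b. a * cnj b)"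
  by (rule bounded_bilinear.comp[OF bounded_bilinear_mult bounded_linear_ident bounded_linear_cnj])

lemma ip_integrable: "u \<in> L2w \<rho> \<Longrightarrow> v \<in> L2w \<rho> \<Longrightarrow> integrable lebesgue (\<lambda>x. complex_of_real (\<rho> x) * (u x * cnj (v x)))"
  by (rule weighted_product_integrable[OF _ _ bounded_bilinear_mult_cnj])

lemma ipv_integrable: "u \<in> L2w \<rho> \<Longrightarrow> v \<in> L2w \<rho> \<Longrightarrow> integrable lebesgue (\<lambda>x. complex_of_real (\<rho> x) * cdot (u x) (vcnj (v x)))"
  by (rule weighted_product_integrable[OF _ _ bounded_bilinear_cdot_vcnj])

lemma ip_self_L2n: "ip \<rho> u u = complex_of_real ((L2n \<rho> u)\<^sup>2)"
proof -
  have "complex_of_real (\<rho> x) * (u x * cnj (u x)) = complex_of_real (\<rho> x * (norm (u x))\<^sup>2)" for x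
    by (simp add: complex_norm_square del: of_real_power)
  then show ?thesis by (simp add: ip_def L2n_sq del: of_real_mult of_real_power)
qed

lemma ipv_self_L2n: "ipv \<rho> u u = complex_of_real ((L2n \<rho> u)\<^sup>2)"
proof -
  have "complex_of_real (\<rho> x) * cdot (u x) (vcnj (u x)) = complex_of_real (\<rho> x * (norm (u x))\<^sup>2)" for x
    by (simp add: cdot_vcnj_self del: of_real_power)
  then show ?thesis by (simp add: ipv_def L2n_sq del: of_real_mult of_real_power)
qed

lemma L2w_cmult: "u \<in> L2w \<rho> \<Longrightarrow> (\<lambda>x. c * u x) \<in> L2w \<rho>" for u :: "real^3 \<Rightarrow> complex"
  by (rule L2w_bound(1)[of u _ "norm c"]) (auto simp: norm_mult)

lemma norm_smult_vec: "norm (c *s v) = norm c * norm v" for v :: "complex^3"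
  by (simp add: norm_vec_def L2_set_def norm_mult power_mult_distrib real_sqrt_mult flip: sum_distrib_left)

lemma measurable_smult_vec [measurable (raw)]:
  fixes f :: "'x \<Rightarrow> complex^3"
  assumes "c \<in> borel_measurable M" "f \<in> borel_measurable M"
  shows "(\<lambda>x. c x *s f x) \<in> borel_measurable M"
proof (rule borel_measurable_continuous_Pair[OF assms])
  show "continuous_on UNIV (\<lambda>p::complex \<times> (complex^3). fst p *s snd p)"
    unfolding vector_scalar_mult_def by (intro continuous_intros)
qed

lemma L2w_smult: "u \<in> L2w \<rho> \<Longrightarrow> (\<lambda>x. c *s u x) \<in> L2w \<rho>" for u :: "real^3 \<Rightarrow> complex^3"
  by (rule L2w_bound(1)[of u _ "norm c"]) (auto simp: norm_smult_vec)

text \<open>The elements are functions and not classes modulo null sets, hence the inner product is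
  only semidefinite. \<open>S\<close> serves scalar functions, \<open>V\<close> below serves vector
  fields.\<close>

sublocale S: semi_hilbert "L2w \<rho>" "\<lambda>u v x. u x + v x" "\<lambda>c u x. c * u x" "ip \<rho>"
proof
  fix u v w :: "real^3 \<Rightarrow> complex" and c assume u: "u \<in> L2w \<rho>" and w: "w \<in> L2w \<rho>"
  show "(\<lambda>x. c * u x) \<in> L2w \<rho>" by (rule L2w_cmult[OF u])
  show "ip \<rho> (\<lambda>x. c * u x) w = c * ip \<rho> u w"
  proof -
    have "complex_of_real (\<rho> x) * (c * u x * cnj (w x)) = c * (complex_of_real (\<rho> x) * (u x * cnj (w x)))" for x
      by (simp add: mult_ac)
    then show ?thesis by (simp only: ip_def integral_mult_right_zero)
  qed
  show "0 \<le> Re (ip \<rho> u u)" by (simp add: ip_self_L2n del: of_real_power)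
  show "ip \<rho> w u = cnj (ip \<rho> u w)"
  proof -
    have "complex_of_real (\<rho> x) * (w x * cnj (u x)) = cnj (complex_of_real (\<rho> x) * (u x * cnj (w x)))" for x
      by (simp add: mult_ac)
    then show ?thesis unfolding ip_def by (simp only: Bochner_Integration.integral_cnj)
  qed
next
  fix u v w :: "real^3 \<Rightarrow> complex" assume u: "u \<in> L2w \<rho>" "v \<in> L2w \<rho>"
  show "(\<lambda>x. u x + v x) \<in> L2w \<rho>" by (rule L2w_add[OF u])
  assume w: "w \<in> L2w \<rho>"
  show "ip \<rho> (\<lambda>x. u x + v x) w = ip \<rho> u w + ip \<rho> v w"
    using ip_integrable[OF u(1) w] ip_integrable[OF u(2) w] by (simp add: ip_def distrib_left distrib_right)
next
  fix X :: "nat \<Rightarrow> real^3 \<Rightarrow> complex" assume X: "\<And>n. X n \<in> L2w \<rho>"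
  have e: "Re (ip \<rho> (\<lambda>x. f x + - 1 * g x) (\<lambda>x. f x + - 1 * g x)) = (LINT x|lebesgue. \<rho> x * (norm (f x - g x))\<^sup>2)" for f g
    by (simp only: ip_self_L2n Re_complex_of_real L2n_sq) simp
  assume "\<And>e. 0 < e \<Longrightarrow> \<exists>N. \<forall>m\<ge>N. \<forall>n\<ge>N. Re (ip \<rho> (\<lambda>x. X m x + - 1 * X n x) (\<lambda>x. X m x + - 1 * X n x)) < e"
  then have "\<And>e. 0 < e \<Longrightarrow> \<exists>N. \<forall>m\<ge>N. \<forall>n\<ge>N. (LINT x|lebesgue. \<rho> x * (norm (X m x - X n x))\<^sup>2) < e"
    unfolding e .
  from L2w_complete[OF X this] show "\<exists>u\<in>L2w \<rho>. (\<lambda>n. Re (ip \<rho> (\<lambda>x. X n x + - 1 * u x) (\<lambda>x. X n x + - 1 * u x))) \<longlonglongrightarrow> 0"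
    unfolding e by blast
qed

sublocale V: semi_hilbert "L2w \<rho>" "\<lambda>u v x. u x + v x" "\<lambda>c u x. c *s u x" "ipv \<rho>"
proof
  fix u v w :: "real^3 \<Rightarrow> complex^3" and c assume u: "u \<in> L2w \<rho>" and w: "w \<in> L2w \<rho>"
  show "(\<lambda>x. c *s u x) \<in> L2w \<rho>" by (rule L2w_smult[OF u])
  have "complex_of_real (\<rho> x) * cdot (c *s u x) (vcnj (w x)) = c * (complex_of_real (\<rho> x) * cdot (u x) (vcnj (w x)))" for x
    by (simp add: cdot_def sum_distrib_left mult_ac)
  then show "ipv \<rho> (\<lambda>x. c *s u x) w = c * ipv \<rho> u w"
    by (simp only: ipv_def integral_mult_right_zero)
  show "0 \<le> Re (ipv \<rho> u u)" by (simp add: ipv_self_L2n del: of_real_power)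
  have "complex_of_real (\<rho> x) * cdot (w x) (vcnj (u x)) = cnj (complex_of_real (\<rho> x) * cdot (u x) (vcnj (w x)))" for x
    by (simp add: cdot_def vcnj_def mult_ac)
  then show "ipv \<rho> w u = cnj (ipv \<rho> u w)" unfolding ipv_def by (simp only: Bochner_Integration.integral_cnj)
next
  fix u v w :: "real^3 \<Rightarrow> complex^3" assume u: "u \<in> L2w \<rho>" "v \<in> L2w \<rho>"
  show "(\<lambda>x. u x + v x) \<in> L2w \<rho>" by (rule L2w_add[OF u])
  assume w: "w \<in> L2w \<rho>"
  show "ipv \<rho> (\<lambda>x. u x + v x) w = ipv \<rho> u w + ipv \<rho> v w"
    using ipv_integrable[OF u(1) w] ipv_integrable[OF u(2) w]
    by (simp add: ipv_def bounded_bilinear.add_left[OF bounded_bilinear_cdot_vcnj] distrib_left)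
next
  fix X :: "nat \<Rightarrow> real^3 \<Rightarrow> complex^3" assume X: "\<And>n. X n \<in> L2w \<rho>"
  have e: "Re (ipv \<rho> (\<lambda>x. f x + - 1 *s g x) (\<lambda>x. f x + - 1 *s g x)) = (LINT x|lebesgue. \<rho> x * (norm (f x - g x))\<^sup>2)" for f g
    by (simp only: ipv_self_L2n Re_complex_of_real L2n_sq) simp
  assume "\<And>e. 0 < e \<Longrightarrow> \<exists>N. \<forall>m\<ge>N. \<forall>n\<ge>N. Re (ipv \<rho> (\<lambda>x. X m x + - 1 *s X n x) (\<lambda>x. X m x + - 1 *s X n x)) < e"
  then have "\<And>e. 0 < e \<Longrightarrow> \<exists>N. \<forall>m\<ge>N. \<forall>n\<ge>N. (LINT x|lebesgue. \<rho> x * (norm (X m x - X n x))\<^sup>2) < e"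
    unfolding e .
  from L2w_complete[OF X this] show "\<exists>u\<in>L2w \<rho>. (\<lambda>n. Re (ipv \<rho> (\<lambda>x. X n x + - 1 *s u x) (\<lambda>x. X n x + - 1 *s u x))) \<longlonglongrightarrow> 0"
    unfolding e by blast
qed

lemma S_nrm: "S.nrm u = L2n \<rho> u"
  by (simp add: S.nrm_def ip_self_L2n del: of_real_power)

lemma V_nrm: "V.nrm u = L2n \<rho> u"
  by (simp add: V.nrm_def ipv_self_L2n del: of_real_power)

lemma ip_Cauchy_Schwarz: "u \<in> L2w \<rho> \<Longrightarrow> v \<in> L2w \<rho> \<Longrightarrow> cmod (ip \<rho> u v) \<le> L2n \<rho> u * L2n \<rho> v"
  using S.Cauchy_Schwarz by (simp add: S_nrm)

lemma ipv_Cauchy_Schwarz: "u \<in> L2w \<rho> \<Longrightarrow> v \<in> L2w \<rho> \<Longrightarrow> cmod (ipv \<rho> u v) \<le> L2n \<rho> u * L2n \<rho> v"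
  using V.Cauchy_Schwarz by (simp add: V_nrm)

text \<open>Passing to the pointwise norm lets the triangle and Cauchy-Schwarz inequalities of the
  scalar instance \<open>S\<close> carry over to other value spaces.\<close>

lemma L2w_complex_of_norm:
  fixes u :: "real^3 \<Rightarrow> 'a::{real_normed_vector, second_countable_topology}"
  assumes "u \<in> L2w \<rho>"
  shows "(\<lambda>x. complex_of_real (norm (u x))) \<in> L2w \<rho>" "L2n \<rho> (\<lambda>x. complex_of_real (norm (u x))) = L2n \<rho> u"
proof -
  note [measurable] = L2w_measurable[OF assms]
  show "(\<lambda>x. complex_of_real (norm (u x))) \<in> L2w \<rho>" by (rule L2w_bound(1)[OF assms, of _ 1]) auto
  show "L2n \<rho> (\<lambda>x. complex_of_real (norm (u x))) = L2n \<rho> u" by (simp add: L2n_def)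
qed

lemma L2n_add_le:
  fixes u v :: "real^3 \<Rightarrow> 'a::{real_normed_vector, second_countable_topology}"
  assumes u: "u \<in> L2w \<rho>" and v: "v \<in> L2w \<rho>"
  shows "L2n \<rho> (\<lambda>x. u x + v x) \<le> L2n \<rho> u + L2n \<rho> v"
proof -
  note [measurable] = L2w_measurable[OF u] L2w_measurable[OF v]
  note cu = L2w_complex_of_norm[OF u] and cv = L2w_complex_of_norm[OF v]
  have "L2n \<rho> (\<lambda>x. u x + v x) \<le> 1 * L2n \<rho> (\<lambda>x. complex_of_real (norm (u x)) + complex_of_real (norm (v x)))"
  proof (rule L2w_bound(2)[OF L2w_add[OF cu(1) cv(1)]])
    show "AE x in lebesgue. norm (u x + v x) \<le> 1 * norm (complex_of_real (norm (u x)) + complex_of_real (norm (v x)))"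
      by (intro AE_I2) (simp add: norm_triangle_ineq flip: of_real_add)
  qed auto
  also have "\<dots> \<le> L2n \<rho> u + L2n \<rho> v" using S.nrm_add_le[OF cu(1) cv(1)] cu(2) cv(2) by (simp add: S_nrm)
  finally show ?thesis .
qed

lemma L2n_minus: "L2n \<rho> (\<lambda>x. - u x) = L2n \<rho> u"
  by (simp add: L2n_def)

lemma L2n_diff_le:
  fixes u v :: "real^3 \<Rightarrow> 'a::{real_normed_vector, second_countable_topology}"
  assumes u: "u \<in> L2w \<rho>" and v: "v \<in> L2w \<rho>"
  shows "L2n \<rho> (\<lambda>x. u x - v x) \<le> L2n \<rho> u + L2n \<rho> v"
  using L2n_add_le[OF u L2w_scaleR[OF v, of "-1"]] by (simp add: L2n_minus)

lemma L2n_cong_AE: "AE x in lebesgue. u x = v x \<Longrightarrow> u \<in> borel_measurable lebesgue \<Longrightarrow> v \<in> borel_measurable lebesgue \<Longrightarrow> L2n \<rho> u = L2n \<rho> v"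
  unfolding L2n_def by (intro arg_cong[where f=sqrt] integral_cong_AE) (auto elim: eventually_mono)

lemma L2n_eq_0_imp_AE:
  assumes "u \<in> L2w \<rho>" "L2n \<rho> u = 0"
  shows "AE x in lebesgue. u x = 0"
proof -
  have pos: "AE x in lebesgue. 0 \<le> \<rho> x * (norm (u x))\<^sup>2" using weight_pos by eventually_elim simp
  have "(LINT x|lebesgue. \<rho> x * (norm (u x))\<^sup>2) = 0" using assms(2) L2n_sq[of u] by simp
  then have "AE x in lebesgue. \<rho> x * (norm (u x))\<^sup>2 = 0"
    using integral_nonneg_eq_0_iff_AE[OF L2w_integrable[OF assms(1)] pos] by simp
  then show ?thesis using weight_pos by eventually_elim simp
qed

lemma Cauchy_Schwarz_norms:
  fixes u :: "real^3 \<Rightarrow> 'a::{real_normed_vector, second_countable_topology}"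
    and v :: "real^3 \<Rightarrow> 'b::{real_normed_vector, second_countable_topology}"
  assumes u: "u \<in> L2w \<rho>" and v: "v \<in> L2w \<rho>"
  shows "integrable lebesgue (\<lambda>x. \<rho> x * (norm (u x) * norm (v x)))"
    "(LINT x|lebesgue. \<rho> x * (norm (u x) * norm (v x))) \<le> L2n \<rho> u * L2n \<rho> v"
proof -
  note cu = L2w_complex_of_norm[OF u] and cv = L2w_complex_of_norm[OF v]
  have eq: "complex_of_real (\<rho> x) * (complex_of_real (norm (u x)) * cnj (complex_of_real (norm (v x)))) =
    complex_of_real (\<rho> x * (norm (u x) * norm (v x)))" for x by simp
  have "integrable lebesgue (\<lambda>x. complex_of_real (\<rho> x * (norm (u x) * norm (v x))))"
    using ip_integrable[OF cu(1) cv(1)] unfolding eq .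
  then show "integrable lebesgue (\<lambda>x. \<rho> x * (norm (u x) * norm (v x)))"
    by (simp only: complex_of_real_integrable_eq)
  have "ip \<rho> (\<lambda>x. complex_of_real (norm (u x))) (\<lambda>x. complex_of_real (norm (v x))) =
    complex_of_real (LINT x|lebesgue. \<rho> x * (norm (u x) * norm (v x)))"
    unfolding ip_def eq by (simp only: integral_complex_of_real)
  then show "(LINT x|lebesgue. \<rho> x * (norm (u x) * norm (v x))) \<le> L2n \<rho> u * L2n \<rho> v"
    using ip_Cauchy_Schwarz[OF cu(1) cv(1)] by (simp add: cu(2) cv(2))
qed

end

section \<open>Weighted against unweighted square integrability\<close>

interpretation unweighted: weight "\<lambda>_. 1"
  by unfold_locales (auto intro: exI[of _ "1::real"])

context weight
begin

lemma weight_bounds_L2: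
  "\<exists>K>0. \<forall>u :: real^3 \<Rightarrow> 'a::{real_normed_vector, second_countable_topology}. u \<in> L2w \<rho> \<longrightarrow>
      (\<lambda>x. indicator (ball 0 R) x *\<^sub>R u x) \<in> L2w (\<lambda>_. 1) \<and>
      L2n (\<lambda>_. 1) (\<lambda>x. indicator (ball 0 R) x *\<^sub>R u x) \<le> K * L2n \<rho> u"
proof -
  obtain c where c: "c > 0" "AE x in lebesgue. norm x < R \<longrightarrow> c \<le> \<rho> x" using weight_lower by blast
  have "(\<lambda>x. indicator (ball 0 R) x *\<^sub>R u x) \<in> L2w (\<lambda>_. 1) \<and>
      L2n (\<lambda>_. 1) (\<lambda>x. indicator (ball 0 R) x *\<^sub>R u x) \<le> sqrt (1 / c) * L2n \<rho> u" if u: "u \<in> L2w \<rho>" for u :: "real^3 \<Rightarrow> 'a"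
  proof -
    note [measurable] = L2w_measurable[OF u]
    have vm: "(\<lambda>x. indicator (ball 0 R) x *\<^sub>R u x) \<in> borel_measurable lebesgue"
      by (intro borel_measurable_scaleR borel_measurable_indicator L2w_measurable[OF u]) auto
    have le: "AE x in lebesgue. 1 * (norm (indicator (ball 0 R) x *\<^sub>R u x))\<^sup>2 \<le> 1 / c * (\<rho> x * (norm (u x))\<^sup>2)"
      using c(2) weight_pos
    proof eventually_elim
      case (elim x)
      show ?case
      proof (cases "norm x < R")
        case True
        then have "c * (norm (u x))\<^sup>2 \<le> \<rho> x * (norm (u x))\<^sup>2" using elim by (intro mult_right_mono) auto
        then show ?thesis using True c(1) by (simp add: field_simps)
      qed (use elim c in simp)
    qed
    have i1: "integrable lebesgue (\<lambda>x. 1 / c * (\<rho> x * (norm (u x))\<^sup>2))" using L2w_integrable[OF u] by auto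
    have i2: "integrable lebesgue (\<lambda>x. 1 * (norm (indicator (ball 0 R) x *\<^sub>R u x))\<^sup>2)"
    proof (rule Bochner_Integration.integrable_bound[OF i1])
      show "AE x in lebesgue. norm (1 * (norm (indicator (ball 0 R) x *\<^sub>R u x))\<^sup>2) \<le> norm (1 / c * (\<rho> x * (norm (u x))\<^sup>2))"
        using le
      proof eventually_elim
        case (elim x)
        moreover have "0 \<le> 1 * (norm (indicator (ball 0 R) x *\<^sub>R u x))\<^sup>2" by simp
        ultimately show ?case unfolding real_norm_def by linarith
      qed
      show "(\<lambda>x. 1 * (norm (indicator (ball 0 R) x *\<^sub>R u x))\<^sup>2) \<in> borel_measurable lebesgue"
        using vm by measurable
    qed
    have "(L2n (\<lambda>_. 1) (\<lambda>x. indicator (ball 0 R) x *\<^sub>R u x))\<^sup>2 \<le> 1 / c * (L2n \<rho> u)\<^sup>2"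
      unfolding L2n_sq unweighted.L2n_sq using integral_mono_AE[OF i2 i1 le] by simp
    then have "(L2n (\<lambda>_. 1) (\<lambda>x. indicator (ball 0 R) x *\<^sub>R u x))\<^sup>2 \<le> (sqrt (1 / c) * L2n \<rho> u)\<^sup>2"
      using c by (simp add: power_mult_distrib)
    then have "L2n (\<lambda>_. 1) (\<lambda>x. indicator (ball 0 R) x *\<^sub>R u x) \<le> sqrt (1 / c) * L2n \<rho> u"
      by (rule power2_le_imp_le) (use c in auto)
    moreover have "(\<lambda>x. indicator (ball 0 R) x *\<^sub>R u x) \<in> L2w (\<lambda>_. 1)" using i2 vm by (simp add: L2w_def)
    ultimately show ?thesis by blast
  qed
  then show ?thesis using c by (intro exI[of _ "sqrt (1 / c)"]) auto
qed

lemma L2w_unweighted: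
  "\<exists>K>0. \<forall>u :: real^3 \<Rightarrow> 'a::{real_normed_vector, second_countable_topology}.
    u \<in> L2w (\<lambda>_. 1) \<longrightarrow> u \<in> L2w \<rho> \<and> L2n \<rho> u \<le> K * L2n (\<lambda>_. 1) u"
proof -
  obtain P where P: "P > 0" "AE x in lebesgue. \<rho> x \<le> P" using weight_upper by blast
  have "u \<in> L2w \<rho> \<and> L2n \<rho> u \<le> sqrt P * L2n (\<lambda>_. 1) u" if u: "u \<in> L2w (\<lambda>_. 1)" for u :: "real^3 \<Rightarrow> 'a"
  proof -
    note [measurable] = unweighted.L2w_measurable[OF u]
    have le: "AE x in lebesgue. \<rho> x * (norm (u x))\<^sup>2 \<le> P * (1 * (norm (u x))\<^sup>2)"
      using P(2) by eventually_elim (simp add: mult_right_mono)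
    have i1: "integrable lebesgue (\<lambda>x. P * (1 * (norm (u x))\<^sup>2))"
      using unweighted.L2w_integrable[OF u] by auto
    have i2: "integrable lebesgue (\<lambda>x. \<rho> x * (norm (u x))\<^sup>2)"
    proof (rule Bochner_Integration.integrable_bound[OF i1])
      show "AE x in lebesgue. norm (\<rho> x * (norm (u x))\<^sup>2) \<le> norm (P * (1 * (norm (u x))\<^sup>2))"
        using le weight_pos by eventually_elim (use P in \<open>simp add: abs_mult\<close>)
    qed measurable
    have "(L2n \<rho> u)\<^sup>2 \<le> P * (L2n (\<lambda>_. 1) u)\<^sup>2"
      unfolding L2n_sq unweighted.L2n_sq using integral_mono_AE[OF i2 i1 le] by simp
    then have "(L2n \<rho> u)\<^sup>2 \<le> (sqrt P * L2n (\<lambda>_. 1) u)\<^sup>2" using P by (simp add: power_mult_distrib)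
    then have "L2n \<rho> u \<le> sqrt P * L2n (\<lambda>_. 1) u" by (rule power2_le_imp_le) (use P in auto)
    moreover have "u \<in> L2w \<rho>" using i2 by (simp add: L2w_def)
    ultimately show ?thesis by blast
  qed
  then show ?thesis using P by (intro exI[of _ "sqrt P"]) auto
qed

lemma L2w_loc_integrable:
  fixes u :: "real^3 \<Rightarrow> 'a::{banach, second_countable_topology}"
  assumes u: "u \<in> L2w \<rho>"
  shows "loc_integrable UNIV u"
  unfolding loc_integrable_def
proof (intro allI impI)
  fix K :: "(real^3) set" assume "compact K \<and> K \<subseteq> UNIV"
  then have K: "compact K" by simp
  then obtain R where R: "\<And>x. x \<in> K \<Longrightarrow> norm x \<le> R" using compact_imp_bounded[OF K] by (auto simp: bounded_iff)
  let ?v = "\<lambda>x. indicator (ball 0 (R + 1)) x *\<^sub>R u x"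
  have v: "?v \<in> L2w (\<lambda>_. 1)" using weight_bounds_L2[where R="R+1"] u by blast
  have "loc_integrable UNIV ?v"
    by (rule square_integrable_loc_integrable) (use v in \<open>auto simp: L2w_def\<close>)
  then have "integrable lebesgue (\<lambda>x. indicator K x *\<^sub>R ?v x)" using K by (simp add: loc_integrable_def set_integrable_def)
  moreover have "indicator K x *\<^sub>R ?v x = indicator K x *\<^sub>R u x" for x
    using R[of x] by (auto simp: indicator_def)
  ultimately show "set_integrable lebesgue K u" by (simp only: set_integrable_def)
qed

text \<open>The bounded support of \<phi> is what makes the lower bound of the weight applicable: on
  that ball the weighted norm of u dominates the unweighted one. Pairing with test data is thus
  continuous on the weighted space.\<close>

lemma L2w_local_pairing:
  fixes u :: "real^3 \<Rightarrow> 'a::{banach, second_countable_topology}"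
    and \<phi> :: "real^3 \<Rightarrow> 'b::{banach, second_countable_topology}"
    and pr :: "'a \<Rightarrow> 'b \<Rightarrow> 'c::{banach, second_countable_topology}"
  assumes pr: "bounded_bilinear pr" and \<phi>: "\<phi> \<in> L2w (\<lambda>_. 1)"
    and supp: "AE x in lebesgue. norm x \<ge> R \<longrightarrow> \<phi> x = 0"
  shows "u \<in> L2w \<rho> \<Longrightarrow> integrable lebesgue (\<lambda>x. pr (u x) (\<phi> x))"
    "\<exists>K>0. \<forall>u\<in>L2w \<rho>. norm (LINT x|lebesgue. pr (u x) (\<phi> x)) \<le> K * L2n \<rho> u"
proof -
  obtain C where C: "C > 0" "\<And>a b. norm (pr a b) \<le> norm a * norm b * C"
    using bounded_bilinear.pos_bounded[OF pr] by blast
  obtain K where K: "K > 0"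
    "\<And>u :: real^3 \<Rightarrow> 'a. u \<in> L2w \<rho> \<Longrightarrow> (\<lambda>x. indicator (ball 0 R) x *\<^sub>R u x) \<in> L2w (\<lambda>_. 1) \<and>
      L2n (\<lambda>_. 1) (\<lambda>x. indicator (ball 0 R) x *\<^sub>R u x) \<le> K * L2n \<rho> u"
    using weight_bounds_L2[where R=R] by blast
  have main: "integrable lebesgue (\<lambda>x. pr (u x) (\<phi> x)) \<and>
    norm (LINT x|lebesgue. pr (u x) (\<phi> x)) \<le> K * L2n (\<lambda>_. 1) \<phi> * C * L2n \<rho> u" if u: "u \<in> L2w \<rho>" for u :: "real^3 \<Rightarrow> 'a"
  proof -
    note [measurable] = L2w_measurable[OF u] unweighted.L2w_measurable[OF \<phi>]
    let ?v = "\<lambda>x. indicator (ball 0 R) x *\<^sub>R u x"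
    have v: "?v \<in> L2w (\<lambda>_. 1)" and vn: "L2n (\<lambda>_. 1) ?v \<le> K * L2n \<rho> u" using K(2)[OF u] by auto
    have [measurable]: "(\<lambda>x. pr (u x) (\<phi> x)) \<in> borel_measurable lebesgue"
      by (rule borel_measurable_continuous_Pair[where H=pr])
         (auto intro!: bounded_bilinear.continuous_on[OF pr] continuous_intros)
    have le: "AE x in lebesgue. norm (pr (u x) (\<phi> x)) \<le> C * (1 * (norm (?v x) * norm (\<phi> x)))"
      using supp
    proof eventually_elim
      case (elim x)
      show ?case
      proof (cases "norm x < R")
        case True
        then show ?thesis using C(2)[of "u x" "\<phi> x"] by (simp add: mult_ac)
      next
        case False
        then show ?thesis using elim bounded_bilinear.zero_right[OF pr] by simp
      qed
    qed
    note i = unweighted.Cauchy_Schwarz_norms[OF v \<phi>]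
    have i1: "integrable lebesgue (\<lambda>x. C * (1 * (norm (?v x) * norm (\<phi> x))))" using i(1) by auto
    have i2: "integrable lebesgue (\<lambda>x. pr (u x) (\<phi> x))"
    proof (rule Bochner_Integration.integrable_bound[OF i1])
      show "AE x in lebesgue. norm (pr (u x) (\<phi> x)) \<le> norm (C * (1 * (norm (?v x) * norm (\<phi> x))))"
        using le by eventually_elim (use C in simp)
    qed measurable
    have "norm (LINT x|lebesgue. pr (u x) (\<phi> x)) \<le> (LINT x|lebesgue. norm (pr (u x) (\<phi> x)))"
      by (rule integral_norm_bound)
    also have "\<dots> \<le> (LINT x|lebesgue. C * (1 * (norm (?v x) * norm (\<phi> x))))"
      by (rule integral_mono_AE[OF integrable_norm[OF i2] i1 le])
    also have "\<dots> = C * (LINT x|lebesgue. 1 * (norm (?v x) * norm (\<phi> x)))" by (rule integral_mult_right_zero)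
    also have "\<dots> \<le> C * (L2n (\<lambda>_. 1) ?v * L2n (\<lambda>_. 1) \<phi>)" using i(2) C(1) by (intro mult_left_mono) auto
    also have "\<dots> \<le> C * ((K * L2n \<rho> u) * L2n (\<lambda>_. 1) \<phi>)" using vn C(1) by (intro mult_left_mono mult_right_mono) auto
    finally show ?thesis using i2 by (simp add: mult_ac)
  qed
  then show "u \<in> L2w \<rho> \<Longrightarrow> integrable lebesgue (\<lambda>x. pr (u x) (\<phi> x))" by blast
  let ?K = "K * L2n (\<lambda>_. 1) \<phi> * C"
  \<comment> \<open>The added 1 keeps the constant positive when \<phi> has norm zero.\<close>
  have "\<forall>u\<in>L2w \<rho>. norm (LINT x|lebesgue. pr (u x) (\<phi> x)) \<le> (?K + 1) * L2n \<rho> u"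
  proof
    fix u :: "real^3 \<Rightarrow> 'a" assume "u \<in> L2w \<rho>"
    with main have "norm (LINT x|lebesgue. pr (u x) (\<phi> x)) \<le> ?K * L2n \<rho> u" by blast
    also have "\<dots> \<le> (?K + 1) * L2n \<rho> u" by (intro mult_right_mono) auto
    finally show "norm (LINT x|lebesgue. pr (u x) (\<phi> x)) \<le> (?K + 1) * L2n \<rho> u" .
  qed
  moreover have "?K + 1 > 0" using K C by (smt (verit) mult_nonneg_nonneg unweighted.L2n_nonneg)
  ultimately show "\<exists>K>0. \<forall>u\<in>L2w \<rho>. norm (LINT x|lebesgue. pr (u x) (\<phi> x)) \<le> K * L2n \<rho> u" by blast
qed

lemma L2w_limit_pairing:
  fixes u :: "nat \<Rightarrow> real^3 \<Rightarrow> 'a::{banach, second_countable_topology}"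
    and \<phi> :: "real^3 \<Rightarrow> 'b::{banach, second_countable_topology}"
    and pr :: "'a \<Rightarrow> 'b \<Rightarrow> 'c::{banach, second_countable_topology}"
  assumes pr: "bounded_bilinear pr" and \<phi>: "\<phi> \<in> L2w (\<lambda>_. 1)"
    and supp: "AE x in lebesgue. norm x \<ge> R \<longrightarrow> \<phi> x = 0"
    and u: "\<And>n. u n \<in> L2w \<rho>" "v \<in> L2w \<rho>" and lim: "(\<lambda>n. L2n \<rho> (\<lambda>x. u n x - v x)) \<longlonglongrightarrow> 0"
  shows "(\<lambda>n. LINT x|lebesgue. pr (u n x) (\<phi> x)) \<longlonglongrightarrow> (LINT x|lebesgue. pr (v x) (\<phi> x))"
proof -
  note i = L2w_local_pairing(1)[OF pr \<phi> supp]
  obtain K where K: "K > 0" "\<And>u. u \<in> L2w \<rho> \<Longrightarrow> norm (LINT x|lebesgue. pr (u x) (\<phi> x)) \<le> K * L2n \<rho> u"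
    using L2w_local_pairing(2)[OF pr \<phi> supp] by blast
  have "(\<lambda>n. (LINT x|lebesgue. pr (u n x) (\<phi> x)) - (LINT x|lebesgue. pr (v x) (\<phi> x))) \<longlonglongrightarrow> 0"
  proof (rule Lim_null_comparison)
    show "(\<lambda>n. K * L2n \<rho> (\<lambda>x. u n x - v x)) \<longlonglongrightarrow> 0" using tendsto_mult_left[OF lim, of K] by simp
    have "(LINT x|lebesgue. pr (u n x) (\<phi> x)) - (LINT x|lebesgue. pr (v x) (\<phi> x)) = (LINT x|lebesgue. pr (u n x - v x) (\<phi> x))" for n
      using i[OF u(1)] i[OF u(2)] by (simp add: bounded_bilinear.diff_left[OF pr])
    then show "eventually (\<lambda>n. norm ((LINT x|lebesgue. pr (u n x) (\<phi> x)) - (LINT x|lebesgue. pr (v x) (\<phi> x))) \<le> K * L2n \<rho> (\<lambda>x. u n x - v x)) sequentially"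
      using K(2)[OF L2w_diff[OF u]] by simp
  qed
  then show ?thesis by (simp add: LIM_zero_iff)
qed

end

lemma test_L2w:
  fixes \<psi> :: "real^3 \<Rightarrow> 'a::{banach, second_countable_topology}"
  assumes \<psi>: "\<psi> \<in> test_functions U"
  shows "\<psi> \<in> L2w (\<lambda>_. 1)"
proof -
  obtain B where B: "B > 0" "\<And>x. norm (\<psi> x) \<le> B" using test_bounded[OF \<psi>] by blast
  have [measurable]: "\<psi> \<in> borel_measurable lebesgue" using smooth_measurable[OF test_smooth[OF \<psi>]] .
  have "integrable lebesgue (\<lambda>x. 1 * (norm (\<psi> x))\<^sup>2)"
  proof (rule Bochner_Integration.integrable_bound)
    show "integrable lebesgue (\<lambda>x. B *\<^sub>R \<psi> x)" using test_integrable[OF \<psi>] by auto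
    show "AE x in lebesgue. norm (1 * (norm (\<psi> x))\<^sup>2) \<le> norm (B *\<^sub>R \<psi> x)"
      using B by (intro AE_I2) (simp add: power2_eq_square mult_right_mono)
  qed measurable
  then show ?thesis by (simp add: L2w_def)
qed

text \<open>Density is checked by orthogonality. An approximant is a pair of real potentials, its
  real and imaginary part; a complex factor mixes the two, so the pairs form a complex subspace.
  Pairs with second potential 0 already annihilate both the real and the imaginary part of an
  orthogonal h.\<close>

theorem helmholtz_range_dense:
  fixes G :: "real^3 \<Rightarrow> complex"
  assumes G: "G \<in> L2w (\<lambda>_. 1)" and e: "e > 0"
  obtains \<psi> \<phi> :: "real^3 \<Rightarrow> real" where "\<psi> \<in> test_functions UNIV" "\<phi> \<in> test_functions UNIV"
    "L2n (\<lambda>_. 1) (\<lambda>x. Complex (laplacian \<psi> x - \<psi> x) (laplacian \<phi> x - \<phi> x) - G x) < e"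
proof -
  let ?T = "test_functions UNIV :: (real^3 \<Rightarrow> real) set"
  define H where "H \<psi> \<phi> x = Complex (laplacian \<psi> x - \<psi> x) (laplacian \<phi> x - \<phi> x)" for \<psi> \<phi> :: "real^3 \<Rightarrow> real" and x
  define M where "M = {H \<psi> \<phi> | \<psi> \<phi>. \<psi> \<in> ?T \<and> \<phi> \<in> ?T}"
  have t: "(\<lambda>x. laplacian \<psi> x - \<psi> x) \<in> ?T" if "\<psi> \<in> ?T" for \<psi>
    by (intro test_diff test_laplacian that)
  have Hsplit: "H \<psi> \<phi> x = complex_of_real (laplacian \<psi> x - \<psi> x) + \<i> * complex_of_real (laplacian \<phi> x - \<phi> x)" for \<psi> \<phi> x
    by (simp add: H_def Complex_eq)
  have of_real_L2w: "(\<lambda>x. complex_of_real (f x)) \<in> L2w (\<lambda>_. 1)" if "f \<in> ?T" for f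
    by (rule test_L2w[OF test_bounded_linear[OF bounded_linear_of_real that]])
  have "H \<psi> \<phi> \<in> L2w (\<lambda>_. 1)" if "\<psi> \<in> ?T" "\<phi> \<in> ?T" for \<psi> \<phi>
    unfolding Hsplit[abs_def]
    by (intro unweighted.L2w_add unweighted.L2w_cmult of_real_L2w t that)
  then have MF: "M \<subseteq> L2w (\<lambda>_. 1)" by (auto simp: M_def)
  have lap: "laplacian (\<lambda>x. a * \<psi> x + b * \<phi> x) x = a * laplacian \<psi> x + b * laplacian \<phi> x"
    if "\<psi> \<in> ?T" "\<phi> \<in> ?T" for \<psi> \<phi> a b x
  proof -
    have p: "partial l (\<lambda>x. a * f x + b * g x) = (\<lambda>x. a * partial l f x + b * partial l g x)"
      if "smooth f" "smooth g" for f g :: "real^3 \<Rightarrow> real" and l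
    proof
      fix x
      have "partial l (\<lambda>x. c * h x) x = c * partial l h x" if "smooth h" for c and h :: "real^3 \<Rightarrow> real"
        by (rule partial_bounded_linear[OF bounded_linear_mult_right smooth_differentiable[OF that]])
      then show "partial l (\<lambda>x. a * f x + b * g x) x = a * partial l f x + b * partial l g x"
        using that by (subst partial_add) (auto intro!: smooth_differentiable smooth_mult)
    qed
    show ?thesis
      unfolding laplacian_def using that
      by (simp add: p test_smooth smooth_partial sum.distrib sum_distrib_left)
  qed
  have comb: "(\<lambda>x. a * \<psi> x + b * \<phi> x) \<in> ?T" if "\<psi> \<in> ?T" "\<phi> \<in> ?T" for \<psi> \<phi> a b
    by (intro test_add test_mult_right smooth_const that)
  have "\<exists>m\<in>M. unweighted.S.nrm (unweighted.S.sub m G) < e"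
  proof (rule unweighted.S.dense_if_orthogonal_zero[OF MF _ _ _ _ G e])
    show "M \<noteq> {}" unfolding M_def by (auto intro: test_zero)
  next
    fix u v assume "u \<in> M" "v \<in> M"
    then obtain a b c d where "u = H a b" "v = H c d" and T: "a \<in> ?T" "b \<in> ?T" "c \<in> ?T" "d \<in> ?T"
      by (auto simp: M_def)
    then have "(\<lambda>x. u x + v x) = H (\<lambda>x. 1 * a x + 1 * c x) (\<lambda>x. 1 * b x + 1 * d x)"
      by (simp only: H_def[abs_def] lap fun_eq_iff) (simp add: complex_eq_iff)
    then show "(\<lambda>x. u x + v x) \<in> M" unfolding M_def using comb[OF T(1,3), of 1 1] comb[OF T(2,4), of 1 1] by blast
  next
    fix k u assume "u \<in> M"
    then obtain a b where "u = H a b" and T: "a \<in> ?T" "b \<in> ?T" by (auto simp: M_def)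
    then have "(\<lambda>x. k * u x) = H (\<lambda>x. Re k * a x + (- Im k) * b x) (\<lambda>x. Im k * a x + Re k * b x)"
      by (simp only: H_def[abs_def] lap fun_eq_iff) (simp add: complex_eq_iff algebra_simps)
    then show "(\<lambda>x. k * u x) \<in> M"
      unfolding M_def using comb[OF T, of "Re k" "- Im k"] comb[OF T, of "Im k" "Re k"] by blast
  next
    fix h assume h: "h \<in> L2w (\<lambda>_. 1)" and orth: "\<And>m. m \<in> M \<Longrightarrow> ip (\<lambda>_. 1) h m = 0"
    note [measurable] = unweighted.L2w_measurable[OF h]
    have loc: "loc_integrable UNIV h" by (rule unweighted.L2w_loc_integrable[OF h])
    have z: "(LINT x|lebesgue. (laplacian \<psi> x - \<psi> x) *\<^sub>R h x) = 0" if "\<psi> \<in> ?T" for \<psi>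
    proof -
      have "H \<psi> (\<lambda>x. 0) \<in> M" unfolding M_def using that test_zero by blast
      from orth[OF this] show ?thesis
        by (simp add: ip_def Hsplit laplacian_def scaleR_conv_of_real mult.commute)
    qed
    have int: "integrable lebesgue (\<lambda>x. (laplacian \<psi> x - \<psi> x) *\<^sub>R h x)" if "\<psi> \<in> ?T" for \<psi>
      using integrable_loc_times_test[OF bounded_bilinear.flip[OF bounded_bilinear_scaleR] loc t[OF that]] by simp
    have sq: "integrable lebesgue (\<lambda>x. (norm (h x))\<^sup>2)" using unweighted.L2w_integrable[OF h] by simp
    have "AE x in lebesgue. Re (h x) = 0"
    proof (rule orthogonal_to_range_imp_zero)
      show "integrable lebesgue (\<lambda>x. (Re (h x))\<^sup>2)"
        by (rule Bochner_Integration.integrable_bound[OF sq]) (auto simp: cmod_power2)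
      show "(LINT x|lebesgue. Re (h x) * (laplacian \<psi> x - \<psi> x)) = 0" if "\<psi> \<in> ?T" for \<psi>
        using integral_Re[OF int[OF that]] z[OF that] by (simp add: mult.commute)
    qed measurable
    moreover have "AE x in lebesgue. Im (h x) = 0"
    proof (rule orthogonal_to_range_imp_zero)
      show "integrable lebesgue (\<lambda>x. (Im (h x))\<^sup>2)"
        by (rule Bochner_Integration.integrable_bound[OF sq]) (auto simp: cmod_power2)
      show "(LINT x|lebesgue. Im (h x) * (laplacian \<psi> x - \<psi> x)) = 0" if "\<psi> \<in> ?T" for \<psi>
        using integral_Im[OF int[OF that]] z[OF that] by (simp add: mult.commute)
    qed measurable
    ultimately have "AE x in lebesgue. h x = 0" by eventually_elim (simp add: complex_eq_iff)
    then have "L2n (\<lambda>_. 1) h = L2n (\<lambda>_. 1) (\<lambda>x. 0 :: complex)"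
      by (intro unweighted.L2n_cong_AE) auto
    then show "unweighted.S.nrm h = 0" by (simp add: unweighted.S_nrm L2n_def)
  qed
  then obtain \<psi> \<phi> where "\<psi> \<in> ?T" "\<phi> \<in> ?T" "unweighted.S.nrm (unweighted.S.sub (H \<psi> \<phi>) G) < e"
    by (auto simp: M_def)
  then show thesis using that by (simp add: unweighted.S_nrm unweighted.S.sub_def H_def)
qed

section \<open>Weak divergence and weak derivative along the flow\<close>

lemma loc_integrable_measurable:
  assumes "loc_integrable UNIV f" shows "f \<in> borel_measurable lebesgue"
proof (rule borel_measurable_LIMSEQ_metric)
  show "(\<lambda>x. indicator (cball 0 (real n)) x *\<^sub>R f x) \<in> borel_measurable lebesgue" for n
    by (rule borel_measurable_integrable) (use assms in \<open>auto simp: loc_integrable_def set_integrable_def\<close>)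
  fix x :: "real^3"
  obtain N :: nat where "norm x \<le> real N" using real_arch_simple by blast
  then have "eventually (\<lambda>n. f x = indicator (cball 0 (real n)) x *\<^sub>R f x) sequentially"
    by (intro eventually_sequentiallyI[of N]) auto
  then show "(\<lambda>n. indicator (cball 0 (real n)) x *\<^sub>R f x) \<longlonglongrightarrow> f x"
    by (rule Lim_transform_eventually[OF tendsto_const])
qed

lemma integral_partial_test_complex:
  fixes \<psi> :: "real^3 \<Rightarrow> complex"
  assumes \<psi>: "\<psi> \<in> test_functions UNIV"
  shows "(LINT x|lebesgue. partial l \<psi> x) = 0"
proof -
  have p: "partial l (\<lambda>x. Re (\<psi> x)) x = Re (partial l \<psi> x)" "partial l (\<lambda>x. Im (\<psi> x)) x = Im (partial l \<psi> x)" for x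
    by (rule partial_bounded_linear[OF bounded_linear_Re smooth_differentiable[OF test_smooth[OF \<psi>]]])
       (rule partial_bounded_linear[OF bounded_linear_Im smooth_differentiable[OF test_smooth[OF \<psi>]]])
  have "(LINT x|lebesgue. Re (partial l \<psi> x)) = 0" "(LINT x|lebesgue. Im (partial l \<psi> x)) = 0"
    using integral_partial_test[OF test_bounded_linear[OF bounded_linear_Re \<psi>], of l]
      integral_partial_test[OF test_bounded_linear[OF bounded_linear_Im \<psi>], of l] by (simp_all add: p)
  then show ?thesis
    using integral_Re[OF test_integrable[OF test_partial[OF \<psi>, of l]]] integral_Im[OF test_integrable[OF test_partial[OF \<psi>, of l]]]
    by (simp add: complex_eq_iff)
qed

lemma loc_integrable_vec_nth:
  fixes u :: "real^3 \<Rightarrow> complex^3"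
  shows "loc_integrable U u \<Longrightarrow> loc_integrable U (\<lambda>x. u x $ l)"
  by (rule loc_integrable_bounded_linear[OF bounded_linear_vec_nth])

lemma integrable_test_scaleR:
  fixes f :: "real^3 \<Rightarrow> 'a::{banach, second_countable_topology}"
  shows "loc_integrable U f \<Longrightarrow> \<psi> \<in> test_functions U \<Longrightarrow> integrable lebesgue (\<lambda>x. \<psi> x *\<^sub>R f x)"
  using integrable_loc_times_test[OF bounded_bilinear.flip[OF bounded_bilinear_scaleR]] by blast

lemma has_weak_div_loc:
  "has_weak_div u g \<Longrightarrow> loc_integrable UNIV (\<lambda>x. u x $ l)" "has_weak_div u g \<Longrightarrow> loc_integrable UNIV g"
  by (auto simp: has_weak_div_def)

lemma has_weak_div_eq:
  assumes "has_weak_div u g" "\<psi> \<in> test_functions UNIV"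
  shows "(\<Sum>l\<in>UNIV. LINT x|lebesgue. partial l \<psi> x *\<^sub>R u x $ l) = - (LINT x|lebesgue. \<psi> x *\<^sub>R g x)"
proof -
  have "(LINT x|lebesgue. (\<Sum>l\<in>UNIV. partial l \<psi> x *\<^sub>R u x $ l)) = - (LINT x|lebesgue. \<psi> x *\<^sub>R g x)"
    using assms unfolding has_weak_div_def by blast
  then show ?thesis
    using integrable_test_scaleR[OF has_weak_div_loc(1)[OF assms(1)] test_partial[OF assms(2)]] by simp
qed

lemma has_weak_divI:
  assumes "\<And>l. loc_integrable UNIV (\<lambda>x. u x $ l)" "loc_integrable UNIV g"
    "\<And>\<psi>. \<psi> \<in> test_functions UNIV \<Longrightarrow>
      (\<Sum>l\<in>UNIV. LINT x|lebesgue. partial l \<psi> x *\<^sub>R u x $ l) = - (LINT x|lebesgue. \<psi> x *\<^sub>R g x)"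
  shows "has_weak_div u g"
  using assms integrable_test_scaleR[OF assms(1) test_partial]
  by (simp add: has_weak_div_def)

lemma has_weak_div_add:
  assumes u: "has_weak_div u g" and v: "has_weak_div v h"
  shows "has_weak_div (\<lambda>x. u x + v x) (\<lambda>x. g x + h x)"
proof (rule has_weak_divI)
  fix \<psi> :: "real^3 \<Rightarrow> real" assume \<psi>: "\<psi> \<in> test_functions UNIV"
  note i = integrable_test_scaleR[OF _ test_partial[OF \<psi>]] integrable_test_scaleR[OF _ \<psi>]
  show "(\<Sum>l\<in>UNIV. LINT x|lebesgue. partial l \<psi> x *\<^sub>R (u x + v x) $ l) = - (LINT x|lebesgue. \<psi> x *\<^sub>R (g x + h x))"
    using has_weak_div_eq[OF u \<psi>] has_weak_div_eq[OF v \<psi>]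
    by (simp add: scaleR_add_right i has_weak_div_loc[OF u] has_weak_div_loc[OF v] sum.distrib)
qed (auto intro!: loc_integrable_add has_weak_div_loc[OF u] has_weak_div_loc[OF v])

lemma has_weak_div_smult:
  fixes u :: "real^3 \<Rightarrow> complex^3"
  assumes u: "has_weak_div u g"
  shows "has_weak_div (\<lambda>x. c *s u x) (\<lambda>x. c * g x)"
proof (rule has_weak_divI)
  show "loc_integrable UNIV (\<lambda>x. (c *s u x) $ l)" for l
    using loc_integrable_bounded_linear[OF bounded_linear_mult_right has_weak_div_loc(1)[OF u]] by simp
  show "loc_integrable UNIV (\<lambda>x. c * g x)"
    by (rule loc_integrable_bounded_linear[OF bounded_linear_mult_right has_weak_div_loc(2)[OF u]])
  fix \<psi> :: "real^3 \<Rightarrow> real" assume \<psi>: "\<psi> \<in> test_functions UNIV"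
  have "(\<Sum>l\<in>UNIV. LINT x|lebesgue. c * (partial l \<psi> x *\<^sub>R u x $ l)) = - (LINT x|lebesgue. c * (\<psi> x *\<^sub>R g x))"
    using has_weak_div_eq[OF u \<psi>] by (simp only: integral_mult_right_zero flip: sum_distrib_left) simp
  then show "(\<Sum>l\<in>UNIV. LINT x|lebesgue. partial l \<psi> x *\<^sub>R (c *s u x) $ l) = - (LINT x|lebesgue. \<psi> x *\<^sub>R (c * g x))"
    by simp
qed

lemma has_weak_div_unique:
  fixes u :: "real^3 \<Rightarrow> complex^3"
  assumes "has_weak_div u g" "has_weak_div u h"
  shows "AE x in lebesgue. g x = h x"
proof -
  have "AE x in lebesgue. g x - h x = 0"
  proof (rule AE_zero_if_test_complex)
    show "loc_integrable UNIV (\<lambda>x. g x - h x)" by (intro loc_integrable_diff has_weak_div_loc(2)[OF assms(1)] has_weak_div_loc(2)[OF assms(2)])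
    fix F :: "real^3 \<Rightarrow> real" assume F: "F \<in> test_functions UNIV"
    show "(LINT x|lebesgue. F x *\<^sub>R (g x - h x)) = 0"
      using has_weak_div_eq[OF assms(1) F] has_weak_div_eq[OF assms(2) F]
        integrable_test_scaleR[OF has_weak_div_loc(2)[OF assms(1)] F] integrable_test_scaleR[OF has_weak_div_loc(2)[OF assms(2)] F]
      by (simp add: scaleR_diff_right)
  qed
  then show ?thesis by eventually_elim simp
qed

lemma has_weak_div_unique_real:
  fixes u :: "real^3 \<Rightarrow> real^3"
  assumes "has_weak_div u g" "has_weak_div u h"
  shows "AE x in lebesgue. g x = h x"
proof -
  have "AE x in lebesgue. x \<in> UNIV \<longrightarrow> g x - h x = 0"
  proof (rule AE_zero_if_test)
    show "loc_integrable UNIV (\<lambda>x. g x - h x)" by (intro loc_integrable_diff has_weak_div_loc(2)[OF assms(1)] has_weak_div_loc(2)[OF assms(2)])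
    fix F :: "real^3 \<Rightarrow> real" assume F: "F \<in> test_functions UNIV"
    have "(LINT x|lebesgue. F x *\<^sub>R (g x - h x)) = 0"
      using has_weak_div_eq[OF assms(1) F] has_weak_div_eq[OF assms(2) F]
        integrable_test_scaleR[OF has_weak_div_loc(2)[OF assms(1)] F] integrable_test_scaleR[OF has_weak_div_loc(2)[OF assms(2)] F]
      by (simp add: right_diff_distrib)
    then show "(LINT x|lebesgue. (g x - h x) * F x) = 0" by (simp add: mult.commute)
  qed simp
  then show ?thesis by simp
qed

lemma has_weak_div_cong:
  assumes u: "has_weak_div u g" and uv: "AE x in lebesgue. u x = v x" and v: "\<And>l. loc_integrable UNIV (\<lambda>x. v x $ l)"
  shows "has_weak_div v g"
proof (rule has_weak_divI[OF v has_weak_div_loc(2)[OF u]])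
  fix \<psi> :: "real^3 \<Rightarrow> real" assume \<psi>: "\<psi> \<in> test_functions UNIV"
  have "(LINT x|lebesgue. partial l \<psi> x *\<^sub>R v x $ l) = (LINT x|lebesgue. partial l \<psi> x *\<^sub>R u x $ l)" for l
    using uv integrable_test_scaleR[OF v test_partial[OF \<psi>]] integrable_test_scaleR[OF has_weak_div_loc(1)[OF u] test_partial[OF \<psi>]]
    by (intro integral_cong_AE) (auto elim: eventually_mono)
  then show "(\<Sum>l\<in>UNIV. LINT x|lebesgue. partial l \<psi> x *\<^sub>R v x $ l) = - (LINT x|lebesgue. \<psi> x *\<^sub>R g x)"
    using has_weak_div_eq[OF u \<psi>] by simp
qed

lemma loc_integrable_bounded_mult:
  fixes f :: "real^3 \<Rightarrow> 'a::{banach, second_countable_topology}"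
  assumes f: "loc_integrable UNIV f" and g: "g \<in> borel_measurable lebesgue" "AE x in lebesgue. \<bar>g x\<bar> \<le> B"
  shows "loc_integrable UNIV (\<lambda>x. g x *\<^sub>R f x)"
  unfolding loc_integrable_def set_integrable_def
proof (intro allI impI)
  fix K :: "(real^3) set" assume "compact K \<and> K \<subseteq> UNIV"
  then have i: "integrable lebesgue (\<lambda>x. indicator K x *\<^sub>R f x)" using f by (simp add: loc_integrable_def set_integrable_def)
  have eq: "indicator K x *\<^sub>R g x *\<^sub>R f x = g x *\<^sub>R (indicator K x *\<^sub>R f x)" for x by simp
  show "integrable lebesgue (\<lambda>x. indicator K x *\<^sub>R g x *\<^sub>R f x)"
    unfolding eq
  proof (rule Bochner_Integration.integrable_bound[of _ "\<lambda>x. B *\<^sub>R (indicator K x *\<^sub>R f x)"])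
    show "integrable lebesgue (\<lambda>x. B *\<^sub>R (indicator K x *\<^sub>R f x))" using i by (rule integrable_scaleR_right)
    show "(\<lambda>x. g x *\<^sub>R (indicator K x *\<^sub>R f x)) \<in> borel_measurable lebesgue"
      by (rule borel_measurable_scaleR[OF g(1) borel_measurable_integrable[OF i]])
    show "AE x in lebesgue. norm (g x *\<^sub>R (indicator K x *\<^sub>R f x)) \<le> norm (B *\<^sub>R (indicator K x *\<^sub>R f x))"
      using g(2)
    proof eventually_elim
      case (elim x)
      then have "\<bar>g x\<bar> \<le> \<bar>B\<bar>" by simp
      then show ?case unfolding norm_scaleR by (rule mult_right_mono) simp
    qed
  qed
qed

text \<open>Testing \<eta> u with \<psi> amounts to testing u with the product \<eta> \<psi>, up to
  \<psi> times the gradient of \<eta>.\<close>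

lemma has_weak_div_times_smooth:
  fixes u :: "real^3 \<Rightarrow> complex^3"
  assumes u: "has_weak_div u g" and \<eta>: "smooth \<eta>" "\<And>x. \<bar>\<eta> x\<bar> \<le> B" "\<And>l x. \<bar>partial l \<eta> x\<bar> \<le> B"
  shows "has_weak_div (\<lambda>x. \<eta> x *\<^sub>R u x) (\<lambda>x. \<eta> x *\<^sub>R g x + (\<Sum>l\<in>UNIV. partial l \<eta> x *\<^sub>R u x $ l))"
proof (rule has_weak_divI)
  note ul = has_weak_div_loc(1)[OF u] and gl = has_weak_div_loc(2)[OF u]
  have l1: "loc_integrable UNIV (\<lambda>x. \<eta> x *\<^sub>R f x)" if "loc_integrable UNIV f" for f :: "real^3 \<Rightarrow> complex"
    by (rule loc_integrable_bounded_mult[OF that smooth_measurable[OF \<eta>(1)], of B]) (simp add: \<eta>)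
  have l2: "loc_integrable UNIV (\<lambda>x. partial l \<eta> x *\<^sub>R f x)" if "loc_integrable UNIV f" for f :: "real^3 \<Rightarrow> complex" and l
    by (rule loc_integrable_bounded_mult[where B=B, OF that smooth_measurable[OF smooth_partial[OF \<eta>(1)]]]) (simp add: \<eta>)
  show "loc_integrable UNIV (\<lambda>x. (\<eta> x *\<^sub>R u x) $ l)" for l using l1[OF ul] by simp
  have l3: "loc_integrable UNIV (\<lambda>x. \<Sum>l\<in>UNIV. partial l \<eta> x *\<^sub>R u x $ l)"
    using l2[OF ul] by (auto simp: loc_integrable_def set_integrable_def scaleR_sum_right)
  show "loc_integrable UNIV (\<lambda>x. \<eta> x *\<^sub>R g x + (\<Sum>l\<in>UNIV. partial l \<eta> x *\<^sub>R u x $ l))"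
    by (intro loc_integrable_add l1 l3 gl)
  fix \<psi> :: "real^3 \<Rightarrow> real" assume \<psi>: "\<psi> \<in> test_functions UNIV"
  have t: "(\<lambda>x. \<eta> x * \<psi> x) \<in> test_functions UNIV" by (rule test_mult_right[OF \<eta>(1) \<psi>])
  have tp: "(\<lambda>x. partial l \<eta> x * \<psi> x) \<in> test_functions UNIV" "(\<lambda>x. \<eta> x * partial l \<psi> x) \<in> test_functions UNIV" for l
    by (intro test_mult_right smooth_partial \<eta> test_partial \<psi>)+
  have p: "partial l (\<lambda>x. \<eta> x * \<psi> x) x = \<eta> x * partial l \<psi> x + partial l \<eta> x * \<psi> x" for l x
    by (rule partial_bilinear[OF bounded_bilinear_mult smooth_differentiable[OF \<eta>(1)] smooth_differentiable[OF test_smooth[OF \<psi>]]])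
  have e1: "(LINT x|lebesgue. partial l \<psi> x *\<^sub>R (\<eta> x *\<^sub>R u x) $ l) =
    (LINT x|lebesgue. partial l (\<lambda>x. \<eta> x * \<psi> x) x *\<^sub>R u x $ l) - (LINT x|lebesgue. (partial l \<eta> x * \<psi> x) *\<^sub>R u x $ l)" for l
    using integrable_test_scaleR[OF ul tp(1)] integrable_test_scaleR[OF ul tp(2)]
    by (simp add: p scaleR_add_left mult.commute)
  have e2: "(LINT x|lebesgue. \<psi> x *\<^sub>R (\<eta> x *\<^sub>R g x + (\<Sum>l\<in>UNIV. partial l \<eta> x *\<^sub>R u x $ l))) =
    (LINT x|lebesgue. (\<eta> x * \<psi> x) *\<^sub>R g x) + (\<Sum>l\<in>UNIV. LINT x|lebesgue. (partial l \<eta> x * \<psi> x) *\<^sub>R u x $ l)"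
    using integrable_test_scaleR[OF ul tp(1)] integrable_test_scaleR[OF gl t]
    by (simp add: scaleR_add_right scaleR_sum_right mult.commute)
  show "(\<Sum>l\<in>UNIV. LINT x|lebesgue. partial l \<psi> x *\<^sub>R (\<eta> x *\<^sub>R u x) $ l) =
    - (LINT x|lebesgue. \<psi> x *\<^sub>R (\<eta> x *\<^sub>R g x + (\<Sum>l\<in>UNIV. partial l \<eta> x *\<^sub>R u x $ l)))"
    unfolding e1 e2 sum_subtractf using has_weak_div_eq[OF u t] by simp
qed

lemma test_loc_integrable:
  fixes \<psi> :: "real^3 \<Rightarrow> 'a::{banach, second_countable_topology}"
  assumes "\<psi> \<in> test_functions U"
  shows "loc_integrable V \<psi>"
  by (rule loc_integrable_mono[OF unweighted.L2w_loc_integrable[OF test_L2w[OF assms]]]) simp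

lemma has_weak_div_test:
  fixes v :: "real^3 \<Rightarrow> complex^3"
  assumes v: "v \<in> test_functions UNIV"
  shows "has_weak_div v (\<lambda>x. \<Sum>l\<in>UNIV. partial l v x $ l)"
proof (rule has_weak_divI)
  have vl: "(\<lambda>x. v x $ l) \<in> test_functions UNIV" for l by (rule test_bounded_linear[OF bounded_linear_vec_nth v])
  show "loc_integrable UNIV (\<lambda>x. v x $ l)" for l by (rule test_loc_integrable[OF vl])
  have pl: "(\<lambda>x. partial k v x $ l) \<in> test_functions UNIV" for k l
    by (rule test_bounded_linear[OF bounded_linear_vec_nth test_partial[OF v]])
  have ps: "(\<lambda>x. \<Sum>l\<in>UNIV. partial l v x $ l) \<in> test_functions UNIV" by (intro test_sum pl) simp
  show "loc_integrable UNIV (\<lambda>x. \<Sum>l\<in>UNIV. partial l v x $ l)" by (rule test_loc_integrable[OF ps])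
  fix \<psi> :: "real^3 \<Rightarrow> real" assume \<psi>: "\<psi> \<in> test_functions UNIV"
  have "(LINT x|lebesgue. partial l \<psi> x *\<^sub>R v x $ l) = - (LINT x|lebesgue. \<psi> x *\<^sub>R partial l v x $ l)" for l
  proof -
    have p: "partial l (\<lambda>x. \<psi> x *\<^sub>R v x $ l) x = \<psi> x *\<^sub>R partial l v x $ l + partial l \<psi> x *\<^sub>R v x $ l" for x
    proof -
      have "partial l (\<lambda>x. v x $ l) x = partial l v x $ l"
        by (rule partial_bounded_linear[OF bounded_linear_vec_nth smooth_differentiable[OF test_smooth[OF v]]])
      then show ?thesis
        using partial_bilinear[OF bounded_bilinear_scaleR smooth_differentiable[OF test_smooth[OF \<psi>]]
            smooth_differentiable[OF test_smooth[OF vl[of l]]], of l] by simp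
    qed
    have "(\<lambda>x. \<psi> x *\<^sub>R v x $ l) \<in> test_functions UNIV"
      by (rule test_bilinear_left[OF bounded_bilinear_scaleR \<psi> test_smooth[OF vl]])
    from integral_partial_test_complex[OF this, of l]
    have "(LINT x|lebesgue. \<psi> x *\<^sub>R partial l v x $ l + partial l \<psi> x *\<^sub>R v x $ l) = 0" by (simp only: p)
    moreover have "integrable lebesgue (\<lambda>x. \<psi> x *\<^sub>R partial l v x $ l)" "integrable lebesgue (\<lambda>x. partial l \<psi> x *\<^sub>R v x $ l)"
      by (rule integrable_test_scaleR[OF test_loc_integrable[OF pl] \<psi>], rule integrable_test_scaleR[OF test_loc_integrable[OF vl] test_partial[OF \<psi>]])
    ultimately show ?thesis by (simp add: eq_neg_iff_add_eq_0 add.commute)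
  qed
  then show "(\<Sum>l\<in>UNIV. LINT x|lebesgue. partial l \<psi> x *\<^sub>R v x $ l) = - (LINT x|lebesgue. \<psi> x *\<^sub>R (\<Sum>l\<in>UNIV. partial l v x $ l))"
    using integrable_test_scaleR[OF test_loc_integrable[OF pl] \<psi>]
    by (simp add: scaleR_sum_right sum_negf)
qed

section \<open>The weak derivative along the flow\<close>

locale flow_field = weight \<rho> for \<rho> +
  fixes b :: "real^3 \<Rightarrow> real^3"
  assumes flow_measurable [measurable]: "b \<in> borel_measurable lebesgue"
    and flow_bounded: "\<exists>B>0. AE x in lebesgue. norm (b x) \<le> B"
    and flow_div: "\<exists>g\<in>L2w (\<lambda>_. 1). has_weak_div (\<lambda>x. \<rho> x *\<^sub>R b x) g"
begin

abbreviation "dv \<equiv> weak_div (\<lambda>x. \<rho> x *\<^sub>R b x)"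

lemma dv: "has_weak_div (\<lambda>x. \<rho> x *\<^sub>R b x) dv"
proof -
  obtain g where "has_weak_div (\<lambda>x. \<rho> x *\<^sub>R b x) g" using flow_div by blast
  from someI[of "has_weak_div (\<lambda>x. \<rho> x *\<^sub>R b x)", OF this] show ?thesis by (simp add: weak_div_def)
qed

text \<open>\<open>dv\<close> is a choice among all weak divergences; uniqueness almost everywhere
  transfers square integrability to it from the one whose existence is assumed.\<close>

lemma dv_L2w: "dv \<in> L2w (\<lambda>_. 1)"
proof -
  obtain g where g: "g \<in> L2w (\<lambda>_. 1)" "has_weak_div (\<lambda>x. \<rho> x *\<^sub>R b x) g" using flow_div by blast
  show ?thesis
    by (rule unweighted.L2w_cong_AE[OF g(1) loc_integrable_measurable[OF has_weak_div_loc(2)[OF dv]] has_weak_div_unique_real[OF dv g(2)]])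
qed

text \<open>The weak divergence is tested with real functions only. The real-linear maps Re and Im,
  taken for \<open>L\<close>, reduce the complex case to that.\<close>

lemma dv_eq_complex:
  fixes h :: "real^3 \<Rightarrow> complex"
  assumes h: "h \<in> test_functions UNIV"
  shows "(LINT x|lebesgue. (\<Sum>l\<in>UNIV. (\<rho> x * b x $ l) *\<^sub>R partial l h x)) = - (LINT x|lebesgue. dv x *\<^sub>R h x)"
proof -
  have lb: "loc_integrable UNIV (\<lambda>x. \<rho> x * b x $ l)" for l using has_weak_div_loc(1)[OF dv, of l] by simp
  have i: "integrable lebesgue (\<lambda>x. (\<rho> x * b x $ l) *\<^sub>R partial l h x)" for l
    by (rule integrable_loc_times_test[OF bounded_bilinear_scaleR lb test_partial[OF h]])
  have j: "integrable lebesgue (\<lambda>x. dv x *\<^sub>R h x)"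
    by (rule integrable_loc_times_test[OF bounded_bilinear_scaleR has_weak_div_loc(2)[OF dv] h])
  have main: "L (LINT x|lebesgue. (\<Sum>l\<in>UNIV. (\<rho> x * b x $ l) *\<^sub>R partial l h x)) = - L (LINT x|lebesgue. dv x *\<^sub>R h x)"
    if L: "bounded_linear L" for L :: "complex \<Rightarrow> real"
  proof -
    have p: "partial l (\<lambda>x. L (h x)) x = L (partial l h x)" for l x
      by (rule partial_bounded_linear[OF L smooth_differentiable[OF test_smooth[OF h]]])
    have s: "integrable lebesgue (\<lambda>x. \<Sum>l\<in>UNIV. (\<rho> x * b x $ l) *\<^sub>R partial l h x)" using i by simp
    have "L (LINT x|lebesgue. (\<Sum>l\<in>UNIV. (\<rho> x * b x $ l) *\<^sub>R partial l h x)) =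
      (LINT x|lebesgue. (\<Sum>l\<in>UNIV. partial l (\<lambda>x. L (h x)) x *\<^sub>R (\<rho> x *\<^sub>R b x) $ l))"
      by (subst integral_bounded_linear[OF L s, symmetric])
         (simp add: linear_sum[OF bounded_linear.linear[OF L]] linear_cmul[OF bounded_linear.linear[OF L]] p mult_ac)
    also have "\<dots> = - (LINT x|lebesgue. L (h x) *\<^sub>R dv x)"
      using dv test_bounded_linear[OF L h] unfolding has_weak_div_def by blast
    also have "(LINT x|lebesgue. L (h x) *\<^sub>R dv x) = L (LINT x|lebesgue. dv x *\<^sub>R h x)"
      by (subst integral_bounded_linear[OF L j, symmetric])
         (simp add: linear_cmul[OF bounded_linear.linear[OF L]] mult_ac)
    finally show ?thesis .
  qed
  show ?thesis using main[OF bounded_linear_Re] main[OF bounded_linear_Im] by (simp add: complex_eq_iff)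
qed

lemma test_in_L2w:
  fixes \<psi> :: "real^3 \<Rightarrow> 'a::{banach, second_countable_topology}"
  shows "\<psi> \<in> test_functions UNIV \<Longrightarrow> \<psi> \<in> L2w \<rho>"
  using L2w_unweighted test_L2w by blast

lemma flow_deriv_L2w:
  fixes u' :: "real^3 \<Rightarrow> complex^3"
  assumes u': "u' \<in> test_functions UNIV"
  shows "flow_deriv b u' \<in> L2w (\<lambda>_. 1)" "flow_deriv b u' \<in> L2w \<rho>"
proof -
  obtain B where B: "B > 0" "AE x in lebesgue. norm (b x) \<le> B" using flow_bounded by blast
  have bl: "(\<lambda>x. b x $ l *\<^sub>R partial l u' x) \<in> L2w (\<lambda>_. 1)" for l
  proof (rule unweighted.L2w_bound(1)[OF test_L2w[OF test_partial[OF u']]])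
    show "(\<lambda>x. b x $ l *\<^sub>R partial l u' x) \<in> borel_measurable lebesgue"
      by (intro borel_measurable_scaleR smooth_measurable smooth_partial test_smooth[OF u']
          borel_measurable_continuous_on[OF _ flow_measurable, of "\<lambda>v. v $ l"] continuous_intros)
    show "AE x in lebesgue. norm (b x $ l *\<^sub>R partial l u' x) \<le> B * norm (partial l u' x)"
      using B(2)
    proof eventually_elim
      case (elim x)
      then have "\<bar>b x $ l\<bar> \<le> B" using Finite_Cartesian_Product.norm_nth_le[of "b x" l] by simp
      then show ?case by (simp add: mult_right_mono)
    qed
  qed (use B in simp)
  have "(\<lambda>x. (\<Sum>l\<in>A. b x $ l *\<^sub>R partial l u' x)) \<in> L2w (\<lambda>_. 1)" if "finite A" for A
    using that by (induction A rule: finite_induct) (auto intro!: unweighted.L2w_add bl test_L2w[OF test_zero])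
  from this[of UNIV] show "flow_deriv b u' \<in> L2w (\<lambda>_. 1)" by (simp add: flow_deriv_def[abs_def])
  then show "flow_deriv b u' \<in> L2w \<rho>" using L2w_unweighted by blast
qed

lemma test_bounded_support:
  assumes "\<psi> \<in> test_functions UNIV"
  obtains R where "\<And>x. norm x \<ge> R \<Longrightarrow> \<psi> x = 0" "\<And>x l. norm x \<ge> R \<Longrightarrow> partial l \<psi> x = 0"
proof -
  have "bounded (closure {x. \<psi> x \<noteq> 0})" using assms by (simp add: test_functions_iff bounded_closure)
  then obtain R where R: "\<And>x. x \<in> closure {x. \<psi> x \<noteq> 0} \<Longrightarrow> norm x \<le> R" by (auto simp: bounded_iff)
  show thesis
  proof (rule that[of "R + 1"])
    fix x :: "real^3" and l assume "norm x \<ge> R + 1"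
    then have "x \<notin> closure {x. \<psi> x \<noteq> 0}" using R[of x] by auto
    then show "\<psi> x = 0" "partial l \<psi> x = 0" using in_support[of \<psi> x] partial_eq_0_outside by auto
  qed
qed

definition dterm :: "(real^3 \<Rightarrow> complex^3) \<Rightarrow> (real^3 \<Rightarrow> complex^3) \<Rightarrow> complex"
  where "dterm u u' = (LINT x|lebesgue. complex_of_real (dv x) * cdot (u x) (vcnj (u' x)))"

lemma dv_test_L2w:
  fixes u' :: "real^3 \<Rightarrow> complex^3"
  assumes u': "u' \<in> test_functions UNIV"
  shows "(\<lambda>x. dv x *\<^sub>R u' x) \<in> L2w (\<lambda>_. 1)"
proof -
  obtain B where B: "B > 0" "\<And>x. norm (u' x) \<le> B" using test_bounded[OF u'] by blast
  show ?thesis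
  proof (rule unweighted.L2w_bound(1)[OF dv_L2w])
    show "(\<lambda>x. dv x *\<^sub>R u' x) \<in> borel_measurable lebesgue"
      by (intro borel_measurable_scaleR smooth_measurable test_smooth[OF u'] unweighted.L2w_measurable[OF dv_L2w])
    show "AE x in lebesgue. norm (dv x *\<^sub>R u' x) \<le> B * norm (dv x)"
      using mult_left_mono[OF B(2) abs_ge_zero] by (intro AE_I2) (simp add: mult.commute[of B])
  qed (use B in simp)
qed

text \<open>Since div(rho b) is merely square integrable, it is attached to the bounded test
  function. The product \<open>dv u'\<close> lies in unweighted L^2 with bounded support, so u pairs
  with it continuously.\<close>

lemma dterm_eq: "dterm u u' = (LINT x|lebesgue. cdot (u x) (vcnj (dv x *\<^sub>R u' x)))"
  unfolding dterm_def
  by (simp add: bounded_bilinear.scaleR_right[OF bounded_bilinear_cdot_vcnj] scaleR_conv_of_real[where 'a=complex])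

lemma dterm_integrable:
  assumes u: "u \<in> L2w \<rho>" and u': "u' \<in> test_functions UNIV"
  shows "integrable lebesgue (\<lambda>x. cdot (u x) (vcnj (dv x *\<^sub>R u' x)))"
proof -
  obtain R where "\<And>x. norm x \<ge> R \<Longrightarrow> u' x = 0" using test_bounded_support[OF u'] by metis
  then show ?thesis
    by (intro L2w_local_pairing(1)[OF bounded_bilinear_cdot_vcnj dv_test_L2w[OF u'] _ u, of R]) simp
qed

lemma dterm_limit:
  assumes u: "\<And>n. u n \<in> L2w \<rho>" "v \<in> L2w \<rho>" and lim: "(\<lambda>n. L2n \<rho> (\<lambda>x. u n x - v x)) \<longlonglongrightarrow> 0"
    and u': "u' \<in> test_functions UNIV"
  shows "(\<lambda>n. dterm (u n) u') \<longlonglongrightarrow> dterm v u'"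
proof -
  obtain R where "\<And>x. norm x \<ge> R \<Longrightarrow> u' x = 0" using test_bounded_support[OF u'] by metis
  then show ?thesis unfolding dterm_eq
    by (intro L2w_limit_pairing[OF bounded_bilinear_cdot_vcnj dv_test_L2w[OF u'] _ u lim, of R]) simp
qed

lemma dterm_add: "u \<in> L2w \<rho> \<Longrightarrow> v \<in> L2w \<rho> \<Longrightarrow> u' \<in> test_functions UNIV \<Longrightarrow>
    dterm (\<lambda>x. u x + v x) u' = dterm u u' + dterm v u'"
  unfolding dterm_eq using dterm_integrable[of u u'] dterm_integrable[of v u']
  by (simp add: bounded_bilinear.add_left[OF bounded_bilinear_cdot_vcnj])

lemma dterm_smult: "dterm (\<lambda>x. c *s u x) u' = c * dterm u u'"
proof -
  have "complex_of_real (dv x) * cdot (c *s u x) (vcnj (u' x)) = c * (complex_of_real (dv x) * cdot (u x) (vcnj (u' x)))" for x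
    by (simp add: cdot_def sum_distrib_left mult_ac)
  then show ?thesis by (simp only: dterm_def integral_mult_right_zero)
qed

lemma has_weak_flow_derivI:
  assumes "u \<in> L2w \<rho>" "v \<in> L2w \<rho>"
    and "\<And>u'. u' \<in> test_functions UNIV \<Longrightarrow> ipv \<rho> v u' = - ipv \<rho> u (flow_deriv b u') - dterm u u'"
  shows "has_weak_flow_deriv \<rho> b u v"
  using assms L2w_loc_integrable by (auto simp: has_weak_flow_deriv_def dterm_def)

lemma has_weak_flow_deriv_eq:
  "has_weak_flow_deriv \<rho> b u v \<Longrightarrow> u' \<in> test_functions UNIV \<Longrightarrow>
    ipv \<rho> v u' = - ipv \<rho> u (flow_deriv b u') - dterm u u'"
  by (auto simp: has_weak_flow_deriv_def dterm_def)

text \<open>Testing with F times a unit vector isolates one component of the difference times the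
  weight, and the weight is positive.\<close>

lemma has_weak_flow_deriv_unique:
  assumes v: "has_weak_flow_deriv \<rho> b u v" and w: "has_weak_flow_deriv \<rho> b u w"
  shows "AE x in lebesgue. v x = w x"
proof -
  have vl: "loc_integrable UNIV v" "loc_integrable UNIV w" using v w by (auto simp: has_weak_flow_deriv_def)
  obtain P where P: "AE x in lebesgue. \<rho> x \<le> P" using weight_upper by blast
  have rb: "AE x in lebesgue. \<bar>\<rho> x\<bar> \<le> P" using P weight_pos by eventually_elim simp
  have "AE x in lebesgue. \<rho> x *\<^sub>R (v x $ l - w x $ l) = 0" for l
  proof (rule AE_zero_if_test_complex)
    have li: "loc_integrable UNIV (\<lambda>x. \<rho> x *\<^sub>R f x $ l)" if "loc_integrable UNIV f" for f :: "real^3 \<Rightarrow> complex^3"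
      by (rule loc_integrable_bounded_mult[OF loc_integrable_vec_nth[OF that] weight_measurable rb])
    show "loc_integrable UNIV (\<lambda>x. \<rho> x *\<^sub>R (v x $ l - w x $ l))"
      using loc_integrable_diff[OF li[OF vl(1)] li[OF vl(2)]] by (simp add: scaleR_diff_right)
    fix F :: "real^3 \<Rightarrow> real" assume F: "F \<in> test_functions UNIV"
    let ?u' = "\<lambda>x. F x *\<^sub>R axis l (1::complex)"
    have u': "?u' \<in> test_functions UNIV"
      by (rule test_bounded_linear[OF bounded_linear_scaleR_left F])
    have cd: "complex_of_real (\<rho> x) * cdot a (vcnj (?u' x)) = F x *\<^sub>R \<rho> x *\<^sub>R a $ l" for x and a :: "complex^3"
      by (simp add: cdot_def vcnj_def axis_def if_distrib[of "\<lambda>t. _ * cnj (_ *\<^sub>R t)"] scaleR_conv_of_real[where 'a=complex]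
          if_distrib[of cnj] if_distrib[of "\<lambda>t. _ * t"] mult_ac cong: if_cong)
    have "ipv \<rho> v ?u' = ipv \<rho> w ?u'" using has_weak_flow_deriv_eq[OF v u'] has_weak_flow_deriv_eq[OF w u'] by simp
    then have "(LINT x|lebesgue. F x *\<^sub>R \<rho> x *\<^sub>R v x $ l) = (LINT x|lebesgue. F x *\<^sub>R \<rho> x *\<^sub>R w x $ l)"
      by (simp only: ipv_def cd)
    then show "(LINT x|lebesgue. F x *\<^sub>R \<rho> x *\<^sub>R (v x $ l - w x $ l)) = 0"
      using integrable_test_scaleR[OF li[OF vl(1)] F] integrable_test_scaleR[OF li[OF vl(2)] F]
      by (simp only: scaleR_diff_right Bochner_Integration.integral_diff) simp
  qed
  then have "AE x in lebesgue. \<forall>l. \<rho> x *\<^sub>R (v x $ l - w x $ l) = 0" by (intro AE_finite_allI[of UNIV, simplified]) auto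
  then show ?thesis using weight_pos by eventually_elim (simp add: vec_eq_iff)
qed

lemma has_weak_flow_deriv_add:
  assumes u: "u \<in> L2w \<rho>" "v \<in> L2w \<rho>" "has_weak_flow_deriv \<rho> b u v"
    and w: "w \<in> L2w \<rho>" "z \<in> L2w \<rho>" "has_weak_flow_deriv \<rho> b w z"
  shows "has_weak_flow_deriv \<rho> b (\<lambda>x. u x + w x) (\<lambda>x. v x + z x)"
  by (rule has_weak_flow_derivI)
     (auto intro!: L2w_add u w simp: V.ip_add u w test_in_L2w flow_deriv_L2w dterm_add
        has_weak_flow_deriv_eq[OF u(3)] has_weak_flow_deriv_eq[OF w(3)])

lemma has_weak_flow_deriv_smult:
  assumes u: "u \<in> L2w \<rho>" "v \<in> L2w \<rho>" "has_weak_flow_deriv \<rho> b u v"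
  shows "has_weak_flow_deriv \<rho> b (\<lambda>x. c *s u x) (\<lambda>x. c *s v x)"
  by (rule has_weak_flow_derivI)
     (auto intro!: L2w_smult u simp: V.ip_smul u test_in_L2w flow_deriv_L2w dterm_smult algebra_simps
        has_weak_flow_deriv_eq[OF u(3)])

lemma ipv_scaleR_swap: "ipv \<rho> (\<lambda>x. f x *\<^sub>R u x) v = ipv \<rho> u (\<lambda>x. f x *\<^sub>R v x)"
  by (simp add: ipv_def bounded_bilinear.scaleR_right[OF bounded_bilinear_cdot_vcnj]
      bounded_bilinear.scaleR_left[OF bounded_bilinear_cdot_vcnj])

lemma dterm_scaleR_swap: "dterm (\<lambda>x. f x *\<^sub>R u x) v = dterm u (\<lambda>x. f x *\<^sub>R v x)"
  by (simp add: dterm_def bounded_bilinear.scaleR_right[OF bounded_bilinear_cdot_vcnj]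
      bounded_bilinear.scaleR_left[OF bounded_bilinear_cdot_vcnj])

lemma L2w_scaleR_bounded:
  fixes u :: "real^3 \<Rightarrow> 'a::{real_normed_vector, second_countable_topology}"
  assumes u: "u \<in> L2w \<rho>" and f: "f \<in> borel_measurable lebesgue" "AE x in lebesgue. \<bar>f x\<bar> \<le> C" and "C \<ge> 0"
  shows "(\<lambda>x. f x *\<^sub>R u x) \<in> L2w \<rho>" "L2n \<rho> (\<lambda>x. f x *\<^sub>R u x) \<le> C * L2n \<rho> u"
proof -
  have m: "(\<lambda>x. f x *\<^sub>R u x) \<in> borel_measurable lebesgue"
    by (rule borel_measurable_scaleR[OF f(1) L2w_measurable[OF u]])
  have le: "AE x in lebesgue. norm (f x *\<^sub>R u x) \<le> C * norm (u x)"
    using f(2) by eventually_elim (simp add: mult_right_mono)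
  show "(\<lambda>x. f x *\<^sub>R u x) \<in> L2w \<rho>" "L2n \<rho> (\<lambda>x. f x *\<^sub>R u x) \<le> C * L2n \<rho> u"
    by (rule L2w_bound[OF u m le \<open>C \<ge> 0\<close>])+
qed

definition bgrad :: "(real^3 \<Rightarrow> real) \<Rightarrow> real^3 \<Rightarrow> real"
  where "bgrad \<eta> x = (\<Sum>l\<in>UNIV. b x $ l * partial l \<eta> x)"

lemma bgrad_bounded:
  assumes \<eta>: "smooth \<eta>" "\<And>l x. \<bar>partial l \<eta> x\<bar> \<le> B"
  shows "bgrad \<eta> \<in> borel_measurable lebesgue" "\<exists>C\<ge>0. AE x in lebesgue. \<bar>bgrad \<eta> x\<bar> \<le> C"
proof -
  have [measurable]: "(\<lambda>x. b x $ l) \<in> borel_measurable lebesgue" "partial l \<eta> \<in> borel_measurable lebesgue" for l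
    by (rule borel_measurable_continuous_on[OF _ flow_measurable, of "\<lambda>v. v $ l"], intro continuous_intros)
       (rule smooth_measurable[OF smooth_partial[OF \<eta>(1)]])
  show "bgrad \<eta> \<in> borel_measurable lebesgue" unfolding bgrad_def[abs_def] by measurable
  obtain D where D: "D > 0" "AE x in lebesgue. norm (b x) \<le> D" using flow_bounded by blast
  have B: "B \<ge> 0" using \<eta>(2)[of undefined undefined] by linarith
  have "AE x in lebesgue. \<bar>bgrad \<eta> x\<bar> \<le> (\<Sum>l\<in>(UNIV::3 set). D * B)"
    using D(2)
  proof eventually_elim
    case (elim x)
    have "\<bar>b x $ l * partial l \<eta> x\<bar> \<le> D * B" for l
      unfolding abs_mult using elim Finite_Cartesian_Product.norm_nth_le[of "b x" l] D \<eta>(2)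
      by (intro mult_mono) auto
    then show ?case unfolding bgrad_def by (intro order_trans[OF sum_abs] sum_mono)
  qed
  then show "\<exists>C\<ge>0. AE x in lebesgue. \<bar>bgrad \<eta> x\<bar> \<le> C" using D B by (intro exI[of _ "\<Sum>l\<in>(UNIV::3 set). D * B"]) (auto intro!: sum_nonneg)
qed

lemma flow_deriv_scaleR:
  assumes "smooth \<eta>" "smooth u'"
  shows "flow_deriv b (\<lambda>x. \<eta> x *\<^sub>R u' x) x = \<eta> x *\<^sub>R flow_deriv b u' x + bgrad \<eta> x *\<^sub>R u' x"
proof -
  have "partial l (\<lambda>x. \<eta> x *\<^sub>R u' x) x = \<eta> x *\<^sub>R partial l u' x + partial l \<eta> x *\<^sub>R u' x" for l
    by (rule partial_bilinear[OF bounded_bilinear_scaleR smooth_differentiable[OF assms(1)] smooth_differentiable[OF assms(2)]])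
  then show ?thesis
    by (simp add: flow_deriv_def bgrad_def scaleR_add_right sum.distrib scaleR_sum_right scaleR_sum_left mult_ac)
qed

text \<open>The real factor \<eta> moves to the test function. The classical product rule there
  produces a term with \<open>bgrad \<eta>\<close>, which cancels against the one in the claimed
  derivative.\<close>

lemma has_weak_flow_deriv_times_smooth:
  assumes u: "u \<in> L2w \<rho>" "v \<in> L2w \<rho>" "has_weak_flow_deriv \<rho> b u v"
    and \<eta>: "smooth \<eta>" "\<And>x. \<bar>\<eta> x\<bar> \<le> B" "\<And>l x. \<bar>partial l \<eta> x\<bar> \<le> B"
  shows "has_weak_flow_deriv \<rho> b (\<lambda>x. \<eta> x *\<^sub>R u x) (\<lambda>x. \<eta> x *\<^sub>R v x + bgrad \<eta> x *\<^sub>R u x)"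
proof -
  have B: "B \<ge> 0" using \<eta>(2)[of undefined] by linarith
  obtain C where C: "C \<ge> 0" "AE x in lebesgue. \<bar>bgrad \<eta> x\<bar> \<le> C" using bgrad_bounded(2)[OF \<eta>(1,3)] by blast
  have s: "(\<lambda>x. \<eta> x *\<^sub>R w x) \<in> L2w \<rho>" if "w \<in> L2w \<rho>" for w :: "real^3 \<Rightarrow> complex^3"
    by (rule L2w_scaleR_bounded(1)[OF that smooth_measurable[OF \<eta>(1)] _ B]) (simp add: \<eta>)
  have t: "(\<lambda>x. bgrad \<eta> x *\<^sub>R w x) \<in> L2w \<rho>" if "w \<in> L2w \<rho>" for w :: "real^3 \<Rightarrow> complex^3"
    by (rule L2w_scaleR_bounded(1)[OF that bgrad_bounded(1)[OF \<eta>(1,3)] C(2,1)])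
  show ?thesis
  proof (rule has_weak_flow_derivI)
    fix u' :: "real^3 \<Rightarrow> complex^3" assume u': "u' \<in> test_functions UNIV"
    have eu': "(\<lambda>x. \<eta> x *\<^sub>R u' x) \<in> test_functions UNIV"
      by (rule test_bilinear_right[OF bounded_bilinear_scaleR \<eta>(1) u'])
    have "ipv \<rho> (\<lambda>x. \<eta> x *\<^sub>R v x + bgrad \<eta> x *\<^sub>R u x) u' = ipv \<rho> v (\<lambda>x. \<eta> x *\<^sub>R u' x) + ipv \<rho> u (\<lambda>x. bgrad \<eta> x *\<^sub>R u' x)"
      by (simp add: V.ip_add s t u test_in_L2w[OF u'] ipv_scaleR_swap)
    also have "ipv \<rho> v (\<lambda>x. \<eta> x *\<^sub>R u' x) = - ipv \<rho> u (flow_deriv b (\<lambda>x. \<eta> x *\<^sub>R u' x)) - dterm u (\<lambda>x. \<eta> x *\<^sub>R u' x)"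
      by (rule has_weak_flow_deriv_eq[OF u(3) eu'])
    also have "ipv \<rho> u (flow_deriv b (\<lambda>x. \<eta> x *\<^sub>R u' x)) = ipv \<rho> u (\<lambda>x. \<eta> x *\<^sub>R flow_deriv b u' x) + ipv \<rho> u (\<lambda>x. bgrad \<eta> x *\<^sub>R u' x)"
      unfolding flow_deriv_scaleR[OF \<eta>(1) test_smooth[OF u'], abs_def]
      by (rule V.ip_add_right) (intro s t flow_deriv_L2w u test_in_L2w u')+
    finally show "ipv \<rho> (\<lambda>x. \<eta> x *\<^sub>R v x + bgrad \<eta> x *\<^sub>R u x) u' =
      - ipv \<rho> (\<lambda>x. \<eta> x *\<^sub>R u x) (flow_deriv b u') - dterm (\<lambda>x. \<eta> x *\<^sub>R u x) u'"
      by (simp add: ipv_scaleR_swap dterm_scaleR_swap)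
  qed (intro L2w_add s t u)+
qed

text \<open>Apply the identity defining div(rho b) to the scalar test function formed by v and the
  conjugate of u'; its derivative along b splits by the product rule.\<close>

lemma has_weak_flow_deriv_test:
  assumes v: "v \<in> test_functions UNIV"
  shows "has_weak_flow_deriv \<rho> b v (flow_deriv b v)"
proof (rule has_weak_flow_derivI)
  fix u' :: "real^3 \<Rightarrow> complex^3" assume u': "u' \<in> test_functions UNIV"
  let ?h = "\<lambda>x. cdot (v x) (vcnj (u' x))"
  have h: "?h \<in> test_functions UNIV" by (rule test_bilinear_left[OF bounded_bilinear_cdot_vcnj v test_smooth[OF u']])
  have p: "partial l ?h x = cdot (v x) (vcnj (partial l u' x)) + cdot (partial l v x) (vcnj (u' x))" for l x
    by (rule partial_bilinear[OF bounded_bilinear_cdot_vcnj smooth_differentiable[OF test_smooth[OF v]] smooth_differentiable[OF test_smooth[OF u']]])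
  have e: "(\<Sum>l\<in>UNIV. (\<rho> x * b x $ l) *\<^sub>R partial l ?h x) =
    complex_of_real (\<rho> x) * cdot (v x) (vcnj (flow_deriv b u' x)) + complex_of_real (\<rho> x) * cdot (flow_deriv b v x) (vcnj (u' x))" for x
    by (simp add: p flow_deriv_def bounded_bilinear.sum_right[OF bounded_bilinear_cdot_vcnj] bounded_bilinear.sum_left[OF bounded_bilinear_cdot_vcnj]
        bounded_bilinear.scaleR_right[OF bounded_bilinear_cdot_vcnj] bounded_bilinear.scaleR_left[OF bounded_bilinear_cdot_vcnj]
        scaleR_add_right sum.distrib sum_distrib_left distrib_left scaleR_conv_of_real[where 'a=complex] mult_ac)
  have "ipv \<rho> v (flow_deriv b u') + ipv \<rho> (flow_deriv b v) u' = - dterm v u'"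
    using dv_eq_complex[OF h, unfolded e]
      ipv_integrable[OF test_in_L2w[OF v] flow_deriv_L2w(2)[OF u']] ipv_integrable[OF flow_deriv_L2w(2)[OF v] test_in_L2w[OF u']]
    by (simp add: dterm_def ipv_def scaleR_conv_of_real[where 'a=complex])
  moreover have "ipv \<rho> (flow_deriv b v) u' = (ipv \<rho> v (flow_deriv b u') + ipv \<rho> (flow_deriv b v) u') - ipv \<rho> v (flow_deriv b u')" by simp
  ultimately show "ipv \<rho> (flow_deriv b v) u' = - ipv \<rho> v (flow_deriv b u') - dterm v u'" by simp
qed (intro test_in_L2w flow_deriv_L2w v)+

end

section \<open>The space X\<close>

context flow_field
begin

abbreviation "X \<equiv> X_fun \<rho> b"
abbreviation "T \<equiv> weak_flow_deriv \<rho> b"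

text \<open>\<open>weak_div\<close> and \<open>T\<close> are arbitrary choices. They inherit square
  integrability from the witnesses in \<open>X_fun\<close> because weak derivatives are unique
  almost everywhere.\<close>

lemma XD:
  assumes "u \<in> X"
  shows "u \<in> L2w \<rho>" "weak_div u \<in> L2w \<rho>" "has_weak_div u (weak_div u)"
    "T u \<in> L2w \<rho>" "has_weak_flow_deriv \<rho> b u (T u)"
proof -
  obtain g v where u: "u \<in> L2w \<rho>" and g: "g \<in> L2w \<rho>" "has_weak_div u g"
    and v: "v \<in> L2w \<rho>" "has_weak_flow_deriv \<rho> b u v"
    using assms by (auto simp: X_fun_def)
  show "u \<in> L2w \<rho>" by (rule u)
  show d: "has_weak_div u (weak_div u)" unfolding weak_div_def by (rule someI[of "has_weak_div u", OF g(2)])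
  show t: "has_weak_flow_deriv \<rho> b u (T u)"
    unfolding weak_flow_deriv_def by (rule someI[of "has_weak_flow_deriv \<rho> b u", OF v(2)])
  show "weak_div u \<in> L2w \<rho>"
    by (rule L2w_cong_AE[OF g(1) loc_integrable_measurable[OF has_weak_div_loc(2)[OF d]] has_weak_div_unique[OF d g(2)]])
  have "loc_integrable UNIV (T u)" using t by (simp add: has_weak_flow_deriv_def)
  then show "T u \<in> L2w \<rho>"
    by (rule L2w_cong_AE[OF v(1) loc_integrable_measurable has_weak_flow_deriv_unique[OF t v(2)]])
qed

lemma XI:
  assumes "u \<in> L2w \<rho>" "g \<in> L2w \<rho>" "has_weak_div u g" "v \<in> L2w \<rho>" "has_weak_flow_deriv \<rho> b u v"
  shows "u \<in> X" "AE x in lebesgue. weak_div u x = g x" "AE x in lebesgue. T u x = v x"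
proof -
  show u: "u \<in> X" using assms by (auto simp: X_fun_def)
  show "AE x in lebesgue. weak_div u x = g x" by (rule has_weak_div_unique[OF XD(3)[OF u] assms(3)])
  show "AE x in lebesgue. T u x = v x" by (rule has_weak_flow_deriv_unique[OF XD(5)[OF u] assms(5)])
qed

lemma X_add:
  assumes u: "u \<in> X" and v: "v \<in> X"
  shows "(\<lambda>x. u x + v x) \<in> X"
    "AE x in lebesgue. weak_div (\<lambda>x. u x + v x) x = weak_div u x + weak_div v x"
    "AE x in lebesgue. T (\<lambda>x. u x + v x) x = T u x + T v x"
  by (rule XI[OF L2w_add[OF XD(1)[OF u] XD(1)[OF v]] L2w_add[OF XD(2)[OF u] XD(2)[OF v]]
        has_weak_div_add[OF XD(3)[OF u] XD(3)[OF v]] L2w_add[OF XD(4)[OF u] XD(4)[OF v]]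
        has_weak_flow_deriv_add[OF XD(1,4,5)[OF u] XD(1,4,5)[OF v]]])+

lemma X_smult:
  assumes u: "u \<in> X"
  shows "(\<lambda>x. c *s u x) \<in> X"
    "AE x in lebesgue. weak_div (\<lambda>x. c *s u x) x = c * weak_div u x"
    "AE x in lebesgue. T (\<lambda>x. c *s u x) x = c *s T u x"
  by (rule XI[OF L2w_smult[OF XD(1)[OF u]] L2w_cmult[OF XD(2)[OF u]] has_weak_div_smult[OF XD(3)[OF u]]
        L2w_smult[OF XD(4)[OF u]] has_weak_flow_deriv_smult[OF XD(1,4,5)[OF u]]])+

lemma X_diff:
  assumes u: "u \<in> X" and v: "v \<in> X"
  shows "(\<lambda>x. u x - v x) \<in> X"
    "AE x in lebesgue. weak_div (\<lambda>x. u x - v x) x = weak_div u x - weak_div v x"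
    "AE x in lebesgue. T (\<lambda>x. u x - v x) x = T u x - T v x"
proof -
  have e: "(\<lambda>x. u x - v x) = (\<lambda>x. u x + (-1) *s v x)" by auto
  show "(\<lambda>x. u x - v x) \<in> X" unfolding e by (rule X_add(1)[OF u X_smult(1)[OF v]])
  show "AE x in lebesgue. weak_div (\<lambda>x. u x - v x) x = weak_div u x - weak_div v x"
    using X_add(2)[OF u X_smult(1)[OF v, of "-1"]] X_smult(2)[OF v, of "-1"] unfolding e by eventually_elim simp
  show "AE x in lebesgue. T (\<lambda>x. u x - v x) x = T u x - T v x"
    using X_add(3)[OF u X_smult(1)[OF v, of "-1"]] X_smult(3)[OF v, of "-1"] unfolding e by eventually_elim simp
qed

lemma X_cong:
  assumes u: "u \<in> X" and v: "v \<in> L2w \<rho>" and eq: "AE x in lebesgue. u x = v x"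
  shows "v \<in> X" "AE x in lebesgue. weak_div v x = weak_div u x" "AE x in lebesgue. T v x = T u x"
proof -
  have d: "has_weak_div v (weak_div u)"
    by (rule has_weak_div_cong[OF XD(3)[OF u] eq]) (rule loc_integrable_vec_nth[OF L2w_loc_integrable[OF v]])
  have i: "ipv \<rho> v w = ipv \<rho> u w" if "w \<in> L2w \<rho>" for w
    unfolding ipv_def
    using ipv_integrable[OF v that] ipv_integrable[OF XD(1)[OF u] that] eq
    by (intro integral_cong_AE) (auto elim: eventually_mono)
  have j: "dterm v w = dterm u w" if "w \<in> test_functions UNIV" for w
    unfolding dterm_eq
    using dterm_integrable[OF v that] dterm_integrable[OF XD(1)[OF u] that] eq
    by (intro integral_cong_AE) (auto elim: eventually_mono)
  have t: "has_weak_flow_deriv \<rho> b v (T u)"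
    by (rule has_weak_flow_derivI[OF v XD(4)[OF u]])
       (simp add: i[OF flow_deriv_L2w(2)] j has_weak_flow_deriv_eq[OF XD(5)[OF u]])
  show "v \<in> X" "AE x in lebesgue. weak_div v x = weak_div u x" "AE x in lebesgue. T v x = T u x"
    by (rule XI[OF v XD(2)[OF u] d XD(4)[OF u] t])+
qed

lemma ip_cong_AE:
  assumes "u \<in> L2w \<rho>" "u' \<in> L2w \<rho>" "AE x in lebesgue. u x = u' x"
    "v \<in> L2w \<rho>" "v' \<in> L2w \<rho>" "AE x in lebesgue. v x = v' x"
  shows "ip \<rho> u v = ip \<rho> u' v'"
  unfolding ip_def
  using ip_integrable[OF assms(1,4)] ip_integrable[OF assms(2,5)] assms(3,6)
  by (intro integral_cong_AE) auto

lemma ipv_cong_AE: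
  assumes "u \<in> L2w \<rho>" "u' \<in> L2w \<rho>" "AE x in lebesgue. u x = u' x"
    "v \<in> L2w \<rho>" "v' \<in> L2w \<rho>" "AE x in lebesgue. v x = v' x"
  shows "ipv \<rho> u v = ipv \<rho> u' v'"
  unfolding ipv_def
  using ipv_integrable[OF assms(1,4)] ipv_integrable[OF assms(2,5)] assms(3,6)
  by (intro integral_cong_AE) auto

definition ipX :: "(real^3 \<Rightarrow> complex^3) \<Rightarrow> (real^3 \<Rightarrow> complex^3) \<Rightarrow> complex"
  where "ipX u v = ip \<rho> (weak_div u) (weak_div v) + ipv \<rho> (T u) (T v) + ipv \<rho> u v"

lemma ipX_self: "u \<in> X \<Longrightarrow> ipX u u = complex_of_real ((L2n \<rho> (weak_div u))\<^sup>2 + (L2n \<rho> (T u))\<^sup>2 + (L2n \<rho> u)\<^sup>2)"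
  by (simp add: ipX_def ip_self_L2n ipv_self_L2n)

text \<open>Both weak derivatives are closed operators, since for a fixed test function each term of
  the defining identities is continuous in weighted L^2. Completeness of X follows from
  this.\<close>

lemma X_limit:
  assumes u: "\<And>n. u n \<in> X" and w: "w \<in> L2w \<rho>" "(\<lambda>n. L2n \<rho> (\<lambda>x. u n x - w x)) \<longlonglongrightarrow> 0"
    and g: "g \<in> L2w \<rho>" "(\<lambda>n. L2n \<rho> (\<lambda>x. weak_div (u n) x - g x)) \<longlonglongrightarrow> 0"
    and v: "v \<in> L2w \<rho>" "(\<lambda>n. L2n \<rho> (\<lambda>x. T (u n) x - v x)) \<longlonglongrightarrow> 0"
  shows "w \<in> X" "AE x in lebesgue. weak_div w x = g x" "AE x in lebesgue. T w x = v x"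
proof -
  have d: "has_weak_div w g"
  proof (rule has_weak_divI[OF loc_integrable_vec_nth[OF L2w_loc_integrable[OF w(1)]] L2w_loc_integrable[OF g(1)]])
    fix \<psi> :: "real^3 \<Rightarrow> real" assume \<psi>: "\<psi> \<in> test_functions UNIV"
    obtain R where R: "\<And>x. norm x \<ge> R \<Longrightarrow> \<psi> x = 0" "\<And>x l. norm x \<ge> R \<Longrightarrow> partial l \<psi> x = 0"
      using test_bounded_support[OF \<psi>] by blast
    have comp: "bounded_bilinear (\<lambda>(v :: complex^3) (t :: real). t *\<^sub>R v $ l)" for l
      by (rule bounded_bilinear.comp[OF bounded_bilinear.flip[OF bounded_bilinear_scaleR] bounded_linear_vec_nth bounded_linear_ident])
    have "(\<lambda>n. LINT x|lebesgue. partial l \<psi> x *\<^sub>R u n x $ l) \<longlonglongrightarrow> (LINT x|lebesgue. partial l \<psi> x *\<^sub>R w x $ l)" for l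
      by (rule L2w_limit_pairing[OF comp test_L2w[OF test_partial[OF \<psi>]] _ XD(1)[OF u] w, of R]) (use R in auto)
    then have "(\<lambda>n. \<Sum>l\<in>UNIV. LINT x|lebesgue. partial l \<psi> x *\<^sub>R u n x $ l) \<longlonglongrightarrow> (\<Sum>l\<in>UNIV. LINT x|lebesgue. partial l \<psi> x *\<^sub>R w x $ l)"
      by (rule tendsto_sum)
    moreover have "(\<lambda>n. LINT x|lebesgue. \<psi> x *\<^sub>R weak_div (u n) x) \<longlonglongrightarrow> (LINT x|lebesgue. \<psi> x *\<^sub>R g x)"
      by (rule L2w_limit_pairing[OF bounded_bilinear.flip[OF bounded_bilinear_scaleR] test_L2w[OF \<psi>] _ XD(2)[OF u] g, of R]) (use R in auto)
    ultimately show "(\<Sum>l\<in>UNIV. LINT x|lebesgue. partial l \<psi> x *\<^sub>R w x $ l) = - (LINT x|lebesgue. \<psi> x *\<^sub>R g x)"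
      unfolding has_weak_div_eq[OF XD(3)[OF u] \<psi>] using LIMSEQ_unique tendsto_minus by blast
  qed
  have iplim: "(\<lambda>n. ipv \<rho> (f n) z) \<longlonglongrightarrow> ipv \<rho> h z"
    if f: "\<And>n. f n \<in> L2w \<rho>" "h \<in> L2w \<rho>" "(\<lambda>n. L2n \<rho> (\<lambda>x. f n x - h x)) \<longlonglongrightarrow> 0" and z: "z \<in> L2w \<rho>" for f h z
  proof -
    have "(\<lambda>n. ipv \<rho> (f n) z - ipv \<rho> h z) \<longlonglongrightarrow> 0"
    proof (rule Lim_null_comparison)
      show "(\<lambda>n. L2n \<rho> (\<lambda>x. f n x - h x) * L2n \<rho> z) \<longlonglongrightarrow> 0" using tendsto_mult_right[OF f(3), of "L2n \<rho> z"] by simp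
      have "ipv \<rho> (f n) z - ipv \<rho> h z = ipv \<rho> (\<lambda>x. f n x - h x) z" for n
        using V.ip_sub[OF f(1) f(2) z] by (simp add: V.sub_def)
      then show "eventually (\<lambda>n. norm (ipv \<rho> (f n) z - ipv \<rho> h z) \<le> L2n \<rho> (\<lambda>x. f n x - h x) * L2n \<rho> z) sequentially"
        using ipv_Cauchy_Schwarz[OF L2w_diff[OF f(1,2)] z] by simp
    qed
    then show ?thesis by (simp add: LIM_zero_iff)
  qed
  have t: "has_weak_flow_deriv \<rho> b w v"
  proof (rule has_weak_flow_derivI[OF w(1) v(1)])
    fix u' :: "real^3 \<Rightarrow> complex^3" assume u': "u' \<in> test_functions UNIV"
    have "(\<lambda>n. ipv \<rho> (T (u n)) u') \<longlonglongrightarrow> ipv \<rho> v u'" by (rule iplim[OF XD(4)[OF u] v test_in_L2w[OF u']])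
    moreover have "(\<lambda>n. - ipv \<rho> (u n) (flow_deriv b u') - dterm (u n) u') \<longlonglongrightarrow> - ipv \<rho> w (flow_deriv b u') - dterm w u'"
      by (intro tendsto_intros iplim[OF XD(1)[OF u] w flow_deriv_L2w(2)[OF u']] dterm_limit[OF XD(1)[OF u] w u'])
    ultimately show "ipv \<rho> v u' = - ipv \<rho> w (flow_deriv b u') - dterm w u'"
      unfolding has_weak_flow_deriv_eq[OF XD(5)[OF u] u'] by (rule LIMSEQ_unique)
  qed
  show "w \<in> X" "AE x in lebesgue. weak_div w x = g x" "AE x in lebesgue. T w x = v x"
    by (rule XI[OF w(1) g(1) d v(1) t])+
qed

sublocale XH: semi_hilbert X "\<lambda>u v x. u x + v x" "\<lambda>c u x. c *s u x" ipX
proof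
  fix u v assume u: "u \<in> X" and v: "v \<in> X"
  show "(\<lambda>x. u x + v x) \<in> X" by (rule X_add(1)[OF u v])
  show "ipX v u = cnj (ipX u v)"
    by (simp add: ipX_def S.ip_cnj[OF XD(2)[OF u] XD(2)[OF v]] V.ip_cnj[OF XD(4)[OF u] XD(4)[OF v]] V.ip_cnj[OF XD(1)[OF u] XD(1)[OF v]])
  fix w assume w: "w \<in> X"
  have "ip \<rho> (weak_div (\<lambda>x. u x + v x)) (weak_div w) = ip \<rho> (\<lambda>x. weak_div u x + weak_div v x) (weak_div w)"
    by (intro ip_cong_AE X_add(2)[OF u v] XD L2w_add w u v X_add(1)) simp
  moreover have "ipv \<rho> (T (\<lambda>x. u x + v x)) (T w) = ipv \<rho> (\<lambda>x. T u x + T v x) (T w)"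
    by (intro ipv_cong_AE X_add(3)[OF u v] XD L2w_add w u v X_add(1)) simp
  ultimately show "ipX (\<lambda>x. u x + v x) w = ipX u w + ipX v w"
    by (simp add: ipX_def S.ip_add V.ip_add XD[OF u] XD[OF v] XD[OF w])
next
  fix u c assume u: "u \<in> X"
  show "(\<lambda>x. c *s u x) \<in> X" by (rule X_smult(1)[OF u])
  show "0 \<le> Re (ipX u u)" by (simp add: ipX_self[OF u] del: of_real_add of_real_power)
  fix w assume w: "w \<in> X"
  have "ip \<rho> (weak_div (\<lambda>x. c *s u x)) (weak_div w) = ip \<rho> (\<lambda>x. c * weak_div u x) (weak_div w)"
    by (intro ip_cong_AE X_smult(2)[OF u] XD L2w_cmult w u X_smult(1)) simp
  moreover have "ipv \<rho> (T (\<lambda>x. c *s u x)) (T w) = ipv \<rho> (\<lambda>x. c *s T u x) (T w)"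
    by (intro ipv_cong_AE X_smult(3)[OF u] XD L2w_smult w u X_smult(1)) simp
  ultimately show "ipX (\<lambda>x. c *s u x) w = c * ipX u w"
    by (simp add: ipX_def S.ip_smul V.ip_smul XD[OF u] XD[OF w] distrib_left)
next
  fix Y :: "nat \<Rightarrow> real^3 \<Rightarrow> complex^3" assume Y: "\<And>n. Y n \<in> X"
  have e: "Re (ipX (\<lambda>x. f x + - 1 *s h x) (\<lambda>x. f x + - 1 *s h x)) =
    (L2n \<rho> (\<lambda>x. weak_div f x - weak_div h x))\<^sup>2 + (L2n \<rho> (\<lambda>x. T f x - T h x))\<^sup>2 + (L2n \<rho> (\<lambda>x. f x - h x))\<^sup>2"
    if f: "f \<in> X" "h \<in> X" for f h
  proof -
    have "(\<lambda>x. f x + - 1 *s h x) = (\<lambda>x. f x - h x)" by auto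
    moreover have "L2n \<rho> (weak_div (\<lambda>x. f x - h x)) = L2n \<rho> (\<lambda>x. weak_div f x - weak_div h x)"
      by (rule L2n_cong_AE[OF X_diff(2)[OF f]]) (intro L2w_measurable L2w_diff XD X_diff(1) f)+
    moreover have "L2n \<rho> (T (\<lambda>x. f x - h x)) = L2n \<rho> (\<lambda>x. T f x - T h x)"
      by (rule L2n_cong_AE[OF X_diff(3)[OF f]]) (intro L2w_measurable L2w_diff XD X_diff(1) f)+
    ultimately show ?thesis using X_diff(1)[OF f] by (simp add: ipX_self del: of_real_add of_real_power)
  qed
  assume cau: "\<And>e. 0 < e \<Longrightarrow> \<exists>N. \<forall>m\<ge>N. \<forall>n\<ge>N. Re (ipX (\<lambda>x. Y m x + - 1 *s Y n x) (\<lambda>x. Y m x + - 1 *s Y n x)) < e"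
  \<comment> \<open>Applied with f the identity, the divergence and \<open>T\<close>: each is Cauchy
    because its squared difference is one summand of \<open>e\<close>.\<close>
  have lim: "\<exists>v\<in>L2w \<rho>. (\<lambda>n. L2n \<rho> (\<lambda>x. f (Y n) x - v x)) \<longlonglongrightarrow> 0"
    if f: "\<And>u. u \<in> X \<Longrightarrow> f u \<in> L2w \<rho>"
      and le: "\<And>u v. u \<in> X \<Longrightarrow> v \<in> X \<Longrightarrow> (L2n \<rho> (\<lambda>x. f u x - f v x))\<^sup>2 \<le> Re (ipX (\<lambda>x. u x + - 1 *s v x) (\<lambda>x. u x + - 1 *s v x))"
    for f :: "(real^3 \<Rightarrow> complex^3) \<Rightarrow> real^3 \<Rightarrow> 'd::{banach, second_countable_topology}"
  proof -
    have "\<exists>N. \<forall>m\<ge>N. \<forall>n\<ge>N. (LINT x|lebesgue. \<rho> x * (norm (f (Y m) x - f (Y n) x))\<^sup>2) < e" if "e > 0" for e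
      using cau[OF that] le[OF Y Y] unfolding L2n_sq by (meson le_less_trans)
    from L2w_complete[OF f[OF Y] this] obtain v where v: "v \<in> L2w \<rho>"
      "(\<lambda>n. LINT x|lebesgue. \<rho> x * (norm (f (Y n) x - v x))\<^sup>2) \<longlonglongrightarrow> 0" by blast
    have "(\<lambda>n. L2n \<rho> (\<lambda>x. f (Y n) x - v x)) \<longlonglongrightarrow> 0"
      using tendsto_real_sqrt[OF v(2)] by (simp add: L2n_def)
    then show ?thesis using v(1) by blast
  qed
  obtain w where w: "w \<in> L2w \<rho>" "(\<lambda>n. L2n \<rho> (\<lambda>x. Y n x - w x)) \<longlonglongrightarrow> 0"
  proof -
    have "(L2n \<rho> (\<lambda>x. u x - v x))\<^sup>2 \<le> Re (ipX (\<lambda>x. u x + - 1 *s v x) (\<lambda>x. u x + - 1 *s v x))"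
      if "u \<in> X" "v \<in> X" for u v unfolding e[OF that] by simp
    from lim[of "\<lambda>u. u", OF XD(1) this] show ?thesis using that by blast
  qed
  obtain g where g: "g \<in> L2w \<rho>" "(\<lambda>n. L2n \<rho> (\<lambda>x. weak_div (Y n) x - g x)) \<longlonglongrightarrow> 0"
  proof -
    have "(L2n \<rho> (\<lambda>x. weak_div u x - weak_div v x))\<^sup>2 \<le> Re (ipX (\<lambda>x. u x + - 1 *s v x) (\<lambda>x. u x + - 1 *s v x))"
      if "u \<in> X" "v \<in> X" for u v unfolding e[OF that] by simp
    from lim[of weak_div, OF XD(2) this] show ?thesis using that by blast
  qed
  obtain v where v: "v \<in> L2w \<rho>" "(\<lambda>n. L2n \<rho> (\<lambda>x. T (Y n) x - v x)) \<longlonglongrightarrow> 0"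
  proof -
    have "(L2n \<rho> (\<lambda>x. T u x - T v x))\<^sup>2 \<le> Re (ipX (\<lambda>x. u x + - 1 *s v x) (\<lambda>x. u x + - 1 *s v x))"
      if "u \<in> X" "v \<in> X" for u v unfolding e[OF that] by simp
    from lim[of T, OF XD(4) this] show ?thesis using that by blast
  qed
  note wX = X_limit[OF Y w g v]
  have "L2n \<rho> (\<lambda>x. weak_div (Y n) x - weak_div w x) = L2n \<rho> (\<lambda>x. weak_div (Y n) x - g x)" for n
    by (rule L2n_cong_AE[OF _ L2w_measurable[OF L2w_diff[OF XD(2)[OF Y] XD(2)[OF wX(1)]]] L2w_measurable[OF L2w_diff[OF XD(2)[OF Y] g(1)]]])
       (use wX(2) in \<open>auto elim: eventually_mono\<close>)
  moreover have "L2n \<rho> (\<lambda>x. T (Y n) x - T w x) = L2n \<rho> (\<lambda>x. T (Y n) x - v x)" for n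
    by (rule L2n_cong_AE[OF _ L2w_measurable[OF L2w_diff[OF XD(4)[OF Y] XD(4)[OF wX(1)]]] L2w_measurable[OF L2w_diff[OF XD(4)[OF Y] v(1)]]])
       (use wX(3) in \<open>auto elim: eventually_mono\<close>)
  ultimately have "(\<lambda>n. Re (ipX (\<lambda>x. Y n x + - 1 *s w x) (\<lambda>x. Y n x + - 1 *s w x))) \<longlonglongrightarrow> 0"
    unfolding e[OF Y wX(1)] using tendsto_add[OF tendsto_add[OF tendsto_power[OF g(2), of 2] tendsto_power[OF v(2), of 2]] tendsto_power[OF w(2), of 2]]
    by simp
  then show "\<exists>u\<in>X. (\<lambda>n. Re (ipX (\<lambda>x. Y n x + - 1 *s u x) (\<lambda>x. Y n x + - 1 *s u x))) \<longlonglongrightarrow> 0"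
    using wX(1) by blast
qed

lemma X_nrm_sq: "u \<in> X \<Longrightarrow> (XH.nrm u)\<^sup>2 = (L2n \<rho> (weak_div u))\<^sup>2 + (L2n \<rho> (T u))\<^sup>2 + (L2n \<rho> u)\<^sup>2"
  by (simp add: XH.nrm_sq ipX_self del: of_real_add of_real_power)

lemma L2n_le_nrm:
  assumes "u \<in> X"
  shows "L2n \<rho> (weak_div u) \<le> XH.nrm u" "L2n \<rho> (T u) \<le> XH.nrm u" "L2n \<rho> u \<le> XH.nrm u"
  by (rule power2_le_imp_le; use assms in \<open>simp add: X_nrm_sq\<close>)+

lemma X_zero: "(\<lambda>x. 0) \<in> X"
proof -
  have t: "(\<lambda>x. 0 :: complex^3) \<in> test_functions UNIV" by simp
  have "(\<lambda>x. 0 :: complex) \<in> L2w \<rho>" by (rule test_in_L2w) simp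
  moreover have "has_weak_div (\<lambda>x. 0 :: complex^3) (\<lambda>x. 0)" using has_weak_div_test[OF t] by simp
  ultimately show ?thesis
    by (intro XI(1)[OF test_in_L2w[OF t] _ _ flow_deriv_L2w(2)[OF t] has_weak_flow_deriv_test[OF t]])
qed

lemma X_test:
  fixes v :: "real^3 \<Rightarrow> complex^3"
  assumes v: "v \<in> test_functions UNIV"
  shows "v \<in> X" "AE x in lebesgue. weak_div v x = (\<Sum>l\<in>UNIV. partial l v x $ l)"
    "AE x in lebesgue. T v x = flow_deriv b v x"
proof -
  have g: "(\<lambda>x. \<Sum>l\<in>UNIV. partial l v x $ l) \<in> L2w \<rho>"
    by (intro test_in_L2w test_sum test_bounded_linear[OF bounded_linear_vec_nth test_partial[OF v]]) simp
  show "v \<in> X" "AE x in lebesgue. weak_div v x = (\<Sum>l\<in>UNIV. partial l v x $ l)"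
    "AE x in lebesgue. T v x = flow_deriv b v x"
    by (rule XI[OF test_in_L2w[OF v] g has_weak_div_test[OF v] flow_deriv_L2w(2)[OF v] has_weak_flow_deriv_test[OF v]])+
qed

lemma X_times_smooth:
  assumes u: "u \<in> X" and \<eta>: "smooth \<eta>" "\<And>x. \<bar>\<eta> x\<bar> \<le> B" "\<And>l x. \<bar>partial l \<eta> x\<bar> \<le> B"
  shows "(\<lambda>x. \<eta> x *\<^sub>R u x) \<in> X"
    "AE x in lebesgue. weak_div (\<lambda>x. \<eta> x *\<^sub>R u x) x = \<eta> x *\<^sub>R weak_div u x + (\<Sum>l\<in>UNIV. partial l \<eta> x *\<^sub>R u x $ l)"
    "AE x in lebesgue. T (\<lambda>x. \<eta> x *\<^sub>R u x) x = \<eta> x *\<^sub>R T u x + bgrad \<eta> x *\<^sub>R u x"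
proof -
  have B: "B \<ge> 0" using \<eta>(2)[of undefined] by linarith
  obtain C where C: "C \<ge> 0" "AE x in lebesgue. \<bar>bgrad \<eta> x\<bar> \<le> C" using bgrad_bounded(2)[OF \<eta>(1,3)] by blast
  have s: "(\<lambda>x. \<eta> x *\<^sub>R w x) \<in> L2w \<rho>" if "w \<in> L2w \<rho>" for w :: "real^3 \<Rightarrow> 'd::{real_normed_vector, second_countable_topology}"
    by (rule L2w_scaleR_bounded(1)[OF that smooth_measurable[OF \<eta>(1)] _ B]) (simp add: \<eta>)
  have t: "(\<lambda>x. bgrad \<eta> x *\<^sub>R u x) \<in> L2w \<rho>"
    by (rule L2w_scaleR_bounded(1)[OF XD(1)[OF u] bgrad_bounded(1)[OF \<eta>(1,3)] C(2,1)])
  have ul: "(\<lambda>x. u x $ l) \<in> L2w \<rho>" for l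
    by (rule L2w_bound(1)[where C=1, OF XD(1)[OF u] measurable_vec_nth[OF L2w_measurable[OF XD(1)[OF u]]]])
       (simp_all add: Finite_Cartesian_Product.norm_nth_le)
  have pl: "(\<lambda>x. partial l \<eta> x *\<^sub>R u x $ l) \<in> L2w \<rho>" for l
    by (rule L2w_scaleR_bounded(1)[OF ul smooth_measurable[OF smooth_partial[OF \<eta>(1)]] _ B]) (simp add: \<eta>)
  have "(\<lambda>x. \<Sum>l\<in>A. partial l \<eta> x *\<^sub>R u x $ l) \<in> L2w \<rho>" if "finite A" for A
    using that by (induction A rule: finite_induct) (auto intro!: L2w_add pl test_in_L2w[OF test_zero])
  then have ps: "(\<lambda>x. \<Sum>l\<in>UNIV. partial l \<eta> x *\<^sub>R u x $ l) \<in> L2w \<rho>" by simp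
  show "(\<lambda>x. \<eta> x *\<^sub>R u x) \<in> X"
    "AE x in lebesgue. weak_div (\<lambda>x. \<eta> x *\<^sub>R u x) x = \<eta> x *\<^sub>R weak_div u x + (\<Sum>l\<in>UNIV. partial l \<eta> x *\<^sub>R u x $ l)"
    "AE x in lebesgue. T (\<lambda>x. \<eta> x *\<^sub>R u x) x = \<eta> x *\<^sub>R T u x + bgrad \<eta> x *\<^sub>R u x"
    by (rule XI[OF s[OF XD(1)[OF u]] L2w_add[OF s[OF XD(2)[OF u]] ps] has_weak_div_times_smooth[OF XD(3)[OF u] \<eta>]
          L2w_add[OF s[OF XD(4)[OF u]] t] has_weak_flow_deriv_times_smooth[OF XD(1,4,5)[OF u] \<eta>]])+
qed

end

section \<open>Approximate gradients\<close>

lemma norm_pairing_le: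
  fixes f :: "real^3 \<Rightarrow> real" and g :: "real^3 \<Rightarrow> complex"
  assumes f: "f \<in> L2w (\<lambda>_. 1)" and g: "g \<in> L2w (\<lambda>_. 1)"
  shows "integrable lebesgue (\<lambda>x. f x *\<^sub>R g x)" "norm (LINT x|lebesgue. f x *\<^sub>R g x) \<le> L2n (\<lambda>_. 1) f * L2n (\<lambda>_. 1) g"
proof -
  note [measurable] = unweighted.L2w_measurable[OF f] unweighted.L2w_measurable[OF g]
  note c = unweighted.Cauchy_Schwarz_norms[OF f g]
  show i: "integrable lebesgue (\<lambda>x. f x *\<^sub>R g x)"
    by (rule Bochner_Integration.integrable_bound[OF c(1)]) auto
  have "norm (LINT x|lebesgue. f x *\<^sub>R g x) \<le> (LINT x|lebesgue. norm (f x *\<^sub>R g x))" by (rule integral_norm_bound)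
  then show "norm (LINT x|lebesgue. f x *\<^sub>R g x) \<le> L2n (\<lambda>_. 1) f * L2n (\<lambda>_. 1) g" using c(2) by simp
qed

lemma L2n_component_le:
  fixes V :: "real^3 \<Rightarrow> complex^3"
  assumes V: "V \<in> L2w (\<lambda>_. 1)"
  shows "(\<lambda>x. V x $ l) \<in> L2w (\<lambda>_. 1)" "L2n (\<lambda>_. 1) (\<lambda>x. V x $ l) \<le> L2n (\<lambda>_. 1) V"
  using unweighted.L2w_bound[where C=1, OF V measurable_vec_nth[OF unweighted.L2w_measurable[OF V], of l]]
  by (simp_all add: Finite_Cartesian_Product.norm_nth_le)

text \<open>Integration by parts. Because of the subtracted identity, the pairing on the right
  controls the potential and its gradient together, without a Poincare inequality.\<close>

lemma energy_identity:
  fixes \<psi> :: "real^3 \<Rightarrow> real"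
  assumes \<psi>: "\<psi> \<in> test_functions UNIV"
  shows "(L2n (\<lambda>_. 1) \<psi>)\<^sup>2 + (\<Sum>l\<in>UNIV. (L2n (\<lambda>_. 1) (partial l \<psi>))\<^sup>2) =
    - (LINT x|lebesgue. \<psi> x * (laplacian \<psi> x - \<psi> x))"
proof -
  note sm = test_smooth[OF \<psi>]
  have t: "(\<lambda>x. \<psi> x * \<psi> x) \<in> test_functions UNIV" "(\<lambda>x. \<psi> x * partial l (partial l \<psi>) x) \<in> test_functions UNIV" for l
    by (intro test_mult_right sm \<psi> test_partial)+
  have "(LINT x|lebesgue. \<psi> x * partial l (partial l \<psi>) x) = - (L2n (\<lambda>_. 1) (partial l \<psi>))\<^sup>2" for l
    using integral_by_parts_test[OF sm test_partial[OF \<psi>, of l], of l]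
    by (simp add: unweighted.L2n_sq power2_eq_square[of "partial l \<psi> x" for x])
  moreover have "(LINT x|lebesgue. \<psi> x * (laplacian \<psi> x - \<psi> x)) =
    (\<Sum>l\<in>UNIV. LINT x|lebesgue. \<psi> x * partial l (partial l \<psi>) x) - (LINT x|lebesgue. \<psi> x * \<psi> x)"
    using test_integrable[OF t(1)] test_integrable[OF t(2)]
    by (simp add: laplacian_def right_diff_distrib sum_distrib_left)
  moreover have "(LINT x|lebesgue. \<psi> x * \<psi> x) = (L2n (\<lambda>_. 1) \<psi>)\<^sup>2"
    by (simp add: unweighted.L2n_sq power2_eq_square[of "\<psi> x" for x])
  ultimately show ?thesis by (simp add: sum_negf)
qed

text \<open>Pair each potential with its \<open>laplacian \<psi> - \<psi>\<close>, which is close to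
  a part of G = div V, and move the divergence onto the potential: its energy is then bounded
  through V and not through G. So the gradients are small when V is, while the Laplacians still
  reproduce G up to the size of V.\<close>

lemma helmholtz_approx:
  fixes V :: "real^3 \<Rightarrow> complex^3" and G :: "real^3 \<Rightarrow> complex"
  assumes V: "V \<in> L2w (\<lambda>_. 1)" and G: "G \<in> L2w (\<lambda>_. 1)" and div: "has_weak_div V G" and \<delta>: "\<delta> > 0"
  obtains \<psi> \<phi> :: "real^3 \<Rightarrow> real" where "\<psi> \<in> test_functions UNIV" "\<phi> \<in> test_functions UNIV"
    "L2n (\<lambda>_. 1) (\<lambda>x. Complex (laplacian \<psi> x) (laplacian \<phi> x) - G x) \<le> 12 * L2n (\<lambda>_. 1) V + 5 * \<delta>"
    "\<And>l. L2n (\<lambda>_. 1) (partial l \<psi>) \<le> 6 * L2n (\<lambda>_. 1) V + 2 * \<delta>"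
    "\<And>l. L2n (\<lambda>_. 1) (partial l \<phi>) \<le> 6 * L2n (\<lambda>_. 1) V + 2 * \<delta>"
proof -
  let ?n = "L2n (\<lambda>_. 1) :: (real^3 \<Rightarrow> real) \<Rightarrow> real"
  obtain \<psi> \<phi> :: "real^3 \<Rightarrow> real" where t: "\<psi> \<in> test_functions UNIV" "\<phi> \<in> test_functions UNIV"
    and close: "L2n (\<lambda>_. 1) (\<lambda>x. Complex (laplacian \<psi> x - \<psi> x) (laplacian \<phi> x - \<phi> x) - G x) < \<delta>"
    using helmholtz_range_dense[OF G \<delta>] by blast
  define H where "H x = Complex (laplacian \<psi> x - \<psi> x) (laplacian \<phi> x - \<phi> x)" for x
  have ofr: "(\<lambda>x. complex_of_real (f x)) \<in> L2w (\<lambda>_. 1)" if "f \<in> test_functions UNIV" for f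
    by (rule test_L2w[OF test_bounded_linear[OF bounded_linear_of_real that]])
  have cpx: "(\<lambda>x. Complex (f x) (g x)) \<in> L2w (\<lambda>_. 1)" if "f \<in> test_functions UNIV" "g \<in> test_functions UNIV" for f g
    unfolding Complex_eq by (intro unweighted.L2w_add unweighted.L2w_cmult ofr that)
  have H: "H \<in> L2w (\<lambda>_. 1)" unfolding H_def[abs_def] by (intro cpx test_diff test_laplacian t)
  define e where "e x = H x - G x" for x
  have e: "e \<in> L2w (\<lambda>_. 1)" unfolding e_def[abs_def] by (rule unweighted.L2w_diff[OF H G])
  have en: "L2n (\<lambda>_. 1) e \<le> \<delta>" using close by (simp add: e_def[abs_def] H_def)
  \<comment> \<open>The H^1 norm of the complex potential \<psi> + i \<phi>.\<close>
  define N where "N = sqrt ((?n \<psi>)\<^sup>2 + (\<Sum>l\<in>UNIV. (?n (partial l \<psi>))\<^sup>2) + ((?n \<phi>)\<^sup>2 + (\<Sum>l\<in>UNIV. (?n (partial l \<phi>))\<^sup>2)))"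
  have N0: "N \<ge> 0" by (simp add: N_def sum_nonneg)
  have N2: "N\<^sup>2 = (?n \<psi>)\<^sup>2 + (\<Sum>l\<in>UNIV. (?n (partial l \<psi>))\<^sup>2) + ((?n \<phi>)\<^sup>2 + (\<Sum>l\<in>UNIV. (?n (partial l \<phi>))\<^sup>2))"
    unfolding N_def by (intro real_sqrt_pow2 add_nonneg_nonneg sum_nonneg) auto
  have pos: "(\<Sum>l\<in>UNIV. (?n (partial l f))\<^sup>2) \<ge> 0" for f by (simp add: sum_nonneg)
  have single: "(?n (partial l f))\<^sup>2 \<le> (\<Sum>l\<in>UNIV. (?n (partial l f))\<^sup>2)" for l f
    by (rule member_le_sum) auto
  have le: "?n \<psi> \<le> N" "?n \<phi> \<le> N" "?n (partial l \<psi>) \<le> N" "?n (partial l \<phi>) \<le> N" for l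
    by (rule power2_le_imp_le[OF _ N0], use N2 pos[of \<psi>] pos[of \<phi>] single[of l \<psi>] single[of l \<phi>] in \<open>smt (verit) zero_le_power2\<close>)+
  have V3: "norm (LINT x|lebesgue. f x *\<^sub>R G x) \<le> 3 * (N * L2n (\<lambda>_. 1) V)"
    if f: "f \<in> test_functions UNIV" and fN: "\<And>l. ?n (partial l f) \<le> N" for f :: "real^3 \<Rightarrow> real"
  proof -
    have "norm (LINT x|lebesgue. partial l f x *\<^sub>R V x $ l) \<le> N * L2n (\<lambda>_. 1) V" for l
      by (rule order_trans[OF norm_pairing_le(2)[OF test_L2w[OF test_partial[OF f]] L2n_component_le(1)[OF V]]])
         (intro mult_mono fN L2n_component_le(2)[OF V] N0 unweighted.L2n_nonneg)
    then have "norm (\<Sum>l\<in>UNIV. LINT x|lebesgue. partial l f x *\<^sub>R V x $ l) \<le> (\<Sum>l\<in>(UNIV::3 set). N * L2n (\<lambda>_. 1) V)"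
      by (rule sum_norm_le)
    then show ?thesis using has_weak_div_eq[OF div f] by simp
  qed
  have e1: "norm (LINT x|lebesgue. f x *\<^sub>R e x) \<le> N * \<delta>"
    if f: "f \<in> test_functions UNIV" and fN: "?n f \<le> N" for f :: "real^3 \<Rightarrow> real"
    by (rule order_trans[OF norm_pairing_le(2)[OF test_L2w[OF f] e]])
       (intro mult_mono fN en N0 unweighted.L2n_nonneg)
  have split: "(LINT x|lebesgue. f x *\<^sub>R H x) = (LINT x|lebesgue. f x *\<^sub>R G x) + (LINT x|lebesgue. f x *\<^sub>R e x)"
    if f: "f \<in> test_functions UNIV" for f :: "real^3 \<Rightarrow> real"
  proof -
    have "f x *\<^sub>R H x = f x *\<^sub>R G x + f x *\<^sub>R e x" for x by (simp add: e_def scaleR_diff_right)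
    then show ?thesis
      using norm_pairing_le(1)[OF test_L2w[OF f] G] norm_pairing_le(1)[OF test_L2w[OF f] e] by simp
  qed
  have HN: "norm (LINT x|lebesgue. f x *\<^sub>R H x) \<le> N * (3 * L2n (\<lambda>_. 1) V + \<delta>)"
    if f: "f \<in> test_functions UNIV" and fN: "?n f \<le> N" "\<And>l. ?n (partial l f) \<le> N" for f :: "real^3 \<Rightarrow> real"
    unfolding split[OF f] using norm_triangle_mono[OF V3[OF f fN(2)] e1[OF f fN(1)]]
    by (simp add: algebra_simps)
  have "N\<^sup>2 = - Re (LINT x|lebesgue. \<psi> x *\<^sub>R H x) - Im (LINT x|lebesgue. \<phi> x *\<^sub>R H x)"
    unfolding N2 energy_identity[OF t(1)] energy_identity[OF t(2)]
    using integral_Re[OF norm_pairing_le(1)[OF test_L2w[OF t(1)] H]] integral_Im[OF norm_pairing_le(1)[OF test_L2w[OF t(2)] H]]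
    by (simp add: H_def)
  also have "\<dots> \<le> norm (LINT x|lebesgue. \<psi> x *\<^sub>R H x) + norm (LINT x|lebesgue. \<phi> x *\<^sub>R H x)"
    using abs_Re_le_cmod[of "LINT x|lebesgue. \<psi> x *\<^sub>R H x"] abs_Im_le_cmod[of "LINT x|lebesgue. \<phi> x *\<^sub>R H x"] by linarith
  also have "\<dots> \<le> N * (3 * L2n (\<lambda>_. 1) V + \<delta>) + N * (3 * L2n (\<lambda>_. 1) V + \<delta>)"
    by (intro add_mono HN t le)
  \<comment> \<open>One factor N cancels below. The 6 stems from two potentials and three components
    of V, the 2 from two potentials.\<close>
  finally have "N * N \<le> N * (6 * L2n (\<lambda>_. 1) V + 2 * \<delta>)" by (simp add: power2_eq_square algebra_simps)
  then have NB: "N \<le> 6 * L2n (\<lambda>_. 1) V + 2 * \<delta>"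
    using N0 \<delta> unweighted.L2n_nonneg[of V] by (cases "N = 0") (auto simp: mult_le_cancel_left)
  have "L2n (\<lambda>_. 1) (\<lambda>x. Complex (laplacian \<psi> x) (laplacian \<phi> x) - G x) \<le> \<delta> + (N + N)"
  proof -
    have eq: "(\<lambda>x. Complex (laplacian \<psi> x) (laplacian \<phi> x) - G x) = (\<lambda>x. e x + (complex_of_real (\<psi> x) + \<i> * complex_of_real (\<phi> x)))"
      by (auto simp: e_def H_def complex_eq_iff)
    have "L2n (\<lambda>_. 1) (\<lambda>x. complex_of_real (\<psi> x) + \<i> * complex_of_real (\<phi> x)) \<le> L2n (\<lambda>_. 1) (\<lambda>x. complex_of_real (\<psi> x)) + L2n (\<lambda>_. 1) (\<lambda>x. \<i> * complex_of_real (\<phi> x))"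
      by (intro unweighted.L2n_add_le unweighted.L2w_cmult ofr t)
    also have "\<dots> = ?n \<psi> + ?n \<phi>" by (simp add: L2n_def norm_mult)
    finally show ?thesis
      unfolding eq using unweighted.L2n_add_le[OF e unweighted.L2w_add[OF ofr[OF t(1)] unweighted.L2w_cmult[OF ofr[OF t(2)], of \<i>]]] en le(1,2)
      by linarith
  qed
  \<comment> \<open>The error is \<delta> plus the norms of the two potentials, each at most N; this
    gives 12 = 2 * 6 and 5 = 1 + 2 * 2.\<close>
  then have "L2n (\<lambda>_. 1) (\<lambda>x. Complex (laplacian \<psi> x) (laplacian \<phi> x) - G x) \<le> 12 * L2n (\<lambda>_. 1) V + 5 * \<delta>"
    using NB by linarith
  then show thesis using that[OF t] order_trans[OF le(3) NB] order_trans[OF le(4) NB] by blast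
qed

text \<open>The weight 1 has Lipschitz constant 0, so the full Hessian and the Laplacian of a test
  function have equal norms.\<close>

lemma hessian_L2n_le:
  fixes \<psi> :: "real^3 \<Rightarrow> real"
  assumes \<psi>: "\<psi> \<in> test_functions UNIV"
  shows "L2n (\<lambda>_. 1) (partial k (partial l \<psi>)) \<le> L2n (\<lambda>_. 1) (laplacian \<psi>)"
proof -
  have "\<bar>(\<Sum>k\<in>UNIV. \<Sum>l\<in>UNIV. LINT x|lebesgue. 1 * (partial k (partial l \<psi>) x)\<^sup>2) - (LINT x|lebesgue. 1 * (laplacian \<psi> x)\<^sup>2)\<bar>
    \<le> (\<Sum>k\<in>UNIV. \<Sum>l\<in>UNIV. 0 * (LINT x|lebesgue. \<bar>partial l \<psi> x * partial k (partial l \<psi>) x\<bar>)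
        + 0 * (LINT x|lebesgue. \<bar>partial l \<psi> x * partial k (partial k \<psi>) x\<bar>))"
    by (rule hessian_laplacian_weighted[OF \<psi> loc_integrable_const]) (simp add: integral_partial_test)
  then have eq: "(\<Sum>k\<in>UNIV. \<Sum>l\<in>UNIV. (L2n (\<lambda>_. 1) (partial k (partial l \<psi>)))\<^sup>2) = (L2n (\<lambda>_. 1) (laplacian \<psi>))\<^sup>2"
    by (simp add: unweighted.L2n_sq)
  have "(L2n (\<lambda>_. 1) (partial k (partial l \<psi>)))\<^sup>2 \<le> (\<Sum>l\<in>UNIV. (L2n (\<lambda>_. 1) (partial k (partial l \<psi>)))\<^sup>2)"
    by (rule member_le_sum) auto
  also have "\<dots> \<le> (\<Sum>k\<in>UNIV. \<Sum>l\<in>UNIV. (L2n (\<lambda>_. 1) (partial k (partial l \<psi>)))\<^sup>2)"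
    by (rule member_le_sum[of k UNIV "\<lambda>k. \<Sum>l\<in>UNIV. (L2n (\<lambda>_. 1) (partial k (partial l \<psi>)))\<^sup>2"]) (auto simp: sum_nonneg)
  finally have "(L2n (\<lambda>_. 1) (partial k (partial l \<psi>)))\<^sup>2 \<le> (L2n (\<lambda>_. 1) (laplacian \<psi>))\<^sup>2" unfolding eq .
  then show ?thesis by (rule power2_le_imp_le) simp
qed

lemma hessian_weighted_le:
  fixes \<psi> w :: "real^3 \<Rightarrow> real"
  assumes \<psi>: "\<psi> \<in> test_functions UNIV" and w: "loc_integrable UNIV w" and C: "C \<ge> 0"
    and lip: "\<And>l F. F \<in> test_functions UNIV \<Longrightarrow> \<bar>LINT x|lebesgue. w x * partial l F x\<bar> \<le> C * (LINT x|lebesgue. \<bar>F x\<bar>)"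
    and A: "\<And>l. L2n (\<lambda>_. 1) (partial l \<psi>) \<le> A" and B: "L2n (\<lambda>_. 1) (laplacian \<psi>) \<le> B"
  shows "(\<Sum>k\<in>UNIV. \<Sum>l\<in>UNIV. LINT x|lebesgue. w x * (partial k (partial l \<psi>) x)\<^sup>2)
    \<le> (LINT x|lebesgue. w x * (laplacian \<psi> x)\<^sup>2) + 18 * C * A * B"
proof -
  have A0: "A \<ge> 0" using A[of undefined] unweighted.L2n_nonneg[of "partial undefined \<psi>"] by linarith
  have i: "(LINT x|lebesgue. \<bar>partial l \<psi> x * partial k (partial m \<psi>) x\<bar>) \<le> A * B" for k l m
  proof -
    have "(LINT x|lebesgue. \<bar>partial l \<psi> x * partial k (partial m \<psi>) x\<bar>) \<le> L2n (\<lambda>_. 1) (partial l \<psi>) * L2n (\<lambda>_. 1) (partial k (partial m \<psi>))"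
      using unweighted.Cauchy_Schwarz_norms(2)[OF test_L2w[OF test_partial[OF \<psi>]] test_L2w[OF test_partial[OF test_partial[OF \<psi>]]], of l k m]
      by (simp add: abs_mult)
    also have "\<dots> \<le> A * B"
      by (intro mult_mono A order_trans[OF hessian_L2n_le[OF \<psi>] B] A0 unweighted.L2n_nonneg)
    finally show ?thesis .
  qed
  have "(\<Sum>k\<in>UNIV. \<Sum>l\<in>UNIV. C * (LINT x|lebesgue. \<bar>partial l \<psi> x * partial k (partial l \<psi>) x\<bar>)
        + C * (LINT x|lebesgue. \<bar>partial l \<psi> x * partial k (partial k \<psi>) x\<bar>))
    \<le> (\<Sum>k\<in>(UNIV::3 set). \<Sum>l\<in>(UNIV::3 set). C * (A * B) + C * (A * B))"
    by (intro sum_mono add_mono mult_left_mono i C)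
  \<comment> \<open>Nine index pairs with two terms each.\<close>
  also have "\<dots> = 18 * C * A * B" by simp
  finally show ?thesis
    using hessian_laplacian_weighted[OF \<psi> w lip] by linarith
qed

section \<open>The Galbrun form\<close>

lemma bounded_bilinear_if_bilinear:
  fixes h :: "'a::euclidean_space \<Rightarrow> 'b::euclidean_space \<Rightarrow> 'c::real_normed_vector"
  assumes "\<And>x y z. h (x + y) z = h x z + h y z" "\<And>c x z. h (c *\<^sub>R x) z = c *\<^sub>R h x z"
    "\<And>x y z. h x (y + z) = h x y + h x z" "\<And>c x y. h x (c *\<^sub>R y) = c *\<^sub>R h x y"
  shows "bounded_bilinear h"
  using assms by (auto simp: bilinear_conv_bounded_bilinear[symmetric] bilinear_def intro!: linearI)

lemma bounded_bilinear_cdot_cvec: "bounded_bilinear (\<lambda>q u. cdot (cvec q) u)"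
  by (rule bounded_bilinear_if_bilinear)
     (simp_all add: cdot_def cvec_def algebra_simps sum.distrib sum_distrib_left scaleR_conv_of_real[where 'a=complex])

lemma bounded_bilinear_cmat: "bounded_bilinear (\<lambda>M u. cmat M *v u)"
  by (rule bounded_bilinear_if_bilinear)
     (simp_all add: vec_eq_iff cmat_def matrix_vector_mult_def algebra_simps sum.distrib sum_distrib_left scaleR_conv_of_real[where 'a=complex])

lemma ccross_add: "ccross v (u + w) = ccross v u + ccross v w"
  and ccross_scaleR: "ccross v (c *\<^sub>R u) = c *\<^sub>R ccross v u"
  by (auto simp: ccross_def vec_eq_iff forall_3 algebra_simps scaleR_conv_of_real[where 'a=complex])

text \<open>The real argument t is a dummy: it lets an operator with constant coefficients be
  treated as multiplication by a bounded field, namely the constant 1.\<close>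

lemma bounded_bilinear_conv: "bounded_bilinear (\<lambda>(t::real) u. t *\<^sub>R (complex_of_real \<omega> *s u + \<i> *s ccross (cvec \<Omega>) u))"
  by (rule bounded_bilinear_if_bilinear)
     (simp_all add: ccross_add ccross_scaleR vec_eq_iff algebra_simps scaleR_conv_of_real[where 'a=complex])

context weight
begin

lemma L2w_bilinear:
  fixes pr :: "'a::euclidean_space \<Rightarrow> 'b::euclidean_space \<Rightarrow> 'c::euclidean_space"
  assumes pr: "bounded_bilinear pr" and g: "g \<in> borel_measurable lebesgue" "\<exists>C>0. AE x in lebesgue. norm (g x) \<le> C"
  shows "\<exists>K>0. \<forall>u\<in>L2w \<rho>. (\<lambda>x. pr (g x) (u x)) \<in> L2w \<rho> \<and> L2n \<rho> (\<lambda>x. pr (g x) (u x)) \<le> K * L2n \<rho> u"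
proof -
  obtain C where C: "C > 0" "AE x in lebesgue. norm (g x) \<le> C" using g(2) by blast
  obtain K where K: "K > 0" "\<And>a b. norm (pr a b) \<le> norm a * norm b * K"
    using bounded_bilinear.pos_bounded[OF pr] by blast
  have "(\<lambda>x. pr (g x) (u x)) \<in> L2w \<rho> \<and> L2n \<rho> (\<lambda>x. pr (g x) (u x)) \<le> (C * K) * L2n \<rho> u" if u: "u \<in> L2w \<rho>" for u
  proof -
    have m: "(\<lambda>x. pr (g x) (u x)) \<in> borel_measurable lebesgue"
      by (rule borel_measurable_continuous_Pair[where H=pr, OF g(1) L2w_measurable[OF u]])
         (intro bounded_bilinear.continuous_on[OF pr] continuous_intros)
    have le: "AE x in lebesgue. norm (pr (g x) (u x)) \<le> C * K * norm (u x)"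
      using C(2)
    proof eventually_elim
      case (elim x)
      have "norm (pr (g x) (u x)) \<le> norm (g x) * norm (u x) * K" by (rule K)
      also have "\<dots> \<le> C * norm (u x) * K" using elim K(1) by (intro mult_right_mono) auto
      finally show ?case by (simp add: mult_ac)
    qed
    show ?thesis using L2w_bound[OF u m le] C K by simp
  qed
  then show ?thesis using C K by (intro exI[of _ "C * K"]) auto
qed

end

lemma norm_sum6_le:
  fixes a :: "'a::real_normed_vector"
  shows "norm (a + b - c - d - e - f) \<le> norm a + norm b + norm c + norm d + norm e + norm f"
  using norm_triangle_ineq4[of "a + b - c - d - e" f] norm_triangle_ineq4[of "a + b - c - d" e]
    norm_triangle_ineq4[of "a + b - c" d] norm_triangle_ineq4[of "a + b" c] norm_triangle_ineq[of a b]
  by linarith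

text \<open>The almost-everywhere facts that the argument draws from the standing assumptions, with
  \<open>q\<close> and \<open>m1\<close> as abstract bounded fields. The weight \<open>w\<close> is
  a Lipschitz minorant of rho c_s^2 that agrees with it where b may be nonzero: the coefficients are
  Lipschitz only near that set, whereas the integration by parts runs over all of space.
  \<open>\<kappa>\<close> bounds the flow speed relative to the sound speed.\<close>

locale galbrun = flow_field \<rho> b for \<rho> b +
  fixes \<omega> :: real and \<Omega> :: "real^3" and cs \<gamma> w :: "real^3 \<Rightarrow> real"
    and q :: "real^3 \<Rightarrow> real^3" and m1 :: "real^3 \<Rightarrow> real^3^3" and r1 \<kappa> :: real
  assumes omega: "\<omega> \<noteq> 0"
    and cs_measurable: "cs \<in> borel_measurable lebesgue"
    and cs_lower: "\<exists>c>0. AE x in lebesgue. c \<le> cs x" and cs_upper: "\<exists>C>0. AE x in lebesgue. cs x \<le> C"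
    and gamma_measurable: "\<gamma> \<in> borel_measurable lebesgue"
    and gamma_lower: "\<exists>c>0. AE x in lebesgue. c \<le> \<gamma> x" and gamma_upper: "\<exists>C>0. AE x in lebesgue. norm (\<gamma> x) \<le> C"
    and q_measurable: "q \<in> borel_measurable lebesgue" and q_bounded: "\<exists>C>0. AE x in lebesgue. norm (q x) \<le> C"
    and m1_measurable: "m1 \<in> borel_measurable lebesgue" and m1_bounded: "\<exists>C>0. AE x in lebesgue. norm (m1 x) \<le> C"
    and m1_symmetric: "AE x in lebesgue. \<forall>k l. m1 x $ k $ l = m1 x $ l $ k"
    and r1: "r1 > 0" and b_support: "AE x in lebesgue. r1 \<le> norm x \<longrightarrow> b x = 0"
    and kappa: "0 \<le> \<kappa>" "\<kappa> < 1" "AE x in lebesgue. norm (b x) \<le> \<kappa> * cs x"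
    and w_loc: "loc_integrable UNIV w"
    and w_lipschitz: "\<exists>C\<ge>0. \<forall>l. \<forall>F\<in>test_functions UNIV. \<bar>LINT x|lebesgue. w x * partial l F x\<bar> \<le> C * (LINT x|lebesgue. \<bar>F x\<bar>)"
    and w_bounds: "AE x in lebesgue. 0 \<le> w x \<and> w x \<le> \<rho> x * (cs x)\<^sup>2"
    and w_eq: "AE x in lebesgue. norm x < r1 \<longrightarrow> w x = \<rho> x * (cs x)\<^sup>2"
begin

abbreviation "D \<equiv> weak_div :: (real^3 \<Rightarrow> complex^3) \<Rightarrow> real^3 \<Rightarrow> complex"
abbreviation "conv \<equiv> conv_op \<omega> \<Omega> \<rho> b"

definition "Q u x = cdot (cvec (q x)) (u x)" for u :: "real^3 \<Rightarrow> complex^3" and x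
definition "C2 f x = complex_of_real ((cs x)\<^sup>2) * f x" for f :: "real^3 \<Rightarrow> complex" and x
definition "rot u x = complex_of_real \<omega> *s u x + \<i> *s ccross (cvec \<Omega>) (u x)" for u :: "real^3 \<Rightarrow> complex^3" and x
definition "Mu u x = cmat (m1 x) *v u x" for u :: "real^3 \<Rightarrow> complex^3" and x
definition "Gu u x = complex_of_real (\<gamma> x) *s u x" for u :: "real^3 \<Rightarrow> complex^3" and x

definition form :: "(real^3 \<Rightarrow> complex^3) \<Rightarrow> (real^3 \<Rightarrow> complex^3) \<Rightarrow> complex"
  where "form u u' = ip \<rho> (C2 (\<lambda>x. D u x + Q u x)) (\<lambda>x. D u' x + Q u' x)
    - ipv \<rho> (conv u) (conv u') - ipv \<rho> (Mu u) u' - \<i> * complex_of_real \<omega> * ipv \<rho> (Gu u) u'"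

text \<open>The principal part: the terms in which both arguments are differentiated.\<close>

definition form0 :: "(real^3 \<Rightarrow> complex^3) \<Rightarrow> (real^3 \<Rightarrow> complex^3) \<Rightarrow> complex"
  where "form0 u u' = ip \<rho> (C2 (D u)) (D u') - ipv \<rho> (T u) (T u')"

lemma Q_bound: "\<exists>K>0. \<forall>u\<in>L2w \<rho>. Q u \<in> L2w \<rho> \<and> L2n \<rho> (Q u) \<le> K * L2n \<rho> u"
  unfolding Q_def[abs_def] by (rule L2w_bilinear[OF bounded_bilinear_cdot_cvec q_measurable q_bounded])

lemma Mu_bound: "\<exists>K>0. \<forall>u\<in>L2w \<rho>. Mu u \<in> L2w \<rho> \<and> L2n \<rho> (Mu u) \<le> K * L2n \<rho> u"
  unfolding Mu_def[abs_def] by (rule L2w_bilinear[OF bounded_bilinear_cmat m1_measurable m1_bounded])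

lemma Gu_bound: "\<exists>K>0. \<forall>u\<in>L2w \<rho>. Gu u \<in> L2w \<rho> \<and> L2n \<rho> (Gu u) \<le> K * L2n \<rho> u"
proof -
  have "Gu u = (\<lambda>x. \<gamma> x *\<^sub>R u x)" for u
    by (simp add: Gu_def[abs_def] fun_eq_iff vec_eq_iff scaleR_conv_of_real[where 'a=complex])
  then show ?thesis using L2w_bilinear[OF bounded_bilinear_scaleR[where 'a="complex^3"] gamma_measurable gamma_upper] by simp
qed

lemma rot_bound: "\<exists>K>0. \<forall>u\<in>L2w \<rho>. rot u \<in> L2w \<rho> \<and> L2n \<rho> (rot u) \<le> K * L2n \<rho> u"
proof -
  have "\<exists>C>0. AE x in (lebesgue :: (real^3) measure). norm (1::real) \<le> C" by (intro exI[of _ 1]) simp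
  from L2w_bilinear[OF bounded_bilinear_conv[of \<omega> \<Omega>] borel_measurable_const this]
  show ?thesis by (simp add: rot_def[abs_def])
qed

lemma cs2_upper: "\<exists>C>0. AE x in lebesgue. norm ((cs x)\<^sup>2) \<le> C"
proof -
  obtain C c where C: "C > 0" "AE x in lebesgue. cs x \<le> C" and c: "c > 0" "AE x in lebesgue. c \<le> cs x"
    using cs_upper cs_lower by blast
  have "AE x in lebesgue. norm ((cs x)\<^sup>2) \<le> C\<^sup>2"
    using C(2) c(2) by eventually_elim (use c(1) in \<open>simp add: power_mono\<close>)
  then show ?thesis using C by (intro exI[of _ "C\<^sup>2"]) auto
qed

lemma C2_bound: "\<exists>K>0. \<forall>f\<in>L2w \<rho>. C2 f \<in> L2w \<rho> \<and> L2n \<rho> (C2 f) \<le> K * L2n \<rho> f"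
proof -
  have "C2 f = (\<lambda>x. (cs x)\<^sup>2 *\<^sub>R f x)" for f
    by (simp add: C2_def[abs_def] fun_eq_iff scaleR_conv_of_real)
  then show ?thesis
    using L2w_bilinear[OF bounded_bilinear_scaleR[where 'a=complex] borel_measurable_power[OF cs_measurable] cs2_upper] by simp
qed

lemma L2w_ops:
  shows "u \<in> L2w \<rho> \<Longrightarrow> Q u \<in> L2w \<rho>" "u \<in> L2w \<rho> \<Longrightarrow> Mu u \<in> L2w \<rho>" "u \<in> L2w \<rho> \<Longrightarrow> Gu u \<in> L2w \<rho>"
    "u \<in> L2w \<rho> \<Longrightarrow> rot u \<in> L2w \<rho>" "f \<in> L2w \<rho> \<Longrightarrow> C2 f \<in> L2w \<rho>"
  using Q_bound Mu_bound Gu_bound rot_bound C2_bound by blast+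

lemma conv_eq: "conv u = (\<lambda>x. \<i> *s T u x + rot u x)"
  by (auto simp: conv_op_def rot_def fun_eq_iff add_ac)

lemma conv_L2w: "u \<in> X \<Longrightarrow> conv u \<in> L2w \<rho>"
  unfolding conv_eq by (intro L2w_add L2w_smult XD L2w_ops)

lemma ipv_i_i: "u \<in> L2w \<rho> \<Longrightarrow> v \<in> L2w \<rho> \<Longrightarrow> ipv \<rho> (\<lambda>x. \<i> *s u x) (\<lambda>x. \<i> *s v x) = ipv \<rho> u v"
  using V.ip_smul[of u "\<lambda>x. \<i> *s v x" \<i>] V.ip_smul_right[of v u \<i>] L2w_smult[of v \<i>] by simp

lemma C2_add: "C2 (\<lambda>x. f x + g x) = (\<lambda>x. C2 f x + C2 g x)"
  by (simp add: C2_def[abs_def] distrib_left)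

lemma L2n_i: "L2n \<rho> (\<lambda>x. \<i> *s u x) = L2n \<rho> u" for u :: "real^3 \<Rightarrow> complex^3"
  by (simp add: L2n_def norm_smult_vec)

text \<open>Every term missing from \<open>form0\<close> has an undifferentiated argument on at
  least one side, and this side supplies an L^2 norm.\<close>

lemma form_lower_order:
  "\<exists>K>0. \<forall>u\<in>X. \<forall>u'\<in>X. cmod (form u u' - form0 u u') \<le> K * (L2n \<rho> u * XH.nrm u' + XH.nrm u * L2n \<rho> u')"
proof -
  obtain kq where kq: "kq > 0" "\<And>u. u \<in> L2w \<rho> \<Longrightarrow> L2n \<rho> (Q u) \<le> kq * L2n \<rho> u" using Q_bound by blast
  obtain km where km: "km > 0" "\<And>u. u \<in> L2w \<rho> \<Longrightarrow> L2n \<rho> (Mu u) \<le> km * L2n \<rho> u" using Mu_bound by blast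
  obtain kg where kg: "kg > 0" "\<And>u. u \<in> L2w \<rho> \<Longrightarrow> L2n \<rho> (Gu u) \<le> kg * L2n \<rho> u" using Gu_bound by blast
  obtain kr where kr: "kr > 0" "\<And>u. u \<in> L2w \<rho> \<Longrightarrow> L2n \<rho> (rot u) \<le> kr * L2n \<rho> u" using rot_bound by blast
  obtain kc where kc: "kc > 0" "\<And>f. f \<in> L2w \<rho> \<Longrightarrow> L2n \<rho> (C2 f) \<le> kc * L2n \<rho> f" using C2_bound by blast
  \<comment> \<open>One summand for each of the six pairings estimated below, in the same
    order.\<close>
  define K where "K = kc * kq + kc * kq * (1 + kq) + kr + kr * (1 + kr) + km + \<bar>\<omega>\<bar> * kg"
  have "K > 0" using kq km kg kr kc unfolding K_def by (intro add_pos_nonneg mult_pos_pos add_pos_pos) auto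
  moreover have "cmod (form u u' - form0 u u') \<le> K * (L2n \<rho> u * XH.nrm u' + XH.nrm u * L2n \<rho> u')"
    if u: "u \<in> X" and u': "u' \<in> X" for u u'
  proof -
    note U = XD[OF u] and U' = XD[OF u']
    let ?U = "L2n \<rho> u" and ?U' = "L2n \<rho> u'" and ?N = "XH.nrm u" and ?N' = "XH.nrm u'"
    have nn: "0 \<le> ?U" "0 \<le> ?U'" "0 \<le> ?N" "0 \<le> ?N'" using u u' by auto
    note nl = L2n_le_nrm[OF u] and nl' = L2n_le_nrm[OF u']
    have DL: "(\<lambda>x. D u x + Q u x) \<in> L2w \<rho>" "(\<lambda>x. D u' x + Q u' x) \<in> L2w \<rho>" by (intro L2w_add U U' L2w_ops)+
    have e1: "ip \<rho> (C2 (\<lambda>x. D u x + Q u x)) (\<lambda>x. D u' x + Q u' x) =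
      ip \<rho> (C2 (D u)) (D u') + ip \<rho> (C2 (D u)) (Q u') + ip \<rho> (C2 (Q u)) (\<lambda>x. D u' x + Q u' x)"
      unfolding C2_add by (simp add: S.ip_add S.ip_add_right L2w_ops U U' DL)
    have TL: "(\<lambda>x. \<i> *s T u x) \<in> L2w \<rho>" "(\<lambda>x. \<i> *s T u' x) \<in> L2w \<rho>" by (intro L2w_smult U U')+
    have e2: "ipv \<rho> (conv u) (conv u') = ipv \<rho> (T u) (T u') + ipv \<rho> (\<lambda>x. \<i> *s T u x) (rot u') + ipv \<rho> (rot u) (conv u')"
    proof -
      have "ipv \<rho> (conv u) (conv u') = ipv \<rho> (\<lambda>x. \<i> *s T u x) (conv u') + ipv \<rho> (rot u) (conv u')"
        by (subst conv_eq[of u]) (intro V.ip_add TL L2w_ops U conv_L2w u')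
      also have "ipv \<rho> (\<lambda>x. \<i> *s T u x) (conv u') = ipv \<rho> (\<lambda>x. \<i> *s T u x) (\<lambda>x. \<i> *s T u' x) + ipv \<rho> (\<lambda>x. \<i> *s T u x) (rot u')"
        by (subst conv_eq[of u']) (intro V.ip_add_right TL L2w_ops U')
      also have "ipv \<rho> (\<lambda>x. \<i> *s T u x) (\<lambda>x. \<i> *s T u' x) = ipv \<rho> (T u) (T u')" by (rule ipv_i_i[OF U(4) U'(4)])
      finally show ?thesis .
    qed
    have E: "form u u' - form0 u u' = ip \<rho> (C2 (D u)) (Q u') + ip \<rho> (C2 (Q u)) (\<lambda>x. D u' x + Q u' x)
      - ipv \<rho> (\<lambda>x. \<i> *s T u x) (rot u') - ipv \<rho> (rot u) (conv u') - ipv \<rho> (Mu u) u'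
      - \<i> * complex_of_real \<omega> * ipv \<rho> (Gu u) u'"
      unfolding form_def form0_def e1 e2 by simp
    have "cmod (form u u' - form0 u u') \<le> cmod (ip \<rho> (C2 (D u)) (Q u')) + cmod (ip \<rho> (C2 (Q u)) (\<lambda>x. D u' x + Q u' x))
      + cmod (ipv \<rho> (\<lambda>x. \<i> *s T u x) (rot u')) + cmod (ipv \<rho> (rot u) (conv u')) + cmod (ipv \<rho> (Mu u) u')
      + cmod (\<i> * complex_of_real \<omega> * ipv \<rho> (Gu u) u')"
      unfolding E by (rule norm_sum6_le)
    also have "\<dots> \<le> (kc * ?N) * (kq * ?U') + (kc * (kq * ?U)) * ((1 + kq) * ?N') + ?N * (kr * ?U')
      + (kr * ?U) * ((1 + kr) * ?N') + (km * ?U) * ?N' + \<bar>\<omega>\<bar> * ((kg * ?U) * ?N')"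
    proof (intro add_mono)
      have kcD: "L2n \<rho> (C2 (D u)) \<le> kc * ?N"
        by (rule order_trans[OF kc(2)[OF U(2)]]) (use kc nl in \<open>simp add: mult_left_mono\<close>)
      have kqU: "L2n \<rho> (Q u') \<le> kq * ?U'" by (rule kq(2)[OF U'(1)])
      show "cmod (ip \<rho> (C2 (D u)) (Q u')) \<le> (kc * ?N) * (kq * ?U')"
        by (rule order_trans[OF ip_Cauchy_Schwarz[OF L2w_ops(5)[OF U(2)] L2w_ops(1)[OF U'(1)]]])
           (intro mult_mono kcD kqU mult_nonneg_nonneg nn less_imp_le[OF kc(1)] L2n_nonneg)
      have "L2n \<rho> (C2 (Q u)) \<le> kc * (kq * ?U)"
        by (rule order_trans[OF kc(2)[OF L2w_ops(1)[OF U(1)]]]) (use kc kq(2)[OF U(1)] in \<open>simp add: mult_left_mono\<close>)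
      moreover have "L2n \<rho> (\<lambda>x. D u' x + Q u' x) \<le> (1 + kq) * ?N'"
      proof -
        have "L2n \<rho> (\<lambda>x. D u' x + Q u' x) \<le> L2n \<rho> (D u') + L2n \<rho> (Q u')" by (intro L2n_add_le U' L2w_ops)
        also have "\<dots> \<le> ?N' + kq * ?N'"
          using nl' kqU mult_left_mono[OF nl'(3), of kq] kq(1) by linarith
        finally show ?thesis by (simp add: distrib_right)
      qed
      ultimately show "cmod (ip \<rho> (C2 (Q u)) (\<lambda>x. D u' x + Q u' x)) \<le> (kc * (kq * ?U)) * ((1 + kq) * ?N')"
        by (intro order_trans[OF ip_Cauchy_Schwarz[OF L2w_ops(5)[OF L2w_ops(1)[OF U(1)]] DL(2)]] mult_mono
            mult_nonneg_nonneg nn less_imp_le[OF kc(1)] less_imp_le[OF kq(1)] L2n_nonneg)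
      have krU: "L2n \<rho> (rot u') \<le> kr * ?U'" by (rule kr(2)[OF U'(1)])
      show "cmod (ipv \<rho> (\<lambda>x. \<i> *s T u x) (rot u')) \<le> ?N * (kr * ?U')"
        by (rule order_trans[OF ipv_Cauchy_Schwarz[OF TL(1) L2w_ops(4)[OF U'(1)]]])
           (unfold L2n_i, intro mult_mono krU nl nn L2n_nonneg)
      have "L2n \<rho> (conv u') \<le> (1 + kr) * ?N'"
      proof -
        have "L2n \<rho> (conv u') \<le> L2n \<rho> (\<lambda>x. \<i> *s T u' x) + L2n \<rho> (rot u')"
          unfolding conv_eq by (intro L2n_add_le TL L2w_ops U')
        also have "\<dots> \<le> ?N' + kr * ?N'"
          unfolding L2n_i using nl' krU mult_left_mono[OF nl'(3), of kr] kr(1) by linarith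
        finally show ?thesis by (simp add: distrib_right)
      qed
      then show "cmod (ipv \<rho> (rot u) (conv u')) \<le> (kr * ?U) * ((1 + kr) * ?N')"
        by (intro order_trans[OF ipv_Cauchy_Schwarz[OF L2w_ops(4)[OF U(1)] conv_L2w[OF u']]] mult_mono kr(2) U
            mult_nonneg_nonneg nn less_imp_le[OF kr(1)] L2n_nonneg)
      show "cmod (ipv \<rho> (Mu u) u') \<le> (km * ?U) * ?N'"
        by (intro order_trans[OF ipv_Cauchy_Schwarz[OF L2w_ops(2)[OF U(1)] U'(1)]] mult_mono km(2) U nl'
            mult_nonneg_nonneg nn less_imp_le[OF km(1)] L2n_nonneg)
      have "cmod (ipv \<rho> (Gu u) u') \<le> (kg * ?U) * ?N'"
        by (intro order_trans[OF ipv_Cauchy_Schwarz[OF L2w_ops(3)[OF U(1)] U'(1)]] mult_mono kg(2) U nl'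
            mult_nonneg_nonneg nn less_imp_le[OF kg(1)] L2n_nonneg)
      then show "cmod (\<i> * complex_of_real \<omega> * ipv \<rho> (Gu u) u') \<le> \<bar>\<omega>\<bar> * ((kg * ?U) * ?N')"
        by (simp add: norm_mult mult_left_mono)
    qed
    also have "\<dots> = (kc * kq + kr) * (?N * ?U') + (kc * kq * (1 + kq) + kr * (1 + kr) + km + \<bar>\<omega>\<bar> * kg) * (?U * ?N')"
      by (simp add: algebra_simps)
    also have "\<dots> \<le> K * (?N * ?U') + K * (?U * ?N')"
    proof -
      have p: "0 \<le> kc * kq" "0 \<le> kc * kq * (1 + kq)" "0 \<le> kr * (1 + kr)" "0 \<le> \<bar>\<omega>\<bar> * kg"
        using kq kc kr kg by simp_all
      have "kc * kq + kr \<le> K" using p km(1) unfolding K_def by linarith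
      moreover have "kc * kq * (1 + kq) + kr * (1 + kr) + km + \<bar>\<omega>\<bar> * kg \<le> K" using p kr(1) unfolding K_def by linarith
      ultimately show ?thesis using nn by (intro add_mono mult_right_mono) simp_all
    qed
    finally show ?thesis by (simp add: algebra_simps)
  qed
  ultimately show ?thesis by blast
qed

lemma form0_bound: "\<exists>K>0. \<forall>u\<in>X. \<forall>u'\<in>X. cmod (form0 u u') \<le> K * (XH.nrm u * XH.nrm u')"
proof -
  obtain kc where kc: "kc > 0" "\<And>f. f \<in> L2w \<rho> \<Longrightarrow> L2n \<rho> (C2 f) \<le> kc * L2n \<rho> f" using C2_bound by blast
  have "cmod (form0 u u') \<le> (kc + 1) * (XH.nrm u * XH.nrm u')" if u: "u \<in> X" "u' \<in> X" for u u'
  proof -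
    note U = XD[OF u(1)] and U' = XD[OF u(2)]
    note nl = L2n_le_nrm[OF u(1)] and nl' = L2n_le_nrm[OF u(2)]
    have n: "0 \<le> XH.nrm u" "0 \<le> XH.nrm u'" using u by auto
    have "L2n \<rho> (C2 (D u)) \<le> kc * XH.nrm u"
      by (rule order_trans[OF kc(2)[OF U(2)]]) (use kc nl in \<open>simp add: mult_left_mono\<close>)
    then have "cmod (ip \<rho> (C2 (D u)) (D u')) \<le> (kc * XH.nrm u) * XH.nrm u'"
      by (intro order_trans[OF ip_Cauchy_Schwarz[OF L2w_ops(5)[OF U(2)] U'(2)]] mult_mono nl' n mult_nonneg_nonneg less_imp_le[OF kc(1)] L2n_nonneg)
    moreover have "cmod (ipv \<rho> (T u) (T u')) \<le> XH.nrm u * XH.nrm u'"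
      by (intro order_trans[OF ipv_Cauchy_Schwarz[OF U(4) U'(4)]] mult_mono nl nl' n L2n_nonneg)
    ultimately have "cmod (form0 u u') \<le> (kc * XH.nrm u) * XH.nrm u' + XH.nrm u * XH.nrm u'"
      unfolding form0_def using norm_triangle_ineq4[of "ip \<rho> (C2 (D u)) (D u')" "ipv \<rho> (T u) (T u')"] by linarith
    then show ?thesis by (simp add: algebra_simps)
  qed
  then show ?thesis using kc(1) by (intro exI[of _ "kc + 1"]) auto
qed

lemma form_bound: "\<exists>K>0. \<forall>u\<in>X. \<forall>u'\<in>X. cmod (form u u') \<le> K * XH.nrm u * XH.nrm u'"
proof -
  obtain K where K: "K > 0" "\<And>u u'. u \<in> X \<Longrightarrow> u' \<in> X \<Longrightarrow>
    cmod (form u u' - form0 u u') \<le> K * (L2n \<rho> u * XH.nrm u' + XH.nrm u * L2n \<rho> u')"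
    using form_lower_order by blast
  obtain K' where K': "K' > 0" "\<And>u u'. u \<in> X \<Longrightarrow> u' \<in> X \<Longrightarrow> cmod (form0 u u') \<le> K' * (XH.nrm u * XH.nrm u')"
    using form0_bound by blast
  have "cmod (form u u') \<le> (2 * K + K') * XH.nrm u * XH.nrm u'" if u: "u \<in> X" "u' \<in> X" for u u'
  proof -
    have n: "0 \<le> XH.nrm u" "0 \<le> XH.nrm u'" using u by auto
    have "L2n \<rho> u * XH.nrm u' + XH.nrm u * L2n \<rho> u' \<le> XH.nrm u * XH.nrm u' + XH.nrm u * XH.nrm u'"
      by (intro add_mono mult_mono L2n_le_nrm u n L2n_nonneg order_refl)
    then have "L2n \<rho> u * XH.nrm u' + XH.nrm u * L2n \<rho> u' \<le> 2 * (XH.nrm u * XH.nrm u')" by linarith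
    then have "K * (L2n \<rho> u * XH.nrm u' + XH.nrm u * L2n \<rho> u') \<le> K * (2 * (XH.nrm u * XH.nrm u'))"
      using K(1) by (intro mult_left_mono) auto
    moreover have "cmod (form u u') \<le> cmod (form u u' - form0 u u') + cmod (form0 u u')"
      using norm_triangle_ineq[of "form u u' - form0 u u'" "form0 u u'"] by simp
    ultimately have "cmod (form u u') \<le> K * (2 * (XH.nrm u * XH.nrm u')) + K' * (XH.nrm u * XH.nrm u')"
      using K(2)[OF u] K'(2)[OF u] by linarith
    then show ?thesis by (simp add: algebra_simps)
  qed
  then show ?thesis using K(1) K'(1) by (intro exI[of _ "2 * K + K'"]) auto
qed

lemma Re_integral_nonneg_Im0:
  fixes f :: "real^3 \<Rightarrow> complex"
  assumes "AE x in lebesgue. Im (f x) = 0" "f \<in> borel_measurable lebesgue"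
  shows "Im (LINT x|lebesgue. f x) = 0"
proof (cases "integrable lebesgue f")
  case True
  have "(LINT x|lebesgue. Im (f x)) = (LINT x::real^3|lebesgue. 0)"
    by (rule integral_cong_AE) (use assms in auto)
  then show ?thesis using integral_Im[OF True] by simp
qed (simp add: not_integrable_integral_eq)

text \<open>On the diagonal the first three terms are real, the third because \<open>m1\<close> is
  real and symmetric. Only the damping term is imaginary, and \<gamma> is bounded below.\<close>

lemma form_Im:
  "\<exists>c>0. \<forall>u\<in>X. c * (L2n \<rho> u)\<^sup>2 \<le> cmod (form u u)"
proof -
  obtain c where c: "c > 0" "AE x in lebesgue. c \<le> \<gamma> x" using gamma_lower by blast
  have "\<bar>\<omega>\<bar> * c * (L2n \<rho> u)\<^sup>2 \<le> cmod (form u u)" if u: "u \<in> X" for u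
  proof -
    note U = XD[OF u]
    have DL: "(\<lambda>x. D u x + Q u x) \<in> L2w \<rho>" by (intro L2w_add U L2w_ops)
    have i1: "Im (ip \<rho> (C2 (\<lambda>x. D u x + Q u x)) (\<lambda>x. D u x + Q u x)) = 0"
      unfolding ip_def
    proof (rule Re_integral_nonneg_Im0)
      show "(\<lambda>x. complex_of_real (\<rho> x) * (C2 (\<lambda>x. D u x + Q u x) x * cnj (D u x + Q u x))) \<in> borel_measurable lebesgue"
        using ip_integrable[OF L2w_ops(5)[OF DL] DL] by auto
      have "Im (complex_of_real r * ((complex_of_real s * z) * cnj z)) = 0" for r s z
        by (simp add: algebra_simps)
      then show "AE x in lebesgue. Im (complex_of_real (\<rho> x) * (C2 (\<lambda>x. D u x + Q u x) x * cnj (D u x + Q u x))) = 0"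
        unfolding C2_def by (intro AE_I2)
    qed
    have i2: "Im (ipv \<rho> (conv u) (conv u)) = 0" by (simp add: ipv_self_L2n del: of_real_power)
    have i3: "Im (ipv \<rho> (Mu u) u) = 0"
      unfolding ipv_def
    proof (rule Re_integral_nonneg_Im0)
      show "(\<lambda>x. complex_of_real (\<rho> x) * cdot (Mu u x) (vcnj (u x))) \<in> borel_measurable lebesgue"
        using ipv_integrable[OF L2w_ops(2)[OF U(1)] U(1)] by auto
      show "AE x in lebesgue. Im (complex_of_real (\<rho> x) * cdot (Mu u x) (vcnj (u x))) = 0"
        using m1_symmetric
      proof eventually_elim
        case (elim x)
        let ?c = "cdot (Mu u x) (vcnj (u x))"
        have "?c = (\<Sum>k\<in>UNIV. \<Sum>l\<in>UNIV. complex_of_real (m1 x $ k $ l) * u x $ l * cnj (u x $ k))"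
          by (simp add: cdot_def Mu_def matrix_vector_mult_def cmat_def vcnj_def sum_distrib_right)
        also have "\<dots> = (\<Sum>l\<in>UNIV. \<Sum>k\<in>UNIV. complex_of_real (m1 x $ k $ l) * u x $ l * cnj (u x $ k))"
          by (rule sum.swap)
        also have "\<dots> = (\<Sum>l\<in>UNIV. \<Sum>k\<in>UNIV. cnj (complex_of_real (m1 x $ l $ k) * u x $ k * cnj (u x $ l)))"
          using elim by (intro sum.cong refl) (simp add: mult_ac)
        also have "\<dots> = cnj ?c"
          by (simp add: cdot_def Mu_def matrix_vector_mult_def cmat_def vcnj_def sum_distrib_right)
        finally have "Im ?c = 0" by (metis Im_complex_of_real Reals_cases Reals_cnj_iff)
        then show ?case by simp
      qed
    qed
    have i4: "c * (L2n \<rho> u)\<^sup>2 \<le> Re (ipv \<rho> (Gu u) u)"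
    proof -
      have g: "complex_of_real (\<rho> x) * cdot (Gu u x) (vcnj (u x)) = complex_of_real (\<gamma> x * (\<rho> x * (norm (u x))\<^sup>2))" for x
      proof -
        have "cdot (Gu u x) (vcnj (u x)) = complex_of_real (\<gamma> x) * cdot (u x) (vcnj (u x))"
          by (simp add: Gu_def cdot_def sum_distrib_left mult_ac)
        then show ?thesis by (simp add: cdot_vcnj_self del: of_real_power)
      qed
      have "integrable lebesgue (\<lambda>x. complex_of_real (\<gamma> x * (\<rho> x * (norm (u x))\<^sup>2)))"
        using ipv_integrable[OF L2w_ops(3)[OF U(1)] U(1)] unfolding g .
      then have gi: "integrable lebesgue (\<lambda>x. \<gamma> x * (\<rho> x * (norm (u x))\<^sup>2))" by (simp only: complex_of_real_integrable_eq)
      have "c * (L2n \<rho> u)\<^sup>2 = (LINT x|lebesgue. c * (\<rho> x * (norm (u x))\<^sup>2))" by (simp add: L2n_sq)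
      also have "\<dots> \<le> (LINT x|lebesgue. \<gamma> x * (\<rho> x * (norm (u x))\<^sup>2))"
      proof (rule integral_mono_AE[OF _ gi])
        show "integrable lebesgue (\<lambda>x. c * (\<rho> x * (norm (u x))\<^sup>2))" using L2w_integrable[OF U(1)] by simp
        show "AE x in lebesgue. c * (\<rho> x * (norm (u x))\<^sup>2) \<le> \<gamma> x * (\<rho> x * (norm (u x))\<^sup>2)"
          using c(2) weight_pos by eventually_elim (simp add: mult_right_mono)
      qed
      also have "\<dots> = Re (ipv \<rho> (Gu u) u)" unfolding ipv_def g by (simp only: integral_complex_of_real Re_complex_of_real)
      finally show ?thesis .
    qed
    have "Im (form u u) = - \<omega> * Re (ipv \<rho> (Gu u) u)"
      unfolding form_def using i1 i2 i3 by simp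
    then have "\<bar>Im (form u u)\<bar> = \<bar>\<omega>\<bar> * \<bar>Re (ipv \<rho> (Gu u) u)\<bar>" by (simp add: abs_mult)
    moreover have "\<bar>\<omega>\<bar> * (c * (L2n \<rho> u)\<^sup>2) \<le> \<bar>\<omega>\<bar> * \<bar>Re (ipv \<rho> (Gu u) u)\<bar>"
      by (intro mult_left_mono order_trans[OF i4 abs_ge_self]) auto
    ultimately show ?thesis using abs_Im_le_cmod[of "form u u"] by (simp add: mult_ac)
  qed
  then show ?thesis using c omega by (intro exI[of _ "\<bar>\<omega>\<bar> * c"]) auto
qed

end

section \<open>The lower bound\<close>

context galbrun
begin

lemma vanishes_on_ball_partial:
  assumes "\<And>x. norm x < r \<Longrightarrow> f x = 0" "norm x < r"
  shows "partial l f x = 0"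
proof (rule partial_eq_0_outside)
  have "closure {x. f x \<noteq> 0} \<subseteq> - ball 0 r"
    by (rule closure_minimal) (use assms(1) in force)+
  then show "x \<notin> closure {x. f x \<noteq> 0}" using assms(2) by auto
qed

text \<open>b vanishes outside the ball of radius r1 and \<eta> inside it, so the flow does not act
  on \<eta> u. The weak definition also contains div(rho b), hence \<open>dv0\<close>: this function
  vanishes wherever \<eta> does not.\<close>

lemma flow_deriv_cutoff_zero:
  assumes u: "u \<in> X" and \<eta>: "smooth \<eta>" "\<And>x. \<bar>\<eta> x\<bar> \<le> B" "\<And>l x. \<bar>partial l \<eta> x\<bar> \<le> B"
    and z: "\<And>x. norm x < r1 \<Longrightarrow> \<eta> x = 0"
  shows "AE x in lebesgue. T (\<lambda>x. \<eta> x *\<^sub>R u x) x = 0" "AE x in lebesgue. \<eta> x *\<^sub>R T u x = 0"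
proof -
  have dv0: "AE x in lebesgue. x \<in> UNIV \<longrightarrow> \<eta> x *\<^sub>R dv x = 0"
  proof (rule AE_zero_if_test)
    show "loc_integrable UNIV (\<lambda>x. \<eta> x *\<^sub>R dv x)"
      by (rule loc_integrable_bounded_mult[where B=B, OF has_weak_div_loc(2)[OF dv] smooth_measurable[OF \<eta>(1)]]) (simp add: \<eta>)
    fix F :: "real^3 \<Rightarrow> real" assume F: "F \<in> test_functions UNIV"
    have t: "(\<lambda>x. \<eta> x * F x) \<in> test_functions UNIV" by (rule test_mult_right[OF \<eta>(1) F])
    have "(LINT x|lebesgue. partial l (\<lambda>x. \<eta> x * F x) x *\<^sub>R (\<rho> x *\<^sub>R b x) $ l) = (LINT x::real^3|lebesgue. 0)" for l
    proof (rule integral_cong_AE)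
      show "(\<lambda>x. partial l (\<lambda>x. \<eta> x * F x) x *\<^sub>R (\<rho> x *\<^sub>R b x) $ l) \<in> borel_measurable lebesgue"
        using integrable_test_scaleR[OF has_weak_div_loc(1)[OF dv] test_partial[OF t]] by (rule borel_measurable_integrable)
      show "AE x in lebesgue. partial l (\<lambda>x. \<eta> x * F x) x *\<^sub>R (\<rho> x *\<^sub>R b x) $ l = 0"
        using b_support
      proof eventually_elim
        case (elim x)
        show ?case
        proof (cases "norm x < r1")
          case True
          have "partial l (\<lambda>x. \<eta> x * F x) x = 0" by (rule vanishes_on_ball_partial[OF _ True]) (simp add: z)
          then show ?thesis by simp
        qed (use elim in simp)
      qed
    qed simp
    then have "(LINT x|lebesgue. (\<eta> x * F x) *\<^sub>R dv x) = 0" using has_weak_div_eq[OF dv t] by simp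
    then show "(LINT x|lebesgue. \<eta> x *\<^sub>R dv x * F x) = 0" by (simp add: mult_ac)
  qed simp
  have su: "(\<lambda>x. \<eta> x *\<^sub>R u x) \<in> X" by (rule X_times_smooth(1)[OF u \<eta>])
  have z0: "(\<lambda>x. 0 :: complex^3) \<in> L2w \<rho>" by (rule test_in_L2w) simp
  have h: "has_weak_flow_deriv \<rho> b (\<lambda>x. \<eta> x *\<^sub>R u x) (\<lambda>x. 0)"
  proof (rule has_weak_flow_derivI[OF XD(1)[OF su] z0])
    fix u' :: "real^3 \<Rightarrow> complex^3" assume u': "u' \<in> test_functions UNIV"
    have "ipv \<rho> (\<lambda>x. \<eta> x *\<^sub>R u x) (flow_deriv b u') = (LINT x::real^3|lebesgue. 0)"
      unfolding ipv_def
    proof (rule integral_cong_AE)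
      show "(\<lambda>x. complex_of_real (\<rho> x) * cdot (\<eta> x *\<^sub>R u x) (vcnj (flow_deriv b u' x))) \<in> borel_measurable lebesgue"
        using ipv_integrable[OF XD(1)[OF su] flow_deriv_L2w(2)[OF u']] by (rule borel_measurable_integrable)
      show "AE x in lebesgue. complex_of_real (\<rho> x) * cdot (\<eta> x *\<^sub>R u x) (vcnj (flow_deriv b u' x)) = 0"
        using b_support
      proof eventually_elim
        case (elim x)
        show ?case
        proof (cases "norm x < r1")
          case False
          then have "flow_deriv b u' x = 0" using elim by (simp add: flow_deriv_def)
          then show ?thesis by (simp add: bounded_bilinear.zero_right[OF bounded_bilinear_cdot_vcnj])
        qed (simp add: z bounded_bilinear.zero_left[OF bounded_bilinear_cdot_vcnj])
      qed
    qed simp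
    moreover have "dterm (\<lambda>x. \<eta> x *\<^sub>R u x) u' = (LINT x::real^3|lebesgue. 0)"
      unfolding dterm_eq
    proof (rule integral_cong_AE)
      show "(\<lambda>x. cdot (\<eta> x *\<^sub>R u x) (vcnj (dv x *\<^sub>R u' x))) \<in> borel_measurable lebesgue"
        using dterm_integrable[OF XD(1)[OF su] u'] by (rule borel_measurable_integrable)
      show "AE x in lebesgue. cdot (\<eta> x *\<^sub>R u x) (vcnj (dv x *\<^sub>R u' x)) = 0"
        using dv0 by eventually_elim
          (auto simp: bounded_bilinear.scaleR_right[OF bounded_bilinear_cdot_vcnj] bounded_bilinear.scaleR_left[OF bounded_bilinear_cdot_vcnj])
    qed simp
    ultimately show "ipv \<rho> (\<lambda>x. 0) u' = - ipv \<rho> (\<lambda>x. \<eta> x *\<^sub>R u x) (flow_deriv b u') - dterm (\<lambda>x. \<eta> x *\<^sub>R u x) u'"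
      by (simp add: ipv_def bounded_bilinear.zero_left[OF bounded_bilinear_cdot_vcnj])
  qed
  show T0: "AE x in lebesgue. T (\<lambda>x. \<eta> x *\<^sub>R u x) x = 0"
    by (rule has_weak_flow_deriv_unique[OF XD(5)[OF su] h])
  \<comment> \<open>By the product rule \<eta> T u differs from T (\<eta> u) by a term with
    \<open>bgrad \<eta>\<close>, which is zero because \<eta> is constant inside the ball and b
    vanishes outside.\<close>
  show "AE x in lebesgue. \<eta> x *\<^sub>R T u x = 0"
    using T0 X_times_smooth(3)[OF u \<eta>] b_support
  proof eventually_elim
    case (elim x)
    have "bgrad \<eta> x = 0"
    proof (cases "norm x < r1")
      case True
      have "partial l \<eta> x = 0" for l by (rule vanishes_on_ball_partial[OF z True])
      then show ?thesis by (simp add: bgrad_def)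
    qed (use elim in \<open>simp add: bgrad_def\<close>)
    then show ?case using elim by simp
  qed
qed

lemma grad_dot_bound:
  fixes u :: "real^3 \<Rightarrow> complex^3"
  assumes u: "u \<in> L2w \<rho>" and \<eta>: "smooth \<eta>" "\<And>l x. \<bar>partial l \<eta> x\<bar> \<le> B"
  shows "(\<lambda>x. \<Sum>l\<in>UNIV. partial l \<eta> x *\<^sub>R u x $ l) \<in> L2w \<rho>"
    "L2n \<rho> (\<lambda>x. \<Sum>l\<in>UNIV. partial l \<eta> x *\<^sub>R u x $ l) \<le> (3 * B) * L2n \<rho> u"
proof -
  have B: "B \<ge> 0" using \<eta>(2)[of undefined undefined] by linarith
  note [measurable] = measurable_vec_nth[OF L2w_measurable[OF u]] smooth_measurable[OF smooth_partial[OF \<eta>(1)]]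
  have m: "(\<lambda>x. \<Sum>l\<in>UNIV. partial l \<eta> x *\<^sub>R u x $ l) \<in> borel_measurable lebesgue" by measurable
  have le: "norm (\<Sum>l\<in>UNIV. partial l \<eta> x *\<^sub>R u x $ l) \<le> (3 * B) * norm (u x)" for x
  proof -
    have "norm (\<Sum>l\<in>UNIV. partial l \<eta> x *\<^sub>R u x $ l) \<le> (\<Sum>l\<in>(UNIV::3 set). B * norm (u x))"
      by (rule sum_norm_le) (simp add: mult_mono \<eta> B Finite_Cartesian_Product.norm_nth_le)
    then show ?thesis by simp
  qed
  show "(\<lambda>x. \<Sum>l\<in>UNIV. partial l \<eta> x *\<^sub>R u x $ l) \<in> L2w \<rho>"
    "L2n \<rho> (\<lambda>x. \<Sum>l\<in>UNIV. partial l \<eta> x *\<^sub>R u x $ l) \<le> (3 * B) * L2n \<rho> u"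
    using L2w_bound[OF u m AE_I2[OF le]] B by auto
qed

definition csD :: "(real^3 \<Rightarrow> complex^3) \<Rightarrow> real^3 \<Rightarrow> complex"
  where "csD u x = cs x *\<^sub>R D u x"

lemma csD_bound: "\<exists>K>0. \<forall>f\<in>L2w \<rho>. (\<lambda>x. cs x *\<^sub>R f x) \<in> L2w \<rho> \<and> L2n \<rho> (\<lambda>x. cs x *\<^sub>R f x) \<le> K * L2n \<rho> (f :: real^3 \<Rightarrow> complex)"
proof (rule L2w_bilinear[OF bounded_bilinear_scaleR cs_measurable])
  obtain C c where C: "C > 0" "AE x in lebesgue. cs x \<le> C" and c: "c > 0" "AE x in lebesgue. c \<le> cs x"
    using cs_upper cs_lower by blast
  have "AE x in lebesgue. norm (cs x) \<le> C" using C(2) c(2) by eventually_elim (use c(1) in simp)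
  then show "\<exists>C>0. AE x in lebesgue. norm (cs x) \<le> C" using C by blast
qed

lemma cs_lower_L2n: "\<exists>c>0. \<forall>f\<in>L2w \<rho>. c * L2n \<rho> f \<le> L2n \<rho> (\<lambda>x. cs x *\<^sub>R (f x :: complex))"
proof -
  obtain c where c: "c > 0" "AE x in lebesgue. c \<le> cs x" using cs_lower by blast
  have "c * L2n \<rho> f \<le> L2n \<rho> (\<lambda>x. cs x *\<^sub>R f x)" if f: "f \<in> L2w \<rho>" for f :: "real^3 \<Rightarrow> complex"
  proof -
    have g: "(\<lambda>x. cs x *\<^sub>R f x) \<in> L2w \<rho>" using csD_bound f by blast
    have "L2n \<rho> f \<le> (1 / c) * L2n \<rho> (\<lambda>x. cs x *\<^sub>R f x)"
    proof (rule L2w_bound(2)[OF g L2w_measurable[OF f]])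
      show "AE x in lebesgue. norm (f x) \<le> 1 / c * norm (cs x *\<^sub>R f x)"
        using c(2)
      proof eventually_elim
        case (elim x)
        then have "c * norm (f x) \<le> \<bar>cs x\<bar> * norm (f x)" by (intro mult_right_mono) auto
        then show ?case using c(1) by (simp add: field_simps)
      qed
    qed (use c in simp)
    then show ?thesis using c(1) by (simp add: field_simps)
  qed
  then show ?thesis using c(1) by blast
qed

lemma ip_C2: "ip \<rho> (C2 f) g = ip \<rho> (\<lambda>x. cs x *\<^sub>R f x) (\<lambda>x. cs x *\<^sub>R g x)"
proof -
  have "complex_of_real r * ((complex_of_real (c\<^sup>2) * a) * cnj d) = complex_of_real r * ((c *\<^sub>R a) * cnj (c *\<^sub>R d))" for r c a d
    by (simp add: scaleR_conv_of_real power2_eq_square mult_ac)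
  then show ?thesis unfolding ip_def C2_def by simp
qed

lemma cutoff_exists:
  fixes r :: real
  assumes "0 \<le> r"
  obtains \<eta> :: "real^3 \<Rightarrow> real" and B where "\<eta> \<in> test_functions UNIV" "\<And>x. 0 \<le> \<eta> x" "\<And>x. \<eta> x \<le> 1"
    "\<And>x. norm x \<le> r \<Longrightarrow> \<eta> x = 1" "\<And>x. norm x \<ge> r + 1 \<Longrightarrow> \<eta> x = 0" "B \<ge> 1" "\<And>l x. \<bar>partial l \<eta> x\<bar> \<le> B"
proof -
  obtain \<eta> :: "real^3 \<Rightarrow> real" where \<eta>: "smooth \<eta>" "\<And>x. 0 \<le> \<eta> x" "\<And>x. \<eta> x \<le> 1"
    "\<And>x. dist 0 x \<le> r \<Longrightarrow> \<eta> x = 1" "\<And>x. dist 0 x \<ge> r + 1 \<Longrightarrow> \<eta> x = 0"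
    by (rule smooth_cutoff_exists[of r "r + 1" 0]) (use assms in auto)
  have "bounded {x. \<eta> x \<noteq> 0}"
    by (rule boundedI[of _ "r + 1"]) (metis (mono_tags) \<eta>(5) dist_0_norm linear mem_Collect_eq)
  then have t: "\<eta> \<in> test_functions UNIV" using \<eta>(1) by (simp add: test_functions_iff)
  have "\<forall>l. \<exists>B. \<forall>x. \<bar>partial l \<eta> x\<bar> \<le> B"
    using test_bounded[OF test_partial[OF t]] by (metis real_norm_def)
  then obtain Bl where Bl: "\<And>l x. \<bar>partial l \<eta> x\<bar> \<le> Bl l" by metis
  \<comment> \<open>The sum serves all three directions with one bound, and the 1 ensures B >=
    1.\<close>
  define B where "B = 1 + (\<Sum>l\<in>UNIV. \<bar>Bl l\<bar>)"
  have "\<bar>partial l \<eta> x\<bar> \<le> B" for l x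
  proof -
    have "\<bar>Bl l\<bar> \<le> (\<Sum>l\<in>UNIV. \<bar>Bl l\<bar>)" by (rule member_le_sum) auto
    then show ?thesis using Bl[of l x] unfolding B_def by linarith
  qed
  then show thesis using that[OF t \<eta>(2,3), of B] \<eta>(4,5) by (simp add: B_def sum_nonneg)
qed

text \<open>Test with \<zeta> u, where \<zeta> = 1 - \<xi> vanishes on the ball of radius r1. The
  flow derivative drops out, so up to lower order the form is a weighted square of div u, and
  \<zeta> equals 1 wherever an admissible \<eta> is nonzero.\<close>

lemma div_outside:
  "\<exists>K>0. \<forall>u\<in>X. \<forall>\<epsilon>\<ge>0. \<forall>\<eta>. XH.nrm u \<le> 1 \<longrightarrow> (\<forall>u'\<in>X. cmod (form u u') \<le> \<epsilon> * XH.nrm u') \<longrightarrow>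
    smooth \<eta> \<longrightarrow> (\<forall>x. 0 \<le> \<eta> x \<and> \<eta> x \<le> 1) \<longrightarrow> (\<forall>x. norm x \<le> r1 + 1 \<longrightarrow> \<eta> x = 0) \<longrightarrow>
    (L2n \<rho> (\<lambda>x. \<eta> x *\<^sub>R D u x))\<^sup>2 \<le> K * (\<epsilon> + L2n \<rho> u)"
proof -
  obtain \<xi> :: "real^3 \<Rightarrow> real" and B where \<xi>: "\<xi> \<in> test_functions UNIV" "\<And>x. 0 \<le> \<xi> x" "\<And>x. \<xi> x \<le> 1"
    "\<And>x. norm x \<le> r1 \<Longrightarrow> \<xi> x = 1" "\<And>x. norm x \<ge> r1 + 1 \<Longrightarrow> \<xi> x = 0" and B: "B \<ge> 1" "\<And>l x. \<bar>partial l \<xi> x\<bar> \<le> B"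
    using cutoff_exists[of r1] r1 by (metis less_imp_le)
  define \<zeta> where "\<zeta> x = 1 - \<xi> x" for x
  have \<zeta>s: "smooth \<zeta>" unfolding \<zeta>_def[abs_def] by (intro smooth_diff smooth_const test_smooth[OF \<xi>(1)])
  have \<zeta>p: "partial l \<zeta> x = - partial l \<xi> x" for l x
    unfolding \<zeta>_def[abs_def]
    using partial_add[OF smooth_differentiable[OF smooth_const[of 1]] smooth_differentiable[OF smooth_minus[OF test_smooth[OF \<xi>(1)]]], of l x]
      partial_bounded_linear[OF bounded_linear_minus[OF bounded_linear_ident] smooth_differentiable[OF test_smooth[OF \<xi>(1)]], of l x] by simp
  have \<zeta>B: "\<bar>\<zeta> x\<bar> \<le> B" "\<bar>partial l \<zeta> x\<bar> \<le> B" for x l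
    using \<xi>(2,3)[of x] B by (auto simp: \<zeta>p) (auto simp: \<zeta>_def)
  have \<zeta>z: "\<zeta> x = 0" if "norm x < r1" for x using that \<xi>(4)[of x] by (simp add: \<zeta>_def)
  obtain K where K: "K > 0" "\<And>u u'. u \<in> X \<Longrightarrow> u' \<in> X \<Longrightarrow>
    cmod (form u u' - form0 u u') \<le> K * (L2n \<rho> u * XH.nrm u' + XH.nrm u * L2n \<rho> u')"
    using form_lower_order by blast
  obtain kc where kc: "kc > 0" "\<And>f. f \<in> L2w \<rho> \<Longrightarrow> L2n \<rho> (C2 f) \<le> kc * L2n \<rho> f" using C2_bound by blast
  obtain c where c: "c > 0" "AE x in lebesgue. c \<le> cs x" using cs_lower by blast
  \<comment> \<open>Bounds the X norm of \<zeta> u: its divergence contributes at most 1 + 3 B, the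
    field itself at most 1, and its flow derivative nothing.\<close>
  define N where "N = 2 + 3 * B"
  \<comment> \<open>Collects the residual, the lower order terms and the commutator with the cutoff;
    dividing by c^2 removes the factor c_s^2 from the left side.\<close>
  define L where "L = (N + K * (N + 1) + kc * (3 * B)) / c\<^sup>2"
  have L: "L > 0" using B K kc c unfolding L_def N_def by (intro divide_pos_pos add_pos_pos mult_pos_pos) auto
  have "(L2n \<rho> (\<lambda>x. \<eta> x *\<^sub>R D u x))\<^sup>2 \<le> L * (\<epsilon> + L2n \<rho> u)"
    if u: "u \<in> X" and \<epsilon>: "\<epsilon> \<ge> 0" and n1: "XH.nrm u \<le> 1" and small: "\<And>u'. u' \<in> X \<Longrightarrow> cmod (form u u') \<le> \<epsilon> * XH.nrm u'"
      and \<eta>: "smooth \<eta>" "\<And>x. 0 \<le> \<eta> x" "\<And>x. \<eta> x \<le> 1" "\<And>x. norm x \<le> r1 + 1 \<Longrightarrow> \<eta> x = 0" for u \<epsilon> \<eta>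
  proof -
    note U = XD[OF u]
    let ?U = "L2n \<rho> u"
    have U1: "?U \<le> 1" "L2n \<rho> (D u) \<le> 1" using L2n_le_nrm[OF u] n1 by linarith+
    let ?v = "\<lambda>x. \<zeta> x *\<^sub>R u x"
    let ?g = "\<lambda>x. \<Sum>l\<in>UNIV. partial l \<zeta> x *\<^sub>R u x $ l"
    note v = X_times_smooth[OF u \<zeta>s \<zeta>B]
    note g = grad_dot_bound[OF U(1) \<zeta>s \<zeta>B(2)]
    have \<zeta>1: "AE x in lebesgue. \<bar>\<zeta> x\<bar> \<le> 1" using \<xi>(2,3) by (intro AE_I2) (simp add: \<zeta>_def)
    have vU: "L2n \<rho> ?v \<le> ?U" using L2w_scaleR_bounded(2)[OF U(1) smooth_measurable[OF \<zeta>s] \<zeta>1] by simp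
    have \<zeta>D: "(\<lambda>x. \<zeta> x *\<^sub>R D u x) \<in> L2w \<rho>" "L2n \<rho> (\<lambda>x. \<zeta> x *\<^sub>R D u x) \<le> 1 * L2n \<rho> (D u)"
      using L2w_scaleR_bounded[OF U(2) smooth_measurable[OF \<zeta>s] \<zeta>1] by auto
    have Dv: "L2n \<rho> (D ?v) = L2n \<rho> (\<lambda>x. \<zeta> x *\<^sub>R D u x + ?g x)"
      by (rule L2n_cong_AE[OF v(2) L2w_measurable[OF XD(2)[OF v(1)]] L2w_measurable[OF L2w_add[OF \<zeta>D(1) g(1)]]])
    have B3: "(3 * B) * ?U \<le> 3 * B" using U1(1) B(1) by (simp add: mult_left_le)
    have "L2n \<rho> (D ?v) \<le> 1 + 3 * B"
      unfolding Dv using L2n_add_le[OF \<zeta>D(1) g(1)] \<zeta>D(2) g(2) U1 B3 by linarith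
    moreover have Tv: "AE x in lebesgue. T ?v x = 0" by (rule flow_deriv_cutoff_zero(1)[OF u \<zeta>s \<zeta>B \<zeta>z])
    have z0: "(\<lambda>x. 0 :: complex^3) \<in> L2w \<rho>" by (rule test_in_L2w) simp
    have Tv0: "L2n \<rho> (T ?v) = 0"
      using L2n_cong_AE[OF Tv L2w_measurable[OF XD(4)[OF v(1)]] L2w_measurable[OF z0]] by (simp add: L2n_def)
    ultimately have "(XH.nrm ?v)\<^sup>2 \<le> (1 + 3 * B)\<^sup>2 + 1\<^sup>2"
      using vU U1(1) L2n_nonneg[of ?v] unfolding X_nrm_sq[OF v(1)]
      by (intro add_mono) (simp_all add: power_mono power_le_one)
    also have "\<dots> \<le> N\<^sup>2" using B by (simp add: N_def power2_eq_square algebra_simps)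
    finally have nv: "XH.nrm ?v \<le> N" by (rule power2_le_imp_le) (use B in \<open>simp add: N_def\<close>)
    have f0: "cmod (form0 u ?v) \<le> N * \<epsilon> + K * (?U * N + ?U)"
    proof -
      have "cmod (form0 u ?v) \<le> cmod (form u ?v) + cmod (form u ?v - form0 u ?v)"
        using norm_triangle_ineq4[of "form u ?v" "form u ?v - form0 u ?v"] by simp
      moreover have "cmod (form u ?v) \<le> \<epsilon> * N" using small[OF v(1)] mult_left_mono[OF nv \<epsilon>] by linarith
      moreover have "cmod (form u ?v - form0 u ?v) \<le> K * (?U * N + 1 * ?U)"
        by (rule order_trans[OF K(2)[OF u v(1)]])
           (intro mult_left_mono add_mono mult_mono nv n1 vU less_imp_le[OF K(1)] L2n_nonneg order_refl XH.nrm_nonneg v(1); simp add: B N_def)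
      ultimately show ?thesis by (simp add: mult.commute)
    qed
    have e: "form0 u ?v = ip \<rho> (C2 (D u)) (\<lambda>x. \<zeta> x *\<^sub>R D u x) + ip \<rho> (C2 (D u)) ?g"
    proof -
      have "ipv \<rho> (T u) (T ?v) = ipv \<rho> (T u) (\<lambda>x. 0)"
        by (intro ipv_cong_AE U(4) XD(4)[OF v(1)] z0 Tv AE_I2 refl)
      also have "\<dots> = 0" by (simp add: ipv_def bounded_bilinear.zero_right[OF bounded_bilinear_cdot_vcnj])
      finally have "form0 u ?v = ip \<rho> (C2 (D u)) (D ?v)" by (simp add: form0_def)
      also have "\<dots> = ip \<rho> (C2 (D u)) (\<lambda>x. \<zeta> x *\<^sub>R D u x + ?g x)"
        by (intro ip_cong_AE L2w_ops U XD(2)[OF v(1)] L2w_add \<zeta>D g v(2) AE_I2 refl)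
      also have "\<dots> = ip \<rho> (C2 (D u)) (\<lambda>x. \<zeta> x *\<^sub>R D u x) + ip \<rho> (C2 (D u)) ?g"
        by (rule S.ip_add_right[OF \<zeta>D(1) g(1) L2w_ops(5)[OF U(2)]])
      finally show ?thesis .
    qed
    have g0: "cmod (ip \<rho> (C2 (D u)) ?g) \<le> kc * ((3 * B) * ?U)"
    proof -
      have "L2n \<rho> (C2 (D u)) \<le> kc * 1" using kc(2)[OF U(2)] mult_left_mono[OF U1(2), of kc] kc(1) by linarith
      then have "L2n \<rho> (C2 (D u)) * L2n \<rho> ?g \<le> (kc * 1) * ((3 * B) * ?U)"
        by (intro mult_mono g) (use kc in auto)
      then show ?thesis using ip_Cauchy_Schwarz[OF L2w_ops(5)[OF U(2)] g(1)] by simp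
    qed
    have lower: "c\<^sup>2 * (L2n \<rho> (\<lambda>x. \<eta> x *\<^sub>R D u x))\<^sup>2 \<le> Re (ip \<rho> (C2 (D u)) (\<lambda>x. \<zeta> x *\<^sub>R D u x))"
    proof -
      have \<eta>1: "AE x in lebesgue. \<bar>\<eta> x\<bar> \<le> 1" using \<eta>(2,3) by (intro AE_I2) simp
      have \<eta>D: "(\<lambda>x. \<eta> x *\<^sub>R D u x) \<in> L2w \<rho>" using L2w_scaleR_bounded(1)[OF U(2) smooth_measurable[OF \<eta>(1)] \<eta>1] by simp
      have r: "complex_of_real (\<rho> x) * (C2 (D u) x * cnj (\<zeta> x *\<^sub>R D u x)) = complex_of_real (\<rho> x * ((cs x)\<^sup>2 * \<zeta> x * (norm (D u x))\<^sup>2))" for x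
        by (simp add: C2_def scaleR_conv_of_real complex_norm_square mult_ac del: of_real_power)
      have "integrable lebesgue (\<lambda>x. complex_of_real (\<rho> x * ((cs x)\<^sup>2 * \<zeta> x * (norm (D u x))\<^sup>2)))"
        using ip_integrable[OF L2w_ops(5)[OF U(2)] \<zeta>D(1)] unfolding r .
      then have i: "integrable lebesgue (\<lambda>x. \<rho> x * ((cs x)\<^sup>2 * \<zeta> x * (norm (D u x))\<^sup>2))" by (simp only: complex_of_real_integrable_eq)
      have "c\<^sup>2 * (L2n \<rho> (\<lambda>x. \<eta> x *\<^sub>R D u x))\<^sup>2 = (LINT x|lebesgue. c\<^sup>2 * (\<rho> x * (norm (\<eta> x *\<^sub>R D u x))\<^sup>2))"
        by (simp add: L2n_sq)
      also have "\<dots> \<le> (LINT x|lebesgue. \<rho> x * ((cs x)\<^sup>2 * \<zeta> x * (norm (D u x))\<^sup>2))"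
      proof (rule integral_mono_AE[OF _ i])
        show "integrable lebesgue (\<lambda>x. c\<^sup>2 * (\<rho> x * (norm (\<eta> x *\<^sub>R D u x))\<^sup>2))" using L2w_integrable[OF \<eta>D] by simp
        show "AE x in lebesgue. c\<^sup>2 * (\<rho> x * (norm (\<eta> x *\<^sub>R D u x))\<^sup>2) \<le> \<rho> x * ((cs x)\<^sup>2 * \<zeta> x * (norm (D u x))\<^sup>2)"
          using c(2) weight_pos
        proof eventually_elim
          case (elim x)
          \<comment> \<open>On the ball of radius r1 + 1 the left side vanishes, and outside it
            \<zeta> is 1.\<close>
          have "(\<eta> x)\<^sup>2 \<le> \<zeta> x"
          proof (cases "norm x \<le> r1 + 1")
            case True then show ?thesis using \<eta>(4) \<xi>(3)[of x] by (simp add: \<zeta>_def)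
          next
            case False then show ?thesis using \<eta>(2,3)[of x] \<xi>(5)[of x] by (simp add: \<zeta>_def power_le_one)
          qed
          moreover have "c\<^sup>2 \<le> (cs x)\<^sup>2" using elim c(1) by (intro power_mono) auto
          ultimately have "c\<^sup>2 * (\<eta> x)\<^sup>2 \<le> (cs x)\<^sup>2 * \<zeta> x" by (intro mult_mono) auto
          then have "(c\<^sup>2 * (\<eta> x)\<^sup>2) * (\<rho> x * (norm (D u x))\<^sup>2) \<le> ((cs x)\<^sup>2 * \<zeta> x) * (\<rho> x * (norm (D u x))\<^sup>2)"
            using elim by (intro mult_right_mono) auto
          then show ?case by (simp add: power_mult_distrib mult_ac)
        qed
      qed
      also have "\<dots> = Re (ip \<rho> (C2 (D u)) (\<lambda>x. \<zeta> x *\<^sub>R D u x))"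
        unfolding ip_def r by (simp only: integral_complex_of_real Re_complex_of_real)
      finally show ?thesis .
    qed
    have "Re (ip \<rho> (C2 (D u)) (\<lambda>x. \<zeta> x *\<^sub>R D u x)) \<le> cmod (form0 u ?v) + cmod (ip \<rho> (C2 (D u)) ?g)"
      using complex_Re_le_cmod[of "form0 u ?v"] abs_Re_le_cmod[of "ip \<rho> (C2 (D u)) ?g"] unfolding e plus_complex.sel by linarith
    also have "\<dots> \<le> (N * \<epsilon> + K * (?U * N + ?U)) + kc * ((3 * B) * ?U)" by (intro add_mono f0 g0)
    also have "\<dots> = N * \<epsilon> + (K * (N + 1) + kc * (3 * B)) * ?U" by (simp add: algebra_simps)
    also have "\<dots> \<le> (L * c\<^sup>2) * \<epsilon> + (L * c\<^sup>2) * ?U"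
    proof (intro add_mono mult_right_mono \<epsilon> L2n_nonneg)
      have "L * c\<^sup>2 = N + K * (N + 1) + kc * (3 * B)" using c by (simp add: L_def)
      moreover have "0 \<le> K * (N + 1)" "0 \<le> kc * (3 * B)" "0 \<le> N" using K kc B by (simp_all add: N_def)
      ultimately show "N \<le> L * c\<^sup>2" "K * (N + 1) + kc * (3 * B) \<le> L * c\<^sup>2" by linarith+
    qed
    finally have "c\<^sup>2 * (L2n \<rho> (\<lambda>x. \<eta> x *\<^sub>R D u x))\<^sup>2 \<le> c\<^sup>2 * (L * (\<epsilon> + ?U))" using lower by (simp add: algebra_simps)
    then show ?thesis using c(1) by simp
  qed
  then show ?thesis using L by blast
qed

end

section \<open>Gradients of complex test potentials\<close>

lemma partial_Complex:
  fixes f g :: "real^3 \<Rightarrow> real"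
  assumes "smooth f" "smooth g"
  shows "partial l (\<lambda>x. Complex (f x) (g x)) x = Complex (partial l f x) (partial l g x)"
proof -
  let ?h = "\<lambda>x. Complex (f x) (g x)"
  have "smooth (\<lambda>x. complex_of_real (f x) + \<i> * complex_of_real (g x))"
    by (intro smooth_add smooth_mult smooth_const smooth_bounded_linear[OF bounded_linear_of_real] assms)
  then have s: "?h differentiable (at x)" by (simp add: Complex_eq smooth_differentiable)
  have "Re (partial l ?h x) = partial l f x" "Im (partial l ?h x) = partial l g x"
    using partial_bounded_linear[OF bounded_linear_Re s, of l] partial_bounded_linear[OF bounded_linear_Im s, of l] by simp_all
  then show ?thesis by (simp add: complex_eq_iff)
qed

text \<open>The gradient of \<psi> + i \<phi>, kept as a pair of real potentials because the Hessian
  identity is stated for real functions.\<close>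

definition gradc :: "(real^3 \<Rightarrow> real) \<Rightarrow> (real^3 \<Rightarrow> real) \<Rightarrow> real^3 \<Rightarrow> complex^3"
  where "gradc \<psi> \<phi> x = (\<chi> l. Complex (partial l \<psi> x) (partial l \<phi> x))"

lemma gradc_split: "gradc \<psi> \<phi> x = (\<Sum>l\<in>UNIV. partial l \<psi> x *\<^sub>R axis l 1 + partial l \<phi> x *\<^sub>R axis l \<i>)"
proof -
  have "(\<Sum>l\<in>UNIV. partial l \<psi> x *\<^sub>R axis l 1 + partial l \<phi> x *\<^sub>R axis l \<i>) $ m = Complex (partial m \<psi> x) (partial m \<phi> x)" for m
  proof -
    have "(partial l \<psi> x *\<^sub>R axis l 1 + partial l \<phi> x *\<^sub>R axis l \<i>) $ m =
      (if l = m then Complex (partial m \<psi> x) (partial m \<phi> x) else 0)" for l :: 3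
      by (auto simp: axis_def complex_eq_iff)
    then show ?thesis by simp
  qed
  then show ?thesis by (simp add: gradc_def vec_eq_iff del: sum_component)
qed

lemma gradc_test:
  assumes "\<psi> \<in> test_functions UNIV" "\<phi> \<in> test_functions UNIV"
  shows "gradc \<psi> \<phi> \<in> test_functions UNIV"
  unfolding gradc_split[abs_def]
  by (intro test_sum test_add test_bounded_linear[OF bounded_linear_scaleR_left] test_partial assms) simp

lemma partial_gradc:
  assumes "\<psi> \<in> test_functions UNIV" "\<phi> \<in> test_functions UNIV"
  shows "partial k (gradc \<psi> \<phi>) x $ l = Complex (partial k (partial l \<psi>) x) (partial k (partial l \<phi>) x)"
  using partial_bounded_linear[OF bounded_linear_vec_nth smooth_differentiable[OF test_smooth[OF gradc_test[OF assms]]], of k l x]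
    partial_Complex[OF smooth_partial[OF test_smooth[OF assms(1)]] smooth_partial[OF test_smooth[OF assms(2)]], of k l l x]
  by (simp add: gradc_def)

text \<open>The factor 6 counts three directions and two real potentials.\<close>

lemma gradc_L2n_le:
  assumes t: "\<psi> \<in> test_functions UNIV" "\<phi> \<in> test_functions UNIV"
    and A: "\<And>l. L2n (\<lambda>_. 1) (partial l \<psi>) \<le> A" "\<And>l. L2n (\<lambda>_. 1) (partial l \<phi>) \<le> A"
  shows "L2n (\<lambda>_. 1) (gradc \<psi> \<phi>) \<le> 6 * A"
proof -
  have one: "L2n (\<lambda>_. 1) (\<lambda>x. f x *\<^sub>R (a::complex^3)) = norm a * L2n (\<lambda>_. 1) f" for f :: "real^3 \<Rightarrow> real" and a
    by (simp add: L2n_def power_mult_distrib real_sqrt_mult mult.commute)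
  have na: "norm (axis l (c::complex)) = cmod c" for l :: 3 and c
    by (simp add: norm_vec_def L2_set_def axis_def if_distrib[of "\<lambda>t. (cmod t)\<^sup>2"] cong: if_cong)
  have tl: "(\<lambda>x. partial l f x *\<^sub>R (a::complex^3)) \<in> L2w (\<lambda>_. 1)" if "f \<in> test_functions UNIV" for l f a
    by (intro test_L2w[of _ UNIV] test_bounded_linear[OF bounded_linear_scaleR_left] test_partial that)
  have two: "L2n (\<lambda>_. 1) (\<lambda>x. partial l \<psi> x *\<^sub>R axis l (1::complex) + partial l \<phi> x *\<^sub>R axis l \<i>) \<le> 2 * A" for l :: 3
    using unweighted.L2n_add_le[OF tl[OF t(1), of l "axis l 1"] tl[OF t(2), of l "axis l \<i>"]] A(1)[of l] A(2)[of l]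
    by (simp add: one na)
  have L: "(\<lambda>x. partial l \<psi> x *\<^sub>R axis l (1::complex) + partial l \<phi> x *\<^sub>R axis l \<i>) \<in> L2w (\<lambda>_. 1)" for l :: 3
    by (intro unweighted.L2w_add tl t)
  have "(\<lambda>x. \<Sum>l\<in>S. partial l \<psi> x *\<^sub>R axis l (1::complex) + partial l \<phi> x *\<^sub>R axis l \<i>) \<in> L2w (\<lambda>_. 1) \<and>
    L2n (\<lambda>_. 1) (\<lambda>x. \<Sum>l\<in>S. partial l \<psi> x *\<^sub>R axis l (1::complex) + partial l \<phi> x *\<^sub>R axis l \<i>) \<le> (\<Sum>l\<in>S. 2 * A)" if "finite S" for S :: "3 set"
    using that
  proof (induction S rule: finite_induct)
    case empty
    have "(\<lambda>x. 0 :: complex^3) \<in> L2w (\<lambda>_. 1)" by (rule test_L2w[OF test_zero])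
    then show ?case by (simp add: L2n_def)
  next
    case (insert l S)
    then show ?case
      using unweighted.L2n_add_le[OF L[of l], of "\<lambda>x. \<Sum>l\<in>S. partial l \<psi> x *\<^sub>R axis l (1::complex) + partial l \<phi> x *\<^sub>R axis l \<i>"] two[of l]
        unweighted.L2w_add[OF L[of l], of "\<lambda>x. \<Sum>l\<in>S. partial l \<psi> x *\<^sub>R axis l (1::complex) + partial l \<phi> x *\<^sub>R axis l \<i>"]
      by (simp del: sum_constant)
  qed
  from this[of UNIV] show ?thesis unfolding gradc_split[abs_def] by simp
qed

context galbrun
begin

text \<open>Cauchy-Schwarz in the index contracted with b: the derivative of a gradient along b is
  at most |b| times the Hilbert-Schmidt norm of the Hessian.\<close>

lemma flow_gradc_pointwise:
  assumes t: "\<psi> \<in> test_functions UNIV" "\<phi> \<in> test_functions UNIV"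
  shows "(norm (flow_deriv b (gradc \<psi> \<phi>) x))\<^sup>2 \<le> (norm (b x))\<^sup>2 *
    ((\<Sum>k\<in>UNIV. \<Sum>l\<in>UNIV. (partial k (partial l \<psi>) x)\<^sup>2) + (\<Sum>k\<in>UNIV. \<Sum>l\<in>UNIV. (partial k (partial l \<phi>) x)\<^sup>2))"
proof -
  let ?P = "\<lambda>f k l. partial k (partial l f) x"
  have comp: "flow_deriv b (gradc \<psi> \<phi>) x $ l = Complex (\<Sum>k\<in>UNIV. b x $ k * ?P \<psi> k l) (\<Sum>k\<in>UNIV. b x $ k * ?P \<phi> k l)" for l
    by (simp add: flow_deriv_def partial_gradc[OF t] complex_eq_iff)
  have nb: "(norm (b x))\<^sup>2 = (\<Sum>k\<in>UNIV. (b x $ k)\<^sup>2)"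
    by (simp add: norm_vec_def L2_set_def sum_nonneg)
  have "(norm (flow_deriv b (gradc \<psi> \<phi>) x))\<^sup>2 = (\<Sum>l\<in>UNIV. (cmod (flow_deriv b (gradc \<psi> \<phi>) x $ l))\<^sup>2)"
    by (simp add: norm_vec_def L2_set_def sum_nonneg)
  also have "\<dots> = (\<Sum>l\<in>UNIV. (\<Sum>k\<in>UNIV. b x $ k * ?P \<psi> k l)\<^sup>2 + (\<Sum>k\<in>UNIV. b x $ k * ?P \<phi> k l)\<^sup>2)"
    by (simp add: comp cmod_power2)
  also have "\<dots> \<le> (\<Sum>l\<in>UNIV. (\<Sum>k\<in>UNIV. (b x $ k)\<^sup>2) * (\<Sum>k\<in>UNIV. (?P \<psi> k l)\<^sup>2) + (\<Sum>k\<in>UNIV. (b x $ k)\<^sup>2) * (\<Sum>k\<in>UNIV. (?P \<phi> k l)\<^sup>2))"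
    by (intro sum_mono add_mono Cauchy_Schwarz_ineq_sum)
  also have "\<dots> = (norm (b x))\<^sup>2 * ((\<Sum>l\<in>UNIV. \<Sum>k\<in>UNIV. (?P \<psi> k l)\<^sup>2) + (\<Sum>l\<in>UNIV. \<Sum>k\<in>UNIV. (?P \<phi> k l)\<^sup>2))"
    by (simp add: nb sum.distrib sum_distrib_left distrib_left)
  also have "(\<Sum>l\<in>UNIV. \<Sum>k\<in>UNIV. (?P \<psi> k l)\<^sup>2) = (\<Sum>k\<in>UNIV. \<Sum>l\<in>UNIV. (?P \<psi> k l)\<^sup>2)" by (rule sum.swap)
  also have "(\<Sum>l\<in>UNIV. \<Sum>k\<in>UNIV. (?P \<phi> k l)\<^sup>2) = (\<Sum>k\<in>UNIV. \<Sum>l\<in>UNIV. (?P \<phi> k l)\<^sup>2)" by (rule sum.swap)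
  finally show ?thesis .
qed

lemma gradc_X:
  assumes t: "\<psi> \<in> test_functions UNIV" "\<phi> \<in> test_functions UNIV"
  shows "gradc \<psi> \<phi> \<in> X" "AE x in lebesgue. D (gradc \<psi> \<phi>) x = Complex (laplacian \<psi> x) (laplacian \<phi> x)"
    "AE x in lebesgue. T (gradc \<psi> \<phi>) x = flow_deriv b (gradc \<psi> \<phi>) x"
proof -
  note v = X_test[OF gradc_test[OF t]]
  show "gradc \<psi> \<phi> \<in> X" "AE x in lebesgue. T (gradc \<psi> \<phi>) x = flow_deriv b (gradc \<psi> \<phi>) x" using v by auto
  have "(\<Sum>l\<in>UNIV. partial l (gradc \<psi> \<phi>) x $ l) = Complex (laplacian \<psi> x) (laplacian \<phi> x)" for x
    by (simp add: partial_gradc[OF t] laplacian_def complex_eq_iff)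
  then show "AE x in lebesgue. D (gradc \<psi> \<phi>) x = Complex (laplacian \<psi> x) (laplacian \<phi> x)" using v(2) by simp
qed

text \<open>This is where gradients are special. Since w = rho c_s^2 where b may be nonzero, rho
  |b|^2 <= \<kappa>^2 w everywhere; the w-weighted Hessian is exchanged for the Laplacian, which is
  the divergence of the gradient, and w <= rho c_s^2 returns to the original weight.\<close>

lemma flow_gradc_estimate:
  "\<exists>C\<ge>0. \<forall>\<psi>\<in>test_functions UNIV. \<forall>\<phi>\<in>test_functions UNIV. \<forall>A B.
    (\<forall>l. L2n (\<lambda>_. 1) (partial l \<psi>) \<le> A \<and> L2n (\<lambda>_. 1) (partial l \<phi>) \<le> A) \<longrightarrow>
    L2n (\<lambda>_. 1) (laplacian \<psi>) \<le> B \<longrightarrow> L2n (\<lambda>_. 1) (laplacian \<phi>) \<le> B \<longrightarrow>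
    (L2n \<rho> (T (gradc \<psi> \<phi>)))\<^sup>2 \<le> \<kappa>\<^sup>2 * (L2n \<rho> (csD (gradc \<psi> \<phi>)))\<^sup>2 + C * A * B"
proof -
  obtain C where C: "C \<ge> 0" "\<And>l F. F \<in> test_functions UNIV \<Longrightarrow> \<bar>LINT x|lebesgue. w x * partial l F x\<bar> \<le> C * (LINT x|lebesgue. \<bar>F x\<bar>)"
    using w_lipschitz by blast
  have "(L2n \<rho> (T (gradc \<psi> \<phi>)))\<^sup>2 \<le> \<kappa>\<^sup>2 * (L2n \<rho> (csD (gradc \<psi> \<phi>)))\<^sup>2 + (36 * C) * A * B"
    if t: "\<psi> \<in> test_functions UNIV" "\<phi> \<in> test_functions UNIV"
      and A: "\<And>l. L2n (\<lambda>_. 1) (partial l \<psi>) \<le> A" "\<And>l. L2n (\<lambda>_. 1) (partial l \<phi>) \<le> A"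
      and B: "L2n (\<lambda>_. 1) (laplacian \<psi>) \<le> B" "L2n (\<lambda>_. 1) (laplacian \<phi>) \<le> B" for \<psi> \<phi> A B
  proof -
    let ?v = "gradc \<psi> \<phi>"
    have A0: "A \<ge> 0" using A(1)[of undefined] unweighted.L2n_nonneg[of "partial undefined \<psi>"] by linarith
    have B0: "B \<ge> 0" using B(1) unweighted.L2n_nonneg[of "laplacian \<psi>"] by linarith
    note v = gradc_X[OF t]
    let ?S = "\<lambda>f x. \<Sum>k\<in>UNIV. \<Sum>l\<in>UNIV. (partial k (partial l f) x)\<^sup>2"
    have sq: "(\<lambda>x. (f x)\<^sup>2) \<in> test_functions UNIV" if "f \<in> test_functions UNIV" for f :: "real^3 \<Rightarrow> real"
      unfolding power2_eq_square by (intro test_mult_right test_smooth[OF that] that)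
    have iw: "integrable lebesgue (\<lambda>x. w x * (f x)\<^sup>2)" if "f \<in> test_functions UNIV" for f :: "real^3 \<Rightarrow> real"
      by (rule integrable_loc_times_test[OF bounded_bilinear_mult w_loc sq[OF that]])
    have iS: "integrable lebesgue (\<lambda>x. w x * ?S f x)" if "f \<in> test_functions UNIV" for f
      using iw[OF test_partial[OF test_partial[OF that]]] by (simp add: sum_distrib_left)
    have eS: "(LINT x|lebesgue. w x * ?S f x) = (\<Sum>k\<in>UNIV. \<Sum>l\<in>UNIV. LINT x|lebesgue. w x * (partial k (partial l f) x)\<^sup>2)"
      if "f \<in> test_functions UNIV" for f
      using iw[OF test_partial[OF test_partial[OF that]]] by (simp add: sum_distrib_left)
    have h: "(LINT x|lebesgue. w x * ?S f x) \<le> (LINT x|lebesgue. w x * (laplacian f x)\<^sup>2) + 18 * C * A * B"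
      if "f \<in> test_functions UNIV" "\<And>l. L2n (\<lambda>_. 1) (partial l f) \<le> A" "L2n (\<lambda>_. 1) (laplacian f) \<le> B" for f
      unfolding eS[OF that(1)] by (rule hessian_weighted_le[OF that(1) w_loc C that(2,3)])
    have "(L2n \<rho> (T ?v))\<^sup>2 = (LINT x|lebesgue. \<rho> x * (norm (T ?v x))\<^sup>2)" by (rule L2n_sq)
    also have "\<dots> \<le> (LINT x|lebesgue. \<kappa>\<^sup>2 * (w x * ?S \<psi> x + w x * ?S \<phi> x))"
    proof (rule integral_mono_AE)
      show "integrable lebesgue (\<lambda>x. \<rho> x * (norm (T ?v x))\<^sup>2)" by (rule L2w_integrable[OF XD(4)[OF v(1)]])
      show "integrable lebesgue (\<lambda>x. \<kappa>\<^sup>2 * (w x * ?S \<psi> x + w x * ?S \<phi> x))" using iS[OF t(1)] iS[OF t(2)] by auto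
      show "AE x in lebesgue. \<rho> x * (norm (T ?v x))\<^sup>2 \<le> \<kappa>\<^sup>2 * (w x * ?S \<psi> x + w x * ?S \<phi> x)"
        using v(3) weight_pos kappa(3) b_support w_bounds w_eq
      proof eventually_elim
        case (elim x)
        have S0: "0 \<le> ?S \<psi> x + ?S \<phi> x" by (intro add_nonneg_nonneg sum_nonneg) auto
        have "\<rho> x * (norm (b x))\<^sup>2 \<le> \<kappa>\<^sup>2 * w x"
        proof (cases "norm x < r1")
          case True
          have "(norm (b x))\<^sup>2 \<le> (\<kappa> * cs x)\<^sup>2" using elim by (intro power_mono) auto
          then have "\<rho> x * (norm (b x))\<^sup>2 \<le> \<rho> x * (\<kappa> * cs x)\<^sup>2" using elim by (intro mult_left_mono) auto
          then show ?thesis using True elim by (simp add: power_mult_distrib mult_ac)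
        qed (use elim in simp)
        then have "\<rho> x * (norm (b x))\<^sup>2 * (?S \<psi> x + ?S \<phi> x) \<le> \<kappa>\<^sup>2 * w x * (?S \<psi> x + ?S \<phi> x)"
          by (rule mult_right_mono[OF _ S0])
        moreover have "\<rho> x * (norm (flow_deriv b ?v x))\<^sup>2 \<le> \<rho> x * ((norm (b x))\<^sup>2 * (?S \<psi> x + ?S \<phi> x))"
          using elim by (intro mult_left_mono flow_gradc_pointwise[OF t]) auto
        ultimately have "\<rho> x * (norm (flow_deriv b ?v x))\<^sup>2 \<le> \<kappa>\<^sup>2 * w x * (?S \<psi> x + ?S \<phi> x)"
          by (simp only: mult.assoc)
        then show ?case using elim by (simp only: distrib_left mult.assoc)
      qed
    qed
    also have "\<dots> = \<kappa>\<^sup>2 * ((LINT x|lebesgue. w x * ?S \<psi> x) + (LINT x|lebesgue. w x * ?S \<phi> x))"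
      using iS[OF t(1)] iS[OF t(2)] by (simp only: integral_mult_right_zero Bochner_Integration.integral_add)
    also have "\<dots> \<le> \<kappa>\<^sup>2 * (((LINT x|lebesgue. w x * (laplacian \<psi> x)\<^sup>2) + 18 * C * A * B) + ((LINT x|lebesgue. w x * (laplacian \<phi> x)\<^sup>2) + 18 * C * A * B))"
      by (intro mult_left_mono add_mono h t A B) auto
    also have "\<dots> = \<kappa>\<^sup>2 * (LINT x|lebesgue. w x * (laplacian \<psi> x)\<^sup>2 + w x * (laplacian \<phi> x)\<^sup>2) + \<kappa>\<^sup>2 * (36 * C * A * B)"
      using iw[OF test_laplacian[OF t(1)]] iw[OF test_laplacian[OF t(2)]] by (simp add: algebra_simps)
    \<comment> \<open>In the error term \<kappa>^2 is estimated by 1; the constant is 36 = 2 * 18,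
      one 18 for each potential.\<close>
    also have "\<dots> \<le> \<kappa>\<^sup>2 * (L2n \<rho> (csD ?v))\<^sup>2 + 1 * (36 * C * A * B)"
    proof (intro add_mono mult_left_mono mult_right_mono)
      have cL: "csD ?v \<in> L2w \<rho>" unfolding csD_def[abs_def] using csD_bound XD(2)[OF v(1)] by blast
      show "(LINT x|lebesgue. w x * (laplacian \<psi> x)\<^sup>2 + w x * (laplacian \<phi> x)\<^sup>2) \<le> (L2n \<rho> (csD ?v))\<^sup>2"
        unfolding L2n_sq
      proof (rule integral_mono_AE[OF _ L2w_integrable[OF cL]])
        show "integrable lebesgue (\<lambda>x. w x * (laplacian \<psi> x)\<^sup>2 + w x * (laplacian \<phi> x)\<^sup>2)"
          using iw[OF test_laplacian[OF t(1)]] iw[OF test_laplacian[OF t(2)]] by auto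
        show "AE x in lebesgue. w x * (laplacian \<psi> x)\<^sup>2 + w x * (laplacian \<phi> x)\<^sup>2 \<le> \<rho> x * (norm (csD ?v x))\<^sup>2"
          using v(2) w_bounds
        proof eventually_elim
          case (elim x)
          have "w x * ((laplacian \<psi> x)\<^sup>2 + (laplacian \<phi> x)\<^sup>2) \<le> (\<rho> x * (cs x)\<^sup>2) * ((laplacian \<psi> x)\<^sup>2 + (laplacian \<phi> x)\<^sup>2)"
            using elim by (intro mult_right_mono) auto
          then show ?case using elim by (simp add: csD_def cmod_power2 power_mult_distrib algebra_simps)
        qed
      qed
      show "\<kappa>\<^sup>2 \<le> 1" using kappa by (simp add: power_le_one)
      show "0 \<le> 36 * C * A * B" using C A0 B0 by simp
    qed simp
    finally show ?thesis by (simp add: mult_ac)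
  qed
  then show ?thesis using C(1) by (intro exI[of _ "36 * C"]) auto
qed

text \<open>The truncated field \<chi>' u has small norm and a square integrable divergence, so it
  can be approximated by a gradient in the sense above. Truncation loses the part \<eta> div u,
  which \<open>div_outside\<close> controls for almost-null vectors. \<open>K\<close> and
  \<open>\<eta>\<close> are fixed before u and \<delta> so that the estimate can be used along a
  sequence.\<close>

lemma approximate_gradient:
  "\<exists>K>0. \<exists>\<eta>. smooth \<eta> \<and> (\<forall>x. 0 \<le> \<eta> x \<and> \<eta> x \<le> 1) \<and> (\<forall>x. norm x \<le> r1 + 1 \<longrightarrow> \<eta> x = 0) \<and>
    (\<forall>u\<in>X. \<forall>\<delta>. XH.nrm u \<le> 1 \<longrightarrow> 0 < \<delta> \<longrightarrow> \<delta> \<le> 1 \<longrightarrow> (\<exists>v\<in>X.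
      L2n \<rho> v \<le> K * (L2n \<rho> u + \<delta>) \<and>
      L2n \<rho> (\<lambda>x. D v x - D u x) \<le> K * (L2n \<rho> u + \<delta>) + L2n \<rho> (\<lambda>x. \<eta> x *\<^sub>R D u x) \<and>
      (L2n \<rho> (T v))\<^sup>2 \<le> \<kappa>\<^sup>2 * (L2n \<rho> (csD v))\<^sup>2 + K * (L2n \<rho> u + \<delta>)))"
proof -
  obtain \<chi>' :: "real^3 \<Rightarrow> real" and B where xi: "\<chi>' \<in> test_functions UNIV" "\<And>x. 0 \<le> \<chi>' x" "\<And>x. \<chi>' x \<le> 1"
    "\<And>x. norm x \<le> r1 + 1 \<Longrightarrow> \<chi>' x = 1" "\<And>x. norm x \<ge> r1 + 1 + 1 \<Longrightarrow> \<chi>' x = 0" and B: "B \<ge> 1" "\<And>l x. \<bar>partial l \<chi>' x\<bar> \<le> B"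
    using cutoff_exists[of "r1 + 1"] r1 by (metis add_nonneg_nonneg less_imp_le zero_le_one)
  have xs: "smooth \<chi>'" by (rule test_smooth[OF xi(1)])
  have xB: "\<bar>\<chi>' x\<bar> \<le> B" for x using xi(2,3)[of x] B(1) by simp
  obtain R where R: "\<And>x. norm x \<ge> R \<Longrightarrow> \<chi>' x = 0" "\<And>x l. norm x \<ge> R \<Longrightarrow> partial l \<chi>' x = 0"
    using test_bounded_support[OF xi(1)] by blast
  define \<eta> where "\<eta> x = 1 - \<chi>' x" for x
  obtain Kv where Kv: "Kv > 0" "\<And>u :: real^3 \<Rightarrow> complex^3. u \<in> L2w \<rho> \<Longrightarrow>
      (\<lambda>x. indicator (ball 0 R) x *\<^sub>R u x) \<in> L2w (\<lambda>_. 1) \<and>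
      L2n (\<lambda>_. 1) (\<lambda>x. indicator (ball 0 R) x *\<^sub>R u x) \<le> Kv * L2n \<rho> u"
    using weight_bounds_L2[where R=R] by blast
  obtain Ks where Ks: "Ks > 0" "\<And>u :: real^3 \<Rightarrow> complex. u \<in> L2w \<rho> \<Longrightarrow>
      (\<lambda>x. indicator (ball 0 R) x *\<^sub>R u x) \<in> L2w (\<lambda>_. 1) \<and>
      L2n (\<lambda>_. 1) (\<lambda>x. indicator (ball 0 R) x *\<^sub>R u x) \<le> Ks * L2n \<rho> u"
    using weight_bounds_L2[where R=R] by blast
  obtain Pv where Pv: "Pv > 0" "\<And>u :: real^3 \<Rightarrow> complex^3. u \<in> L2w (\<lambda>_. 1) \<Longrightarrow> u \<in> L2w \<rho> \<and> L2n \<rho> u \<le> Pv * L2n (\<lambda>_. 1) u"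
    using L2w_unweighted by blast
  obtain Ps where Ps: "Ps > 0" "\<And>u :: real^3 \<Rightarrow> complex. u \<in> L2w (\<lambda>_. 1) \<Longrightarrow> u \<in> L2w \<rho> \<and> L2n \<rho> u \<le> Ps * L2n (\<lambda>_. 1) u"
    using L2w_unweighted by blast
  obtain C where C: "C \<ge> 0" "\<And>\<psi> \<phi> A B. \<psi> \<in> test_functions UNIV \<Longrightarrow> \<phi> \<in> test_functions UNIV \<Longrightarrow>
    (\<And>l. L2n (\<lambda>_. 1) (partial l \<psi>) \<le> A) \<Longrightarrow> (\<And>l. L2n (\<lambda>_. 1) (partial l \<phi>) \<le> A) \<Longrightarrow>
    L2n (\<lambda>_. 1) (laplacian \<psi>) \<le> B \<Longrightarrow> L2n (\<lambda>_. 1) (laplacian \<phi>) \<le> B \<Longrightarrow>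
    (L2n \<rho> (T (gradc \<psi> \<phi>)))\<^sup>2 \<le> \<kappa>\<^sup>2 * (L2n \<rho> (csD (gradc \<psi> \<phi>)))\<^sup>2 + C * A * B"
    using flow_gradc_estimate by blast
  \<comment> \<open>Relative to |u| + \<delta>, \<open>MA\<close> bounds the gradients and
    \<open>ME\<close> the error in the divergence; \<open>MB\<close> bounds the Laplacians
    absolutely. The numbers 6, 2 and 12, 5 come from \<open>helmholtz_approx\<close>.\<close>
  define MA where "MA = 6 * Kv + 2"
  define ME where "ME = 12 * Kv + 5"
  define MB where "MB = ME * 2 + Ks * (1 + 3 * B)"
  define K where "K = Pv * (6 * MA) + (Ps * ME + 3 * B) + C * MA * MB"
  have pos: "MA > 0" "ME > 0" "MB > 0" using Kv(1) Ks(1) B by (auto simp: MA_def ME_def MB_def intro!: add_pos_pos)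
  have Kp: "Pv * (6 * MA) \<le> K" "Ps * ME + 3 * B \<le> K" "C * MA * MB \<le> K" "K > 0"
  proof -
    have "0 < Pv * (6 * MA)" "0 < Ps * ME + 3 * B" "0 \<le> C * MA * MB" using pos Pv Ps C B by (auto intro!: add_pos_pos mult_nonneg_nonneg)
    then show "Pv * (6 * MA) \<le> K" "Ps * ME + 3 * B \<le> K" "C * MA * MB \<le> K" "K > 0" unfolding K_def by linarith+
  qed
  have main: "\<exists>v\<in>X.
      L2n \<rho> v \<le> K * (L2n \<rho> u + \<delta>) \<and>
      L2n \<rho> (\<lambda>x. D v x - D u x) \<le> K * (L2n \<rho> u + \<delta>) + L2n \<rho> (\<lambda>x. \<eta> x *\<^sub>R D u x) \<and>
      (L2n \<rho> (T v))\<^sup>2 \<le> \<kappa>\<^sup>2 * (L2n \<rho> (csD v))\<^sup>2 + K * (L2n \<rho> u + \<delta>)"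
    if u: "u \<in> X" and n1: "XH.nrm u \<le> 1" and \<delta>: "0 < \<delta>" "\<delta> \<le> 1" for u \<delta>
  proof -
    note U = XD[OF u]
    let ?U = "L2n \<rho> u"
    have U1: "?U \<le> 1" "L2n \<rho> (D u) \<le> 1" "0 \<le> ?U" using L2n_le_nrm[OF u] n1 by (auto intro: order_trans)
    define V where "V x = \<chi>' x *\<^sub>R u x" for x
    define g where "g x = (\<Sum>l\<in>UNIV. partial l \<chi>' x *\<^sub>R u x $ l)" for x
    define G where "G x = \<chi>' x *\<^sub>R D u x + g x" for x
    have x1: "AE x in lebesgue. \<bar>\<chi>' x\<bar> \<le> 1" using xi(2,3) by (intro AE_I2) simp
    have V: "V \<in> L2w \<rho>" "L2n \<rho> V \<le> 1 * ?U"
      unfolding V_def[abs_def] by (rule L2w_scaleR_bounded[OF U(1) smooth_measurable[OF xs] x1], simp)+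
    have g: "g \<in> L2w \<rho>" "L2n \<rho> g \<le> (3 * B) * ?U"
      unfolding g_def[abs_def] by (rule grad_dot_bound[OF U(1) xs B(2)])+
    have xD: "(\<lambda>x. \<chi>' x *\<^sub>R D u x) \<in> L2w \<rho>" "L2n \<rho> (\<lambda>x. \<chi>' x *\<^sub>R D u x) \<le> 1 * L2n \<rho> (D u)"
      by (rule L2w_scaleR_bounded[OF U(2) smooth_measurable[OF xs] x1], simp)+
    have G: "G \<in> L2w \<rho>" unfolding G_def[abs_def] by (rule L2w_add[OF xD(1) g(1)])
    have B3: "(3 * B) * ?U \<le> 3 * B" using U1(1) B(1) by (simp add: mult_left_le)
    have Gn: "L2n \<rho> G \<le> 1 + 3 * B"
      unfolding G_def[abs_def] using L2n_add_le[OF xD(1) g(1)] xD(2) g(2) U1 B3 by linarith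
    \<comment> \<open>V and G vanish outside the ball of radius R, so restricting to it changes
      nothing and the local comparison of norms places both in unweighted L^2.\<close>
    have iV: "(\<lambda>x. indicator (ball 0 R) x *\<^sub>R V x) = V"
      using R(1) by (auto simp: V_def indicator_def fun_eq_iff not_le[symmetric])
    have iG: "(\<lambda>x. indicator (ball 0 R) x *\<^sub>R G x) = G"
      using R by (auto simp: G_def g_def indicator_def fun_eq_iff)
    have V1: "V \<in> L2w (\<lambda>_. 1)" "L2n (\<lambda>_. 1) V \<le> Kv * ?U"
      using Kv(2)[OF V(1)] mult_left_mono[OF V(2), of Kv] Kv(1) by (auto simp: iV intro: order_trans)
    have G1: "G \<in> L2w (\<lambda>_. 1)" "L2n (\<lambda>_. 1) G \<le> Ks * (1 + 3 * B)"
      using Ks(2)[OF G] mult_left_mono[OF Gn, of Ks] Ks(1) by (auto simp: iG intro: order_trans)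
    have dG: "has_weak_div V G"
      unfolding V_def[abs_def] G_def[abs_def] g_def by (rule has_weak_div_times_smooth[OF U(3) xs xB B(2)])
    obtain \<psi> \<phi> where t: "\<psi> \<in> test_functions UNIV" "\<phi> \<in> test_functions UNIV"
      and E: "L2n (\<lambda>_. 1) (\<lambda>x. Complex (laplacian \<psi> x) (laplacian \<phi> x) - G x) \<le> 12 * L2n (\<lambda>_. 1) V + 5 * \<delta>"
      and A: "\<And>l. L2n (\<lambda>_. 1) (partial l \<psi>) \<le> 6 * L2n (\<lambda>_. 1) V + 2 * \<delta>"
        "\<And>l. L2n (\<lambda>_. 1) (partial l \<phi>) \<le> 6 * L2n (\<lambda>_. 1) V + 2 * \<delta>"
      using helmholtz_approx[OF V1(1) G1(1) dG \<delta>(1)] by blast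
    have sU: "0 \<le> ?U + \<delta>" using U1(3) \<delta> by simp
    have KvU: "0 \<le> Kv * ?U" "0 \<le> Kv * \<delta>" using Kv(1) U1(3) \<delta> by simp_all
    have "6 * L2n (\<lambda>_. 1) V + 2 * \<delta> \<le> MA * (?U + \<delta>)"
    proof -
      have "MA * (?U + \<delta>) = 6 * (Kv * ?U) + 6 * (Kv * \<delta>) + 2 * ?U + 2 * \<delta>" by (simp add: MA_def algebra_simps)
      then show ?thesis using V1(2) KvU U1(3) by linarith
    qed
    then have A': "L2n (\<lambda>_. 1) (partial l \<psi>) \<le> MA * (?U + \<delta>)" "L2n (\<lambda>_. 1) (partial l \<phi>) \<le> MA * (?U + \<delta>)" for l
      using A[of l] by (auto intro: order_trans)
    have "12 * L2n (\<lambda>_. 1) V + 5 * \<delta> \<le> ME * (?U + \<delta>)"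
    proof -
      have "ME * (?U + \<delta>) = 12 * (Kv * ?U) + 12 * (Kv * \<delta>) + 5 * ?U + 5 * \<delta>" by (simp add: ME_def algebra_simps)
      then show ?thesis using V1(2) KvU U1(3) by linarith
    qed
    then have E': "L2n (\<lambda>_. 1) (\<lambda>x. Complex (laplacian \<psi> x) (laplacian \<phi> x) - G x) \<le> ME * (?U + \<delta>)" using E by simp
    let ?v = "gradc \<psi> \<phi>"
    note v = gradc_X[OF t]
    have HL: "(\<lambda>x. Complex (laplacian \<psi> x) (laplacian \<phi> x)) \<in> L2w (\<lambda>_. 1)"
      unfolding Complex_eq
      by (intro unweighted.L2w_add unweighted.L2w_cmult test_L2w[of _ UNIV] test_bounded_linear[OF bounded_linear_of_real] test_laplacian t)
    have eL: "(\<lambda>x. Complex (laplacian \<psi> x) (laplacian \<phi> x) - G x) \<in> L2w (\<lambda>_. 1)" by (rule unweighted.L2w_diff[OF HL G1(1)])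
    have "L2n \<rho> ?v \<le> Pv * (6 * (MA * (?U + \<delta>)))"
      using Pv(2)[OF test_L2w[OF gradc_test[OF t]]] mult_left_mono[OF gradc_L2n_le[OF t A'], of Pv] Pv(1) by linarith
    also have "\<dots> = (Pv * (6 * MA)) * (?U + \<delta>)" by simp
    also have "\<dots> \<le> K * (?U + \<delta>)" by (rule mult_right_mono[OF Kp(1) sU])
    finally have c1: "L2n \<rho> ?v \<le> K * (?U + \<delta>)" .
    have c2: "L2n \<rho> (\<lambda>x. D ?v x - D u x) \<le> K * (?U + \<delta>) + L2n \<rho> (\<lambda>x. \<eta> x *\<^sub>R D u x)"
    proof -
      have \<eta>1: "AE x in lebesgue. \<bar>\<eta> x\<bar> \<le> 1" using xi(2,3) by (intro AE_I2) (simp add: \<eta>_def)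
      have \<eta>m: "\<eta> \<in> borel_measurable lebesgue"
        unfolding \<eta>_def[abs_def] by (intro smooth_measurable smooth_diff smooth_const xs)
      have \<eta>D: "(\<lambda>x. \<eta> x *\<^sub>R D u x) \<in> L2w \<rho>" by (rule L2w_scaleR_bounded(1)[OF U(2) \<eta>m \<eta>1]) simp
      have eR: "(\<lambda>x. Complex (laplacian \<psi> x) (laplacian \<phi> x) - G x) \<in> L2w \<rho>"
        and eRn: "L2n \<rho> (\<lambda>x. Complex (laplacian \<psi> x) (laplacian \<phi> x) - G x) \<le> Ps * (ME * (?U + \<delta>))"
        using Ps(2)[OF eL] mult_left_mono[OF E', of Ps] Ps(1) by (auto intro: order_trans)
      have gD: "(\<lambda>x. g x - \<eta> x *\<^sub>R D u x) \<in> L2w \<rho>" by (rule L2w_diff[OF g(1) \<eta>D])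
      \<comment> \<open>As \<chi>' + \<eta> = 1, the difference splits into the approximation error,
        the commutator g with the cutoff, and the truncated part \<eta> div u.\<close>
      have "L2n \<rho> (\<lambda>x. D ?v x - D u x) = L2n \<rho> (\<lambda>x. (Complex (laplacian \<psi> x) (laplacian \<phi> x) - G x) + (g x - \<eta> x *\<^sub>R D u x))"
      proof (rule L2n_cong_AE[OF _ L2w_measurable[OF L2w_diff[OF XD(2)[OF v(1)] U(2)]] L2w_measurable[OF L2w_add[OF eR gD]]])
        show "AE x in lebesgue. D ?v x - D u x = (Complex (laplacian \<psi> x) (laplacian \<phi> x) - G x) + (g x - \<eta> x *\<^sub>R D u x)"
          using v(2) by eventually_elim (simp add: G_def \<eta>_def algebra_simps)
      qed
      also have "\<dots> \<le> L2n \<rho> (\<lambda>x. Complex (laplacian \<psi> x) (laplacian \<phi> x) - G x) + L2n \<rho> (\<lambda>x. g x - \<eta> x *\<^sub>R D u x)"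
        by (rule L2n_add_le[OF eR gD])
      also have "\<dots> \<le> Ps * (ME * (?U + \<delta>)) + ((3 * B) * (?U + \<delta>) + L2n \<rho> (\<lambda>x. \<eta> x *\<^sub>R D u x))"
      proof (rule add_mono[OF eRn order_trans[OF L2n_diff_le[OF g(1) \<eta>D] add_right_mono]])
        have "(3 * B) * ?U \<le> (3 * B) * (?U + \<delta>)" using B(1) \<delta> by (intro mult_left_mono) auto
        then show "L2n \<rho> g \<le> (3 * B) * (?U + \<delta>)" using g(2) by linarith
      qed
      also have "\<dots> = (Ps * ME + 3 * B) * (?U + \<delta>) + L2n \<rho> (\<lambda>x. \<eta> x *\<^sub>R D u x)" by (simp add: algebra_simps)
      also have "\<dots> \<le> K * (?U + \<delta>) + L2n \<rho> (\<lambda>x. \<eta> x *\<^sub>R D u x)" by (intro add_right_mono mult_right_mono Kp sU)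
      finally show ?thesis .
    qed
    have HB: "L2n (\<lambda>_. 1) (\<lambda>x. Complex (laplacian \<psi> x) (laplacian \<phi> x)) \<le> MB"
    proof -
      have "L2n (\<lambda>_. 1) (\<lambda>x. Complex (laplacian \<psi> x) (laplacian \<phi> x)) \<le>
        L2n (\<lambda>_. 1) (\<lambda>x. Complex (laplacian \<psi> x) (laplacian \<phi> x) - G x) + L2n (\<lambda>_. 1) G"
        using unweighted.L2n_add_le[OF eL G1(1)] by simp
      also have "\<dots> \<le> ME * 2 + Ks * (1 + 3 * B)"
        using E' G1(2) mult_left_mono[of "?U + \<delta>" 2 ME] U1(1) \<delta>(2) pos(2) by linarith
      finally show ?thesis by (simp add: MB_def)
    qed
    have lap: "L2n (\<lambda>_. 1) (laplacian \<psi>) \<le> MB" "L2n (\<lambda>_. 1) (laplacian \<phi>) \<le> MB"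
      using unweighted.L2w_bound(2)[where C=1, OF HL smooth_measurable[OF test_smooth[OF test_laplacian[OF t(1)]]]]
        unweighted.L2w_bound(2)[where C=1, OF HL smooth_measurable[OF test_smooth[OF test_laplacian[OF t(2)]]]] HB
        abs_Re_le_cmod[of "Complex a b" for a b] abs_Im_le_cmod[of "Complex a b" for a b] by force+
    have "(L2n \<rho> (T ?v))\<^sup>2 \<le> \<kappa>\<^sup>2 * (L2n \<rho> (csD ?v))\<^sup>2 + C * (MA * (?U + \<delta>)) * MB"
      by (rule C(2)[OF t A' lap])
    also have "C * (MA * (?U + \<delta>)) * MB = (C * MA * MB) * (?U + \<delta>)" by simp
    also have "\<dots> \<le> K * (?U + \<delta>)" by (rule mult_right_mono[OF Kp(3) sU])
    finally have "(L2n \<rho> (T ?v))\<^sup>2 \<le> \<kappa>\<^sup>2 * (L2n \<rho> (csD ?v))\<^sup>2 + K * (?U + \<delta>)" by simp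
    with v(1) c1 c2 show ?thesis by blast
  qed
  have "smooth \<eta>" unfolding \<eta>_def[abs_def] by (intro smooth_diff smooth_const xs)
  moreover have "\<forall>x. 0 \<le> \<eta> x \<and> \<eta> x \<le> 1" using xi(2,3) by (simp add: \<eta>_def)
  moreover have "\<forall>x. norm x \<le> r1 + 1 \<longrightarrow> \<eta> x = 0" using xi(4) by (simp add: \<eta>_def)
  ultimately show ?thesis using Kp(4) main by (intro exI[of _ K] conjI exI[of _ \<eta>]) auto
qed

theorem form_lower_bound:
  "\<exists>\<epsilon>>0. \<forall>u\<in>X. XH.nrm u = 1 \<longrightarrow> (\<exists>u'\<in>X. cmod (form u u') > \<epsilon> * XH.nrm u')"
proof (rule ccontr)
  assume "\<not> ?thesis"
  then have neg: "\<exists>u\<in>X. XH.nrm u = 1 \<and> (\<forall>u'\<in>X. cmod (form u u') \<le> \<epsilon> * XH.nrm u')" if "\<epsilon> > 0" for \<epsilon>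
    using that by (metis not_le)
  define \<epsilon> where "\<epsilon> n = 1 / real (Suc n)" for n
  have \<epsilon>: "0 < \<epsilon> n" "\<epsilon> n \<le> 1" for n by (auto simp: \<epsilon>_def)
  have \<epsilon>0: "\<epsilon> \<longlonglongrightarrow> 0" unfolding \<epsilon>_def by (rule LIMSEQ_Suc, rule lim_const_over_n)
  have "\<forall>n. \<exists>u. u \<in> X \<and> XH.nrm u = 1 \<and> (\<forall>u'\<in>X. cmod (form u u') \<le> \<epsilon> n * XH.nrm u')" using neg[OF \<epsilon>(1)] by blast
  from choice[OF this] obtain u where u: "\<And>n. u n \<in> X" "\<And>n. XH.nrm (u n) = 1"
    "\<And>n u'. u' \<in> X \<Longrightarrow> cmod (form (u n) u') \<le> \<epsilon> n * XH.nrm u'" by blast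
  define U where "U n = L2n \<rho> (u n)" for n
  have U01: "0 \<le> U n" "U n \<le> 1" for n using L2n_le_nrm(3)[OF u(1)] u(2) by (auto simp: U_def)
  have U0: "U \<longlonglongrightarrow> 0"
  proof -
    obtain c where c: "c > 0" "\<And>u. u \<in> X \<Longrightarrow> c * (L2n \<rho> u)\<^sup>2 \<le> cmod (form u u)" using form_Im by blast
    have b: "(U n)\<^sup>2 \<le> \<epsilon> n / c" for n
      using c(2)[OF u(1), of n] u(3)[OF u(1), of n n] u(2)[of n] c(1) by (simp add: U_def pos_le_divide_eq mult.commute)
    have l: "(\<lambda>n. \<epsilon> n / c) \<longlonglongrightarrow> 0" using tendsto_divide[OF \<epsilon>0 tendsto_const[of c]] c(1) by simp
    have "(\<lambda>n. (U n)\<^sup>2) \<longlonglongrightarrow> 0"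
      by (rule tendsto_sandwich[OF _ _ tendsto_const l]) (use b in auto)
    then show ?thesis by simp
  qed
  obtain K \<eta> where K: "K > 0" and \<eta>: "smooth \<eta>" "\<forall>x. 0 \<le> \<eta> x \<and> \<eta> x \<le> 1" "\<forall>x. norm x \<le> r1 + 1 \<longrightarrow> \<eta> x = 0"
    and approx: "\<And>u \<delta>. u \<in> X \<Longrightarrow> XH.nrm u \<le> 1 \<Longrightarrow> 0 < \<delta> \<Longrightarrow> \<delta> \<le> 1 \<Longrightarrow> \<exists>v\<in>X.
      L2n \<rho> v \<le> K * (L2n \<rho> u + \<delta>) \<and>
      L2n \<rho> (\<lambda>x. D v x - D u x) \<le> K * (L2n \<rho> u + \<delta>) + L2n \<rho> (\<lambda>x. \<eta> x *\<^sub>R D u x) \<and>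
      (L2n \<rho> (T v))\<^sup>2 \<le> \<kappa>\<^sup>2 * (L2n \<rho> (csD v))\<^sup>2 + K * (L2n \<rho> u + \<delta>)"
    using approximate_gradient by blast
  define P where "P n = L2n \<rho> (\<lambda>x. \<eta> x *\<^sub>R D (u n) x)" for n
  have P0: "P \<longlonglongrightarrow> 0"
  proof -
    obtain L where L: "L > 0" "\<And>u e. u \<in> X \<Longrightarrow> e \<ge> 0 \<Longrightarrow> XH.nrm u \<le> 1 \<Longrightarrow> (\<forall>u'\<in>X. cmod (form u u') \<le> e * XH.nrm u') \<Longrightarrow>
      (L2n \<rho> (\<lambda>x. \<eta> x *\<^sub>R D u x))\<^sup>2 \<le> L * (e + L2n \<rho> u)"
      using div_outside \<eta> by blast
    have b: "(P n)\<^sup>2 \<le> L * (\<epsilon> n + U n)" for n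
      unfolding P_def U_def using u by (intro L less_imp_le[OF \<epsilon>(1)]) auto
    have l: "(\<lambda>n. L * (\<epsilon> n + U n)) \<longlonglongrightarrow> 0" using tendsto_mult_left[OF tendsto_add[OF \<epsilon>0 U0], of L] by simp
    have "(\<lambda>n. (P n)\<^sup>2) \<longlonglongrightarrow> 0"
      by (rule tendsto_sandwich[OF _ _ tendsto_const l]) (use b in auto)
    then show ?thesis by simp
  qed
  have P1: "0 \<le> P n" "P n \<le> 1" for n
  proof -
    have "AE x in lebesgue. \<bar>\<eta> x\<bar> \<le> 1" using \<eta>(2) by (intro AE_I2) simp
    from L2w_scaleR_bounded(2)[OF XD(2)[OF u(1)] smooth_measurable[OF \<eta>(1)] this, of n]
    show "P n \<le> 1" using L2n_le_nrm(1)[OF u(1), of n] u(2)[of n] by (simp add: P_def)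
  qed (simp add: P_def)
  have "\<forall>n. \<exists>v. v \<in> X \<and> L2n \<rho> v \<le> K * (U n + \<epsilon> n) \<and> L2n \<rho> (\<lambda>x. D v x - D (u n) x) \<le> K * (U n + \<epsilon> n) + P n \<and>
      (L2n \<rho> (T v))\<^sup>2 \<le> \<kappa>\<^sup>2 * (L2n \<rho> (csD v))\<^sup>2 + K * (U n + \<epsilon> n)"
  proof
    fix n
    have "XH.nrm (u n) \<le> 1" using u(2)[of n] by simp
    from approx[OF u(1) this \<epsilon>, of n] show "\<exists>v. v \<in> X \<and> L2n \<rho> v \<le> K * (U n + \<epsilon> n) \<and> L2n \<rho> (\<lambda>x. D v x - D (u n) x) \<le> K * (U n + \<epsilon> n) + P n \<and>
      (L2n \<rho> (T v))\<^sup>2 \<le> \<kappa>\<^sup>2 * (L2n \<rho> (csD v))\<^sup>2 + K * (U n + \<epsilon> n)"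
      unfolding U_def P_def by blast
  qed
  from choice[OF this] obtain v where v: "\<And>n. v n \<in> X" "\<And>n. L2n \<rho> (v n) \<le> K * (U n + \<epsilon> n)"
    "\<And>n. L2n \<rho> (\<lambda>x. D (v n) x - D (u n) x) \<le> K * (U n + \<epsilon> n) + P n"
    "\<And>n. (L2n \<rho> (T (v n)))\<^sup>2 \<le> \<kappa>\<^sup>2 * (L2n \<rho> (csD (v n)))\<^sup>2 + K * (U n + \<epsilon> n)" by blast
  \<comment> \<open>\<open>k\<close> measures the error of the approximate gradient;
    \<open>d\<close> adds the divergence lost outside and bounds the distance between div v and div
    u.\<close>
  define k where "k n = K * (U n + \<epsilon> n)" for n
  define d where "d n = k n + P n" for n
  have k0: "k \<longlonglongrightarrow> 0" unfolding k_def using tendsto_mult_left[OF tendsto_add[OF U0 \<epsilon>0], of K] by simp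
  have d0: "d \<longlonglongrightarrow> 0" unfolding d_def using tendsto_add[OF k0 P0] by simp
  have kpos: "0 \<le> k n" "k n \<le> 2 * K" for n
  proof -
    show "0 \<le> k n" using K U01(1)[of n] \<epsilon>(1)[of n] by (simp add: k_def)
    have "U n + \<epsilon> n \<le> 2" using U01(2)[of n] \<epsilon>(2)[of n] by simp
    then have "K * (U n + \<epsilon> n) \<le> K * 2" using K by (intro mult_left_mono) auto
    then show "k n \<le> 2 * K" by (simp add: k_def)
  qed
  have dpos: "0 \<le> d n" "d n \<le> 2 * K + 1" for n using kpos[of n] P1[of n] by (auto simp: d_def)
  obtain M where M: "M > 0" "\<And>f :: real^3 \<Rightarrow> complex. f \<in> L2w \<rho> \<Longrightarrow> (\<lambda>x. cs x *\<^sub>R f x) \<in> L2w \<rho>"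
    "\<And>f :: real^3 \<Rightarrow> complex. f \<in> L2w \<rho> \<Longrightarrow> L2n \<rho> (\<lambda>x. cs x *\<^sub>R f x) \<le> M * L2n \<rho> f" using csD_bound by blast
  \<comment> \<open>Four quantities are compared: x and x' are the norms of c_s div for
    \<open>u n\<close> and \<open>v n\<close>, while y and z are those of their flow derivatives.
    The aim is y^2 <= x^2, x^2 <= y z and z^2 <= \<kappa>^2 x^2, each up to a null sequence.\<close>
  define x where "x n = L2n \<rho> (csD (u n))" for n
  define x' where "x' n = L2n \<rho> (csD (v n))" for n
  define y where "y n = L2n \<rho> (T (u n))" for n
  define z where "z n = L2n \<rho> (T (v n))" for n
  note XDu = XD[OF u(1)] and XDv = XD[OF v(1)]
  have pos: "0 \<le> x n" "0 \<le> x' n" "0 \<le> y n" "0 \<le> z n" for n by (auto simp: x_def x'_def y_def z_def)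
  have xM: "x n \<le> M" for n
    using M(3)[OF XDu(2)[of n]] mult_left_mono[OF L2n_le_nrm(1)[OF u(1), of n], of M] M(1) unfolding u(2)
    unfolding x_def csD_def[abs_def] by linarith
  have diffL: "(\<lambda>x. D (v n) x - D (u n) x) \<in> L2w \<rho>" for n by (intro L2w_diff XDu XDv)
  have csL: "csD (u n) \<in> L2w \<rho>" "csD (v n) \<in> L2w \<rho>" for n
    unfolding csD_def[abs_def] by (intro M(2) XDu XDv)+
  have diff: "L2n \<rho> (\<lambda>x. cs x *\<^sub>R (D (v n) x - D (u n) x)) \<le> M * d n" for n
    using M(3)[OF diffL, of n] mult_left_mono[OF v(3), of M n] M(1) unfolding d_def k_def by linarith
  have xx': "x' n \<le> x n + M * d n" for n
  proof -
    have "csD (v n) = (\<lambda>x. csD (u n) x + cs x *\<^sub>R (D (v n) x - D (u n) x))" by (simp add: csD_def fun_eq_iff algebra_simps)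
    then show ?thesis using L2n_add_le[OF csL(1) M(2)[OF diffL], of n n] diff[of n] unfolding x_def x'_def by simp
  qed
  \<comment> \<open>The residual tested with \<open>v n\<close> tends to zero only if the X norms of
    the \<open>v n\<close> stay bounded.\<close>
  have nv: "\<exists>N\<ge>0. \<forall>n. XH.nrm (v n) \<le> N"
  proof -
    define N where "N = (2 * K + 2)\<^sup>2 + ((M + M * (2 * K + 1))\<^sup>2 + 2 * K) + (2 * K)\<^sup>2"
    have b: "(XH.nrm (v n))\<^sup>2 \<le> N" for n
    proof -
      have "L2n \<rho> (D (v n)) \<le> L2n \<rho> (\<lambda>x. D (v n) x - D (u n) x) + L2n \<rho> (D (u n))"
        using L2n_add_le[OF diffL XDu(2), of n n] by simp
      then have "L2n \<rho> (D (v n)) \<le> 2 * K + 2"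
        using v(3)[of n] dpos(2)[of n] L2n_le_nrm(1)[OF u(1), of n] u(2)[of n] by (simp add: d_def k_def)
      then have a: "(L2n \<rho> (D (v n)))\<^sup>2 \<le> (2 * K + 2)\<^sup>2" by (intro power_mono) auto
      have "x' n \<le> M + M * (2 * K + 1)"
        using xx'[of n] xM[of n] mult_left_mono[OF dpos(2)[of n], of M] M(1) by linarith
      then have "(x' n)\<^sup>2 \<le> (M + M * (2 * K + 1))\<^sup>2" using pos by (intro power_mono) auto
      moreover have "\<kappa>\<^sup>2 * (x' n)\<^sup>2 \<le> 1 * (x' n)\<^sup>2" using kappa by (intro mult_right_mono power_le_one) auto
      ultimately have b: "(L2n \<rho> (T (v n)))\<^sup>2 \<le> (M + M * (2 * K + 1))\<^sup>2 + 2 * K"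
        using v(4)[of n] kpos(2)[of n] unfolding x'_def k_def by linarith
      have c: "(L2n \<rho> (v n))\<^sup>2 \<le> (2 * K)\<^sup>2"
        using v(2)[of n] kpos(2)[of n] by (intro power_mono) (auto simp: k_def)
      show ?thesis unfolding X_nrm_sq[OF v(1)] N_def using a b c by linarith
    qed
    have "0 \<le> N" using K by (simp add: N_def)
    have "XH.nrm (v n) \<le> N + 1" for n
    proof (rule power2_le_imp_le)
      have "N \<le> (N + 1)\<^sup>2" using \<open>0 \<le> N\<close> by (simp add: power2_sum)
      then show "(XH.nrm (v n))\<^sup>2 \<le> (N + 1)\<^sup>2" using b[of n] by linarith
    qed (use \<open>0 \<le> N\<close> in simp)
    then show ?thesis using \<open>0 \<le> N\<close> by (intro exI[of _ "N + 1"]) auto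
  qed
  then obtain N where N: "N \<ge> 0" "\<And>n. XH.nrm (v n) \<le> N" by blast
  obtain H where H: "H > 0" "\<And>u u'. u \<in> X \<Longrightarrow> u' \<in> X \<Longrightarrow>
    cmod (form u u' - form0 u u') \<le> H * (L2n \<rho> u * XH.nrm u' + XH.nrm u * L2n \<rho> u')"
    using form_lower_order by blast
  define \<alpha> where "\<alpha> n = \<epsilon> n + H * (U n + U n)" for n
  define \<beta> where "\<beta> n = \<epsilon> n * N + H * (U n * N + k n)" for n
  have form0: "cmod (form0 s t) \<le> cmod (form s t) + cmod (form s t - form0 s t)" for s t
    using norm_triangle_ineq4[of "form s t" "form s t - form0 s t"] by simp
  have fa: "cmod (form0 (u n) (u n)) \<le> \<alpha> n" for n
    using form0[of "u n" "u n"] u(3)[OF u(1), of n n] H(2)[OF u(1) u(1), of n n] u(2)[of n]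
    by (simp add: \<alpha>_def U_def)
  have fb: "cmod (form0 (u n) (v n)) \<le> \<beta> n" for n
  proof -
    have "cmod (form (u n) (v n)) \<le> \<epsilon> n * N"
      using u(3)[OF v(1), of n n] mult_left_mono[OF N(2)[of n] less_imp_le[OF \<epsilon>(1)[of n]]] by linarith
    moreover have "H * (L2n \<rho> (u n) * XH.nrm (v n) + XH.nrm (u n) * L2n \<rho> (v n)) \<le> H * (U n * N + 1 * k n)"
    proof (intro mult_left_mono add_mono)
      show "L2n \<rho> (u n) * XH.nrm (v n) \<le> U n * N" unfolding U_def by (intro mult_left_mono N) simp
      show "XH.nrm (u n) * L2n \<rho> (v n) \<le> 1 * k n" using v(2)[of n] u(2)[of n] by (simp add: k_def)
    qed (use H in simp)
    ultimately show ?thesis using form0[of "u n" "v n"] H(2)[OF u(1) v(1), of n n] by (simp add: \<beta>_def)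
  qed
  have \<alpha>0: "\<alpha> \<longlonglongrightarrow> 0"
    unfolding \<alpha>_def using tendsto_add[OF \<epsilon>0 tendsto_mult_left[OF tendsto_add[OF U0 U0], of H]] by simp
  have \<beta>0: "\<beta> \<longlonglongrightarrow> 0"
    unfolding \<beta>_def using tendsto_add[OF tendsto_mult_right[OF \<epsilon>0, of N] tendsto_mult_left[OF tendsto_add[OF tendsto_mult_right[OF U0, of N] k0], of H]] by simp
  have ya: "(y n)\<^sup>2 \<le> (x n)\<^sup>2 + \<alpha> n" for n
  proof -
    have "form0 (u n) (u n) = complex_of_real ((x n)\<^sup>2 - (y n)\<^sup>2)"
      unfolding form0_def ip_C2 x_def y_def csD_def[abs_def] by (simp add: ip_self_L2n ipv_self_L2n)
    then have "\<bar>(x n)\<^sup>2 - (y n)\<^sup>2\<bar> \<le> \<alpha> n" using fa[of n] by (simp only: norm_of_real)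
    then show ?thesis by simp
  qed
  have xb: "(x n)\<^sup>2 \<le> y n * z n + (\<beta> n + M * (M * d n))" for n
  proof -
    let ?w = "\<lambda>x. cs x *\<^sub>R (D (v n) x - D (u n) x)"
    have "csD (v n) = (\<lambda>x. csD (u n) x + ?w x)" by (simp add: csD_def fun_eq_iff algebra_simps)
    then have "ip \<rho> (C2 (D (u n))) (D (v n)) = ip \<rho> (csD (u n)) (\<lambda>x. csD (u n) x + ?w x)"
      unfolding ip_C2 by (simp add: csD_def[abs_def])
    also have "\<dots> = complex_of_real ((x n)\<^sup>2) + ip \<rho> (csD (u n)) ?w"
      using S.ip_add_right[OF csL(1) M(2)[OF diffL] csL(1), of n n n] by (simp add: ip_self_L2n x_def)
    finally have "complex_of_real ((x n)\<^sup>2) = form0 (u n) (v n) + ipv \<rho> (T (u n)) (T (v n)) - ip \<rho> (csD (u n)) ?w"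
      by (simp add: form0_def)
    then have "(x n)\<^sup>2 = Re (form0 (u n) (v n) + ipv \<rho> (T (u n)) (T (v n)) - ip \<rho> (csD (u n)) ?w)"
      by (metis Re_complex_of_real)
    also have "\<dots> \<le> cmod (form0 (u n) (v n)) + cmod (ipv \<rho> (T (u n)) (T (v n))) + cmod (ip \<rho> (csD (u n)) ?w)"
      using complex_Re_le_cmod[of "form0 (u n) (v n)"] complex_Re_le_cmod[of "ipv \<rho> (T (u n)) (T (v n))"]
        abs_Re_le_cmod[of "ip \<rho> (csD (u n)) ?w"] by simp
    also have "\<dots> \<le> \<beta> n + y n * z n + M * (M * d n)"
    proof (intro add_mono fb)
      show "cmod (ipv \<rho> (T (u n)) (T (v n))) \<le> y n * z n" unfolding y_def z_def by (rule ipv_Cauchy_Schwarz[OF XDu(4) XDv(4)])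
      have "x n * L2n \<rho> ?w \<le> M * (M * d n)" by (intro mult_mono xM diff) (use M in auto)
      then show "cmod (ip \<rho> (csD (u n)) ?w) \<le> M * (M * d n)"
        using ip_Cauchy_Schwarz[OF csL(1) M(2)[OF diffL], of n n] by (simp add: x_def)
    qed
    finally show ?thesis by simp
  qed
  define \<zeta> where "\<zeta> n = 2 * M * (M * d n) + (M * d n)\<^sup>2 + k n" for n
  have \<zeta>0: "\<zeta> \<longlonglongrightarrow> 0"
    unfolding \<zeta>_def
    using tendsto_add[OF tendsto_add[OF tendsto_mult_left[OF tendsto_mult_left[OF d0, of M], of "2 * M"] tendsto_power[OF tendsto_mult_left[OF d0, of M], of 2]] k0]
    by simp
  have zb: "(z n)\<^sup>2 \<le> \<kappa>\<^sup>2 * (x n)\<^sup>2 + \<zeta> n" for n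
  proof -
    have Md: "0 \<le> M * d n" using M dpos by simp
    have "(x' n)\<^sup>2 \<le> (x n + M * d n)\<^sup>2" using pos xx' by (intro power_mono) auto
    also have "\<dots> = (x n)\<^sup>2 + (2 * x n * (M * d n) + (M * d n)\<^sup>2)" by (simp add: power2_sum)
    also have "\<dots> \<le> (x n)\<^sup>2 + (2 * M * (M * d n) + (M * d n)\<^sup>2)"
      using mult_right_mono[OF xM[of n] Md] by simp
    finally have "\<kappa>\<^sup>2 * (x' n)\<^sup>2 \<le> \<kappa>\<^sup>2 * ((x n)\<^sup>2 + (2 * M * (M * d n) + (M * d n)\<^sup>2))" by (intro mult_left_mono) auto
    moreover have "\<kappa>\<^sup>2 * (2 * M * (M * d n) + (M * d n)\<^sup>2) \<le> 1 * (2 * M * (M * d n) + (M * d n)\<^sup>2)"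
      using kappa Md M by (intro mult_right_mono power_le_one) auto
    ultimately show ?thesis using v(4)[of n] unfolding z_def x'_def[symmetric] k_def[symmetric] \<zeta>_def by (simp add: distrib_left)
  qed
  \<comment> \<open>Up to null sequences x^2 <= y z <= (y^2 + z^2) / 2 <= (1 + \<kappa>^2) x^2 / 2,
    so the left side retains the fraction (1 - \<kappa>^2) / 2, which is positive as \<kappa> <
    1.\<close>
  define \<mu> where "\<mu> = (1 - \<kappa>\<^sup>2) / 2"
  have \<mu>: "\<mu> > 0" using kappa abs_square_less_1[of \<kappa>] by (simp add: \<mu>_def)
  define \<tau> where "\<tau> n = ((\<alpha> n + \<zeta> n) / 2 + (\<beta> n + M * (M * d n))) / \<mu>" for n
  have \<tau>0: "\<tau> \<longlonglongrightarrow> 0"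
    unfolding \<tau>_def
    using tendsto_divide[OF tendsto_add[OF tendsto_divide[OF tendsto_add[OF \<alpha>0 \<zeta>0] tendsto_const[of 2]]
      tendsto_add[OF \<beta>0 tendsto_mult_left[OF tendsto_mult_left[OF d0, of M], of M]]] tendsto_const[of \<mu>]] \<mu> by simp
  have x\<tau>: "(x n)\<^sup>2 \<le> \<tau> n" for n
  proof -
    have yz: "y n * z n \<le> ((y n)\<^sup>2 + (z n)\<^sup>2) / 2" using sum_squares_bound[of "y n" "z n"] by simp
    have "(x n)\<^sup>2 \<le> ((x n)\<^sup>2 + \<alpha> n + (\<kappa>\<^sup>2 * (x n)\<^sup>2 + \<zeta> n)) / 2 + (\<beta> n + M * (M * d n))"
    proof -
      have "X \<le> (A + B) / 2 + r" if "X \<le> p + r" "p \<le> (Y + Z) / 2" "Y \<le> A" "Z \<le> B" for X A B p r Y Z :: real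
        using that by argo
      from this[OF xb[of n] yz ya[of n] zb[of n]] show ?thesis .
    qed
    then have "\<mu> * (x n)\<^sup>2 \<le> (\<alpha> n + \<zeta> n) / 2 + (\<beta> n + M * (M * d n))"
      by (simp add: \<mu>_def field_simps)
    then show ?thesis using \<mu> by (simp add: \<tau>_def pos_le_divide_eq mult.commute)
  qed
  obtain c where c: "c > 0" "\<And>f :: real^3 \<Rightarrow> complex. f \<in> L2w \<rho> \<Longrightarrow> c * L2n \<rho> f \<le> L2n \<rho> (\<lambda>x. cs x *\<^sub>R f x)"
    using cs_lower_L2n by blast
  \<comment> \<open>The squared X norm of \<open>u n\<close> is 1, while each of its three parts is
    bounded by a null sequence.\<close>
  have one: "1 \<le> \<tau> n / c\<^sup>2 + (\<tau> n + \<alpha> n) + (U n)\<^sup>2" for n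
  proof -
    have "(c * L2n \<rho> (D (u n)))\<^sup>2 \<le> (x n)\<^sup>2"
      using c(2)[OF XDu(2)[of n]] c(1) by (intro power_mono) (simp_all add: x_def csD_def[abs_def])
    then have "c\<^sup>2 * (L2n \<rho> (D (u n)))\<^sup>2 \<le> \<tau> n" using x\<tau>[of n] by (simp add: power_mult_distrib)
    then have "(L2n \<rho> (D (u n)))\<^sup>2 \<le> \<tau> n / c\<^sup>2" using c(1) by (simp add: pos_le_divide_eq mult.commute)
    moreover have "(y n)\<^sup>2 \<le> \<tau> n + \<alpha> n" using ya[of n] x\<tau>[of n] by linarith
    moreover have "1 = (L2n \<rho> (D (u n)))\<^sup>2 + (y n)\<^sup>2 + (U n)\<^sup>2"
      using X_nrm_sq[OF u(1), of n] u(2)[of n] by (simp add: y_def U_def)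
    ultimately show ?thesis by linarith
  qed
  have "(\<lambda>n. \<tau> n / c\<^sup>2 + (\<tau> n + \<alpha> n) + (U n)\<^sup>2) \<longlonglongrightarrow> 0 / c\<^sup>2 + (0 + 0) + 0\<^sup>2"
    using c(1) by (intro tendsto_intros \<tau>0 \<alpha>0 U0) auto
  then have "1 \<le> 0 / c\<^sup>2 + (0 + 0) + (0::real)\<^sup>2"
    by (rule LIMSEQ_le_const) (use one in auto)
  then show False by simp
qed


section \<open>Sesquilinearity of the form and solvability on functions\<close>

abbreviation "E u x \<equiv> D u x + Q u x"

lemma form_fold: "form u u' = ip \<rho> (C2 (E u)) (E u') - ipv \<rho> (conv u) (conv u') - ipv \<rho> (Mu u) u'
    - \<i> * complex_of_real \<omega> * ipv \<rho> (Gu u) u'"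
  by (simp add: form_def)

lemma E_L2w: "u \<in> X \<Longrightarrow> E u \<in> L2w \<rho>"
  by (intro L2w_add XD L2w_ops)

lemma form_add_AE:
  assumes u: "u \<in> X" and v: "v \<in> X"
  shows "AE x in lebesgue. E (\<lambda>x. u x + v x) x = E u x + E v x"
    "AE x in lebesgue. conv (\<lambda>x. u x + v x) x = conv u x + conv v x"
  using X_add(2,3)[OF u v]
  by (eventually_elim, simp add: Q_def cdot_def distrib_left sum.distrib,
      eventually_elim, simp add: conv_op_def ccross_def vec_eq_iff forall_3 algebra_simps)

lemma form_smult_AE:
  assumes u: "u \<in> X"
  shows "AE x in lebesgue. E (\<lambda>x. c *s u x) x = c * E u x"
    "AE x in lebesgue. conv (\<lambda>x. c *s u x) x = c *s conv u x"
  using X_smult(2,3)[OF u, of c]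
  by (eventually_elim, simp add: Q_def cdot_def distrib_left sum_distrib_left mult.left_commute,
      eventually_elim, simp add: conv_op_def ccross_def vec_eq_iff forall_3 algebra_simps)

text \<open>\<open>D\<close> and \<open>T\<close> are chosen separately for each function, so
  invariance under changes on null sets is not automatic; it follows from uniqueness of weak
  derivatives. It is what lets the form descend to classes.\<close>

lemma form_cong:
  assumes u: "u \<in> X" and v: "v \<in> X" and uv: "AE x in lebesgue. u x = v x"
    and u': "u' \<in> X" and v': "v' \<in> X" and uv': "AE x in lebesgue. u' x = v' x"
  shows "form u u' = form v v'" "ipX u u' = ipX v v'"
proof -
  have c: "AE x in lebesgue. E s x = E t x" "AE x in lebesgue. conv s x = conv t x"
    if "s \<in> X" "t \<in> X" "AE x in lebesgue. s x = t x" for s t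
    using X_cong(2,3)[OF that(1) XD(1)[OF that(2)] that(3)] that(3)
    by (eventually_elim, simp add: Q_def, eventually_elim, simp add: conv_op_def)
  have lin: "AE x in lebesgue. C2 (E u) x = C2 (E v) x" "AE x in lebesgue. Mu u x = Mu v x" "AE x in lebesgue. Gu u x = Gu v x"
    using c(1)[OF u v uv] uv
    by (eventually_elim, simp add: C2_def, eventually_elim, simp add: Mu_def, eventually_elim, simp add: Gu_def)
  note L = L2w_ops(5)[OF E_L2w] L2w_ops(2,3)[OF XD(1)]
  have "ip \<rho> (C2 (E u)) (E u') = ip \<rho> (C2 (E v)) (E v')"
    by (intro ip_cong_AE L lin c E_L2w u v u' v' uv')
  moreover have "ipv \<rho> (conv u) (conv u') = ipv \<rho> (conv v) (conv v')"
    by (intro ipv_cong_AE conv_L2w c u v u' v' uv uv')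
  moreover have "ipv \<rho> (Mu u) u' = ipv \<rho> (Mu v) v'" "ipv \<rho> (Gu u) u' = ipv \<rho> (Gu v) v'"
    by (intro ipv_cong_AE L lin XD(1) u v u' v' uv')+
  ultimately show "form u u' = form v v'" by (simp add: form_fold)
  have d: "AE x in lebesgue. D s x = D t x" "AE x in lebesgue. T s x = T t x"
    if "s \<in> X" "t \<in> X" "AE x in lebesgue. s x = t x" for s t
    using X_cong(2,3)[OF that(1) XD(1)[OF that(2)] that(3)] by (eventually_elim, simp)+
  have "ip \<rho> (D u) (D u') = ip \<rho> (D v) (D v')"
    by (intro ip_cong_AE XD(2) d u v u' v' uv uv')
  moreover have "ipv \<rho> (T u) (T u') = ipv \<rho> (T v) (T v')" "ipv \<rho> u u' = ipv \<rho> v v'"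
    by (intro ipv_cong_AE XD(1,4) d u v u' v' uv uv')+
  ultimately show "ipX u u' = ipX v v'" by (simp add: ipX_def)
qed

lemma form_add:
  assumes u: "u \<in> X" and v: "v \<in> X" and z: "z \<in> X"
  shows "form (\<lambda>x. u x + v x) z = form u z + form v z" "form z (\<lambda>x. u x + v x) = form z u + form z v"
proof -
  note a = X_add(1)[OF u v]
  note L = L2w_ops(5)[OF E_L2w] L2w_ops(2,3)[OF XD(1)]
  have e: "AE x in lebesgue. C2 (E (\<lambda>x. u x + v x)) x = C2 (E u) x + C2 (E v) x"
    using form_add_AE(1)[OF u v] by eventually_elim (simp add: C2_def distrib_left)
  have r: "AE x in lebesgue. f x = f x" for f :: "real^3 \<Rightarrow> 'x" by simp
  have "ip \<rho> (C2 (E (\<lambda>x. u x + v x))) (E z) = ip \<rho> (\<lambda>x. C2 (E u) x + C2 (E v) x) (E z)"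
    by (intro ip_cong_AE L L2w_add e r E_L2w a u v z)
  also have "\<dots> = ip \<rho> (C2 (E u)) (E z) + ip \<rho> (C2 (E v)) (E z)" by (intro S.ip_add L E_L2w u v z)
  finally have e1: "ip \<rho> (C2 (E (\<lambda>x. u x + v x))) (E z) = ip \<rho> (C2 (E u)) (E z) + ip \<rho> (C2 (E v)) (E z)" .
  have "ip \<rho> (C2 (E z)) (E (\<lambda>x. u x + v x)) = ip \<rho> (C2 (E z)) (\<lambda>x. E u x + E v x)"
    by (rule ip_cong_AE[OF L(1)[OF z] L(1)[OF z] r E_L2w[OF a] L2w_add[OF E_L2w[OF u] E_L2w[OF v]] form_add_AE(1)[OF u v]])
  also have "\<dots> = ip \<rho> (C2 (E z)) (E u) + ip \<rho> (C2 (E z)) (E v)" by (intro S.ip_add_right L E_L2w u v z)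
  finally have e1': "ip \<rho> (C2 (E z)) (E (\<lambda>x. u x + v x)) = ip \<rho> (C2 (E z)) (E u) + ip \<rho> (C2 (E z)) (E v)" .
  note CV = conv_L2w[OF u] conv_L2w[OF v] and CW = conv_L2w[OF z]
  have "ipv \<rho> (conv (\<lambda>x. u x + v x)) (conv z) = ipv \<rho> (\<lambda>x. conv u x + conv v x) (conv z)"
    by (rule ipv_cong_AE[OF conv_L2w[OF a] L2w_add[OF CV] form_add_AE(2)[OF u v] CW CW r])
  also have "\<dots> = ipv \<rho> (conv u) (conv z) + ipv \<rho> (conv v) (conv z)" by (rule V.ip_add[OF CV CW])
  finally have e2: "ipv \<rho> (conv (\<lambda>x. u x + v x)) (conv z) = ipv \<rho> (conv u) (conv z) + ipv \<rho> (conv v) (conv z)" .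
  have "ipv \<rho> (conv z) (conv (\<lambda>x. u x + v x)) = ipv \<rho> (conv z) (\<lambda>x. conv u x + conv v x)"
    by (rule ipv_cong_AE[OF CW CW r conv_L2w[OF a] L2w_add[OF CV] form_add_AE(2)[OF u v]])
  also have "\<dots> = ipv \<rho> (conv z) (conv u) + ipv \<rho> (conv z) (conv v)" by (rule V.ip_add_right[OF CV CW])
  finally have e2': "ipv \<rho> (conv z) (conv (\<lambda>x. u x + v x)) = ipv \<rho> (conv z) (conv u) + ipv \<rho> (conv z) (conv v)" .
  have M: "Mu (\<lambda>x. u x + v x) = (\<lambda>x. Mu u x + Mu v x)" "Gu (\<lambda>x. u x + v x) = (\<lambda>x. Gu u x + Gu v x)"
    by (simp_all add: Mu_def[abs_def] Gu_def[abs_def] matrix_vector_right_distrib vec_eq_iff fun_eq_iff distrib_left)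
  note U = XD(1)[OF u] and V' = XD(1)[OF v] and Z = XD(1)[OF z]
  show "form (\<lambda>x. u x + v x) z = form u z + form v z"
    unfolding form_fold e1 e2 M V.ip_add[OF L2w_ops(2)[OF U] L2w_ops(2)[OF V'] Z] V.ip_add[OF L2w_ops(3)[OF U] L2w_ops(3)[OF V'] Z]
    by (simp add: algebra_simps)
  show "form z (\<lambda>x. u x + v x) = form z u + form z v"
    unfolding form_fold e1' e2' V.ip_add_right[OF U V' L2w_ops(2)[OF Z]] V.ip_add_right[OF U V' L2w_ops(3)[OF Z]]
    by (simp add: algebra_simps)
qed

lemma form_smult:
  assumes u: "u \<in> X" and z: "z \<in> X"
  shows "form (\<lambda>x. c *s u x) z = c * form u z" "form z (\<lambda>x. c *s u x) = cnj c * form z u"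
proof -
  note a = X_smult(1)[OF u, of c]
  note L = L2w_ops(5)[OF E_L2w] L2w_ops(2,3)[OF XD(1)]
  have e: "AE x in lebesgue. C2 (E (\<lambda>x. c *s u x)) x = c * C2 (E u) x"
    using form_smult_AE(1)[OF u, of c] by eventually_elim (simp add: C2_def mult.left_commute)
  have r: "AE x in lebesgue. f x = f x" for f :: "real^3 \<Rightarrow> 'x" by simp
  have "ip \<rho> (C2 (E (\<lambda>x. c *s u x))) (E z) = ip \<rho> (\<lambda>x. c * C2 (E u) x) (E z)"
    by (intro ip_cong_AE L L2w_cmult e r E_L2w a u z)
  also have "\<dots> = c * ip \<rho> (C2 (E u)) (E z)" by (intro S.ip_smul L E_L2w u z)
  finally have e1: "ip \<rho> (C2 (E (\<lambda>x. c *s u x))) (E z) = c * ip \<rho> (C2 (E u)) (E z)" .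
  have "ip \<rho> (C2 (E z)) (E (\<lambda>x. c *s u x)) = ip \<rho> (C2 (E z)) (\<lambda>x. c * E u x)"
    by (rule ip_cong_AE[OF L(1)[OF z] L(1)[OF z] r E_L2w[OF a] L2w_cmult[OF E_L2w[OF u]] form_smult_AE(1)[OF u]])
  also have "\<dots> = cnj c * ip \<rho> (C2 (E z)) (E u)" by (intro S.ip_smul_right L E_L2w u z)
  finally have e1': "ip \<rho> (C2 (E z)) (E (\<lambda>x. c *s u x)) = cnj c * ip \<rho> (C2 (E z)) (E u)" .
  note CV = conv_L2w[OF u] and CW = conv_L2w[OF z]
  have "ipv \<rho> (conv (\<lambda>x. c *s u x)) (conv z) = ipv \<rho> (\<lambda>x. c *s conv u x) (conv z)"
    by (rule ipv_cong_AE[OF conv_L2w[OF a] L2w_smult[OF CV] form_smult_AE(2)[OF u] CW CW r])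
  also have "\<dots> = c * ipv \<rho> (conv u) (conv z)" by (rule V.ip_smul[OF CV CW])
  finally have e2: "ipv \<rho> (conv (\<lambda>x. c *s u x)) (conv z) = c * ipv \<rho> (conv u) (conv z)" .
  have "ipv \<rho> (conv z) (conv (\<lambda>x. c *s u x)) = ipv \<rho> (conv z) (\<lambda>x. c *s conv u x)"
    by (rule ipv_cong_AE[OF CW CW r conv_L2w[OF a] L2w_smult[OF CV] form_smult_AE(2)[OF u]])
  also have "\<dots> = cnj c * ipv \<rho> (conv z) (conv u)" by (rule V.ip_smul_right[OF CV CW])
  finally have e2': "ipv \<rho> (conv z) (conv (\<lambda>x. c *s u x)) = cnj c * ipv \<rho> (conv z) (conv u)" .
  have M: "Mu (\<lambda>x. c *s u x) = (\<lambda>x. c *s Mu u x)" "Gu (\<lambda>x. c *s u x) = (\<lambda>x. c *s Gu u x)"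
    by (simp_all add: Mu_def[abs_def] Gu_def[abs_def] matrix_vector_mult_def sum_distrib_left vec_eq_iff fun_eq_iff mult.left_commute)
  note U = XD(1)[OF u] and Z = XD(1)[OF z]
  show "form (\<lambda>x. c *s u x) z = c * form u z"
    unfolding form_fold e1 e2 M V.ip_smul[OF L2w_ops(2)[OF U] Z] V.ip_smul[OF L2w_ops(3)[OF U] Z]
    by (simp add: algebra_simps)
  show "form z (\<lambda>x. c *s u x) = cnj c * form z u"
    unfolding form_fold e1' e2' V.ip_smul_right[OF U L2w_ops(2)[OF Z]] V.ip_smul_right[OF U L2w_ops(3)[OF Z]]
    by (simp add: algebra_simps)
qed

lemma nrm_eq_0_iff: "u \<in> X \<Longrightarrow> XH.nrm u = 0 \<longleftrightarrow> (AE x in lebesgue. u x = 0)"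
proof
  assume u: "u \<in> X" and "XH.nrm u = 0"
  then have "L2n \<rho> u = 0" using L2n_le_nrm(3)[OF u] L2n_nonneg[of u] by simp
  then show "AE x in lebesgue. u x = 0" by (rule L2n_eq_0_imp_AE[OF XD(1)[OF u]])
next
  assume u: "u \<in> X" and "AE x in lebesgue. u x = 0"
  then have "ipX u u = ipX (\<lambda>x. 0 *s u x) (\<lambda>x. 0 *s u x)"
    by (intro form_cong X_smult) auto
  also have "\<dots> = 0" using XH.ip_smul[OF u X_smult(1)[OF u, of 0], of 0] by simp
  finally show "XH.nrm u = 0" by (simp add: XH.nrm_def)
qed

lemma
  shows form_riesz: "u \<in> X \<Longrightarrow> \<exists>v\<in>X. \<forall>u'\<in>X. ipX v u' = form u u'"
    and form_injective: "u \<in> X \<Longrightarrow> (\<And>u'. u' \<in> X \<Longrightarrow> form u u' = 0) \<Longrightarrow> AE x in lebesgue. u x = 0"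
    and form_surjective: "f \<in> X \<Longrightarrow> \<exists>u\<in>X. \<forall>u'\<in>X. form u u' = ipX f u'"
proof -
  obtain K where K: "K > 0" "\<And>u u'. u \<in> X \<Longrightarrow> u' \<in> X \<Longrightarrow> cmod (form u u') \<le> K * XH.nrm u * XH.nrm u'"
    using form_bound by blast
  have ne: "X \<noteq> {}" using X_zero by blast
  have ri: "\<exists>v\<in>X. \<forall>u'\<in>X. ipX v u' = form u u'" if "u \<in> X" for u
    by (rule XH.riesz[OF ne, of "form u" "K * XH.nrm u"]) (use form_add(2) form_smult(2) K that in auto)
  then show "u \<in> X \<Longrightarrow> \<exists>v\<in>X. \<forall>u'\<in>X. ipX v u' = form u u'" .
  from bchoice[of X "\<lambda>u v. v \<in> X \<and> (\<forall>u'\<in>X. ipX v u' = form u u')"] ri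
  obtain A where A: "\<And>u. u \<in> X \<Longrightarrow> A u \<in> X" "\<And>u u'. u \<in> X \<Longrightarrow> u' \<in> X \<Longrightarrow> ipX (A u) u' = form u u'" by blast
  obtain \<epsilon> where \<epsilon>: "\<epsilon> > 0" "\<And>u. u \<in> X \<Longrightarrow> XH.nrm u = 1 \<Longrightarrow> \<exists>u'\<in>X. cmod (form u u') > \<epsilon> * XH.nrm u'"
    using form_lower_bound by blast
  \<comment> \<open>\<open>form_lower_bound\<close> speaks of unit vectors. Scaling u to norm 1 and
    applying Cauchy-Schwarz to A u turns it into a bound of the norm of u by that of A u.\<close>
  have lower: "XH.nrm u \<le> (1 / \<epsilon>) * XH.nrm (A u)" if u: "u \<in> X" for u
  proof (cases "XH.nrm u = 0")
    case False
    define c where "c = complex_of_real (1 / XH.nrm u)"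
    have p: "XH.nrm u > 0" using False XH.nrm_nonneg[OF u] by linarith
    have cX: "(\<lambda>x. c *s u x) \<in> X" by (rule X_smult(1)[OF u])
    have "(XH.nrm (\<lambda>x. c *s u x))\<^sup>2 = Re (c * (cnj c * ipX u u))"
      unfolding XH.nrm_sq[OF cX] XH.ip_smul[OF u cX] XH.ip_smul_right[OF u u] ..
    also have "\<dots> = 1" using p by (simp add: XH.ip_self[OF u] c_def power2_eq_square)
    finally have "(XH.nrm (\<lambda>x. c *s u x))\<^sup>2 = 1" .
    then have "XH.nrm (\<lambda>x. c *s u x) = 1" using XH.nrm_nonneg[OF cX] by (simp add: power2_eq_1_iff)
    then obtain u' where u': "u' \<in> X" "cmod (form (\<lambda>x. c *s u x) u') > \<epsilon> * XH.nrm u'" using \<epsilon>(2)[OF cX] by blast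
    have "cmod (form (\<lambda>x. c *s u x) u') = cmod (ipX (A u) u') / XH.nrm u"
      using p by (simp add: form_smult(1)[OF u u'(1)] A(2)[OF u u'(1)] c_def norm_mult norm_divide)
    also have "\<dots> \<le> XH.nrm (A u) * XH.nrm u' / XH.nrm u"
      using p by (intro divide_right_mono XH.Cauchy_Schwarz A u u') auto
    finally have "\<epsilon> * XH.nrm u' < XH.nrm (A u) * XH.nrm u' / XH.nrm u" using u'(2) by linarith
    then have h: "(\<epsilon> * XH.nrm u) * XH.nrm u' < XH.nrm (A u) * XH.nrm u'"
      using p by (simp add: pos_less_divide_eq mult_ac)
    have "\<epsilon> * XH.nrm u < XH.nrm (A u)"
      using h XH.nrm_nonneg[OF u'(1)] by (simp add: mult_less_cancel_right)
    then show ?thesis using \<epsilon>(1) by (simp add: field_simps)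
  qed (use \<epsilon>(1) XH.nrm_nonneg[OF A(1)[OF u]] in simp)
  have upper: "XH.nrm (A u) \<le> K * XH.nrm u" if u: "u \<in> X" for u
  proof (cases "XH.nrm (A u) = 0")
    case False
    have p: "XH.nrm (A u) > 0" using False XH.nrm_nonneg[OF A(1)[OF u]] by linarith
    have "(XH.nrm (A u))\<^sup>2 \<le> K * XH.nrm u * XH.nrm (A u)"
      using K(2)[OF u A(1)[OF u]] by (simp add: A(2)[OF u A(1)[OF u], symmetric] XH.ip_self[OF A(1)[OF u]] norm_power)
    then show ?thesis using p by (simp add: power2_eq_square)
  qed (use K(1) XH.nrm_nonneg[OF u] in simp)
  show "AE x in lebesgue. u x = 0" if u: "u \<in> X" and 0: "\<And>u'. u' \<in> X \<Longrightarrow> form u u' = 0"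
  proof -
    have "(XH.nrm (A u))\<^sup>2 = 0"
      using XH.ip_self[OF A(1)[OF u]] A(2)[OF u A(1)[OF u]] 0[OF A(1)[OF u]] by (simp del: of_real_power)
    then have "XH.nrm u = 0" using lower[OF u] XH.nrm_nonneg[OF u] by simp
    then show ?thesis using nrm_eq_0_iff[OF u] by simp
  qed
  \<comment> \<open>The case u = v suffices: by \<open>form_Im\<close> the diagonal value of the
    form dominates the squared L^2 norm.\<close>
  have adj: "XH.nrm v = 0" if v: "v \<in> X" and 0: "\<And>u. u \<in> X \<Longrightarrow> ipX (A u) v = 0" for v
  proof -
    obtain c where c: "c > 0" "\<And>u. u \<in> X \<Longrightarrow> c * (L2n \<rho> u)\<^sup>2 \<le> cmod (form u u)" using form_Im by blast
    have "c * (L2n \<rho> v)\<^sup>2 \<le> 0" using c(2)[OF v] 0[OF v] A(2)[OF v v] by simp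
    then have "L2n \<rho> v = 0" using c(1) by (simp add: mult_le_0_iff)
    then show ?thesis using L2n_eq_0_imp_AE[OF XD(1)[OF v]] nrm_eq_0_iff[OF v] by simp
  qed
  show "\<exists>u\<in>X. \<forall>u'\<in>X. form u u' = ipX f u'" if f: "f \<in> X"
  proof (rule XH.lower_bound_imp_surjective[OF ne A(1) _ _ upper lower K(1) _ adj f])
    show "ipX (A (\<lambda>x. u x + v x)) w = ipX (A u) w + ipX (A v) w" if "u \<in> X" "v \<in> X" "w \<in> X" for u v w
      using that by (simp add: A X_add form_add)
    show "ipX (A (\<lambda>x. c *s u x)) w = c * ipX (A u) w" if "u \<in> X" "w \<in> X" for c u w
      using that by (simp add: A X_smult form_smult)
    show "0 < 1 / \<epsilon>" using \<epsilon>(1) by simp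
    show ?thesis if "u \<in> X" "\<And>v. v \<in> X \<Longrightarrow> ipX (A u) v = ipX f v" for u
      using that A(2) by (intro bexI[of _ u]) auto
  qed
qed

end

section \<open>Equivalence classes modulo null sets\<close>

context flow_field
begin

lemma X_space_rep:
  assumes U: "U \<in> X_space \<rho> b"
  shows "rep U \<in> X" "V \<in> X_space \<rho> b \<Longrightarrow> AE x in lebesgue. rep U x = rep V x \<Longrightarrow> U = V"
proof -
  let ?R = "{(u, v). u \<in> X \<and> v \<in> X \<and> (AE x in lebesgue. u x = v x)}"
  have R: "equiv X ?R"
  proof (rule equivI)
    show "sym ?R" by (auto simp: sym_def elim: eventually_mono)
    have "AE x in lebesgue. u x = z x" if "AE x in lebesgue. u x = v x" "AE x in lebesgue. v x = z x" for u v z :: "real^3 \<Rightarrow> complex^3"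
      using that by eventually_elim simp
    then show "trans ?R" by (auto intro!: transI)
  qed (auto simp: refl_on_def)
  have r: "rep W \<in> W \<and> W \<subseteq> X" if "W \<in> X_space \<rho> b" for W
  proof -
    have W: "W \<in> X // ?R" using that by (simp add: X_space_def)
    then have "W \<noteq> {}" using in_quotient_imp_non_empty[OF R] by blast
    then show ?thesis using in_quotient_imp_subset[OF R W] unfolding rep_def by (simp add: some_in_eq)
  qed
  then show u: "rep U \<in> X" using U by blast
  assume V: "V \<in> X_space \<rho> b" and "AE x in lebesgue. rep U x = rep V x"
  then have "(rep U, rep V) \<in> ?R" using u r[OF V] by auto
  then show "U = V"
    using quotient_eq_iff[OF R, of U V "rep U" "rep V"] r U V by (simp add: X_space_def)
qed

lemma X_space_class:
  assumes u: "u \<in> X"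
  obtains U where "U \<in> X_space \<rho> b" "AE x in lebesgue. rep U x = u x"
proof
  let ?R = "{(u, v). u \<in> X \<and> v \<in> X \<and> (AE x in lebesgue. u x = v x)}"
  show U: "?R `` {u} \<in> X_space \<rho> b" unfolding X_space_def by (rule quotientI[OF u])
  have "rep (?R `` {u}) \<in> ?R `` {u}" unfolding rep_def by (rule someI[of _ u]) (use u in simp)
  then show "AE x in lebesgue. rep (?R `` {u}) x = u x" by (auto elim: eventually_mono)
qed

end

context galbrun
begin

lemma ipX_ext:
  assumes u: "u \<in> X" and v: "v \<in> X" and eq: "\<And>w. w \<in> X \<Longrightarrow> ipX u w = ipX v w"
  shows "AE x in lebesgue. u x = v x"
proof -
  have s: "(\<lambda>x. u x - v x) \<in> X" by (rule X_diff(1)[OF u v])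
  have e: "XH.sub u v = (\<lambda>x. u x - v x)" by (simp add: XH.sub_def fun_eq_iff vec_eq_iff)
  have "ipX (\<lambda>x. u x - v x) (\<lambda>x. u x - v x) = 0"
    using XH.ip_sub[OF u v s] eq[OF s] by (simp add: e)
  then have "XH.nrm (\<lambda>x. u x - v x) = 0" by (simp add: XH.nrm_def)
  then show ?thesis using nrm_eq_0_iff[OF s] by simp
qed

theorem form_operator_bijective:
  fixes A :: "(real^3 \<Rightarrow> complex^3) set \<Rightarrow> (real^3 \<Rightarrow> complex^3) set"
  assumes a: "\<And>U U'. a U U' = form (rep U) (rep U')"
    and A: "\<And>U. A U = (THE V. V \<in> X_space \<rho> b \<and> (\<forall>U'\<in>X_space \<rho> b. X_inner \<rho> b V U' = a U U'))"
  shows "bij_betw A (X_space \<rho> b) (X_space \<rho> b)"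
proof -
  let ?S = "X_space \<rho> b"
  let ?P = "\<lambda>U V. V \<in> ?S \<and> (\<forall>U'\<in>?S. X_inner \<rho> b V U' = a U U')"
  have inner: "X_inner \<rho> b U V = ipX (rep U) (rep V)" for U V by (simp add: X_inner_def ipX_def Let_def)
  have refl: "AE x in lebesgue. u x = u x" for u :: "real^3 \<Rightarrow> complex^3" by simp
  \<comment> \<open>The defining property of the operator is stated for classes through chosen
    representatives; by \<open>form_cong\<close> it may be tested with every function of X.\<close>
  have P_iff: "?P U V \<longleftrightarrow> V \<in> ?S \<and> (\<forall>w\<in>X. ipX (rep V) w = form (rep U) w)" if U: "U \<in> ?S" for U V
  proof (intro conj_cong refl iffI ballI)
    fix w assume V: "V \<in> ?S" and h: "\<forall>U'\<in>?S. X_inner \<rho> b V U' = a U U'" and w: "w \<in> X"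
    obtain W where W: "W \<in> ?S" "AE x in lebesgue. rep W x = w x" by (rule X_space_class[OF w])
    note r = X_space_rep(1)[OF U] X_space_rep(1)[OF V] X_space_rep(1)[OF W(1)]
    have "ipX (rep V) w = ipX (rep V) (rep W)" using form_cong(2)[OF r(2,2) refl r(3) w W(2)] by simp
    also have "\<dots> = form (rep U) (rep W)" using h W(1) by (simp add: inner a)
    also have "\<dots> = form (rep U) w" by (rule form_cong(1)[OF r(1,1) refl r(3) w W(2)])
    finally show "ipX (rep V) w = form (rep U) w" .
  next
    fix U' assume "\<forall>w\<in>X. ipX (rep V) w = form (rep U) w" "U' \<in> ?S"
    then show "X_inner \<rho> b V U' = a U U'" by (simp add: inner a X_space_rep(1))
  qed
  have ex: "\<exists>V. ?P U V" if U: "U \<in> ?S" for U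
  proof -
    obtain v where v: "v \<in> X" "\<forall>u'\<in>X. ipX v u' = form (rep U) u'" using form_riesz[OF X_space_rep(1)[OF U]] by blast
    obtain V where V: "V \<in> ?S" "AE x in lebesgue. rep V x = v x" by (rule X_space_class[OF v(1)])
    have "ipX (rep V) w = form (rep U) w" if w: "w \<in> X" for w
      using form_cong(2)[OF X_space_rep(1)[OF V(1)] v(1) V(2) w w refl] v(2) w by simp
    then show ?thesis using P_iff[OF U] V(1) by blast
  qed
  have uniq: "V = V'" if U: "U \<in> ?S" and P: "?P U V" "?P U V'" for U V V'
  proof -
    have VV: "V \<in> ?S" "V' \<in> ?S" using P by auto
    have "ipX (rep V) w = ipX (rep V') w" if "w \<in> X" for w using P that unfolding P_iff[OF U] by simp
    then have "AE x in lebesgue. rep V x = rep V' x" by (rule ipX_ext[OF X_space_rep(1)[OF VV(1)] X_space_rep(1)[OF VV(2)]])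
    then show ?thesis by (rule X_space_rep(2)[OF VV])
  qed
  \<comment> \<open>Existence and uniqueness together give the definite description its
    meaning.\<close>
  have AP: "?P U (A U)" if U: "U \<in> ?S" for U
    unfolding A by (rule theI'[OF ex_ex1I[OF ex[OF U] uniq[OF U]]])
  have "inj_on A ?S"
  proof (rule inj_onI)
    fix U V assume U: "U \<in> ?S" and V: "V \<in> ?S" and eq: "A U = A V"
    note r = X_space_rep(1)[OF U] X_space_rep(1)[OF V]
    have m: "(\<lambda>x. (- 1) *s rep V x) \<in> X" by (rule X_smult(1)[OF r(2)])
    have "form (\<lambda>x. rep U x + (- 1) *s rep V x) w = 0" if w: "w \<in> X" for w
    proof -
      have "form (rep U) w = form (rep V) w" using AP[OF U] AP[OF V] eq w unfolding P_iff[OF U] P_iff[OF V] by simp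
      then show ?thesis unfolding form_add(1)[OF r(1) m w] form_smult(1)[OF r(2) w] by simp
    qed
    from form_injective[OF X_add(1)[OF r(1) m] this]
    have "AE x in lebesgue. rep U x + (- 1) *s rep V x = 0" .
    then have "AE x in lebesgue. rep U x = rep V x" by eventually_elim (simp add: vec_eq_iff)
    then show "U = V" by (rule X_space_rep(2)[OF U V])
  qed
  moreover have "A ` ?S = ?S"
  proof (intro equalityI subsetI)
    fix F assume F: "F \<in> ?S"
    obtain u where u: "u \<in> X" "\<forall>u'\<in>X. form u u' = ipX (rep F) u'" using form_surjective[OF X_space_rep(1)[OF F]] by blast
    obtain U where U: "U \<in> ?S" "AE x in lebesgue. rep U x = u x" by (rule X_space_class[OF u(1)])
    have "ipX (rep F) w = form (rep U) w" if w: "w \<in> X" for w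
      using form_cong(1)[OF X_space_rep(1)[OF U(1)] u(1) U(2) w w refl] u(2) w by simp
    then have "?P U F" using P_iff[OF U(1)] F by blast
    then have "A U = F" using uniq[OF U(1) AP[OF U(1)]] by blast
    then show "F \<in> A ` ?S" using U(1) by blast
  qed (use AP in auto)
  ultimately show ?thesis by (simp add: bij_betw_def)
qed

end

section \<open>Essentially bounded functions and weak derivatives\<close>

lemma AE_lebesgue_on_iff:
  fixes U :: "(real^3) set"
  shows "open U \<Longrightarrow> (AE x in lebesgue_on U. P x) \<longleftrightarrow> (AE x in lebesgue. x \<in> U \<longrightarrow> P x)"
  by (simp add: AE_restrict_space_iff)

lemma Linf_AE:
  assumes "f \<in> Linf M"
  shows "f \<in> borel_measurable M" "\<exists>C>0. AE x in M. norm (f x) \<le> C"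
proof -
  show "f \<in> borel_measurable M" using assms by (simp add: Linf_def)
  define e where "e = Linf_norm M f"
  have ae: "AE x in M. ereal (norm (f x)) \<le> e" unfolding e_def Linf_norm_def by (rule esssup_AE)
  have "e < \<infinity>" using assms by (simp add: Linf_def e_def)
  then obtain C where C: "e \<le> ereal C" by (cases e) auto
  from ae have "AE x in M. norm (f x) \<le> max C 1"
  proof eventually_elim
    case (elim x)
    then have "ereal (norm (f x)) \<le> ereal C" using C by (rule order_trans)
    then show ?case by simp
  qed
  then show "\<exists>C>0. AE x in M. norm (f x) \<le> C" by (intro exI[of _ "max C 1"]) auto
qed

lemma essinf_pos_AE:
  assumes "essinf M f > 0"
  shows "\<exists>c>0. AE x in M. c \<le> f x"
proof -
  have "esssup M (\<lambda>x. ereal (- f x)) < 0" using assms by (simp add: essinf_def ereal_less_uminus_reorder)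
  then obtain r where r: "esssup M (\<lambda>x. ereal (- f x)) < ereal r" "ereal r < 0" using ereal_dense2 by blast
  have "AE x in M. - r \<le> f x"
    using esssup_AE[of "\<lambda>x. ereal (- f x)" M]
  proof eventually_elim
    case (elim x)
    then have "ereal (- f x) < ereal r" using r(1) by (rule le_less_trans)
    then show ?case by simp
  qed
  then show ?thesis using r(2) by (intro exI[of _ "- r"]) simp
qed

text \<open>The complement of the support is an arbitrary union of open sets. Lindelof's theorem
  replaces it by a countable one, for which the exceptional null sets can be united.\<close>

lemma ess_supp_AE:
  fixes f :: "real^3 \<Rightarrow> 'a::zero"
  shows "AE x in lebesgue. x \<notin> ess_supp f \<longrightarrow> f x = 0"
proof -
  let ?F = "{U. open U \<and> (AE x in lebesgue. x \<in> U \<longrightarrow> f x = 0)}"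
  obtain F where F: "F \<subseteq> ?F" "countable F" "\<Union>F = \<Union>?F" by (rule Lindelof[of ?F]) auto
  have "AE x in lebesgue. \<forall>U\<in>F. x \<in> U \<longrightarrow> f x = 0" using F by (subst AE_ball_countable) auto
  then show ?thesis
  proof eventually_elim
    case (elim x)
    have "x \<notin> ess_supp f \<longleftrightarrow> x \<in> \<Union>F" unfolding F(3) ess_supp_def by blast
    then show ?case using elim by blast
  qed
qed

section \<open>Weak partial derivatives, local and global\<close>

lemma has_weak_partial_iff:
  "has_weak_partial U l f g \<longleftrightarrow> loc_integrable U f \<and> loc_integrable U g \<and>
    (\<forall>\<psi>\<in>test_functions U. (LINT x|lebesgue. f x * partial l \<psi> x) = - (LINT x|lebesgue. g x * \<psi> x))"
proof -
  \<comment> \<open>A test function on U vanishes outside U, so the integral over U is one over the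
    whole space.\<close>
  have "(LINT x:U|lebesgue. h x * \<psi> x) = (LINT x|lebesgue. h x * \<psi> x)" if "\<psi> \<in> test_functions U" for h \<psi> :: "real^3 \<Rightarrow> real"
  proof -
    have "\<psi> x = 0" if "x \<notin> U" for x
      using that \<open>\<psi> \<in> test_functions U\<close> in_support[of \<psi> x] by (auto simp: test_functions_def)
    then have "indicator U x *\<^sub>R (h x * \<psi> x) = h x * \<psi> x" for x by (cases "x \<in> U") auto
    then show ?thesis unfolding set_lebesgue_integral_def by (simp only:)
  qed
  then show ?thesis unfolding has_weak_partial_def by (simp add: test_partial)
qed

lemma has_weak_partial_mono: "has_weak_partial U l f g \<Longrightarrow> V \<subseteq> U \<Longrightarrow> has_weak_partial V l f g"
  unfolding has_weak_partial_iff using test_mono loc_integrable_mono by blast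

lemma has_weak_partial_unique:
  assumes "open U" "has_weak_partial U l f g" "has_weak_partial U l f h"
  shows "AE x in lebesgue. x \<in> U \<longrightarrow> g x = h x"
proof -
  have loc: "loc_integrable U g" "loc_integrable U h" using assms by (auto simp: has_weak_partial_iff)
  have "AE x in lebesgue. x \<in> U \<longrightarrow> g x - h x = 0"
  proof (rule AE_zero_if_test[OF assms(1) loc_integrable_diff[OF loc]])
    fix F :: "real^3 \<Rightarrow> real" assume F: "F \<in> test_functions U"
    have "integrable lebesgue (\<lambda>x. g x * F x)" "integrable lebesgue (\<lambda>x. h x * F x)"
      by (rule integrable_loc_times_test[OF bounded_bilinear_mult _ F], rule loc)+
    moreover have "- (LINT x|lebesgue. g x * F x) = - (LINT x|lebesgue. h x * F x)"
      using bspec[OF assms(2)[unfolded has_weak_partial_iff, THEN conjunct2, THEN conjunct2] F]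
        bspec[OF assms(3)[unfolded has_weak_partial_iff, THEN conjunct2, THEN conjunct2] F] by (rule trans[OF sym])
    ultimately show "(LINT x|lebesgue. (g x - h x) * F x) = 0" by (simp add: left_diff_distrib)
  qed
  then show ?thesis by simp
qed

lemma loc_integrable_cong:
  fixes f g :: "real^3 \<Rightarrow> real"
  assumes "loc_integrable U f" "AE x in lebesgue. x \<in> U \<longrightarrow> f x = g x"
  shows "loc_integrable U g"
  unfolding loc_integrable_def set_integrable_def
proof (intro allI impI)
  fix K :: "(real^3) set" assume K: "compact K \<and> K \<subseteq> U"
  have i: "integrable lebesgue (\<lambda>x. indicator K x *\<^sub>R f x)" using assms(1) K by (simp add: loc_integrable_def set_integrable_def)
  have ae: "AE x in lebesgue. indicator K x *\<^sub>R f x = indicator K x *\<^sub>R g x"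
    using assms(2) by eventually_elim (use K in \<open>auto simp: indicator_def\<close>)
  have "(\<lambda>x. indicator K x *\<^sub>R g x) \<in> borel_measurable lebesgue"
    by (rule borel_measurable_AE[OF borel_measurable_integrable[OF i] ae])
  then show "integrable lebesgue (\<lambda>x. indicator K x *\<^sub>R g x)"
    using i integrable_cong_AE[OF borel_measurable_integrable[OF i] _ ae] by blast
qed

lemma integral_cong_test:
  fixes f g F :: "real^3 \<Rightarrow> real"
  assumes "loc_integrable U f" "AE x in lebesgue. x \<in> U \<longrightarrow> f x = g x" "F \<in> test_functions U"
  shows "(LINT x|lebesgue. f x * F x) = (LINT x|lebesgue. g x * F x)"
proof (rule integral_cong_AE)
  show "AE x in lebesgue. f x * F x = g x * F x"
    using assms(2)
  proof eventually_elim
    case (elim x)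
    show ?case using elim in_support[of F x] assms(3) by (cases "F x = 0") (auto simp: test_functions_def)
  qed
qed (use integrable_loc_times_test[OF bounded_bilinear_mult assms(1,3)]
      integrable_loc_times_test[OF bounded_bilinear_mult loc_integrable_cong[OF assms(1,2)] assms(3)] in auto)

lemma has_weak_partial_cong:
  assumes "has_weak_partial U l f g" "AE x in lebesgue. x \<in> U \<longrightarrow> f x = f' x" "AE x in lebesgue. x \<in> U \<longrightarrow> g x = g' x"
  shows "has_weak_partial U l f' g'"
proof -
  have loc: "loc_integrable U f" "loc_integrable U g"
    and eq: "\<And>\<psi>. \<psi> \<in> test_functions U \<Longrightarrow> (LINT x|lebesgue. f x * partial l \<psi> x) = - (LINT x|lebesgue. g x * \<psi> x)"
    using assms(1) by (auto simp: has_weak_partial_iff)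
  show ?thesis
    unfolding has_weak_partial_iff
  proof (intro conjI ballI)
    fix \<psi> :: "real^3 \<Rightarrow> real" assume \<psi>: "\<psi> \<in> test_functions U"
    show "(LINT x|lebesgue. f' x * partial l \<psi> x) = - (LINT x|lebesgue. g' x * \<psi> x)"
      unfolding integral_cong_test[OF loc(1) assms(2) test_partial[OF \<psi>], symmetric]
        integral_cong_test[OF loc(2) assms(3) \<psi>, symmetric] by (rule eq[OF \<psi>])
  qed (rule loc_integrable_cong[OF loc(1) assms(2)], rule loc_integrable_cong[OF loc(2) assms(3)])
qed

lemma compact_subset_ball:
  fixes K :: "(real^3) set"
  assumes "compact K"
  obtains n where "K \<subseteq> ball 0 (real (Suc n))"
proof -
  obtain B where B: "\<And>x. x \<in> K \<Longrightarrow> norm x \<le> B" using compact_imp_bounded[OF assms] by (auto simp: bounded_iff)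
  obtain n where n: "B < real n" using reals_Archimedean2 by blast
  show ?thesis by (rule that[of n]) (use B n in \<open>fastforce simp: dist_norm\<close>)
qed

lemma has_weak_partial_UNIV:
  assumes h: "\<And>n. has_weak_partial (ball 0 (real (Suc n))) l f g"
  shows "has_weak_partial UNIV l f g"
proof -
  have loc: "loc_integrable UNIV f'" if "\<And>n. loc_integrable (ball 0 (real (Suc n))) f'" for f' :: "real^3 \<Rightarrow> real"
    using that compact_subset_ball unfolding loc_integrable_def by metis
  have "(LINT x|lebesgue. f x * partial l \<psi> x) = - (LINT x|lebesgue. g x * \<psi> x)" if \<psi>: "\<psi> \<in> test_functions UNIV" for \<psi>
  proof -
    obtain n where "closure {x. \<psi> x \<noteq> 0} \<subseteq> ball 0 (real (Suc n))"
      using compact_subset_ball[of "closure {x. \<psi> x \<noteq> 0}"] \<psi> by (auto simp: test_functions_def)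
    then have "\<psi> \<in> test_functions (ball 0 (real (Suc n)))" using \<psi> by (simp add: test_functions_def)
    then show ?thesis using h[of n] by (simp add: has_weak_partial_iff)
  qed
  then show ?thesis using h unfolding has_weak_partial_iff by (auto intro!: loc)
qed

text \<open>Derivatives on different balls agree almost everywhere on the smaller one and so patch
  to a global derivative. Its existence is what makes the choice \<open>weak_partial\<close> a
  genuine weak derivative.\<close>

lemma has_weak_partial_glue:
  assumes h: "\<And>n. has_weak_partial (ball 0 (real (Suc n))) l f (g n)"
  shows "has_weak_partial UNIV l f (weak_partial l f)"
proof -
  \<comment> \<open>The index is the ceiling of the norm of x, and the ball with this index has
    radius one larger, hence contains x.\<close>
  define G where "G x = g (nat \<lceil>norm x\<rceil>) x" for x
  have "AE x in lebesgue. x \<in> ball 0 (real (Suc n)) \<longrightarrow> g n x = G x" for n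
  proof -
    have "AE x in lebesgue. x \<in> ball 0 (real (Suc (min m n))) \<longrightarrow> g m x = g n x" for m
      by (rule has_weak_partial_unique[OF open_ball has_weak_partial_mono[OF h] has_weak_partial_mono[OF h]]) auto
    then have "AE x in lebesgue. \<forall>m. x \<in> ball 0 (real (Suc (min m n))) \<longrightarrow> g m x = g n x" by (simp add: AE_all_countable)
    then show ?thesis
    proof eventually_elim
      case (elim x)
      have "norm x < real (Suc (nat \<lceil>norm x\<rceil>))" by linarith
      then have "x \<in> ball 0 (real (Suc n)) \<Longrightarrow> x \<in> ball 0 (real (Suc (min (nat \<lceil>norm x\<rceil>) n)))" by (simp add: min_def)
      then show ?case using spec[OF elim, of "nat \<lceil>norm x\<rceil>"] unfolding G_def by metis
    qed
  qed
  then have "has_weak_partial (ball 0 (real (Suc n))) l f G" for n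
    by (rule has_weak_partial_cong[OF h, rotated]) simp
  then have "has_weak_partial UNIV l f G" by (rule has_weak_partial_UNIV)
  then show ?thesis unfolding weak_partial_def by (rule someI[of "has_weak_partial UNIV l f"])
qed

lemma sobolev_inf_loc_weak_partial:
  assumes f: "f \<in> sobolev_inf_loc 2"
  shows "has_weak_partial UNIV l f (weak_partial l f)"
    "has_weak_partial UNIV k (weak_partial l f) (weak_partial k (weak_partial l f))"
proof -
  have "\<exists>g h. has_weak_partial (ball 0 (real (Suc n))) l f g \<and> has_weak_partial (ball 0 (real (Suc n))) k g h" for n
  proof -
    have "f \<in> sobolev_inf (Suc (Suc 0)) (ball 0 (real (Suc n)))" using f by (simp add: sobolev_inf_loc_def numeral_2_eq_2)
    then show ?thesis by fastforce
  qed
  then obtain g h where g: "\<And>n. has_weak_partial (ball 0 (real (Suc n))) l f (g n)"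
    and h: "\<And>n. has_weak_partial (ball 0 (real (Suc n))) k (g n) (h n)" by metis
  show 1: "has_weak_partial UNIV l f (weak_partial l f)" by (rule has_weak_partial_glue[OF g])
  \<comment> \<open>On each ball the local first derivative equals \<open>weak_partial l f\<close>
    almost everywhere, so it may be replaced before differentiating again.\<close>
  have "has_weak_partial (ball 0 (real (Suc n))) k (weak_partial l f) (h n)" for n
    by (rule has_weak_partial_cong[OF h has_weak_partial_unique[OF open_ball g has_weak_partial_mono[OF 1]]]) auto
  then show "has_weak_partial UNIV k (weak_partial l f) (weak_partial k (weak_partial l f))"
    by (rule has_weak_partial_glue)
qed

text \<open>Two integrations by parts put both derivatives on the test function, where they
  commute.\<close>

lemma weak_hess_symmetric:
  assumes f: "f \<in> sobolev_inf_loc 2"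
  shows "AE x in lebesgue. \<forall>k l. weak_hess f x $ k $ l = weak_hess f x $ l $ k"
proof -
  note p = sobolev_inf_loc_weak_partial[OF f]
  have eq: "(LINT x|lebesgue. weak_partial k (weak_partial l f) x * F x) = (LINT x|lebesgue. f x * partial l (partial k F) x)"
    if F: "F \<in> test_functions UNIV" for k l F
    using p(2)[of k l] p(1)[of l] F test_partial[OF F] unfolding has_weak_partial_iff by simp
  have "AE x in lebesgue. weak_partial k (weak_partial l f) x - weak_partial l (weak_partial k f) x = 0" for k l
  proof -
    have loc: "loc_integrable UNIV (weak_partial k (weak_partial l f))" for k l using p(2)[of k l] by (simp add: has_weak_partial_iff)
    have "AE x in lebesgue. x \<in> UNIV \<longrightarrow> weak_partial k (weak_partial l f) x - weak_partial l (weak_partial k f) x = 0"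
    proof (rule AE_zero_if_test[OF open_UNIV loc_integrable_diff[OF loc loc]])
      fix F :: "real^3 \<Rightarrow> real" assume F: "F \<in> test_functions UNIV"
      have i: "integrable lebesgue (\<lambda>x. weak_partial k (weak_partial l f) x * F x)" for k l
        by (rule integrable_loc_times_test[OF bounded_bilinear_mult loc F])
      show "(LINT x|lebesgue. (weak_partial k (weak_partial l f) x - weak_partial l (weak_partial k f) x) * F x) = 0"
        using i[of k l] i[of l k] by (simp add: left_diff_distrib eq[OF F] partial_commute[OF test_smooth[OF F], of k l])
    qed
    then show ?thesis by simp
  qed
  then have "AE x in lebesgue. \<forall>k l. weak_partial k (weak_partial l f) x - weak_partial l (weak_partial k f) x = 0"
    by (simp add: AE_all_countable)
  then show ?thesis by eventually_elim (simp add: weak_hess_def)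
qed

section \<open>Construction of the Lipschitz weight\<close>

lemma cutoff_weak_lipschitz:
  fixes f \<chi>' :: "real^3 \<Rightarrow> real"
  assumes f: "f \<in> sobolev_inf 1 U" "open U" "f \<in> borel_measurable lebesgue" "AE x in lebesgue. \<bar>f x\<bar> \<le> A"
    and xi: "\<chi>' \<in> test_functions U" "\<And>x. \<bar>\<chi>' x\<bar> \<le> 1"
  shows "\<exists>C\<ge>0. \<forall>t. AE x in lebesgue. \<bar>\<chi>' (x + t *\<^sub>R axis l 1) * f (x + t *\<^sub>R axis l 1) - \<chi>' x * f x\<bar> \<le> C * \<bar>t\<bar>"
proof -
  obtain g where "g \<in> Linf (lebesgue_on U)" and g: "has_weak_partial U l f g" using f(1) by auto
  then obtain G where G: "G > 0" "AE x in lebesgue. x \<in> U \<longrightarrow> \<bar>g x\<bar> \<le> G"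
    using Linf_AE(2)[of g "lebesgue_on U"] by (auto simp: AE_lebesgue_on_iff[OF f(2)])
  have loc: "loc_integrable U f" "loc_integrable U g" using g by (auto simp: has_weak_partial_iff)
  have xs: "smooth \<chi>'" by (rule test_smooth[OF xi(1)])
  obtain B where B: "B > 0" "\<And>x. \<bar>partial l \<chi>' x\<bar> \<le> B" using test_bounded[OF test_partial[OF xi(1)], of l] by auto
  have A0: "0 \<le> \<bar>A\<bar>" by simp
  have lw: "loc_integrable UNIV (\<lambda>x. \<chi>' x * f x)"
  proof -
    have "AE x in lebesgue. \<bar>\<chi>' x * f x\<bar> \<le> \<bar>A\<bar>"
      using f(4) by eventually_elim (use xi(2) in \<open>simp add: abs_mult, smt (verit) mult_left_le_one_le abs_ge_zero\<close>)
    then show ?thesis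
      using loc_integrable_bounded_mult[OF loc_integrable_const[of UNIV "1::real"] borel_measurable_times[OF smooth_measurable[OF xs] f(3)]] by simp
  qed
  have "\<bar>LINT x|lebesgue. (\<chi>' x * f x) * partial l F x\<bar> \<le> (G + \<bar>A\<bar> * B) * (LINT x|lebesgue. \<bar>F x\<bar>)"
    if F: "F \<in> test_functions UNIV" for F
  proof -
    \<comment> \<open>F may have its support anywhere, but the product with \<chi>' is a test
      function on U, so the weak derivative on U can be tested with it. The product rule leaves an
      extra term with the derivative of \<chi>'; this accounts for the two parts of the
      constant.\<close>
    have t: "(\<lambda>x. \<chi>' x * F x) \<in> test_functions U" "(\<lambda>x. partial l \<chi>' x * F x) \<in> test_functions U"
      by (intro test_mult_left test_partial xi test_smooth[OF F])+
    have pe: "partial l (\<lambda>x. \<chi>' x * F x) x = \<chi>' x * partial l F x + partial l \<chi>' x * F x" for x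
      by (rule partial_bilinear[OF bounded_bilinear_mult]) (intro smooth_differentiable xs test_smooth[OF F])+
    have i1: "integrable lebesgue (\<lambda>x. f x * partial l (\<lambda>x. \<chi>' x * F x) x)"
      by (rule integrable_loc_times_test[OF bounded_bilinear_mult loc(1) test_partial[OF t(1)]])
    have i2: "integrable lebesgue (\<lambda>x. f x * (partial l \<chi>' x * F x))"
      by (rule integrable_loc_times_test[OF bounded_bilinear_mult loc(1) t(2)])
    have i3: "integrable lebesgue (\<lambda>x. g x * (\<chi>' x * F x))"
      by (rule integrable_loc_times_test[OF bounded_bilinear_mult loc(2) t(1)])
    have iF: "integrable lebesgue (\<lambda>x. \<bar>F x\<bar>)" using test_integrable[OF F] by auto
    have "(LINT x|lebesgue. (\<chi>' x * f x) * partial l F x) =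
      (LINT x|lebesgue. f x * partial l (\<lambda>x. \<chi>' x * F x) x - f x * (partial l \<chi>' x * F x))"
      unfolding pe by (simp add: algebra_simps)
    also have "\<dots> = (LINT x|lebesgue. f x * partial l (\<lambda>x. \<chi>' x * F x) x) - (LINT x|lebesgue. f x * (partial l \<chi>' x * F x))"
      by (rule Bochner_Integration.integral_diff[OF i1 i2])
    also have "(LINT x|lebesgue. f x * partial l (\<lambda>x. \<chi>' x * F x) x) = - (LINT x|lebesgue. g x * (\<chi>' x * F x))"
      using g t(1) unfolding has_weak_partial_iff by blast
    also have "- (LINT x|lebesgue. g x * (\<chi>' x * F x)) - (LINT x|lebesgue. f x * (partial l \<chi>' x * F x))
      = - (LINT x|lebesgue. g x * (\<chi>' x * F x) + f x * (partial l \<chi>' x * F x))"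
      by (simp only: Bochner_Integration.integral_add[OF i3 i2])
    finally have "\<bar>LINT x|lebesgue. (\<chi>' x * f x) * partial l F x\<bar> = \<bar>LINT x|lebesgue. g x * (\<chi>' x * F x) + f x * (partial l \<chi>' x * F x)\<bar>" by simp
    also have "\<dots> \<le> (LINT x|lebesgue. \<bar>g x * (\<chi>' x * F x) + f x * (partial l \<chi>' x * F x)\<bar>)" by (rule integral_abs_bound)
    also have "\<dots> \<le> (LINT x|lebesgue. (G + \<bar>A\<bar> * B) * \<bar>F x\<bar>)"
    proof (rule integral_mono_AE)
      show "AE x in lebesgue. \<bar>g x * (\<chi>' x * F x) + f x * (partial l \<chi>' x * F x)\<bar> \<le> (G + \<bar>A\<bar> * B) * \<bar>F x\<bar>"
        using G(2) f(4)
      proof eventually_elim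
        case (elim x)
        have "\<bar>g x * \<chi>' x\<bar> \<le> G"
        proof (cases "x \<in> U")
          case True
          have "\<bar>g x\<bar> * \<bar>\<chi>' x\<bar> \<le> G * 1" using True elim(1) xi(2) G(1) by (intro mult_mono) auto
          then show ?thesis by (simp add: abs_mult)
        next
          case False
          then have "\<chi>' x = 0" using in_support[of \<chi>' x] xi(1) by (auto simp: test_functions_def)
          then show ?thesis using G(1) by simp
        qed
        moreover have "\<bar>f x * partial l \<chi>' x\<bar> \<le> \<bar>A\<bar> * B" unfolding abs_mult using elim(2) B by (intro mult_mono) auto
        ultimately have "\<bar>g x * \<chi>' x + f x * partial l \<chi>' x\<bar> \<le> G + \<bar>A\<bar> * B" by linarith
        then have "\<bar>g x * \<chi>' x + f x * partial l \<chi>' x\<bar> * \<bar>F x\<bar> \<le> (G + \<bar>A\<bar> * B) * \<bar>F x\<bar>" by (rule mult_right_mono) simp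
        then show ?case unfolding abs_mult[symmetric] by (simp add: algebra_simps)
      qed
    qed (use i2 i3 iF in auto)
    finally show ?thesis by simp
  qed
  from weak_lipschitz_imp_translate[OF lw this]
  have "\<forall>t. AE x in lebesgue. \<bar>\<chi>' (x + t *\<^sub>R axis l 1) * f (x + t *\<^sub>R axis l 1) - \<chi>' x * f x\<bar> \<le> (G + \<bar>A\<bar> * B) * \<bar>t\<bar>" by simp
  then show ?thesis using G(1) B(1) A0 by (intro exI[of _ "G + \<bar>A\<bar> * B"]) auto
qed

text \<open>Each of the three factors c_s, c_s and rho receives its own cutoff and thereby becomes
  Lipschitz on all of space. The product carries the cube of the cutoff, which lies in [0, 1] and is
  1 on the ball of radius r1.\<close>

lemma lipschitz_weight_exists:
  fixes cs \<rho> :: "real^3 \<Rightarrow> real"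
  assumes r: "0 < r1" "r1 < r2"
    and cs: "cs \<in> sobolev_inf 1 (ball 0 r2)" "cs \<in> borel_measurable lebesgue" "AE x in lebesgue. \<bar>cs x\<bar> \<le> A"
    and \<rho>: "\<rho> \<in> sobolev_inf 1 (ball 0 r2)" "\<rho> \<in> borel_measurable lebesgue" "AE x in lebesgue. \<bar>\<rho> x\<bar> \<le> B" "AE x in lebesgue. 0 < \<rho> x"
  obtains w where "loc_integrable UNIV w"
    "\<exists>C\<ge>0. \<forall>l. \<forall>F\<in>test_functions UNIV. \<bar>LINT x|lebesgue. w x * partial l F x\<bar> \<le> C * (LINT x|lebesgue. \<bar>F x\<bar>)"
    "AE x in lebesgue. 0 \<le> w x \<and> w x \<le> \<rho> x * (cs x)\<^sup>2" "AE x in lebesgue. norm x < r1 \<longrightarrow> w x = \<rho> x * (cs x)\<^sup>2"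
proof -
  \<comment> \<open>The midpoint leaves room for the cutoff to have its closed support inside the
    ball of radius r2.\<close>
  define R where "R = (r1 + r2) / 2"
  have R: "r1 < R" "R < r2" using r by (auto simp: R_def)
  obtain \<chi>' :: "real^3 \<Rightarrow> real" where xi: "smooth \<chi>'" "\<And>x. 0 \<le> \<chi>' x" "\<And>x. \<chi>' x \<le> 1"
    "\<And>x. norm x \<le> r1 \<Longrightarrow> \<chi>' x = 1" "\<And>x. norm x \<ge> R \<Longrightarrow> \<chi>' x = 0"
    using smooth_cutoff_exists[of r1 R 0] r R by (auto simp: dist_norm)
  have t: "\<chi>' \<in> test_functions (ball 0 r2)"
  proof -
    have s: "{x. \<chi>' x \<noteq> 0} \<subseteq> cball 0 R" using xi(5) by (force simp: dist_norm not_le[symmetric])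
    then have "closure {x. \<chi>' x \<noteq> 0} \<subseteq> cball 0 R" by (rule closure_minimal) simp
    also have "\<dots> \<subseteq> ball 0 r2" using R by auto
    finally show ?thesis using xi(1) bounded_subset[OF bounded_cball s] by (simp add: test_functions_iff)
  qed
  have x1: "\<bar>\<chi>' x\<bar> \<le> 1" for x using xi(2,3)[of x] by simp
  let ?c = "\<lambda>x. \<chi>' x * cs x" and ?r = "\<lambda>x. \<chi>' x * \<rho> x"
  define w where "w x = ?c x * ?c x * ?r x" for x
  have b: "AE x in lebesgue. \<bar>\<chi>' x * f x\<bar> \<le> K" if "AE x in lebesgue. \<bar>f x\<bar> \<le> K" for f K
    using that
  proof eventually_elim
    case (elim x)
    have "\<bar>\<chi>' x\<bar> * \<bar>f x\<bar> \<le> 1 * \<bar>f x\<bar>" by (rule mult_right_mono[OF x1]) simp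
    then show ?case using elim by (simp add: abs_mult)
  qed
  have bcc: "AE x in lebesgue. \<bar>?c x * ?c x\<bar> \<le> A * A"
    using b[OF cs(3)]
  proof eventually_elim
    case (elim x)
    then show ?case unfolding abs_mult[of "?c x"] by (intro mult_mono) (auto intro: order_trans[OF abs_ge_zero])
  qed
  have bw: "AE x in lebesgue. \<bar>w x\<bar> \<le> A * A * B"
    using bcc b[OF \<rho>(3)] unfolding w_def
  proof eventually_elim
    case (elim x)
    have "\<bar>?c x * ?c x\<bar> * \<bar>?r x\<bar> \<le> A * A * B" by (rule mult_mono[OF elim]) auto
    then show ?case by (simp add: abs_mult)
  qed
  have wm: "w \<in> borel_measurable lebesgue"
    unfolding w_def[abs_def] by (intro borel_measurable_times smooth_measurable xi cs \<rho>)
  have lw: "loc_integrable UNIV w"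
    using loc_integrable_bounded_mult[OF loc_integrable_const[of UNIV "1::real"] wm bw] by simp
  have "\<exists>C\<ge>0. \<forall>F\<in>test_functions UNIV. \<bar>LINT x|lebesgue. w x * partial l F x\<bar> \<le> C * (LINT x|lebesgue. \<bar>F x\<bar>)" for l
  proof -
    obtain C where C: "C \<ge> 0" "\<And>t. AE x in lebesgue. \<bar>?c (x + t *\<^sub>R axis l 1) - ?c x\<bar> \<le> C * \<bar>t\<bar>"
      using cutoff_weak_lipschitz[OF cs(1) open_ball cs(2,3) t x1, of l] by auto
    obtain E where E: "E \<ge> 0" "\<And>t. AE x in lebesgue. \<bar>?r (x + t *\<^sub>R axis l 1) - ?r x\<bar> \<le> E * \<bar>t\<bar>"
      using cutoff_weak_lipschitz[OF \<rho>(1) open_ball \<rho>(2,3) t x1, of l] by auto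
    have cc: "AE x in lebesgue. \<bar>?c (x + t *\<^sub>R axis l 1) * ?c (x + t *\<^sub>R axis l 1) - ?c x * ?c x\<bar> \<le> (A * C + A * C) * \<bar>t\<bar>" for t
      by (rule translate_lipschitz_mult[OF b[OF cs(3)] C(2) b[OF cs(3)] C(2)])
    have "AE x in lebesgue. \<bar>w (x + t *\<^sub>R axis l 1) - w x\<bar> \<le> (A * A * E + B * (A * C + A * C)) * \<bar>t\<bar>" for t
      unfolding w_def by (rule translate_lipschitz_mult[OF bcc cc b[OF \<rho>(3)] E(2)])
    note * = translate_imp_weak_lipschitz[OF lw this]
    \<comment> \<open>Taking the absolute value yields a nonnegative constant without discussing the
      signs of A and B.\<close>
    have AB: "0 \<le> \<bar>A * A * E + B * (A * C + A * C)\<bar>" by simp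
    have "\<bar>LINT x|lebesgue. w x * partial l F x\<bar> \<le> \<bar>A * A * E + B * (A * C + A * C)\<bar> * (LINT x|lebesgue. \<bar>F x\<bar>)" if "F \<in> test_functions UNIV" for F
      by (rule order_trans[OF *[OF that] mult_right_mono[OF abs_ge_self]]) simp
    with AB show ?thesis by blast
  qed
  then obtain C where C: "\<And>l. C l \<ge> 0" "\<And>l F. F \<in> test_functions UNIV \<Longrightarrow> \<bar>LINT x|lebesgue. w x * partial l F x\<bar> \<le> C l * (LINT x|lebesgue. \<bar>F x\<bar>)"
    by metis
  have lip: "\<exists>C\<ge>0. \<forall>l. \<forall>F\<in>test_functions UNIV. \<bar>LINT x|lebesgue. w x * partial l F x\<bar> \<le> C * (LINT x|lebesgue. \<bar>F x\<bar>)"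
  proof (intro exI[of _ "\<Sum>l\<in>UNIV. C l"] conjI allI ballI sum_nonneg C)
    fix l F assume "F \<in> (test_functions UNIV :: (real^3 \<Rightarrow> real) set)"
    moreover have "C l * (LINT x|lebesgue. \<bar>F x\<bar>) \<le> (\<Sum>l\<in>UNIV. C l) * (LINT x|lebesgue. \<bar>F x\<bar>)"
      by (intro mult_right_mono member_le_sum C) auto
    ultimately show "\<bar>LINT x|lebesgue. w x * partial l F x\<bar> \<le> (\<Sum>l\<in>UNIV. C l) * (LINT x|lebesgue. \<bar>F x\<bar>)"
      using C(2) order_trans by blast
  qed
  have we: "w x = \<chi>' x ^ 3 * (\<rho> x * (cs x)\<^sup>2)" for x by (simp add: w_def power2_eq_square power3_eq_cube)
  have "AE x in lebesgue. 0 \<le> w x \<and> w x \<le> \<rho> x * (cs x)\<^sup>2"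
    using \<rho>(4)
  proof eventually_elim
    case (elim x)
    then show ?case using xi(2,3)[of x] by (simp add: we mult_left_le_one_le power_le_one)
  qed
  moreover have "AE x in lebesgue. norm x < r1 \<longrightarrow> w x = \<rho> x * (cs x)\<^sup>2" using xi(4) by (intro AE_I2) (simp add: we)
  ultimately show ?thesis using that lw lip by blast
qed

section \<open>From the stated assumptions to the abstract setting\<close>

lemma m1_field_symmetric:
  assumes "p \<in> sobolev_inf_loc 2" "\<phi> \<in> sobolev_inf_loc 2"
  shows "AE x in lebesgue. \<forall>k l. m1_field \<rho> cs p \<phi> x $ k $ l = m1_field \<rho> cs p \<phi> x $ l $ k"
  using weak_hess_symmetric[OF assms(1)] weak_hess_symmetric[OF assms(2)]
proof eventually_elim
  case (elim x)
  show ?case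
  proof (intro allI)
    fix k l
    show "m1_field \<rho> cs p \<phi> x $ k $ l = m1_field \<rho> cs p \<phi> x $ l $ k"
      using elim(1)[rule_format, of k l] elim(2)[rule_format, of k l] by (simp add: m1_field_def mult.commute)
  qed
qed

lemma Linf_norm_sq_less_1:
  assumes "(Linf_norm M f)\<^sup>2 < 1"
  obtains \<kappa> where "0 \<le> \<kappa>" "\<kappa> < 1" "AE x in M. norm (f x) \<le> \<kappa>"
proof -
  have ae: "AE x in M. ereal (norm (f x)) \<le> Linf_norm M f" unfolding Linf_norm_def by (rule esssup_AE)
  \<comment> \<open>An infinite value would have an infinite square, which is not below 1.\<close>
  obtain r where r: "Linf_norm M f = ereal r" using assms by (cases "Linf_norm M f") (auto simp: power2_eq_square)
  have "r\<^sup>2 < 1" using assms by (simp add: r power2_eq_square one_ereal_def)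
  then have "\<bar>r\<bar> < 1" by (simp add: abs_square_less_1)
  moreover have "AE x in M. norm (f x) \<le> \<bar>r\<bar>"
    using ae by eventually_elim (simp add: r)
  ultimately show ?thesis using that[of "\<bar>r\<bar>"] by simp
qed

theorem proposition3p4:
  fixes \<omega> r1 r2 :: real
    and \<Omega> :: "real^3"
    and \<rho> cs \<gamma> p \<phi> :: "real^3 \<Rightarrow> real"
    and b :: "real^3 \<Rightarrow> real^3"
  assumes "\<rho> \<in> Linf lebesgue"
    and "\<And>r. r > 0 \<Longrightarrow> essinf (lebesgue_on (ball 0 r)) \<rho> > 0"
    and "cs \<in> Linf lebesgue" and "essinf lebesgue cs > 0"
    and "\<gamma> \<in> Linf lebesgue" and "essinf lebesgue \<gamma> > 0"
    and "p \<in> sobolev_inf_loc 2" and "\<phi> \<in> sobolev_inf_loc 2"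
    and "q_field \<rho> cs p \<in> Linf lebesgue"
    and "m1_field \<rho> cs p \<phi> \<in> Linf lebesgue"
    and "b \<in> Linf lebesgue"
    and "\<exists>g\<in>L2w (\<lambda>_. 1). has_weak_div (\<lambda>x. \<rho> x *\<^sub>R b x) g"
    and "r1 > 0" and "ess_supp b \<subseteq> ball 0 r1"
    and "r2 > r1"
    and "cs \<in> sobolev_inf 1 (ball 0 r2)" and "\<rho> \<in> sobolev_inf 1 (ball 0 r2)"
    and "\<omega> \<noteq> 0"
    and "(Linf_norm lebesgue (\<lambda>x. (1 / cs x) *\<^sub>R b x))\<^sup>2
           < ereal (1 / (1 + (tan (theta \<omega> \<rho> cs \<gamma> p \<phi> r2))\<^sup>2))"
  shows "bij_betw (A_Cow \<omega> \<Omega> \<rho> cs \<gamma> p \<phi> b) (X_space \<rho> b) (X_space \<rho> b)"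
proof -
  note \<rho> = Linf_AE[OF assms(1)] and cs = Linf_AE[OF assms(3)] and \<gamma> = Linf_AE[OF assms(5)]
    and q = Linf_AE[OF assms(9)] and m1 = Linf_AE[OF assms(10)] and b = Linf_AE[OF assms(11)]
  obtain P where P: "P > 0" "AE x in lebesgue. \<bar>\<rho> x\<bar> \<le> P" using \<rho>(2) by auto
  obtain S where S: "S > 0" "AE x in lebesgue. \<bar>cs x\<bar> \<le> S" using cs(2) by auto
  obtain c where c: "c > 0" "AE x in lebesgue. c \<le> cs x" using essinf_pos_AE[OF assms(4)] by blast
  have \<rho>_lower: "\<exists>c>0. AE x in lebesgue. norm x < R \<longrightarrow> c \<le> \<rho> x" for R
  proof -
    \<comment> \<open>The assumption on \<rho> concerns positive radii, so R is enlarged to one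
      whatever its sign.\<close>
    have "\<exists>c>0. AE x in lebesgue. x \<in> ball 0 (\<bar>R\<bar> + 1) \<longrightarrow> c \<le> \<rho> x"
      using essinf_pos_AE[OF assms(2)[of "\<bar>R\<bar> + 1"]] by (simp add: AE_lebesgue_on_iff)
    then obtain c where c: "c > 0" "AE x in lebesgue. x \<in> ball 0 (\<bar>R\<bar> + 1) \<longrightarrow> c \<le> \<rho> x" by blast
    from c(2) have "AE x in lebesgue. norm x < R \<longrightarrow> c \<le> \<rho> x" by eventually_elim (auto simp: dist_norm)
    with c(1) show ?thesis by blast
  qed
  have \<rho>_pos: "AE x in lebesgue. 0 < \<rho> x"
  proof -
    have "AE x in lebesgue. norm x < real n \<longrightarrow> 0 < \<rho> x" for n
    proof -
      obtain c where c: "c > 0" "AE x in lebesgue. norm x < real n \<longrightarrow> c \<le> \<rho> x" using \<rho>_lower by blast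
      from c(2) show ?thesis by eventually_elim (use c(1) in auto)
    qed
    then have "AE x in lebesgue. \<forall>n. norm x < real n \<longrightarrow> 0 < \<rho> x" unfolding AE_all_countable ..
    then show ?thesis by eventually_elim (use reals_Archimedean2 in blast)
  qed
  have "1 / (1 + t\<^sup>2) \<le> 1" for t :: real using zero_le_power2[of t] by (simp add: pos_divide_le_eq add_pos_nonneg)
  then have "(Linf_norm lebesgue (\<lambda>x. (1 / cs x) *\<^sub>R b x))\<^sup>2 < 1"
    by (intro less_le_trans[OF assms(19)]) (simp only: one_ereal_def ereal_less_eq)
  then obtain \<kappa> where \<kappa>: "0 \<le> \<kappa>" "\<kappa> < 1" "AE x in lebesgue. norm ((1 / cs x) *\<^sub>R b x) \<le> \<kappa>" by (rule Linf_norm_sq_less_1)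
  have \<kappa>_cs: "AE x in lebesgue. norm (b x) \<le> \<kappa> * cs x"
    using \<kappa>(3) c(2)
  proof eventually_elim
    case (elim x)
    then have "cs x > 0" using c(1) by linarith
    then show ?case using elim(1) by (simp add: pos_divide_le_eq)
  qed
  obtain w where w: "loc_integrable UNIV w"
    "\<exists>C\<ge>0. \<forall>l. \<forall>F\<in>test_functions UNIV. \<bar>LINT x|lebesgue. w x * partial l F x\<bar> \<le> C * (LINT x|lebesgue. \<bar>F x\<bar>)"
    "AE x in lebesgue. 0 \<le> w x \<and> w x \<le> \<rho> x * (cs x)\<^sup>2" "AE x in lebesgue. norm x < r1 \<longrightarrow> w x = \<rho> x * (cs x)\<^sup>2"
    by (rule lipschitz_weight_exists[OF assms(13,15,16) cs(1) S(2) assms(17) \<rho>(1) P(2) \<rho>_pos])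
  interpret galbrun \<rho> b \<omega> \<Omega> cs \<gamma> w "q_field \<rho> cs p" "m1_field \<rho> cs p \<phi>" r1 \<kappa>
  proof
    show "\<exists>P>0. AE x in lebesgue. \<rho> x \<le> P"
      by (intro exI[of _ P] conjI P(1) eventually_mono[OF P(2)]) simp
    show "\<exists>C>0. AE x in lebesgue. cs x \<le> C"
      by (intro exI[of _ S] conjI S(1) eventually_mono[OF S(2)]) simp
    show "\<exists>c>0. AE x in lebesgue. c \<le> \<gamma> x" by (rule essinf_pos_AE[OF assms(6)])
    show "AE x in lebesgue. r1 \<le> norm x \<longrightarrow> b x = 0"
      using ess_supp_AE[of b] by eventually_elim (use assms(14) in \<open>auto simp: dist_norm\<close>)
  qed (use assms \<rho> cs \<gamma> q m1 b \<rho>_lower \<rho>_pos c \<kappa> \<kappa>_cs w m1_field_symmetric[OF assms(7,8)] in blast)+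
  show ?thesis
  proof (rule form_operator_bijective)
    show "a_Cow \<omega> \<Omega> \<rho> cs \<gamma> p \<phi> b U U' = form (rep U) (rep U')" for U U'
      by (simp add: a_Cow_def form_def C2_def[abs_def] Q_def[abs_def] Mu_def[abs_def] Gu_def[abs_def] Let_def)
  qed (rule A_Cow_def)
qed
end
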